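(* Let $r\ge 2$ and $G=\mathrm{GL}(r,\mathbb R)$, and let $\delta\in(\mathbb Z/2\mathbb Z)^r$. The Jacquet integral $$\lambda\mapsto\langle\tau,\cdot\rangle_{\lambda,\delta},\qquad \langle\tau,f\rangle_{\lambda,\delta}=\int_N\psi(n)f(n)\,dn\quad (f\in V_{-\lambda,\delta}^\infty),$$ which converges absolutely for $\lambda$ in a nonempty open subset $U\subset\mathbb C^r$, admits an analytic continuation to all $\lambda\in\mathbb C^r$, and defines a Whittaker functional (on $V_{-\lambda,\delta}^\infty$) that depends holomorphically on $\lambda$.
   Context: $B_-$ is the group of invertible lower triangular matrices in $G$ and $N$ is the group of upper triangular unipotent matrices, with Haar measure $dn$. For $\lambda\in\mathbb C^r$, $\delta\in(\mathbb Z/2\mathbb Z)^r$ let $\chi_{\lambda,\delta}:B_-\to\mathbb C^*$, $\chi_{\lambda,\delta}(b)=\prod_{j=1}^r\mathrm{sgn}(b_{j,j})^{\delta_j}|b_{j,j}|^{\lambda_j}$, and let $\rho=(\frac{r-1}2,\frac{r-3}2,\dots,\frac{1-r}2)$. Then $V_{\lambda,\delta}^\infty=\{f\in C^\infty(G)\mid f(gb)=\chi_{\lambda-\rho,\delta}^{-1}(b)f(g)\text{ for } g\in G,\ b\in B_-\}$, and $V_{\lambda,\delta}^{-\infty}$ is the analogous space of distributions $\sigma\in C^{-\infty}(G)$ with $\sigma(gb)=\chi_{\lambda-\rho,\delta}^{-1}(b)\sigma(g)$. $G$ acts on these by left translation, $(\pi(g)f)(h)=f(g^{-1}h)$. The pairing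 $\langle f_1,f_2\rangle_{\lambda,\delta}=\int_N f_1(n)f_2(n)\,dn$ identifies $V_{\lambda,\delta}^{-\infty}$ with the dual of $V_{-\lambda,\delta}^{\infty}$. Let $e(z)=e^{2\pi iz}$ and $\psi(n)=e(n_{1,2}+n_{2,3}+\cdots+n_{r-1,r})$ for $n\in N$. A Whittaker distribution is $\tau\in V_{\lambda,\delta}^{-\infty}$ with $\tau(ngb)=\psi(n)\tau(g)\chi^{-1}_{\lambda-\rho,\delta}(b)$ for $n\in N,g\in G,b\in B_-$; this determines its restriction to the open set $NB_-$ up to a constant, normalized as $\tau(nb)=\psi(n)\chi_{\lambda-\rho,\delta}^{-1}(b)$. A Whittaker functional on a representation $(\pi,V)$ with space of smooth vectors $V^\infty$ is a continuous linear functional $T:V^\infty\to\mathbb C$ with $T(\pi(n)v)=\psi(n)T(v)$ for all $n\in N$, $v\in V^\infty$. Holomorphic dependence on $\lambda$ is understood in the usual sense: restriction to $K=\mathrm O(r)$ identifies all the spaces $V_{-\lambda,\delta}^\infty$ ($\delta$ fixed) with one space of smooth functions on $K$ independent of $\lambda$, and for each fixed function in it the value of the functional is holomorphic in $\lambda$. *)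

theory Defs
  imports "HOL-Analysis.Analysis" "HOL-Library.Z2"
begin

section \<open>Smooth functions on an open subset of a Euclidean space\<close>

primrec iterated_deriv ::
    "'a::euclidean_space list \<Rightarrow> ('a \<Rightarrow> complex) \<Rightarrow> 'a \<Rightarrow> complex" where
  "iterated_deriv [] f = f"
| "iterated_deriv (v # vs) f = (\<lambda>x. frechet_derivative (iterated_deriv vs f) (at x) v)"

text \<open>Every iterated directional derivative exists and is differentiable; hence all of them are
  continuous, and this is the usual notion of a smooth function on an open set.\<close>

definition smooth_on :: "'a::euclidean_space set \<Rightarrow> ('a \<Rightarrow> complex) \<Rightarrow> bool" where
  "smooth_on \<Omega> f \<longleftrightarrow> (\<forall>vs. \<forall>x\<in>\<Omega>. iterated_deriv vs f differentiable (at x))"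

text \<open>A function on \<open>\<Omega>\<close> is encoded as a total function that is zero outside \<open>\<Omega>\<close>, so that pointwise
  sums and multiples of such functions are again of this form.\<close>

definition smooth_functions :: "'a::euclidean_space set \<Rightarrow> ('a \<Rightarrow> complex) set" where
  "smooth_functions \<Omega> = {f. smooth_on \<Omega> f \<and> (\<forall>x. x \<notin> \<Omega> \<longrightarrow> f x = 0)}"

text \<open>The Frechet topology: uniform convergence of all derivatives on compact subsets.\<close>

definition smooth_topology :: "'a::euclidean_space set \<Rightarrow> ('a \<Rightarrow> complex) topology" where
  "smooth_topology \<Omega> = topology_generated_by
     {{h \<in> smooth_functions \<Omega>. \<forall>x\<in>C. norm (iterated_deriv vs h x - iterated_deriv vs f x) < \<epsilon>} |
        f vs C \<epsilon>. f \<in> smooth_functions \<Omega> \<and> compact C \<and> C \<subseteq> \<Omega> \<and> 0 < (\<epsilon>::real)}"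

section \<open>Holomorphic functions of several variables\<close>

definition holomorphic_several_on :: "(complex^'n \<Rightarrow> complex) \<Rightarrow> (complex^'n) set \<Rightarrow> bool" where
  "holomorphic_several_on F S \<longleftrightarrow>
     (\<forall>z\<in>S. \<exists>D. (F has_derivative D) (at z) \<and> (\<forall>c v. D (c *s v) = c * D v))"

section \<open>Matrix groups\<close>

text \<open>The rank is \<open>r = CARD('n)\<close>. The index type is well-ordered; its elements in increasing order
  play the role of \<open>1, \<dots>, r\<close>.\<close>

definition GL :: "(real^'n^'n) set" where
  "GL = {g. invertible g}"

definition lower_borel :: "(real^'n::_^'n::{finite,wellorder}) set" where
  "lower_borel = {b \<in> GL. \<forall>i j. i < j \<longrightarrow> b $ i $ j = 0}"

definition unipotent_upper :: "(real^'n::_^'n::{finite,wellorder}) set" where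
  "unipotent_upper = {n. (\<forall>i. n $ i $ i = 1) \<and> (\<forall>i j. j < i \<longrightarrow> n $ i $ j = 0)}"

definition orthogonal_group :: "(real^'n^'n) set" where
  "orthogonal_group = {k. orthogonal_matrix k}"

text \<open>Left Haar measures of a closed group of matrices. Regularity is automatic, since such a group
  is locally compact and second countable.\<close>

definition haar_measure_on :: "(real^'n^'n) set \<Rightarrow> (real^'n^'n) measure \<Rightarrow> bool" where
  "haar_measure_on H \<mu> \<longleftrightarrow>
     space \<mu> = H \<and> sets \<mu> = sets (restrict_space borel H) \<and>
     (\<forall>h\<in>H. \<forall>A\<in>sets \<mu>. emeasure \<mu> ((\<lambda>x. h ** x) ` A) = emeasure \<mu> A) \<and>
     (\<forall>C. compact C \<and> C \<subseteq> H \<longrightarrow> emeasure \<mu> C < \<infinity>) \<and>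
     emeasure \<mu> H \<noteq> 0"

section \<open>Principal series\<close>

definition chi ::
    "complex^'n::_ \<Rightarrow> bit^'n::_ \<Rightarrow> real^'n::_^'n::{finite,wellorder} \<Rightarrow> complex" where
  "chi lam \<delta> b =
     (\<Prod>j\<in>UNIV. of_real (sgn (b $ j $ j) ^ (of_bit (\<delta> $ j) :: nat)) *
                of_real \<bar>b $ j $ j\<bar> powr (lam $ j))"

text \<open>As \<open>card {..j}\<close> is the position of \<open>j\<close>, counted from \<open>1\<close>, the entries are
  \<open>(r - 1) / 2, (r - 3) / 2, \<dots>, (1 - r) / 2\<close>.\<close>

definition rho :: "complex^'n::{finite,wellorder}" where
  "rho = (\<chi> j. (of_nat CARD('n) + 1) / 2 - of_nat (card {..j}))"

definition principal_series ::
    "complex^'n::_ \<Rightarrow> bit^'n::_ \<Rightarrow> (real^'n::_^'n::{finite,wellorder} \<Rightarrow> complex) set" where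
  "principal_series lam \<delta> =
     {f \<in> smooth_functions GL.
        \<forall>g\<in>GL. \<forall>b\<in>lower_borel. f (g ** b) = inverse (chi (lam - rho) \<delta> b) * f g}"

definition principal_series_topology ::
    "complex^'n::_ \<Rightarrow> bit^'n::_ \<Rightarrow> (real^'n::_^'n::{finite,wellorder} \<Rightarrow> complex) topology" where
  "principal_series_topology lam \<delta> = subtopology (smooth_topology GL) (principal_series lam \<delta>)"

definition left_translation ::
    "real^'n^'n \<Rightarrow> (real^'n^'n \<Rightarrow> complex) \<Rightarrow> real^'n^'n \<Rightarrow> complex" where
  "left_translation g f = (\<lambda>h. f (matrix_inv g ** h))"

text \<open>The common model of the spaces \<open>principal_series lam \<delta>\<close> for fixed \<open>\<delta>\<close>: smooth functions on \<open>O(r)\<close>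
  (restrictions of smooth functions on a neighbourhood) with the parity given by \<open>\<delta>\<close>. The elements
  of \<open>lower_borel\<close> in \<open>O(r)\<close> are the diagonal sign matrices, on which \<open>chi\<close> does not depend on \<open>lam\<close>.\<close>

definition compact_model ::
    "bit^'n::_ \<Rightarrow> (real^'n::_^'n::{finite,wellorder} \<Rightarrow> complex) set" where
  "compact_model \<delta> =
     {\<phi>. (\<exists>\<Omega> h. open \<Omega> \<and> orthogonal_group \<subseteq> \<Omega> \<and> smooth_on \<Omega> h \<and>
              (\<forall>k\<in>orthogonal_group. \<phi> k = h k)) \<and>
         (\<forall>k. k \<notin> orthogonal_group \<longrightarrow> \<phi> k = 0) \<and>
         (\<forall>k\<in>orthogonal_group. \<forall>m\<in>orthogonal_group \<inter> lower_borel.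
              \<phi> (k ** m) = inverse (chi 0 \<delta> m) * \<phi> k)}"

definition restrict_to_K ::
    "(real^'n^'n \<Rightarrow> complex) \<Rightarrow> real^'n^'n \<Rightarrow> complex" where
  "restrict_to_K f = (\<lambda>k. if k \<in> orthogonal_group then f k else 0)"

text \<open>By the decomposition \<open>GL(r) = O(r) B\<^sub>-\<close>, \<open>restrict_to_K\<close> is a bijection from
  \<open>principal_series lam \<delta>\<close> onto \<open>compact_model \<delta>\<close>; this is its inverse.\<close>

definition extend_from_K ::
    "complex^'n::_ \<Rightarrow> bit^'n::_ \<Rightarrow> (real^'n::_^'n::_ \<Rightarrow> complex) \<Rightarrow>
     real^'n::_^'n::{finite,wellorder} \<Rightarrow> complex"
  where "extend_from_K lam \<delta> = inv_into (principal_series lam \<delta>) restrict_to_K"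

section \<open>Whittaker functionals and the Jacquet integral\<close>

text \<open>\<open>e(n\<^sub>1\<^sub>,\<^sub>2 + n\<^sub>2\<^sub>,\<^sub>3 + \<dots>)\<close> with \<open>e(z) = exp (2 \<pi> i z)\<close>: the sum is over the pairs of consecutive
  indices.\<close>

definition psi :: "real^'n::_^'n::{finite,wellorder} \<Rightarrow> complex" where
  "psi n = exp (2 * of_real pi * \<i> *
             of_real (\<Sum>(i, j)\<in>{(i, j). i < j \<and> {i<..<j} = {}}. n $ i $ j))"

definition whittaker_functional ::
    "complex^'n::_ \<Rightarrow> bit^'n::_ \<Rightarrow> ((real^'n::_^'n::{finite,wellorder} \<Rightarrow> complex) \<Rightarrow> complex) \<Rightarrow> bool"
  where
  "whittaker_functional lam \<delta> T \<longleftrightarrow>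
     (\<forall>f\<in>principal_series lam \<delta>. \<forall>h\<in>principal_series lam \<delta>. T (\<lambda>x. f x + h x) = T f + T h) \<and>
     (\<forall>c. \<forall>f\<in>principal_series lam \<delta>. T (\<lambda>x. c * f x) = c * T f) \<and>
     continuous_map (principal_series_topology lam \<delta>) euclidean T \<and>
     (\<forall>n\<in>unipotent_upper. \<forall>f\<in>principal_series lam \<delta>. T (left_translation n f) = psi n * T f)"

definition jacquet_integral ::
    "(real^'n::_^'n::_) measure \<Rightarrow> (real^'n::_^'n::{finite,wellorder} \<Rightarrow> complex) \<Rightarrow> complex" where
  "jacquet_integral dn f = (LINT n|dn. psi n * f n)"

end

theory Submission
  imports Defs "HOL-Complex_Analysis.Conformal_Mappings"
begin

text \<open>The Jacquet integral diverges in general because \<open>f\<close> grows on \<open>N\<close>; it is continued by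
  repeated integration by parts against the oscillating factor \<open>\<psi>\<close> (non-stationary phase). What makes
  this work is that \<open>\<psi>\<close> has no critical point at infinity along suitable vector fields.

  For a matrix unit \<open>E\<^sub>c\<^sub>d\<close> let \<open>X\<^sub>c\<^sub>d\<close> (\<open>borel_field\<close>) be the vector field on \<open>N\<close>, viewed as an open
  subset of \<open>G / B\<^sub>-\<close>, that is induced by left translation by \<open>exp (t E\<^sub>c\<^sub>d)\<close>. Then
  \<open>X\<^sub>c\<^sub>d \<psi> = 2 \<pi> i \<theta>\<^sub>c\<^sub>d \<psi>\<close>, where \<open>\<theta>\<^sub>c\<^sub>d\<close> (\<open>shift_entry\<close>) is the entry in row \<open>d\<close> and column \<open>c\<close> of
  \<open>A = n E n\<^sup>-\<^sup>1\<close> and \<open>E\<close> is the lower shift. Since \<open>n e\<^sub>j = A\<^sup>j\<^sup>-\<^sup>1 e\<^sub>1\<close>, the matrix \<open>A\<close> determines \<open>n\<close>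
  polynomially: if \<open>n\<close> is large, some \<open>\<theta>\<^sub>c\<^sub>d\<close> with \<open>d \<le> c\<close> is large. Give \<open>n\<^sub>i\<^sub>j\<close> the degree \<open>j - i\<close>; then
  \<open>\<theta>\<^sub>c\<^sub>d\<close> has degree \<open>c - d + 1\<close>, and \<open>R = 1 + \<Sum> \<theta>\<^sub>c\<^sub>d\<^bsup>2 e\<^esup>\<close>, with exponents \<open>e\<close> that make all terms
  homogeneous of one degree, defines a homogeneous gauge of size comparable, up to powers, with
  the size of \<open>n\<close> (\<open>entry_norm_le_hgauge\<close>, \<open>hgauge_le_entry_norm\<close>).

  Writing \<open>1 = 1 / R + \<Sum> \<theta>\<^sub>c\<^sub>d \<cdot> (\<theta>\<^sub>c\<^sub>d\<^bsup>2 e - 1\<^esup> / R)\<close> and integrating the fields \<open>X\<^sub>c\<^sub>d\<close> by parts gives an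
  operator \<open>L\<close> (\<open>gain_op\<close>) with \<open>\<integral> \<psi> f = \<integral> \<psi> L f\<close> for every \<open>f\<close> of sufficient decay
  (\<open>integral_psi_gain_op\<close>). In symbol classes where a derivative along \<open>X\<^sub>c\<^sub>d\<close> may cost the factor
  \<open>gauge\<^bsup>c - d\<^esup>\<close>, the operator \<open>L\<close> gains the factor \<open>gauge\<^sup>-\<^sup>1\<close> (\<open>gain_op_gain\<close>). Functions of the principal
  series lie in such classes (\<open>pos_equivariant_symbol\<close>): \<open>X\<^sub>c\<^sub>d f\<close> differs from the derivative of \<open>f\<close>
  along the right invariant field of \<open>E\<^sub>c\<^sub>d\<close>, which is again equivariant and hence controlled on \<open>O(r)\<close>,
  by a multiple of \<open>f\<close> that comes from the Lie algebra of \<open>B\<^sub>-\<close>. Their size on \<open>N\<close> is that of the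
  Iwasawa character, a power of the gauge whose exponent grows linearly with \<open>\<lambda>\<close>.

  Therefore \<open>\<integral> \<psi> L\<^sup>M f\<close> converges absolutely, locally uniformly in \<open>\<lambda>\<close>, as soon as \<open>M\<close> is large
  compared with \<open>\<lambda>\<close>, and does not depend on such an \<open>M\<close>. This is the continuation. It is holomorphic as
  a locally dominated integral of holomorphic functions (\<open>holomorphic_integral\<close>) and bounded by
  finitely many derivatives of \<open>f\<close> on \<open>O(r)\<close>, hence continuous. On the ball of \<open>\<lambda>\<close> found in
  \<open>continued_integral_far\<close> the functions \<open>f\<close> decay so fast that \<open>M = 0\<close> is allowed, so that the
  continuation is the Jacquet integral there. The operator \<open>L\<close> is not \<open>N\<close>-invariant; equivariance holds
  on that ball by invariance of the Haar measure and spreads to all \<open>\<lambda>\<close> by the identity theorem on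
  complex lines.\<close>

section \<open>Smooth functions\<close>

definition vf_deriv :: "('a::euclidean_space \<Rightarrow> 'a) \<Rightarrow> ('a \<Rightarrow> complex) \<Rightarrow> 'a \<Rightarrow> complex" where
  "vf_deriv \<xi> f = (\<lambda>x. frechet_derivative f (at x) (\<xi> x))"

text \<open>Smoothness counted by order, with the first derivative taken innermost: the closure
  properties are then inductions on the order.\<close>

primrec ck_on :: "nat \<Rightarrow> 'a::euclidean_space set \<Rightarrow> ('a \<Rightarrow> complex) \<Rightarrow> bool" where
  "ck_on 0 \<Omega> f \<longleftrightarrow> (\<forall>x\<in>\<Omega>. f differentiable at x)"
| "ck_on (Suc k) \<Omega> f \<longleftrightarrow> (\<forall>x\<in>\<Omega>. f differentiable at x) \<and> (\<forall>v. ck_on k \<Omega> (vf_deriv (\<lambda>_. v) f))"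

lemma iterated_deriv_append: "iterated_deriv (vs @ ws) f = iterated_deriv vs (iterated_deriv ws f)"
  by (induction vs) auto

lemma iterated_deriv_snoc: "iterated_deriv (vs @ [v]) f = iterated_deriv vs (vf_deriv (\<lambda>_. v) f)"
  by (simp add: iterated_deriv_append vf_deriv_def)

lemma ck_on_iff: "ck_on k \<Omega> f \<longleftrightarrow> (\<forall>vs. length vs \<le> k \<longrightarrow> (\<forall>x\<in>\<Omega>. iterated_deriv vs f differentiable at x))"
proof (induction k arbitrary: f)
  case (Suc k)
  have "(\<forall>vs. length vs \<le> Suc k \<longrightarrow> (\<forall>x\<in>\<Omega>. iterated_deriv vs f differentiable at x)) \<longleftrightarrow>
     (\<forall>x\<in>\<Omega>. f differentiable at x) \<and>
     (\<forall>v vs. length vs \<le> k \<longrightarrow> (\<forall>x\<in>\<Omega>. iterated_deriv (vs @ [v]) f differentiable at x))" (is "?A \<longleftrightarrow> ?B")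
  proof
    assume A: ?A
    have "\<forall>x\<in>\<Omega>. f differentiable at x"
      using A[rule_format, of "[]"] by simp
    moreover have "\<forall>v vs. length vs \<le> k \<longrightarrow> (\<forall>x\<in>\<Omega>. iterated_deriv (vs @ [v]) f differentiable at x)"
      using A by (metis Suc_le_mono length_append_singleton)
    ultimately show ?B by blast
  next
    assume B: ?B
    show ?A
    proof (intro allI impI)
      fix vs :: "'a list" assume "length vs \<le> Suc k"
      then show "\<forall>x\<in>\<Omega>. iterated_deriv vs f differentiable at x"
      proof (cases vs rule: rev_cases)
        case (snoc ws w)
        then show ?thesis using B \<open>length vs \<le> Suc k\<close> by auto
      qed (use B in simp)
    qed
  qed
  then show ?case
    using Suc by (simp add: iterated_deriv_snoc)
qed simp

lemma smooth_on_iff_ck: "smooth_on \<Omega> f \<longleftrightarrow> (\<forall>k. ck_on k \<Omega> f)"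
  unfolding ck_on_iff smooth_on_def by blast

lemma ck_on_imp_differentiable: "ck_on k \<Omega> f \<Longrightarrow> x \<in> \<Omega> \<Longrightarrow> f differentiable at x"
  by (cases k) auto

lemma vf_deriv_cong:
  assumes "open \<Omega>" "x \<in> \<Omega>" "\<And>x. x \<in> \<Omega> \<Longrightarrow> f x = g x" "f differentiable at x"
  shows "vf_deriv \<xi> f x = vf_deriv \<xi> g x"
  unfolding vf_deriv_def
  using frechet_derivative_transform_within_open[OF assms(4,1,2)] assms(3) by metis

lemma ck_on_cong:
  assumes "open \<Omega>" "\<And>x. x \<in> \<Omega> \<Longrightarrow> f x = g x"
  shows "ck_on k \<Omega> f \<Longrightarrow> ck_on k \<Omega> g"
  using assms(2)
proof (induction k arbitrary: f g)
  case 0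
  then show ?case
    unfolding ck_on.simps differentiable_def by (meson assms(1) has_derivative_transform_within_open)
next
  case (Suc k)
  have "\<forall>x\<in>\<Omega>. g differentiable at x"
    using Suc.prems unfolding ck_on.simps differentiable_def
    by (meson assms(1) has_derivative_transform_within_open)
  moreover have "ck_on k \<Omega> (vf_deriv (\<lambda>_. v) g)" for v
  proof (rule Suc.IH)
    show "ck_on k \<Omega> (vf_deriv (\<lambda>_. v) f)" using Suc.prems by simp
    show "vf_deriv (\<lambda>_. v) f x = vf_deriv (\<lambda>_. v) g x" if "x \<in> \<Omega>" for x
      using vf_deriv_cong[OF assms(1) that, of f g] Suc.prems that by simp
  qed
  ultimately show ?case by simp
qed

lemma ck_on_Suc_imp: "ck_on (Suc k) \<Omega> f \<Longrightarrow> ck_on k \<Omega> f"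
  by (auto simp: ck_on_iff)

lemma ck_on_const: "ck_on k \<Omega> (\<lambda>x. c)"
proof (induction k arbitrary: c)
  case (Suc k)
  have "vf_deriv (\<lambda>_. v) (\<lambda>x. c) = (\<lambda>x. 0)" for v :: 'a
    by (simp add: vf_deriv_def)
  with Suc show ?case by simp
qed simp

lemma vf_deriv_eqI: "(f has_derivative D) (at x) \<Longrightarrow> vf_deriv \<xi> f x = D (\<xi> x)"
  unfolding vf_deriv_def by (metis frechet_derivative_at)

lemma has_derivative_vf_deriv:
  "f differentiable at x \<Longrightarrow> (f has_derivative (\<lambda>v. vf_deriv (\<lambda>_. v) f x)) (at x)"
  unfolding vf_deriv_def using frechet_derivative_works by auto

lemma vf_deriv_apply: "vf_deriv \<xi> f x = vf_deriv (\<lambda>_. \<xi> x) f x"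
  by (simp add: vf_deriv_def)

lemma vf_deriv_add:
  "f differentiable at x \<Longrightarrow> g differentiable at x \<Longrightarrow>
   vf_deriv \<xi> (\<lambda>x. f x + g x) x = vf_deriv \<xi> f x + vf_deriv \<xi> g x"
  by (subst vf_deriv_eqI[OF has_derivative_add[OF has_derivative_vf_deriv has_derivative_vf_deriv]])
    (auto simp: vf_deriv_def)

lemma vf_deriv_mult:
  "f differentiable at x \<Longrightarrow> g differentiable at x \<Longrightarrow>
   vf_deriv \<xi> (\<lambda>x. f x * g x) x = vf_deriv \<xi> f x * g x + f x * vf_deriv \<xi> g x"
  by (subst vf_deriv_eqI[OF has_derivative_mult[OF has_derivative_vf_deriv has_derivative_vf_deriv]])
    (auto simp: vf_deriv_def)

lemma ck_on_add:
  assumes "open \<Omega>" shows "ck_on k \<Omega> f \<Longrightarrow> ck_on k \<Omega> g \<Longrightarrow> ck_on k \<Omega> (\<lambda>x. f x + g x)"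
proof (induction k arbitrary: f g)
  case (Suc k)
  have "ck_on k \<Omega> (vf_deriv (\<lambda>_. v) (\<lambda>x. f x + g x))" for v
    by (rule ck_on_cong[OF assms _ Suc.IH[of "vf_deriv (\<lambda>_. v) f" "vf_deriv (\<lambda>_. v) g"]])
      (use Suc.prems in \<open>auto simp: vf_deriv_add\<close>)
  then show ?case using Suc.prems by auto
qed auto

lemma ck_on_mult:
  assumes "open \<Omega>" shows "ck_on k \<Omega> f \<Longrightarrow> ck_on k \<Omega> g \<Longrightarrow> ck_on k \<Omega> (\<lambda>x. f x * g x)"
proof (induction k arbitrary: f g)
  case (Suc k)
  have fg: "ck_on k \<Omega> f" "ck_on k \<Omega> g" 
    using Suc.prems by (auto intro: ck_on_Suc_imp simp del: ck_on.simps)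
  have "ck_on k \<Omega> (vf_deriv (\<lambda>_. v) (\<lambda>x. f x * g x))" for v
    by (rule ck_on_cong[OF assms _ ck_on_add[OF assms Suc.IH[of "vf_deriv (\<lambda>_. v) f" g] Suc.IH[of f "vf_deriv (\<lambda>_. v) g"]]])
      (use Suc.prems fg in \<open>auto simp: vf_deriv_mult\<close>)
  then show ?case using Suc.prems by auto
qed auto

text \<open>The derivatives of an inverse, an exponential, a logarithm and a composite are products
  of the derivative of the argument with a construct of the same kind, or with one that has been
  treated already; so an induction on the order applies.\<close>

lemma ck_on_inverse:
  assumes "open \<Omega>" and nz: "\<And>x. x \<in> \<Omega> \<Longrightarrow> f x \<noteq> 0"
  shows "ck_on k \<Omega> f \<Longrightarrow> ck_on k \<Omega> (\<lambda>x. inverse (f x))"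
proof (induction k)
  case 0
  then show ?case using nz by auto
next
  case (Suc k)
  have i: "ck_on k \<Omega> (\<lambda>x. inverse (f x))"
    by (rule Suc.IH) (use Suc.prems in \<open>auto intro: ck_on_Suc_imp simp del: ck_on.simps\<close>)
  have "ck_on k \<Omega> (vf_deriv (\<lambda>_. v) (\<lambda>x. inverse (f x)))" for v
  proof (rule ck_on_cong[OF assms(1)])
    show "ck_on k \<Omega> (\<lambda>x. (-1) * (vf_deriv (\<lambda>_. v) f x * (inverse (f x) * inverse (f x))))"
      by (intro ck_on_mult assms(1) ck_on_const i) (use Suc.prems in auto)
    fix x assume x: "x \<in> \<Omega>"
    then have "f differentiable at x" using Suc.prems by auto
    note D = Deriv.has_derivative_inverse[OF nz[OF x] has_derivative_vf_deriv[OF this]]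
    show "(-1) * (vf_deriv (\<lambda>_. v) f x * (inverse (f x) * inverse (f x))) = vf_deriv (\<lambda>_. v) (\<lambda>x. inverse (f x)) x"
      unfolding vf_deriv_eqI[OF D] by simp
  qed
  then show ?case using Suc.prems nz by auto
qed

lemma has_derivative_exp_vf_deriv:
  assumes "f differentiable at x"
  shows "((\<lambda>x. exp (f x)) has_derivative (\<lambda>v. exp (f x) * vf_deriv (\<lambda>_. v) f x)) (at x)"
proof -
  have "((\<lambda>z. exp z) has_derivative (\<lambda>h. exp (f x) * h)) (at (f x))" for x
    using DERIV_exp[of "f x"] by (simp add: has_field_derivative_def)
  from diff_chain_at[OF has_derivative_vf_deriv[OF assms] this] show ?thesis
    by (simp add: o_def)
qed

lemma ck_on_exp:
  assumes "open \<Omega>"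
  shows "ck_on k \<Omega> f \<Longrightarrow> ck_on k \<Omega> (\<lambda>x. exp (f x))"
proof (induction k)
  case 0
  then show ?case using has_derivative_exp_vf_deriv[of f] by (auto simp: differentiable_def)
next
  case (Suc k)
  have i: "ck_on k \<Omega> (\<lambda>x. exp (f x))"
    by (rule Suc.IH) (use Suc.prems in \<open>auto intro: ck_on_Suc_imp simp del: ck_on.simps\<close>)
  have "ck_on k \<Omega> (vf_deriv (\<lambda>_. v) (\<lambda>x. exp (f x)))" for v
  proof (rule ck_on_cong[OF assms(1)])
    show "ck_on k \<Omega> (\<lambda>x. exp (f x) * vf_deriv (\<lambda>_. v) f x)"
      by (intro ck_on_mult assms(1) i) (use Suc.prems in auto)
    fix x assume "x \<in> \<Omega>"
    then show "exp (f x) * vf_deriv (\<lambda>_. v) f x = vf_deriv (\<lambda>_. v) (\<lambda>x. exp (f x)) x"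
      using Suc.prems by (subst vf_deriv_eqI[OF has_derivative_exp_vf_deriv]) auto
  qed
  moreover have "\<forall>x\<in>\<Omega>. (\<lambda>x. exp (f x)) differentiable at x"
    using ck_on_imp_differentiable[OF i] by blast
  ultimately show ?case by auto
qed

lemma ck_on_of_real_ln:
  fixes u :: "'a::euclidean_space \<Rightarrow> real"
  assumes op: "open \<Omega>" and pos: "\<And>x. x \<in> \<Omega> \<Longrightarrow> 0 < u x"
    and u: "ck_on k \<Omega> (\<lambda>x. complex_of_real (u x))"
  shows "ck_on k \<Omega> (\<lambda>x. complex_of_real (ln (u x)))"
proof -
  let ?U = "\<lambda>x. complex_of_real (u x)"
  have der: "((\<lambda>x. complex_of_real (ln (u x))) has_derivative
      (\<lambda>v. vf_deriv (\<lambda>_. v) ?U x * inverse (?U x))) (at x)" if x: "x \<in> \<Omega>" for x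
  proof -
    have d: "?U differentiable at x" using ck_on_imp_differentiable[OF u x] .
    have nn: "?U x \<notin> \<real>\<^sub>\<le>\<^sub>0" using pos[OF x] by simp
    have "((\<lambda>y. Ln (?U y)) has_derivative (\<lambda>v. inverse (?U x) * vf_deriv (\<lambda>_. v) ?U x)) (at x)"
      using diff_chain_at[OF has_derivative_vf_deriv[OF d]
          has_field_derivative_imp_has_derivative[OF has_field_derivative_Ln[OF nn]]]
      by (simp add: o_def)
    then have "((\<lambda>x. complex_of_real (ln (u x))) has_derivative
      (\<lambda>v. inverse (?U x) * vf_deriv (\<lambda>_. v) ?U x)) (at x)"
      by (rule has_derivative_transform_within_open[OF _ op x]) (use pos in \<open>simp add: Ln_of_real\<close>)
    then show ?thesis by (simp add: mult.commute)
  qed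
  then have diff: "\<forall>x\<in>\<Omega>. (\<lambda>x. complex_of_real (ln (u x))) differentiable at x"
    by (auto simp: differentiable_def)
  show ?thesis
  proof (cases k)
    case (Suc j)
    have "ck_on j \<Omega> (vf_deriv (\<lambda>_. v) (\<lambda>x. complex_of_real (ln (u x))))" for v
    proof (rule ck_on_cong[OF op])
      show "ck_on j \<Omega> (\<lambda>x. vf_deriv (\<lambda>_. v) ?U x * inverse (?U x))"
        by (intro ck_on_mult op ck_on_inverse)
          (use u pos Suc in \<open>auto intro: ck_on_Suc_imp simp del: ck_on.simps(2) simp: less_imp_neq[symmetric]\<close>,
           use u Suc in auto)
      fix x assume "x \<in> \<Omega>"
      then show "vf_deriv (\<lambda>_. v) ?U x * inverse (?U x) = vf_deriv (\<lambda>_. v) (\<lambda>x. complex_of_real (ln (u x))) x"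
        by (subst vf_deriv_eqI[OF der]) auto
    qed
    then show ?thesis using diff Suc by auto
  qed (use diff in auto)
qed

lemma ck_on_bounded_linear:
  assumes "bounded_linear l" shows "ck_on k \<Omega> l"
proof -
  have d: "l differentiable at x" for x
    using assms by (rule bounded_linear_imp_differentiable)
  have "vf_deriv (\<lambda>_. v) l = (\<lambda>x. l v)" for v
    by (rule ext, subst vf_deriv_eqI[OF bounded_linear_imp_has_derivative[OF assms]]) auto
  with d show ?thesis
    by (cases k) (auto simp: ck_on_const)
qed

lemma ck_on_compose:
  fixes g :: "'a::euclidean_space \<Rightarrow> 'b::euclidean_space"
  assumes op: "open \<Omega>" "open \<Omega>'" and g: "\<And>b. b \<in> Basis \<Longrightarrow> ck_on k \<Omega> (\<lambda>x. complex_of_real (g x \<bullet> b))"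
    and gim: "\<And>x. x \<in> \<Omega> \<Longrightarrow> g x \<in> \<Omega>'" and h: "ck_on k \<Omega>' h"
  shows "ck_on k \<Omega> (\<lambda>x. h (g x))"
proof -
  define g' where "g' = (\<lambda>x v. \<Sum>b\<in>Basis. Re (vf_deriv (\<lambda>_. v) (\<lambda>x. complex_of_real (g x \<bullet> b)) x) *\<^sub>R b)"
  have gb: "((\<lambda>x. g x \<bullet> b) has_derivative (\<lambda>v. Re (vf_deriv (\<lambda>_. v) (\<lambda>x. complex_of_real (g x \<bullet> b)) x))) (at x)"
    if "x \<in> \<Omega>" "b \<in> Basis" for x b
    using bounded_linear.has_derivative[OF bounded_linear_Re
        has_derivative_vf_deriv[OF ck_on_imp_differentiable[OF g[OF that(2)] that(1)]]] by simp
  have gd: "(g has_derivative (\<lambda>v. g' x v)) (at x)" if "x \<in> \<Omega>" for x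
    using that gb by (subst has_derivative_componentwise_within) (auto simp: g'_def inner_sum_left inner_Basis if_distrib cong: if_cong)
  have gre: "complex_of_real (Re (vf_deriv (\<lambda>_. v) (\<lambda>x. complex_of_real (g x \<bullet> b)) x)) =
      vf_deriv (\<lambda>_. v) (\<lambda>x. complex_of_real (g x \<bullet> b)) x" if "x \<in> \<Omega>" "b \<in> Basis" for x b v
    using vf_deriv_eqI[OF bounded_linear.has_derivative[OF bounded_linear_of_real gb[OF that]], of "\<lambda>_. v"] by simp
  have chain: "vf_deriv (\<lambda>_. v) (\<lambda>x. h (g x)) x =
      (\<Sum>b\<in>Basis. vf_deriv (\<lambda>_. v) (\<lambda>x. complex_of_real (g x \<bullet> b)) x * vf_deriv (\<lambda>_. b) h (g x))"
      "(\<lambda>x. h (g x)) differentiable at x"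
    if x: "x \<in> \<Omega>" and hd: "h differentiable at (g x)" for x h v
  proof -
    have D: "((\<lambda>x. h (g x)) has_derivative (\<lambda>v. vf_deriv (\<lambda>_. g' x v) h (g x))) (at x)"
      using diff_chain_at[OF gd[OF x] has_derivative_vf_deriv[OF hd]] by (simp add: o_def)
    then show "(\<lambda>x. h (g x)) differentiable at x" by (auto simp: differentiable_def)
    have lin: "linear (\<lambda>v. vf_deriv (\<lambda>_. v) h (g x))"
      using has_derivative_vf_deriv[OF hd] has_derivative_linear by blast
    show "vf_deriv (\<lambda>_. v) (\<lambda>x. h (g x)) x =
      (\<Sum>b\<in>Basis. vf_deriv (\<lambda>_. v) (\<lambda>x. complex_of_real (g x \<bullet> b)) x * vf_deriv (\<lambda>_. b) h (g x))"
      unfolding vf_deriv_eqI[OF D] g'_def linear_sum[OF lin] linear_cmul[OF lin] scaleR_conv_of_real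
      by (rule sum.cong) (auto simp: gre x)
  qed
  show ?thesis using g h
  proof (induction k arbitrary: h)
    case 0
    then show ?case using chain(2) gim by auto
  next
    case (Suc k)
    have "ck_on k \<Omega> (vf_deriv (\<lambda>_. v) (\<lambda>x. h (g x)))" for v
    proof (rule ck_on_cong[OF op(1)])
      have "ck_on k \<Omega> (\<lambda>x. \<Sum>b\<in>B. vf_deriv (\<lambda>_. v) (\<lambda>x. complex_of_real (g x \<bullet> b)) x * vf_deriv (\<lambda>_. b) h (g x))"
        if "B \<subseteq> Basis" for B
        using finite_subset[OF that finite_Basis] that
      proof (induction B rule: finite_induct)
        case (insert b B)
        have "ck_on k \<Omega> (\<lambda>x. vf_deriv (\<lambda>_. b) h (g x))"
          by (rule Suc.IH) (use Suc.prems in \<open>auto intro: ck_on_Suc_imp simp del: ck_on.simps\<close>, use Suc.prems in auto)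
        then show ?case using insert Suc.prems(1)[of b]
          by (auto intro!: ck_on_add ck_on_mult op)
      qed (simp add: ck_on_const)
      then show "ck_on k \<Omega> (\<lambda>x. \<Sum>b\<in>Basis. vf_deriv (\<lambda>_. v) (\<lambda>x. complex_of_real (g x \<bullet> b)) x * vf_deriv (\<lambda>_. b) h (g x))"
        by auto
      show "(\<Sum>b\<in>Basis. vf_deriv (\<lambda>_. v) (\<lambda>x. complex_of_real (g x \<bullet> b)) x * vf_deriv (\<lambda>_. b) h (g x)) =
         vf_deriv (\<lambda>_. v) (\<lambda>x. h (g x)) x" if "x \<in> \<Omega>" for x
        using chain(1)[OF that, of h v] Suc.prems(2) gim that by auto
    qed
    moreover have "\<forall>x\<in>\<Omega>. (\<lambda>x. h (g x)) differentiable at x"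
      using chain(2) gim Suc.prems(2) by auto
    ultimately show ?case by auto
  qed
qed

lemma smooth_on_imp_differentiable: "smooth_on \<Omega> f \<Longrightarrow> x \<in> \<Omega> \<Longrightarrow> f differentiable at x"
  using ck_on_imp_differentiable smooth_on_iff_ck by blast

lemma smooth_on_imp_continuous_on: "smooth_on \<Omega> f \<Longrightarrow> continuous_on \<Omega> f"
  by (meson continuous_at_imp_continuous_on differentiable_imp_continuous_within smooth_on_imp_differentiable)

lemma smooth_on_cong: "open \<Omega> \<Longrightarrow> (\<And>x. x \<in> \<Omega> \<Longrightarrow> f x = g x) \<Longrightarrow> smooth_on \<Omega> f \<Longrightarrow> smooth_on \<Omega> g"
  unfolding smooth_on_iff_ck using ck_on_cong by metis

lemma smooth_on_vf_deriv_const: "smooth_on \<Omega> f \<Longrightarrow> smooth_on \<Omega> (vf_deriv (\<lambda>_. v) f)"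
  unfolding smooth_on_iff_ck by (metis ck_on.simps(2))

lemma smooth_on_const: "smooth_on \<Omega> (\<lambda>x. c)"
  by (simp add: smooth_on_iff_ck ck_on_const)

lemma smooth_on_bounded_linear: "bounded_linear l \<Longrightarrow> smooth_on \<Omega> l"
  by (simp add: smooth_on_iff_ck ck_on_bounded_linear)

lemma smooth_on_add: "open \<Omega> \<Longrightarrow> smooth_on \<Omega> f \<Longrightarrow> smooth_on \<Omega> g \<Longrightarrow> smooth_on \<Omega> (\<lambda>x. f x + g x)"
  by (simp add: smooth_on_iff_ck ck_on_add)

lemma smooth_on_mult: "open \<Omega> \<Longrightarrow> smooth_on \<Omega> f \<Longrightarrow> smooth_on \<Omega> g \<Longrightarrow> smooth_on \<Omega> (\<lambda>x. f x * g x)"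
  by (simp add: smooth_on_iff_ck ck_on_mult)

lemma smooth_on_minus: "open \<Omega> \<Longrightarrow> smooth_on \<Omega> f \<Longrightarrow> smooth_on \<Omega> (\<lambda>x. - f x)"
  using smooth_on_mult[OF _ smooth_on_const[of _ "-1"], of \<Omega> f] by simp

lemma smooth_on_diff: "open \<Omega> \<Longrightarrow> smooth_on \<Omega> f \<Longrightarrow> smooth_on \<Omega> g \<Longrightarrow> smooth_on \<Omega> (\<lambda>x. f x - g x)"
  using smooth_on_add[OF _ _ smooth_on_minus, of \<Omega> f g] by simp

lemma smooth_on_sum:
  "open \<Omega> \<Longrightarrow> (\<And>i. i \<in> I \<Longrightarrow> smooth_on \<Omega> (f i)) \<Longrightarrow> smooth_on \<Omega> (\<lambda>x. \<Sum>i\<in>I. f i x)"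
  by (induction I rule: infinite_finite_induct) (auto intro: smooth_on_const smooth_on_add)

lemma smooth_on_prod:
  "open \<Omega> \<Longrightarrow> (\<And>i. i \<in> I \<Longrightarrow> smooth_on \<Omega> (f i)) \<Longrightarrow> smooth_on \<Omega> (\<lambda>x. \<Prod>i\<in>I. f i x)"
  by (induction I rule: infinite_finite_induct) (auto intro: smooth_on_const smooth_on_mult)

lemma smooth_on_inverse:
  "open \<Omega> \<Longrightarrow> (\<And>x. x \<in> \<Omega> \<Longrightarrow> f x \<noteq> 0) \<Longrightarrow> smooth_on \<Omega> f \<Longrightarrow> smooth_on \<Omega> (\<lambda>x. inverse (f x))"
  by (simp add: smooth_on_iff_ck ck_on_inverse)

lemma smooth_on_exp: "open \<Omega> \<Longrightarrow> smooth_on \<Omega> f \<Longrightarrow> smooth_on \<Omega> (\<lambda>x. exp (f x))"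
  by (simp add: smooth_on_iff_ck ck_on_exp)

lemma smooth_on_of_real_ln:
  "open \<Omega> \<Longrightarrow> (\<And>x. x \<in> \<Omega> \<Longrightarrow> 0 < u x) \<Longrightarrow> smooth_on \<Omega> (\<lambda>x. complex_of_real (u x)) \<Longrightarrow>
   smooth_on \<Omega> (\<lambda>x. complex_of_real (ln (u x)))"
  by (simp add: smooth_on_iff_ck ck_on_of_real_ln)

lemma smooth_on_compose:
  fixes g :: "'a::euclidean_space \<Rightarrow> 'b::euclidean_space"
  assumes "open \<Omega>" "open \<Omega>'" "\<And>b. b \<in> Basis \<Longrightarrow> smooth_on \<Omega> (\<lambda>x. complex_of_real (g x \<bullet> b))"
    "\<And>x. x \<in> \<Omega> \<Longrightarrow> g x \<in> \<Omega>'" "smooth_on \<Omega>' h"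
  shows "smooth_on \<Omega> (\<lambda>x. h (g x))"
  unfolding smooth_on_iff_ck
proof
  fix k
  have 1: "ck_on k \<Omega> (\<lambda>x. complex_of_real (g x \<bullet> b))" if "b \<in> Basis" for b
    using assms(3)[OF that] unfolding smooth_on_iff_ck by blast
  have 2: "ck_on k \<Omega>' h"
    using assms(5) unfolding smooth_on_iff_ck by blast
  show "ck_on k \<Omega> (\<lambda>x. h (g x))"
    by (rule ck_on_compose[where g = g and h = h and k = k and \<Omega> = \<Omega> and \<Omega>' = \<Omega>'])
      (fact assms(1,2,4) 1 2)+
qed

lemma smooth_on_vf_deriv:
  assumes "open \<Omega>" "smooth_on \<Omega> f" "\<And>b. b \<in> Basis \<Longrightarrow> smooth_on \<Omega> (\<lambda>x. complex_of_real (\<xi> x \<bullet> b))"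
  shows "smooth_on \<Omega> (vf_deriv \<xi> f)"
    and "x \<in> \<Omega> \<Longrightarrow> vf_deriv \<xi> f x = (\<Sum>b\<in>Basis. complex_of_real (\<xi> x \<bullet> b) * vf_deriv (\<lambda>_. b) f x)"
proof -
  have eq: "vf_deriv \<xi> f x = (\<Sum>b\<in>Basis. complex_of_real (\<xi> x \<bullet> b) * vf_deriv (\<lambda>_. b) f x)" if "x \<in> \<Omega>" for x
  proof -
    have lin: "linear (frechet_derivative f (at x))"
      using smooth_on_imp_differentiable[OF assms(2) that] by (rule linear_frechet_derivative)
    have "vf_deriv \<xi> f x = frechet_derivative f (at x) (\<Sum>b\<in>Basis. (\<xi> x \<bullet> b) *\<^sub>R b)"
      by (simp add: vf_deriv_def euclidean_representation)
    also have "\<dots> = (\<Sum>b\<in>Basis. complex_of_real (\<xi> x \<bullet> b) * vf_deriv (\<lambda>_. b) f x)"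
      unfolding linear_sum[OF lin] linear_cmul[OF lin] vf_deriv_def by (simp add: scaleR_conv_of_real)
    finally show ?thesis .
  qed
  then show "x \<in> \<Omega> \<Longrightarrow> vf_deriv \<xi> f x = (\<Sum>b\<in>Basis. complex_of_real (\<xi> x \<bullet> b) * vf_deriv (\<lambda>_. b) f x)" .
  show "smooth_on \<Omega> (vf_deriv \<xi> f)"
    by (rule smooth_on_cong[OF assms(1) eq[symmetric]])
      (auto intro!: smooth_on_sum smooth_on_mult assms smooth_on_vf_deriv_const)
qed

section \<open>Matrix entries, inverse matrices and the unipotent group\<close>

definition munit :: "'n \<Rightarrow> 'n \<Rightarrow> real^'n^'n" where
  "munit c d = (\<chi> i j. if i = c \<and> j = d then 1 else 0)"

definition entry :: "'n \<Rightarrow> 'n \<Rightarrow> real^'n^'n \<Rightarrow> complex" where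
  "entry i j x = complex_of_real (x $ i $ j)"

definition inv_entry :: "'n \<Rightarrow> 'n \<Rightarrow> real^'n^'n \<Rightarrow> complex" where
  "inv_entry i j x = complex_of_real (matrix_inv x $ i $ j)"

lemma GL_iff_det: "x \<in> GL \<longleftrightarrow> det x \<noteq> 0" for x :: "real^'n^'n"
  by (simp add: GL_def invertible_det_nz)

lemma continuous_on_det: "continuous_on S (det :: real^'n^'n \<Rightarrow> real)"
  unfolding det_def[abs_def] by (intro continuous_intros)

lemma open_GL: "open (GL :: (real^'n^'n) set)"
proof -
  have "GL = det -` (- {0}) \<inter> (UNIV :: (real^'n^'n) set)" by (auto simp: GL_iff_det)
  moreover have "open (det -` (- {0}) :: (real^'n^'n) set)"
    by (intro open_vimage continuous_on_det) auto
  ultimately show ?thesis by simp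
qed

lemma matrix_inv_right_left:
  fixes x :: "real^'n^'n"
  assumes "x \<in> GL"
  shows "x ** matrix_inv x = mat 1" "matrix_inv x ** x = mat 1"
proof -
  have "\<exists>y. x ** y = mat 1 \<and> y ** x = mat 1"
    using assms by (simp add: GL_def invertible_def)
  then have "x ** matrix_inv x = mat 1 \<and> matrix_inv x ** x = mat 1"
    unfolding matrix_inv_def by (rule someI_ex)
  then show "x ** matrix_inv x = mat 1" "matrix_inv x ** x = mat 1" by auto
qed

lemma matrix_inv_unique_GL:
  fixes x y :: "real^'n^'n"
  assumes "x ** y = mat 1"
  shows "x \<in> GL" "y \<in> GL" "matrix_inv x = y" "matrix_inv y = x"
proof -
  have yx: "y ** x = mat 1" using assms matrix_left_right_inverse by blast
  show x: "x \<in> GL" and y: "y \<in> GL" unfolding GL_def invertible_def using assms yx by auto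
  show "matrix_inv x = y" "matrix_inv y = x"
    using assms yx matrix_inv_right_left[OF x] matrix_inv_right_left[OF y]
    by (metis matrix_mul_assoc matrix_mul_lid matrix_mul_rid)+
qed

lemma matrix_inv_GL: "x \<in> GL \<Longrightarrow> matrix_inv x \<in> GL" for x :: "real^'n^'n"
  using matrix_inv_right_left(1) matrix_inv_unique_GL(2) by blast

lemma mult_GL: "x \<in> GL \<Longrightarrow> y \<in> GL \<Longrightarrow> x ** y \<in> GL" for x y :: "real^'n^'n"
  by (simp add: GL_iff_det det_mul)

lemma mat1_GL: "mat 1 \<in> GL" by (simp add: GL_iff_det)

lemma sum_entry_inv_entry: "x \<in> GL \<Longrightarrow> (\<Sum>l\<in>UNIV. entry i l x * inv_entry l j x) = (if i = j then 1 else 0)"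
  using arg_cong[OF matrix_inv_right_left(1)[of x], of "\<lambda>A. complex_of_real (A $ i $ j)"]
  by (simp add: matrix_matrix_mult_def entry_def inv_entry_def mat_def)

lemma sum_inv_entry_entry: "x \<in> GL \<Longrightarrow> (\<Sum>l\<in>UNIV. inv_entry i l x * entry l j x) = (if i = j then 1 else 0)"
  using arg_cong[OF matrix_inv_right_left(2)[of x], of "\<lambda>A. complex_of_real (A $ i $ j)"]
  by (simp add: matrix_matrix_mult_def entry_def inv_entry_def mat_def)

lemma Basis_matrix: "b \<in> Basis \<longleftrightarrow> (\<exists>i j. b = munit i j)" for b :: "real^'n^'n"
proof -
  have "munit i j = axis i (axis j 1)" for i j :: 'n
    by (auto simp: munit_def axis_def vec_eq_iff)
  then show ?thesis by (auto simp: Basis_vec_def)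
qed

lemma inner_munit: "x \<bullet> munit i j = x $ i $ j" for x :: "real^'n^'n"
proof -
  have "munit i j = axis i (axis j 1)"
    by (auto simp: munit_def axis_def vec_eq_iff)
  then show ?thesis by (simp add: inner_axis)
qed

lemma munit_nth [simp]: "munit c d $ i $ j = (if i = c \<and> j = d then 1 else 0)"
  by (simp add: munit_def)

lemma bounded_linear_entry: "bounded_linear (\<lambda>x::real^'n^'n. complex_of_real (x $ i $ j))"
proof -
  have "bounded_linear (\<lambda>x::real^'n^'n. x $ i)" by (rule bounded_linear_vec_nth)
  from bounded_linear_compose[OF bounded_linear_vec_nth[of j] this]
  show ?thesis by (rule bounded_linear_compose[OF bounded_linear_of_real])
qed

lemma smooth_on_entry: "smooth_on \<Omega> (entry i j)"
  unfolding entry_def[abs_def] by (rule smooth_on_bounded_linear[OF bounded_linear_entry])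

lemma vf_deriv_entry: "vf_deriv \<xi> (entry i j) x = complex_of_real (\<xi> x $ i $ j)"
  unfolding entry_def[abs_def]
  by (rule vf_deriv_eqI[OF bounded_linear_imp_has_derivative[OF bounded_linear_entry]])

lemma smooth_on_det:
  assumes "open \<Omega>" "\<And>i j. smooth_on \<Omega> (\<lambda>x. complex_of_real (M x $ i $ j))"
  shows "smooth_on \<Omega> (\<lambda>x. complex_of_real (det (M x)))"
  unfolding det_def of_real_sum of_real_mult of_real_prod
  by (intro smooth_on_sum smooth_on_mult smooth_on_prod smooth_on_const assms)

text \<open>Cramer's rule shows that the entries of the inverse are rational in the entries of the
  matrix, hence smooth.\<close>

lemma matrix_inv_cramer:
  fixes x :: "real^'n^'n"
  assumes "x \<in> GL"
  shows "matrix_inv x $ i $ j = det (\<chi> a b. if b = i then (if a = j then 1 else 0) else x $ a $ b) / det x"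
proof -
  have "x *v (matrix_inv x *v axis j 1) = axis j 1"
    by (simp add: matrix_vector_mul_assoc matrix_inv_right_left[OF assms])
  then have "matrix_inv x *v axis j 1 = (\<chi> k. det (\<chi> a b. if b = k then axis j 1 $ a else x $ a $ b) / det x)"
    using assms cramer[of x "matrix_inv x *v axis j 1" "axis j 1"] by (simp add: GL_iff_det)
  from arg_cong[OF this, of "\<lambda>v. v $ i"] show ?thesis
    by (simp add: matrix_vector_mul_component axis_def if_distrib cong: if_cong)
      (simp add: matrix_vector_mult_basis column_def axis_def[symmetric] inner_axis)
qed

lemma smooth_on_inv_entry: "smooth_on GL (inv_entry i j)" for i j :: "'n::finite"
proof (rule smooth_on_cong[OF open_GL])
  show "smooth_on GL (\<lambda>x::real^'n^'n. complex_of_real (det (\<chi> a b. if b = i then (if a = j then 1 else 0) else x $ a $ b)) *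
      inverse (complex_of_real (det x)))"
  proof (intro smooth_on_mult open_GL smooth_on_det smooth_on_inverse)
    show "smooth_on GL (\<lambda>x::real^'n^'n. complex_of_real ((\<chi> a b. if b = i then if a = j then 1 else 0 else x $ a $ b) $ a $ b))"
      for a b
      by (cases "b = i") (simp_all add: smooth_on_const smooth_on_entry[unfolded entry_def[abs_def]])
  qed (auto simp: GL_iff_det smooth_on_entry[unfolded entry_def[abs_def]])
  fix x :: "real^'n^'n" assume "x \<in> GL"
  then show "complex_of_real (det (\<chi> a b. if b = i then (if a = j then 1 else 0) else x $ a $ b)) *
      inverse (complex_of_real (det x)) = inv_entry i j x"
    by (simp add: inv_entry_def matrix_inv_cramer divide_inverse)
qed

lemma entry_differentiable [simp]: "entry i j differentiable at x"
  using smooth_on_imp_differentiable[OF smooth_on_entry[of UNIV]] by simp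

lemma inv_entry_differentiable: "x \<in> GL \<Longrightarrow> inv_entry i j differentiable at x" for i j :: "'n::finite"
  by (rule smooth_on_imp_differentiable[OF smooth_on_inv_entry])

lemma vf_deriv_sum:
  assumes "\<And>i. i \<in> I \<Longrightarrow> f i differentiable at x"
  shows "vf_deriv \<xi> (\<lambda>x. \<Sum>i\<in>I. f i x) x = (\<Sum>i\<in>I. vf_deriv \<xi> (f i) x)"
  by (subst vf_deriv_eqI[OF has_derivative_sum[OF has_derivative_vf_deriv[OF assms]]])
    (auto simp: vf_deriv_def)

lemma vf_deriv_const [simp]: "vf_deriv \<xi> (\<lambda>x. c) x = 0"
  by (simp add: vf_deriv_def)

text \<open>The rule \<open>d (x\<^sup>-\<^sup>1) = - x\<^sup>-\<^sup>1 (dx)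
  x\<^sup>-\<^sup>1\<close>, obtained by differentiating \<open>x\<^sup>-\<^sup>1 x =
  1\<close>.\<close>

lemma vf_deriv_inv_entry:
  assumes x: "x \<in> GL"
  shows "vf_deriv \<xi> (inv_entry i j) x = - (\<Sum>p\<in>UNIV. \<Sum>l\<in>UNIV. inv_entry i l x * complex_of_real (\<xi> x $ l $ p) * inv_entry p j x)"
proof -
  let ?V = "\<lambda>f. vf_deriv \<xi> f x"
  have eq: "(\<Sum>l\<in>UNIV. ?V (inv_entry i l) * entry l p x) = - (\<Sum>l\<in>UNIV. inv_entry i l x * complex_of_real (\<xi> x $ l $ p))" for p
  proof -
    have "0 = ?V (\<lambda>x. if i = p then 1 else 0)" by simp
    also have "\<dots> = ?V (\<lambda>x. \<Sum>l\<in>UNIV. inv_entry i l x * entry l p x)"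
      by (rule vf_deriv_cong[OF open_GL x]) (auto simp: sum_inv_entry_entry)
    also have "\<dots> = (\<Sum>l\<in>UNIV. ?V (inv_entry i l) * entry l p x + inv_entry i l x * complex_of_real (\<xi> x $ l $ p))"
      by (subst vf_deriv_sum) (auto simp: vf_deriv_mult vf_deriv_entry inv_entry_differentiable[OF x])
    finally show ?thesis by (simp add: sum.distrib eq_neg_iff_add_eq_0)
  qed
  have "(\<Sum>p\<in>UNIV. (\<Sum>l\<in>UNIV. ?V (inv_entry i l) * entry l p x) * inv_entry p j x) =
        (\<Sum>l\<in>UNIV. ?V (inv_entry i l) * (\<Sum>p\<in>UNIV. entry l p x * inv_entry p j x))"
    unfolding sum_distrib_right sum_distrib_left mult.assoc by (rule sum.swap)
  also have "\<dots> = ?V (inv_entry i j)"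
    by (simp add: sum_entry_inv_entry[OF x] if_distrib cong: if_cong)
  finally show ?thesis
    unfolding eq by (simp add: sum_negf sum_distrib_right)
qed

lemma smooth_on_vf_deriv_matrix:
  fixes \<xi> :: "real^'n^'n \<Rightarrow> real^'n^'n"
  assumes "open \<Omega>" "smooth_on \<Omega> f" "\<And>i j. smooth_on \<Omega> (\<lambda>x. complex_of_real (\<xi> x $ i $ j))"
  shows "smooth_on \<Omega> (vf_deriv \<xi> f)"
  by (rule smooth_on_vf_deriv(1)[OF assms(1,2)]) (use assms(3) in \<open>auto simp: Basis_matrix inner_munit\<close>)

lemma smooth_on_compose_matrix:
  fixes g :: "'a::euclidean_space \<Rightarrow> real^'n^'n"
  assumes "open \<Omega>" "open \<Omega>'" "\<And>i j. smooth_on \<Omega> (\<lambda>x. complex_of_real (g x $ i $ j))"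
    "\<And>x. x \<in> \<Omega> \<Longrightarrow> g x \<in> \<Omega>'" "smooth_on \<Omega>' h"
  shows "smooth_on \<Omega> (\<lambda>x. h (g x))"
  by (rule smooth_on_compose[where g = g and h = h and \<Omega> = \<Omega> and \<Omega>' = \<Omega>', OF assms(1,2) _ assms(4,5)])
    (use assms(3) in \<open>auto simp: Basis_matrix inner_munit\<close>)

lemma smooth_on_left_mult:
  fixes g :: "real^'n^'n"
  assumes "g \<in> GL" "smooth_on GL h"
  shows "smooth_on GL (\<lambda>x. h (g ** x))"
proof (rule smooth_on_compose_matrix[OF open_GL open_GL _ _ assms(2)])
  show "smooth_on GL (\<lambda>x. complex_of_real ((g ** x) $ i $ j))" for i j
    unfolding matrix_matrix_mult_def by simp
      (intro smooth_on_sum smooth_on_mult open_GL smooth_on_const smooth_on_entry[unfolded entry_def[abs_def]])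
qed (use assms mult_GL in auto)

subsection \<open>Positions\<close>

definition pos :: "'n::{finite,wellorder} \<Rightarrow> nat" where "pos j = card {..<j}"

lemma pos_less: "i < j \<Longrightarrow> pos i < pos j"
  unfolding pos_def by (rule psubset_card_mono) auto

lemma pos_less_iff: "pos i < pos j \<longleftrightarrow> i < j"
  by (metis pos_less less_asym neqE)

lemma pos_le_iff: "pos i \<le> pos j \<longleftrightarrow> i \<le> j"
  by (metis pos_less_iff linorder_not_less)

lemma pos_eq_iff: "pos i = pos j \<longleftrightarrow> i = j"
  by (metis pos_less_iff less_irrefl neqE)

lemma pos_lt_card: "pos (j :: 'n::{finite,wellorder}) < CARD('n)"
  unfolding pos_def by (rule psubset_card_mono) auto

definition consec :: "('n::{finite,wellorder} \<times> 'n) set" where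
  "consec = {(i, j). i < j \<and> {i<..<j} = {}}"

lemma consec_pos: "(i, j) \<in> consec \<longleftrightarrow> pos j = Suc (pos i)"
proof
  assume "(i, j) \<in> consec"
  then have ij: "i < j" "{i<..<j} = {}" by (auto simp: consec_def)
  have "{..<j} = insert i {..<i}" using ij by (auto simp: set_eq_iff) (metis linorder_neqE)
  then show "pos j = Suc (pos i)" unfolding pos_def by simp
next
  assume p: "pos j = Suc (pos i)"
  have "\<not> (i < l \<and> l < j)" for l using p pos_less[of i l] pos_less[of l j] by auto
  moreover have "i < j" using p pos_less_iff[of i j] by simp
  ultimately show "(i, j) \<in> consec" by (auto simp: consec_def)
qed

lemma consec_pred: "pos j > 0 \<Longrightarrow> \<exists>i. (i, j) \<in> consec" for j :: "'n::{finite,wellorder}"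
proof -
  assume "pos j > 0"
  then have ne: "{..<j} \<noteq> {}" unfolding pos_def by (metis card.empty less_irrefl)
  let ?i = "Max {..<j}"
  have "?i < j" using Max_in[OF _ ne] by auto
  moreover have "{?i<..<j} = {}" using Max_ge[of "{..<j}"] by (force simp: set_eq_iff not_less)
  ultimately show ?thesis by (auto simp: consec_def)
qed

text \<open>Induction from the last index backwards, the direction in which the triangular systems
  below are solved.\<close>

lemma down_induct [case_names step]:
  fixes i :: "'n::{finite,wellorder}"
  assumes "\<And>i. (\<And>l. i < l \<Longrightarrow> P l) \<Longrightarrow> P i"
  shows "P i"
proof (induction "card {i<..}" arbitrary: i rule: less_induct)
  case less
  show ?case
  proof (rule assms)
    fix l assume "i < l"
    then have "card {l<..} < card {i<..}" by (intro psubset_card_mono) auto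
    then show "P l" by (rule less)
  qed
qed

subsection \<open>The unipotent group\<close>

lemma unipotent_upperD:
  assumes "n \<in> unipotent_upper"
  shows "n $ i $ i = 1" "j < i \<Longrightarrow> n $ i $ j = 0"
  using assms by (auto simp: unipotent_upper_def)

lemma det_unipotent: "n \<in> unipotent_upper \<Longrightarrow> det n = 1"
  by (subst det_upperdiagonal) (auto simp: unipotent_upperD)

lemma unipotent_GL: "n \<in> unipotent_upper \<Longrightarrow> n \<in> GL"
  by (simp add: GL_iff_det det_unipotent)

lemma unipotent_mult:
  assumes "n \<in> unipotent_upper" "m \<in> unipotent_upper"
  shows "n ** m \<in> unipotent_upper"
proof -
  have z: "n $ i $ l * m $ l $ j = 0" if "j < i" for i j l
    using that unipotent_upperD(2)[OF assms(1), of l i] unipotent_upperD(2)[OF assms(2), of j l]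
    by (cases "l < i") auto
  have z': "(\<Sum>l\<in>UNIV. n $ i $ l * m $ l $ j) = 0" if "j < i" for i j
    by (rule sum.neutral) (use z that in blast)
  have o: "n $ i $ l * m $ l $ i = (if l = i then 1 else 0)" for i l
    using unipotent_upperD(2)[OF assms(1), of l i] unipotent_upperD(2)[OF assms(2), of i l]
      unipotent_upperD(1)[OF assms(1)] unipotent_upperD(1)[OF assms(2)]
    by (cases l i rule: linorder_cases) auto
  show ?thesis unfolding unipotent_upper_def matrix_matrix_mult_def by (auto simp: o z')
qed

lemma unipotent_inverse_rec:
  assumes "n \<in> unipotent_upper"
  shows "matrix_inv n $ i $ j = (if i = j then 1 else 0) - (\<Sum>l\<in>{i<..}. n $ i $ l * matrix_inv n $ l $ j)"
proof -
  have "(\<Sum>l\<in>UNIV. n $ i $ l * matrix_inv n $ l $ j) = (if i = j then 1 else 0)"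
    using arg_cong[OF matrix_inv_right_left(1)[OF unipotent_GL[OF assms]], of "\<lambda>A. A $ i $ j"]
    by (simp add: matrix_matrix_mult_def mat_def)
  also have "(\<Sum>l\<in>UNIV. n $ i $ l * matrix_inv n $ l $ j) =
     (\<Sum>l\<in>{i..}. n $ i $ l * matrix_inv n $ l $ j)"
    by (rule sum.mono_neutral_right) (auto simp: unipotent_upperD[OF assms])
  also have "{i..} = insert i {i<..}" by auto
  finally show ?thesis by (simp add: unipotent_upperD[OF assms])
qed

lemma unipotent_inverse:
  assumes "n \<in> unipotent_upper"
  shows "matrix_inv n \<in> unipotent_upper"
proof -
  have "(\<forall>j<i. matrix_inv n $ i $ j = 0) \<and> matrix_inv n $ i $ i = 1" for i
  proof (induction i rule: down_induct)
    case (step i)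
    have "(\<Sum>l\<in>{i<..}. n $ i $ l * matrix_inv n $ l $ j) = 0" if "j \<le> i" for j
      using step that by (intro sum.neutral) auto
    then show ?case by (subst (1 2) unipotent_inverse_rec[OF assms]) auto
  qed
  then show ?thesis by (auto simp: unipotent_upper_def)
qed

lemma closed_unipotent: "closed (unipotent_upper :: (real^'n::_^'n::{finite,wellorder}) set)"
proof -
  have "closed {n :: real^'n::_^'n::{finite,wellorder}. n $ i $ i = 1}" for i
    by (intro closed_Collect_eq continuous_intros)
  moreover have "closed {n :: real^'n::_^'n::{finite,wellorder}. j < i \<longrightarrow> n $ i $ j = 0}" for i j
    by (cases "j < i") (auto intro!: closed_Collect_eq continuous_intros)
  moreover have "unipotent_upper = (\<Inter>i. {n :: real^'n::_^'n::{finite,wellorder}. n $ i $ i = 1}) \<inter> (\<Inter>i. \<Inter>j. {n. j < i \<longrightarrow> n $ i $ j = 0})"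
    by (auto simp: unipotent_upper_def)
  ultimately show ?thesis
    by (metis (no_types, lifting) closed_INT closed_Int)
qed

section \<open>Symbol estimates\<close>

text \<open>Symbol estimates in the abstract: derivatives along the field \<open>\<xi> i\<close> may
  cost the factor \<open>W i\<close>. The functions are smooth on the open set
  \<open>\<Omega>\<close> and estimated on \<open>S\<close>; the set \<open>S\<close> can be lower
  dimensional and the fields need not be tangent to it.\<close>

locale derivation_bounds =
  fixes \<xi> :: "'i \<Rightarrow> 'a::euclidean_space \<Rightarrow> 'a" and W :: "'i \<Rightarrow> 'a \<Rightarrow> real" and S \<Omega> :: "'a set"
  assumes open_dom: "open \<Omega>" and sub_dom: "S \<subseteq> \<Omega>"
    and smooth_field: "\<And>i F. smooth_on \<Omega> F \<Longrightarrow> smooth_on \<Omega> (vf_deriv (\<xi> i) F)"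
    and weight_nonneg: "\<And>i x. x \<in> S \<Longrightarrow> 0 \<le> W i x"
begin

text \<open>All derivatives of order at most \<open>k\<close> along the fields are bounded by
  \<open>\<alpha>\<close> times the weights of the fields used. The constants are kept explicit
  because they must be uniform in families.\<close>

primrec bounded_by :: "nat \<Rightarrow> ('a \<Rightarrow> real) \<Rightarrow> ('a \<Rightarrow> complex) \<Rightarrow> bool" where
  "bounded_by 0 \<alpha> F \<longleftrightarrow> smooth_on \<Omega> F \<and> (\<forall>x\<in>S. norm (F x) \<le> \<alpha> x)"
| "bounded_by (Suc k) \<alpha> F \<longleftrightarrow> smooth_on \<Omega> F \<and> (\<forall>x\<in>S. norm (F x) \<le> \<alpha> x) \<and>
     (\<forall>i. bounded_by k (\<lambda>x. \<alpha> x * W i x) (vf_deriv (\<xi> i) F))"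

lemma bounded_by_smooth: "bounded_by k \<alpha> F \<Longrightarrow> smooth_on \<Omega> F"
  by (cases k) auto

lemma bounded_by_le: "bounded_by k \<alpha> F \<Longrightarrow> x \<in> S \<Longrightarrow> norm (F x) \<le> \<alpha> x"
  by (cases k) auto

lemma bounded_by_nonneg: "bounded_by k \<alpha> F \<Longrightarrow> x \<in> S \<Longrightarrow> 0 \<le> \<alpha> x"
  using bounded_by_le norm_ge_zero order_trans by blast

lemma bounded_by_differentiable: "bounded_by k \<alpha> F \<Longrightarrow> x \<in> \<Omega> \<Longrightarrow> F differentiable at x"
  using bounded_by_smooth smooth_on_imp_differentiable by blast

lemma bounded_by_SucD: "bounded_by (Suc k) \<alpha> F \<Longrightarrow> bounded_by k \<alpha> F"
  by (induction k arbitrary: \<alpha> F) auto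

lemma bounded_by_field: "bounded_by (Suc k) \<alpha> F \<Longrightarrow> bounded_by k (\<lambda>x. \<alpha> x * W i x) (vf_deriv (\<xi> i) F)"
  by simp

lemma bounded_by_mono: "bounded_by k \<alpha> F \<Longrightarrow> (\<And>x. x \<in> S \<Longrightarrow> \<alpha> x \<le> \<beta> x) \<Longrightarrow> bounded_by k \<beta> F"
proof (induction k arbitrary: \<alpha> \<beta> F)
  case 0
  then show ?case by (auto intro: order_trans)
next
  case (Suc k)
  have "bounded_by k (\<lambda>x. \<beta> x * W i x) (vf_deriv (\<xi> i) F)" for i
    by (rule Suc.IH[of "\<lambda>x. \<alpha> x * W i x"]) (use Suc.prems weight_nonneg in \<open>auto intro: mult_right_mono\<close>)
  then show ?case using Suc.prems by (auto intro: order_trans)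
qed

lemma bounded_by_cong:
  "bounded_by k \<alpha> F \<Longrightarrow> (\<And>x. x \<in> \<Omega> \<Longrightarrow> F x = G x) \<Longrightarrow> bounded_by k \<alpha> G"
proof (induction k arbitrary: \<alpha> F G)
  case 0
  have "norm (G x) \<le> \<alpha> x" if "x \<in> S" for x
    using bounded_by_le[OF 0(1) that] 0(2)[of x] that sub_dom by auto
  then show ?case using smooth_on_cong[OF open_dom, of F G] 0 by auto
next
  case (Suc k)
  have sm: "smooth_on \<Omega> G" using Suc.prems smooth_on_cong[OF open_dom, of F G] by auto
  have "bounded_by k (\<lambda>x. \<alpha> x * W i x) (vf_deriv (\<xi> i) G)" for i
    by (rule Suc.IH[of _ "vf_deriv (\<xi> i) F"])
      (use Suc.prems vf_deriv_cong[OF open_dom _ Suc.prems(2)] bounded_by_differentiable[OF Suc.prems(1)] in auto)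
  moreover have "norm (G x) \<le> \<alpha> x" if "x \<in> S" for x
    using bounded_by_le[OF Suc.prems(1) that] Suc.prems(2)[of x] that sub_dom by auto
  ultimately show ?case using sm by simp
qed

lemma bounded_by_SucI:
  assumes "bounded_by k \<alpha> F" "\<And>i. bounded_by k (\<lambda>x. \<alpha> x * W i x) (vf_deriv (\<xi> i) F)"
  shows "bounded_by (Suc k) \<alpha> F"
  using assms bounded_by_le bounded_by_smooth by auto

lemma bounded_by_add: "bounded_by k \<alpha> F \<Longrightarrow> bounded_by k \<beta> G \<Longrightarrow> bounded_by k (\<lambda>x. \<alpha> x + \<beta> x) (\<lambda>x. F x + G x)"
proof (induction k arbitrary: \<alpha> \<beta> F G)
  case 0
  then show ?case by (auto intro!: smooth_on_add open_dom norm_triangle_le add_mono)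
next
  case (Suc k)
  have "bounded_by k (\<lambda>x. (\<alpha> x + \<beta> x) * W i x) (vf_deriv (\<xi> i) (\<lambda>x. F x + G x))" for i
    by (rule bounded_by_cong[OF bounded_by_mono[OF Suc.IH[OF bounded_by_field[of k \<alpha> F i] bounded_by_field[of k \<beta> G i]]]])
      (use Suc.prems in \<open>auto simp: vf_deriv_add algebra_simps bounded_by_differentiable[OF Suc.prems(1)]
        bounded_by_differentiable[OF Suc.prems(2)]\<close>)
  moreover have "norm (F x + G x) \<le> \<alpha> x + \<beta> x" if "x \<in> S" for x
    using Suc.prems that by (auto intro!: norm_triangle_le add_mono)
  ultimately show ?case using Suc.prems by (auto intro!: smooth_on_add open_dom)
qed

text \<open>The Leibniz rule: each of the \<open>k\<close> derivatives falls on one of two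
  factors.\<close>

lemma bounded_by_mult: "bounded_by k \<alpha> F \<Longrightarrow> bounded_by k \<beta> G \<Longrightarrow> bounded_by k (\<lambda>x. 2 ^ k * (\<alpha> x * \<beta> x)) (\<lambda>x. F x * G x)"
proof (induction k arbitrary: \<alpha> \<beta> F G)
  case 0
  have "norm (F x * G x) \<le> \<alpha> x * \<beta> x" if "x \<in> S" for x
    unfolding norm_mult using 0 that by (intro mult_mono) (auto intro: order_trans[OF norm_ge_zero])
  then show ?case using 0 by (auto intro!: smooth_on_mult open_dom)
next
  case (Suc k)
  have d: "bounded_by k (\<lambda>x. (2 ^ Suc k * (\<alpha> x * \<beta> x)) * W i x) (vf_deriv (\<xi> i) (\<lambda>x. F x * G x))" for i
    by (rule bounded_by_cong[OF bounded_by_mono[OF bounded_by_add[OF Suc.IH[OF bounded_by_field[of k \<alpha> F i] bounded_by_SucD[of k \<beta> G]]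
            Suc.IH[OF bounded_by_SucD[of k \<alpha> F] bounded_by_field[of k \<beta> G i]]]]])
      (use Suc.prems bounded_by_differentiable in \<open>auto simp: vf_deriv_mult algebra_simps simp del: bounded_by.simps\<close>)
  have "norm (F x * G x) \<le> 2 ^ Suc k * (\<alpha> x * \<beta> x)" if "x \<in> S" for x
  proof -
    have "norm (F x * G x) \<le> 1 * (\<alpha> x * \<beta> x)"
      unfolding norm_mult mult_1 using Suc.prems that by (intro mult_mono) (auto intro: order_trans[OF norm_ge_zero])
    also have "\<dots> \<le> 2 ^ Suc k * (\<alpha> x * \<beta> x)"
      using Suc.prems that by (intro mult_right_mono mult_nonneg_nonneg bounded_by_nonneg) (auto simp del: power_Suc bounded_by.simps)
    finally show ?thesis .
  qed
  then show ?case using d Suc.prems by (auto intro!: smooth_on_mult open_dom simp del: power_Suc)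
qed

lemma bounded_by_zero: "(\<And>x. x \<in> S \<Longrightarrow> 0 \<le> \<alpha> x) \<Longrightarrow> bounded_by k \<alpha> (\<lambda>x. 0)"
proof (induction k arbitrary: \<alpha>)
  case (Suc k)
  have "vf_deriv (\<xi> i) (\<lambda>x. 0) = (\<lambda>x. 0)" for i by (simp add: vf_deriv_def)
  then show ?case using Suc weight_nonneg by (auto intro: smooth_on_const)
qed (auto intro: smooth_on_const)

lemma bounded_by_const: "bounded_by k (\<lambda>x. norm c) (\<lambda>x. c)"
proof (cases k)
  case (Suc j)
  have "vf_deriv (\<xi> i) (\<lambda>x. c) = (\<lambda>x. 0)" for i by (simp add: vf_deriv_def)
  then show ?thesis using Suc weight_nonneg by (auto intro: smooth_on_const bounded_by_zero)
qed (auto intro: smooth_on_const)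

lemma bounded_by_cmult: "bounded_by k \<alpha> F \<Longrightarrow> bounded_by k (\<lambda>x. norm c * \<alpha> x) (\<lambda>x. c * F x)"
proof (induction k arbitrary: \<alpha> F)
  case 0
  then show ?case by (auto intro!: smooth_on_mult smooth_on_const open_dom mult_left_mono simp: norm_mult)
next
  case (Suc k)
  have "bounded_by k (\<lambda>x. (norm c * \<alpha> x) * W i x) (vf_deriv (\<xi> i) (\<lambda>x. c * F x))" for i
    by (rule bounded_by_cong[OF bounded_by_mono[OF Suc.IH[OF bounded_by_field[of k \<alpha> F i]]]])
      (use Suc.prems in \<open>auto simp: vf_deriv_mult algebra_simps bounded_by_differentiable[OF Suc.prems(1)]\<close>)
  then show ?case using Suc.prems
    by (auto intro!: smooth_on_mult smooth_on_const open_dom mult_left_mono simp: norm_mult)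
qed

lemma bounded_by_sum:
  "(\<And>i. i \<in> I \<Longrightarrow> bounded_by k (\<alpha> i) (F i)) \<Longrightarrow> bounded_by k (\<lambda>x. \<Sum>i\<in>I. \<alpha> i x) (\<lambda>x. \<Sum>i\<in>I. F i x)"
  by (induction I rule: infinite_finite_induct) (auto intro: bounded_by_zero bounded_by_add)

end

subsection \<open>The vector fields and the homogeneous gauge\<close>

text \<open>The matrix \<open>x\<close> times the strictly upper triangular part of
  \<open>x\<^sup>-\<^sup>1 E\<^sub>c\<^sub>d x\<close>. On \<open>N\<close>, an open subset of
  \<open>G / B\<^sub>-\<close>, this is the field induced by left translation by \<open>exp (t
  E\<^sub>c\<^sub>d)\<close>; the formula makes sense on all of \<open>GL\<close>.\<close>

definition borel_field :: "'n::{finite,wellorder} \<times> 'n \<Rightarrow> real^'n::_^'n::{finite,wellorder} \<Rightarrow> real^'n::_^'n::{finite,wellorder}" where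
  "borel_field cd x = (\<chi> i j. \<Sum>l\<in>{..<j}. x $ i $ l * matrix_inv x $ l $ fst cd * x $ snd cd $ j)"

text \<open>The degree by which \<open>borel_field\<close> raises homogeneity; truncation at
  \<open>0\<close> for \<open>c < d\<close> is harmless because the gauge is at least
  \<open>1\<close>.\<close>

definition level :: "'n::{finite,wellorder} \<times> 'n \<Rightarrow> nat" where
  "level cd = pos (fst cd) - pos (snd cd)"

text \<open>The derivative of the phase of \<open>\<psi>\<close> along \<open>borel_field (c,
  d)\<close>. With \<open>A = x E x\<^sup>-\<^sup>1\<close>, \<open>E\<close> the lower shift, it is
  the entry of \<open>A\<close> in row \<open>d\<close> and column \<open>c\<close>.\<close>

definition shift_entry :: "'n::{finite,wellorder} \<times> 'n \<Rightarrow> real^'n::_^'n::{finite,wellorder} \<Rightarrow> real" where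
  "shift_entry cd x = (\<Sum>(i, j)\<in>consec. matrix_inv x $ i $ fst cd * x $ snd cd $ j)"

definition lower_pairs :: "('n::{finite,wellorder} \<times> 'n) set" where "lower_pairs = {(c, d). d \<le> c}"

text \<open>Any common multiple of the degrees \<open>1, \<dots>, r\<close> of the functions
  \<open>shift_entry\<close> would do.\<close>

definition gauge_degree :: "'n itself \<Rightarrow> nat" where "gauge_degree _ = fact CARD('n)"

definition gauge_expo :: "'n::{finite,wellorder} \<times> 'n \<Rightarrow> nat" where
  "gauge_expo cd = gauge_degree TYPE('n) div Suc (level cd)"

definition gauge_sum :: "real^'n::_^'n::{finite,wellorder} \<Rightarrow> real" where
  "gauge_sum x = 1 + (\<Sum>cd\<in>lower_pairs. shift_entry cd x ^ (2 * gauge_expo cd))"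

definition hgauge :: "real^'n::_^'n::{finite,wellorder} \<Rightarrow> real" where
  "hgauge x = gauge_sum x powr (1 / (2 * real (gauge_degree TYPE('n))))"

lemma gauge_degree_pos: "0 < gauge_degree TYPE('n)" by (simp add: gauge_degree_def)

lemma gauge_expo_mult: "Suc (level cd) * gauge_expo cd = gauge_degree TYPE('n)" for cd :: "'n::{finite,wellorder} \<times> 'n"
proof -
  have "level cd < CARD('n)" unfolding level_def using pos_lt_card[of "fst cd"] by linarith
  then have "Suc (level cd) dvd fact CARD('n)" by (intro dvd_fact) auto
  then show ?thesis unfolding gauge_expo_def gauge_degree_def by (rule dvd_mult_div_cancel)
qed

lemma gauge_expo_pos: "0 < gauge_expo cd" for cd :: "'n::{finite,wellorder} \<times> 'n"
  using gauge_expo_mult[of cd] gauge_degree_pos[where 'n = 'n] by (metis gr0I mult_0_right less_irrefl)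

lemma gauge_sum_ge: "1 \<le> gauge_sum x" "cd \<in> lower_pairs \<Longrightarrow> shift_entry cd x ^ (2 * gauge_expo cd) \<le> gauge_sum x"
proof -
  have nn: "0 \<le> shift_entry cd x ^ (2 * gauge_expo cd)" for cd by (simp add: power_mult)
  then show "1 \<le> gauge_sum x" unfolding gauge_sum_def by (simp add: sum_nonneg)
  assume "cd \<in> lower_pairs"
  then have "shift_entry cd x ^ (2 * gauge_expo cd) \<le> (\<Sum>cd\<in>lower_pairs. shift_entry cd x ^ (2 * gauge_expo cd))"
    using nn by (intro member_le_sum) auto
  then show "shift_entry cd x ^ (2 * gauge_expo cd) \<le> gauge_sum x" unfolding gauge_sum_def by simp
qed

lemma hgauge_ge1: "1 \<le> hgauge x"
  unfolding hgauge_def using gauge_sum_ge(1)[of x] by (simp add: ge_one_powr_ge_zero)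

lemma hgauge_pos: "0 < hgauge x" using hgauge_ge1[of x] by linarith

lemma hgauge_powr_mono: "a \<le> b \<Longrightarrow> hgauge x powr a \<le> hgauge x powr b"
  using hgauge_ge1[of x] by (simp add: powr_mono)

lemma gauge_sum_gauge: "gauge_sum x = hgauge x powr (2 * real (gauge_degree TYPE('n)))" for x :: "real^'n::_^'n::{finite,wellorder}"
  unfolding hgauge_def powr_powr using gauge_degree_pos[where 'n = 'n] gauge_sum_ge(1)[of x] by simp

lemma shift_entry_le_gauge:
  assumes "cd \<in> lower_pairs" shows "\<bar>shift_entry cd x\<bar> \<le> hgauge x powr (real (level cd) + 1)"
proof -
  let ?e = "2 * gauge_expo cd"
  have "\<bar>shift_entry cd x\<bar> ^ ?e \<le> gauge_sum x"
    using gauge_sum_ge(2)[OF assms, of x] by (metis power_even_abs even_mult_iff even_numeral)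
  also have "\<dots> = (hgauge x powr (real (level cd) + 1)) ^ ?e"
  proof -
    have "(real (level cd) + 1) * real ?e = 2 * real (Suc (level cd) * gauge_expo cd)" by (simp add: algebra_simps)
    then show ?thesis unfolding gauge_sum_gauge gauge_expo_mult[of cd]
      using hgauge_pos[of x] by (metis powr_powr powr_gt_zero less_irrefl powr_realpow)
  qed
  finally show ?thesis
    using gauge_expo_pos[of cd] by (subst (asm) power_mono_iff) auto
qed

lemma consec_unique:
  assumes "(i, j) \<in> consec" "(p, q) \<in> consec"
  shows "p = i \<longleftrightarrow> q = j"
  using assms pos_eq_iff[of p i] pos_eq_iff[of q j] by (auto simp: consec_pos)

text \<open>The equation \<open>A n = n E\<close>, which recovers a column of \<open>n\<close> from
  the preceding one; the next lemma is \<open>n\<^sup>-\<^sup>1 A = E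
  n\<^sup>-\<^sup>1\<close>.\<close>

lemma shift_entry_column_rec:
  assumes "x \<in> GL" "(i, j) \<in> consec"
  shows "x $ b $ j = (\<Sum>a\<in>UNIV. shift_entry (a, b) x * x $ a $ i)"
proof -
  have "(\<Sum>a\<in>UNIV. shift_entry (a, b) x * x $ a $ i) =
     (\<Sum>(p, q)\<in>consec. x $ b $ q * (\<Sum>a\<in>UNIV. matrix_inv x $ p $ a * x $ a $ i))"
    unfolding shift_entry_def sum_distrib_right sum_distrib_left
    by (subst sum.swap) (auto intro!: sum.cong simp: mult_ac)
  also have "\<dots> = (\<Sum>(p, q)\<in>consec. x $ b $ q * (if p = i then 1 else 0))"
  proof -
    have "(\<Sum>a\<in>UNIV. matrix_inv x $ p $ a * x $ a $ i) = (if p = i then 1 else 0)" for p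
      using arg_cong[OF matrix_inv_right_left(2)[OF assms(1)], of "\<lambda>A. A $ p $ i"]
      by (simp add: matrix_matrix_mult_def mat_def)
    then show ?thesis by simp
  qed
  also have "\<dots> = (\<Sum>pq\<in>{(i, j)}. x $ b $ j)"
  proof (rule sum.mono_neutral_cong_right)
    show "\<forall>pq\<in>consec - {(i, j)}. (case pq of (p, q) \<Rightarrow> x $ b $ q * (if p = i then 1 else 0)) = 0"
      using consec_unique[OF assms(2)] by (auto split: if_splits)
  qed (use assms in auto)
  finally show ?thesis by simp
qed

lemma shift_entry_row_rec:
  assumes "x \<in> GL" "(i, j) \<in> consec"
  shows "matrix_inv x $ i $ b = (\<Sum>a\<in>UNIV. matrix_inv x $ j $ a * shift_entry (b, a) x)"
proof -
  have "(\<Sum>a\<in>UNIV. matrix_inv x $ j $ a * shift_entry (b, a) x) =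
     (\<Sum>(p, q)\<in>consec. matrix_inv x $ p $ b * (\<Sum>a\<in>UNIV. matrix_inv x $ j $ a * x $ a $ q))"
    unfolding shift_entry_def sum_distrib_right sum_distrib_left
    by (subst sum.swap) (auto intro!: sum.cong simp: mult_ac)
  also have "\<dots> = (\<Sum>(p, q)\<in>consec. matrix_inv x $ p $ b * (if j = q then 1 else 0))"
  proof -
    have "(\<Sum>a\<in>UNIV. matrix_inv x $ j $ a * x $ a $ q) = (if j = q then 1 else 0)" for q
      using arg_cong[OF matrix_inv_right_left(2)[OF assms(1)], of "\<lambda>A. A $ j $ q"]
      by (simp add: matrix_matrix_mult_def mat_def)
    then show ?thesis by simp
  qed
  also have "\<dots> = (\<Sum>pq\<in>{(i, j)}. matrix_inv x $ i $ b)"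
  proof (rule sum.mono_neutral_cong_right)
    show "\<forall>pq\<in>consec - {(i, j)}. (case pq of (p, q) \<Rightarrow> matrix_inv x $ p $ b * (if j = q then 1 else 0)) = 0"
      using consec_unique[OF assms(2)] by (auto split: if_splits)
  qed (use assms in auto)
  finally show ?thesis by simp
qed

definition height :: "'n::{finite,wellorder} \<Rightarrow> 'n \<Rightarrow> real" where
  "height i j = real (pos j) - real (pos i)"

text \<open>On and above the diagonal the bound holds by construction of the gauge. Below the
  diagonal \<open>A\<close> agrees with \<open>E\<close>, whose entries \<open>1\<close> have degree
  \<open>0\<close>.\<close>

lemma shift_entry_bound_all:
  assumes n: "n \<in> unipotent_upper"
  shows "\<bar>shift_entry (a, b) n\<bar> \<le> hgauge n powr (height b a + 1)"
proof (cases "b \<le> a")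
  case True
  then have "real (level (a, b)) = height b a" using pos_le_iff[of b a] by (simp add: level_def height_def)
  with shift_entry_le_gauge[of "(a, b)" n] True show ?thesis by (simp add: lower_pairs_def)
next
  case False
  note y = unipotent_upperD[OF unipotent_inverse[OF n]] and x = unipotent_upperD[OF n]
  have nz: "(i, j) = (a, b)" if "(i, j) \<in> consec" "matrix_inv n $ i $ a * n $ b $ j \<noteq> 0" for i j
  proof -
    have "\<not> a < i" "\<not> j < b" using that(2) x(2) y(2) by auto
    with that(1) False show "(i, j) = (a, b)"
      using pos_le_iff[of i a] pos_le_iff[of b j] pos_le_iff[of b a] pos_eq_iff[of i a] pos_eq_iff[of b j]
      by (auto simp: consec_pos not_less)
  qed
  show ?thesis
  proof (cases "(a, b) \<in> consec")
    case True
    have "shift_entry (a, b) n = (\<Sum>(i, j)\<in>{(a, b)}. matrix_inv n $ i $ a * n $ b $ j)"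
      unfolding shift_entry_def fst_conv snd_conv
      by (rule sum.mono_neutral_right) (use True nz in auto)
    moreover have "height b a + 1 = 0" using True by (simp add: consec_pos height_def)
    ultimately show ?thesis using x(1) y(1) hgauge_pos[of n] by simp
  next
    case False
    have "shift_entry (a, b) n = 0" unfolding shift_entry_def fst_conv snd_conv
      by (rule sum.neutral) (use False nz in fastforce)
    then show ?thesis by simp
  qed
qed

text \<open>The entries of \<open>n\<close> and of its inverse are bounded according to their
  degree: \<open>n e\<^sub>j = A\<^sup>j\<^sup>-\<^sup>1 e\<^sub>1\<close>, and each application of
  \<open>A\<close> to a column raises the degree by one and the constant by the factor
  \<open>r\<close>. For the inverse the same is done with rows, starting from the last one.\<close>

lemma entry_gauge_bound:
  fixes n :: "real^'n::_^'n::{finite,wellorder}"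
  assumes n: "n \<in> unipotent_upper"
  shows "\<bar>n $ b $ j\<bar> \<le> real CARD('n) ^ CARD('n) * hgauge n powr height b j"
    and "\<bar>matrix_inv n $ b $ j\<bar> \<le> real CARD('n) ^ CARD('n) * hgauge n powr height b j"
proof -
  let ?K = "real CARD('n)"
  have K1: "1 \<le> ?K" by (simp add: Suc_leI)
  have base: "\<bar>m $ b $ j\<bar> \<le> hgauge n powr height b j" if "m \<in> unipotent_upper" "j \<le> b"
    for m :: "real^'n::_^'n::{finite,wellorder}" and b j
    using unipotent_upperD[OF that(1)] that(2) hgauge_pos[of n] by (cases "j = b") (auto simp: height_def)
  have "\<bar>n $ b $ j\<bar> \<le> ?K ^ pos j * hgauge n powr height b j"
  proof (induction j arbitrary: b rule: less_induct)
    case (less j)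
    show ?case
    proof (cases "pos j = 0")
      case True
      then have "j \<le> b" using pos_le_iff[of j b] by simp
      then show ?thesis using base[OF n] True by simp
    next
      case False
      then obtain i where ij: "(i, j) \<in> consec" using consec_pred by blast
      then have "i < j" and pj: "pos j = Suc (pos i)" by (simp add: consec_def, simp add: consec_pos)
      have "\<bar>n $ b $ j\<bar> \<le> (\<Sum>a\<in>(UNIV::'n set). \<bar>shift_entry (a, b) n * n $ a $ i\<bar>)"
        unfolding shift_entry_column_rec[OF unipotent_GL[OF n] ij] by (rule sum_abs)
      also have "\<dots> \<le> (\<Sum>a\<in>(UNIV::'n set). ?K ^ pos i * hgauge n powr height b j)"
      proof (rule sum_mono)
        fix a :: 'n
        have "\<bar>shift_entry (a, b) n * n $ a $ i\<bar> \<le> hgauge n powr (height b a + 1) * (?K ^ pos i * hgauge n powr height a i)"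
          unfolding abs_mult by (intro mult_mono shift_entry_bound_all n less[OF \<open>i < j\<close>]) auto
        also have "\<dots> = ?K ^ pos i * hgauge n powr ((height b a + 1) + height a i)" by (simp add: powr_add)
        also have "(height b a + 1) + height a i = height b j" using pj by (simp add: height_def)
        finally show "\<bar>shift_entry (a, b) n * n $ a $ i\<bar> \<le> ?K ^ pos i * hgauge n powr height b j" .
      qed
      finally show ?thesis by (simp add: pj mult_ac)
    qed
  qed
  also have "\<dots> \<le> ?K ^ CARD('n) * hgauge n powr height b j"
    by (intro mult_right_mono power_increasing K1) (auto intro: less_imp_le pos_lt_card)
  finally show "\<bar>n $ b $ j\<bar> \<le> ?K ^ CARD('n) * hgauge n powr height b j" .
  have "\<bar>matrix_inv n $ b $ j\<bar> \<le> ?K ^ (CARD('n) - pos b) * hgauge n powr height b j"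
  proof (induction b arbitrary: j rule: down_induct)
    case (step i)
    show ?case
    proof (cases "\<exists>k. (i, k) \<in> consec")
      case False
      have "j \<le> i"
      proof (rule ccontr)
        assume "\<not> j \<le> i"
        then have "j \<in> {i<..}" by simp
        then have ne: "{i<..} \<noteq> {}" by blast
        have "(i, Min {i<..}) \<in> consec"
          using Min_in[OF _ ne] Min_le[of "{i<..}"] by (force simp: consec_def not_le[symmetric])
        with False show False by blast
      qed
      then have "\<bar>matrix_inv n $ i $ j\<bar> \<le> 1 * hgauge n powr height i j" using base[OF unipotent_inverse[OF n]] by simp
      also have "\<dots> \<le> ?K ^ (CARD('n) - pos i) * hgauge n powr height i j"
        by (intro mult_right_mono one_le_power K1) auto
      finally show ?thesis .
    next
      case True
      then obtain k where ik: "(i, k) \<in> consec" by blast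
      then have "i < k" and pk: "pos k = Suc (pos i)" by (simp add: consec_def, simp add: consec_pos)
      have "\<bar>matrix_inv n $ i $ j\<bar> \<le> (\<Sum>a\<in>(UNIV::'n set). \<bar>matrix_inv n $ k $ a * shift_entry (j, a) n\<bar>)"
        unfolding shift_entry_row_rec[OF unipotent_GL[OF n] ik] by (rule sum_abs)
      also have "\<dots> \<le> (\<Sum>a\<in>(UNIV::'n set). ?K ^ (CARD('n) - pos k) * hgauge n powr height i j)"
      proof (rule sum_mono)
        fix a :: 'n
        have "\<bar>matrix_inv n $ k $ a * shift_entry (j, a) n\<bar> \<le> (?K ^ (CARD('n) - pos k) * hgauge n powr height k a) * hgauge n powr (height a j + 1)"
          unfolding abs_mult by (intro mult_mono shift_entry_bound_all n step[OF \<open>i < k\<close>]) auto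
        also have "\<dots> = ?K ^ (CARD('n) - pos k) * hgauge n powr (height k a + (height a j + 1))" by (simp add: powr_add)
        also have "height k a + (height a j + 1) = height i j" using pk by (simp add: height_def)
        finally show "\<bar>matrix_inv n $ k $ a * shift_entry (j, a) n\<bar> \<le> ?K ^ (CARD('n) - pos k) * hgauge n powr height i j" .
      qed
      also have "\<dots> = ?K ^ Suc (CARD('n) - pos k) * hgauge n powr height i j" by (simp add: mult_ac)
      also have "Suc (CARD('n) - pos k) = CARD('n) - pos i"
        using pk pos_lt_card[of k] by simp
      finally show ?thesis .
    qed
  qed
  also have "\<dots> \<le> ?K ^ CARD('n) * hgauge n powr height b j"
    by (intro mult_right_mono power_increasing K1) auto
  finally show "\<bar>matrix_inv n $ b $ j\<bar> \<le> ?K ^ CARD('n) * hgauge n powr height b j" .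
qed

lemma borel_field_entry: "complex_of_real (borel_field cd x $ i $ j) = (\<Sum>l\<in>{..<j}. entry i l x * inv_entry l (fst cd) x * entry (snd cd) j x)"
  by (simp add: borel_field_def entry_def inv_entry_def)

lemma smooth_on_borel_field: "smooth_on GL (\<lambda>x. complex_of_real (borel_field cd x $ i $ j))"
  unfolding borel_field_entry by (intro smooth_on_sum smooth_on_mult open_GL smooth_on_entry smooth_on_inv_entry)

interpretation sym: derivation_bounds borel_field "\<lambda>cd x. hgauge x ^ level cd" unipotent_upper GL
  by unfold_locales
    (auto intro: open_GL unipotent_GL smooth_on_vf_deriv_matrix smooth_on_borel_field zero_le_power less_imp_le[OF hgauge_pos])

lemma vf_deriv_borel_field_entry:
  "vf_deriv (borel_field cd) (entry i j) x = (\<Sum>l\<in>{..<j}. entry i l x * inv_entry l (fst cd) x * entry (snd cd) j x)"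
  unfolding vf_deriv_entry borel_field_entry ..

lemma vf_deriv_borel_field_inv_entry:
  assumes x: "x \<in> GL"
  shows "vf_deriv (borel_field cd) (inv_entry i j) x = - (\<Sum>l\<in>{i<..}. inv_entry i (fst cd) x * entry (snd cd) l x * inv_entry l j x)"
proof -
  have "(\<Sum>l\<in>UNIV. inv_entry i l x * complex_of_real (borel_field cd x $ l $ p)) =
      (if i < p then inv_entry i (fst cd) x * entry (snd cd) p x else 0)" for p
  proof -
    have "(\<Sum>l\<in>UNIV. inv_entry i l x * complex_of_real (borel_field cd x $ l $ p)) =
        (\<Sum>q\<in>{..<p}. (\<Sum>l\<in>UNIV. inv_entry i l x * entry l q x) * (inv_entry q (fst cd) x * entry (snd cd) p x))"
      unfolding borel_field_entry sum_distrib_left sum_distrib_right by (subst sum.swap) (simp add: mult_ac)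
    also have "\<dots> = (if i < p then inv_entry i (fst cd) x * entry (snd cd) p x else 0)"
      unfolding sum_inv_entry_entry[OF x] by (simp add: if_distrib[of "\<lambda>z. z * _"] sum.delta' cong: if_cong)
    finally show ?thesis .
  qed
  then have "(\<Sum>l\<in>UNIV. inv_entry i l x * complex_of_real (borel_field cd x $ l $ p) * inv_entry p j x) =
      (if i < p then inv_entry i (fst cd) x * entry (snd cd) p x * inv_entry p j x else 0)" for p
    unfolding sum_distrib_right[symmetric] by simp
  then have "vf_deriv (borel_field cd) (inv_entry i j) x = - (\<Sum>p\<in>UNIV. if i < p then inv_entry i (fst cd) x * entry (snd cd) p x * inv_entry p j x else 0)"
    unfolding vf_deriv_inv_entry[OF x] by simp
  also have "(\<Sum>p\<in>UNIV. if i < p then inv_entry i (fst cd) x * entry (snd cd) p x * inv_entry p j x else 0) =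
     (\<Sum>l\<in>{i<..}. inv_entry i (fst cd) x * entry (snd cd) l x * inv_entry l j x)"
    by (rule sum.mono_neutral_cong_right) auto
  finally show ?thesis .
qed

text \<open>Symbols of homogeneous order \<open>e\<close>.\<close>

definition symbol :: "real \<Rightarrow> (real^'n::_^'n::{finite,wellorder} \<Rightarrow> complex) \<Rightarrow> bool" where
  "symbol e F \<longleftrightarrow> (\<forall>k. \<exists>C\<ge>0. sym.bounded_by k (\<lambda>x. C * hgauge x powr e) F)"

lemma symbE: "symbol e F \<Longrightarrow> (\<And>C. 0 \<le> C \<Longrightarrow> sym.bounded_by k (\<lambda>x. C * hgauge x powr e) F \<Longrightarrow> thesis) \<Longrightarrow> thesis"
  unfolding symbol_def by blast

lemma symbD: "symbol e F \<Longrightarrow> \<exists>C\<ge>0. sym.bounded_by k (\<lambda>x. C * hgauge x powr e) F"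
  unfolding symbol_def by blast

lemma symbol_smooth: "symbol e F \<Longrightarrow> smooth_on GL F"
  by (erule symbE[of _ _ 0]) (rule sym.bounded_by_smooth)

lemma symbol_mult:
  assumes "symbol e F" "symbol e' G" shows "symbol (e + e') (\<lambda>x. F x * G x)"
  unfolding symbol_def
proof
  fix k
  obtain C where C: "0 \<le> C" "sym.bounded_by k (\<lambda>x. C * hgauge x powr e) F" by (rule symbE[OF assms(1)])
  obtain C' where C': "0 \<le> C'" "sym.bounded_by k (\<lambda>x. C' * hgauge x powr e') G" by (rule symbE[OF assms(2)])
  have "sym.bounded_by k (\<lambda>x. (2 ^ k * (C * C')) * hgauge x powr (e + e')) (\<lambda>x. F x * G x)"
    by (rule sym.bounded_by_mono[OF sym.bounded_by_mult[OF C(2) C'(2)]]) (simp add: powr_add)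
  then show "\<exists>C\<ge>0. sym.bounded_by k (\<lambda>x. C * hgauge x powr (e + e')) (\<lambda>x. F x * G x)"
    using C(1) C'(1) by (intro exI[of _ "2 ^ k * (C * C')"]) auto
qed

lemma symbol_mono: "symbol e F \<Longrightarrow> e \<le> e' \<Longrightarrow> symbol e' F"
  unfolding symbol_def
proof
  fix k assume "\<forall>k. \<exists>C\<ge>0. sym.bounded_by k (\<lambda>x. C * hgauge x powr e) F" and e: "e \<le> e'"
  then obtain C where C: "0 \<le> C" "sym.bounded_by k (\<lambda>x. C * hgauge x powr e) F" by blast
  have "sym.bounded_by k (\<lambda>x. C * hgauge x powr e') F"
    by (rule sym.bounded_by_mono[OF C(2)]) (intro mult_left_mono hgauge_powr_mono e C(1))
  with C(1) show "\<exists>C\<ge>0. sym.bounded_by k (\<lambda>x. C * hgauge x powr e') F" by blast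
qed

lemma symbol_add:
  assumes "symbol e F" "symbol e G" shows "symbol e (\<lambda>x. F x + G x)"
  unfolding symbol_def
proof
  fix k
  obtain C where C: "0 \<le> C" "sym.bounded_by k (\<lambda>x. C * hgauge x powr e) F" by (rule symbE[OF assms(1)])
  obtain C' where C': "0 \<le> C'" "sym.bounded_by k (\<lambda>x. C' * hgauge x powr e) G" by (rule symbE[OF assms(2)])
  have "sym.bounded_by k (\<lambda>x. (C + C') * hgauge x powr e) (\<lambda>x. F x + G x)"
    by (rule sym.bounded_by_mono[OF sym.bounded_by_add[OF C(2) C'(2)]]) (simp add: distrib_right)
  then show "\<exists>C\<ge>0. sym.bounded_by k (\<lambda>x. C * hgauge x powr e) (\<lambda>x. F x + G x)"
    using C(1) C'(1) by (intro exI[of _ "C + C'"]) auto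
qed

lemma symbol_const: "0 \<le> e \<Longrightarrow> symbol e (\<lambda>x. c)"
  unfolding symbol_def
proof
  fix k assume e: "0 \<le> e"
  have "1 \<le> hgauge x powr e" for x :: "real^'n::_^'n::{finite,wellorder}"
    using hgauge_powr_mono[OF e, of x] hgauge_pos[of x] by simp
  then show "\<exists>C\<ge>0. sym.bounded_by k (\<lambda>x. C * hgauge x powr e) (\<lambda>x. c)"
    by (intro exI[of _ "norm c"] conjI sym.bounded_by_mono[OF sym.bounded_by_const]) (auto simp: mult_le_cancel_left1)
qed

lemma symbol_minus: "symbol e F \<Longrightarrow> symbol e (\<lambda>x. - F x)"
  using symbol_mult[OF symbol_const[OF order_refl, of "-1"], of e F] by simp

lemma symbol_zero: "symbol e (\<lambda>x. 0)"
  unfolding symbol_def by (intro allI exI[of _ 0]) (auto intro: sym.bounded_by_zero)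

lemma symbol_sum: "(\<And>i. i \<in> I \<Longrightarrow> symbol e (F i)) \<Longrightarrow> symbol e (\<lambda>x. \<Sum>i\<in>I. F i x)"
  by (induction I rule: infinite_finite_induct) (auto intro: symbol_zero symbol_add)

lemma symbol_cong: "symbol e F \<Longrightarrow> (\<And>x. x \<in> GL \<Longrightarrow> F x = G x) \<Longrightarrow> symbol e G"
  unfolding symbol_def
proof
  fix k assume "\<forall>k. \<exists>C\<ge>0. sym.bounded_by k (\<lambda>x. C * hgauge x powr e) F" and e: "\<And>x. x \<in> GL \<Longrightarrow> F x = G x"
  then obtain C where C: "0 \<le> C" "sym.bounded_by k (\<lambda>x. C * hgauge x powr e) F" by blast
  have "sym.bounded_by k (\<lambda>x. C * hgauge x powr e) G"
    by (rule sym.bounded_by_cong[OF C(2)]) (rule e)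
  with C(1) show "\<exists>C\<ge>0. sym.bounded_by k (\<lambda>x. C * hgauge x powr e) G" by blast
qed

lemma symbol_power: "symbol e F \<Longrightarrow> symbol (real m * e) (\<lambda>x. F x ^ m)"
proof (induction m)
  case 0
  then show ?case by (simp add: symbol_const)
next
  case (Suc m)
  have "symbol (e + real m * e) (\<lambda>x. F x * F x ^ m)" by (intro symbol_mult Suc)
  then show ?case by (simp add: algebra_simps)
qed

lemma triple_symbol:
  assumes k: "sym.bounded_by k (\<lambda>x. C * hgauge x powr a) F" "sym.bounded_by k (\<lambda>x. C * hgauge x powr b) G" "sym.bounded_by k (\<lambda>x. C * hgauge x powr c) H"
    and C: "0 \<le> C" and e: "a + b + c \<le> e"
  shows "sym.bounded_by k (\<lambda>x. 4 ^ k * C ^ 3 * hgauge x powr e) (\<lambda>x. F x * G x * H x)"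
proof (rule sym.bounded_by_mono[OF sym.bounded_by_mult[OF sym.bounded_by_mult[OF k(1,2)] k(3)]])
  fix x :: "real^'n::_^'n::{finite,wellorder}"
  have "2 ^ k * (2 ^ k * (C * hgauge x powr a * (C * hgauge x powr b)) * (C * hgauge x powr c)) =
     ((2 ^ k * 2 ^ k) * C ^ 3) * hgauge x powr (a + b + c)"
    by (simp add: powr_add power3_eq_cube mult_ac)
  also have "\<dots> = (4 ^ k * C ^ 3) * hgauge x powr (a + b + c)"
    by (simp flip: power_mult_distrib)
  also have "\<dots> \<le> (4 ^ k * C ^ 3) * hgauge x powr e"
    using C by (intro mult_left_mono hgauge_powr_mono e) auto
  finally show "2 ^ k * (2 ^ k * (C * hgauge x powr a * (C * hgauge x powr b)) * (C * hgauge x powr c)) \<le> 4 ^ k * C ^ 3 * hgauge x powr e" .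
qed

text \<open>The derivative of an entry of \<open>x\<close> or \<open>x\<^sup>-\<^sup>1\<close> along
  \<open>borel_field\<close> is a sum of products of three such entries whose degrees add up
  correctly, so the estimates reproduce themselves.\<close>

lemma entries_symbol_aux:
  "\<exists>C\<ge>0. \<forall>i j::'n::{finite,wellorder}. sym.bounded_by k (\<lambda>x. C * hgauge x powr height i j) (entry i j) \<and> sym.bounded_by k (\<lambda>x. C * hgauge x powr height i j) (inv_entry i j)"
proof (induction k)
  case 0
  let ?K = "real CARD('n) ^ CARD('n)"
  have "sym.bounded_by 0 (\<lambda>x. ?K * hgauge x powr height i j) (entry i j) \<and> sym.bounded_by 0 (\<lambda>x. ?K * hgauge x powr height i j) (inv_entry i j)" for i j :: 'n
    by (auto simp: smooth_on_entry smooth_on_inv_entry entry_def[abs_def] inv_entry_def[abs_def] intro: entry_gauge_bound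
        smooth_on_entry[unfolded entry_def[abs_def]] smooth_on_inv_entry[unfolded inv_entry_def[abs_def]])
  then show ?case by (intro exI[of _ ?K]) auto
next
  case (Suc k)
  then obtain C where C: "0 \<le> C" "\<And>i j::'n. sym.bounded_by k (\<lambda>x. C * hgauge x powr height i j) (entry i j)"
    "\<And>i j::'n. sym.bounded_by k (\<lambda>x. C * hgauge x powr height i j) (inv_entry i j)" by blast
  let ?B = "real CARD('n) * (4 ^ k * C ^ 3)"
  have B: "0 \<le> ?B" using C(1) by simp
  have le: "(\<Sum>l\<in>I. 4 ^ k * C ^ 3 * hgauge x powr e) \<le> ?B * hgauge x powr e" for I :: "'n set" and e and x :: "real^'n::_^'n::{finite,wellorder}"
    using C(1) card_mono[of UNIV I] by (simp add: mult_right_mono mult.assoc[symmetric])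
  have step: "sym.bounded_by k (\<lambda>x. (C + ?B) * hgauge x powr height i j * hgauge x ^ level cd) F"
    if "sym.bounded_by k (\<lambda>x. \<Sum>l\<in>I. 4 ^ k * C ^ 3 * hgauge x powr (height i j + level cd)) F"
    for i j :: 'n and cd :: "'n \<times> 'n" and I :: "'n set" and F :: "real^'n::_^'n::{finite,wellorder} \<Rightarrow> complex"
  proof (rule sym.bounded_by_mono[OF that])
    fix x :: "real^'n::_^'n::{finite,wellorder}"
    have "(\<Sum>l\<in>I. 4 ^ k * C ^ 3 * hgauge x powr (height i j + level cd)) \<le> (C + ?B) * hgauge x powr (height i j + level cd)"
      by (rule order_trans[OF le]) (use C(1) in \<open>simp add: distrib_right\<close>)
    then show "(\<Sum>l\<in>I. 4 ^ k * C ^ 3 * hgauge x powr (height i j + level cd)) \<le> (C + ?B) * hgauge x powr height i j * hgauge x ^ level cd"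
      by (simp add: powr_add powr_realpow hgauge_pos mult.assoc)
  qed
  have level: "real (pos (fst cd)) - real (pos (snd cd)) \<le> real (level cd)" for cd :: "'n \<times> 'n"
    by (simp add: level_def)
  have x: "sym.bounded_by k (\<lambda>x. (C + ?B) * hgauge x powr height i j * hgauge x ^ level cd) (vf_deriv (borel_field cd) (entry i j))" for i j :: 'n and cd
  proof (rule step[where I = "{..<j}"], unfold vf_deriv_borel_field_entry[abs_def], rule sym.bounded_by_sum)
    show "sym.bounded_by k (\<lambda>x. 4 ^ k * C ^ 3 * hgauge x powr (height i j + real (level cd)))
          (\<lambda>x. entry i l x * inv_entry l (fst cd) x * entry (snd cd) j x)" for l
      using level[of cd] by (intro triple_symbol[OF C(2) C(3) C(2) C(1)]) (simp add: height_def)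
  qed
  have y: "sym.bounded_by k (\<lambda>x. (C + ?B) * hgauge x powr height i j * hgauge x ^ level cd) (vf_deriv (borel_field cd) (inv_entry i j))" for i j :: 'n and cd
  proof (rule step[where I = "{i<..}"], rule sym.bounded_by_cong[OF _ vf_deriv_borel_field_inv_entry[symmetric]], unfold sum_negf[symmetric], rule sym.bounded_by_sum)
    show "sym.bounded_by k (\<lambda>x. 4 ^ k * C ^ 3 * hgauge x powr (height i j + real (level cd)))
          (\<lambda>x. - (inv_entry i (fst cd) x * entry (snd cd) l x * inv_entry l j x))" for l
      using sym.bounded_by_cmult[OF triple_symbol[OF C(3)[of i "fst cd"] C(2)[of "snd cd" l] C(3)[of l j] C(1)], of "height i j + real (level cd)" "-1"] level[of cd]
      by (simp add: height_def)
  qed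
  have m: "sym.bounded_by k (\<lambda>x. (C + ?B) * hgauge x powr height i j) F" if "sym.bounded_by k (\<lambda>x. C * hgauge x powr height i j) F" for i j :: 'n and F
    by (rule sym.bounded_by_mono[OF that]) (use B in \<open>simp add: distrib_right\<close>)
  show ?case
    by (rule exI[of _ "C + ?B"]) (use B C(1) in \<open>auto intro!: sym.bounded_by_SucI x y m C(2,3) simp del: sym.bounded_by.simps\<close>)
qed

lemma symbol_entry: "symbol (height i j) (entry i j)" for i j :: "'n::{finite,wellorder}"
  unfolding symbol_def
proof
  fix k show "\<exists>C\<ge>0. sym.bounded_by k (\<lambda>x. C * hgauge x powr height i j) (entry i j)"
    using entries_symbol_aux[where 'n = 'n, of k] by blast
qed

lemma symbol_inv_entry: "symbol (height i j) (inv_entry i j)" for i j :: "'n::{finite,wellorder}"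
  unfolding symbol_def
proof
  fix k show "\<exists>C\<ge>0. sym.bounded_by k (\<lambda>x. C * hgauge x powr height i j) (inv_entry i j)"
    using entries_symbol_aux[where 'n = 'n, of k] by blast
qed

lemma symbol_shift_entry:
  fixes cd :: "'n::{finite,wellorder} \<times> 'n"
  shows "symbol (real (level cd) + 1) (\<lambda>x. complex_of_real (shift_entry cd x))"
proof -
  have "symbol (real (level cd) + 1) (\<lambda>x. \<Sum>p\<in>consec. inv_entry (fst p) (fst cd) x * entry (snd cd) (snd p) x)"
  proof (rule symbol_sum)
    fix p :: "'n \<times> 'n" assume "p \<in> consec"
    then have "pos (snd p) = Suc (pos (fst p))" using consec_pos[of "fst p" "snd p"] by simp
    then show "symbol (real (level cd) + 1) (\<lambda>x. inv_entry (fst p) (fst cd) x * entry (snd cd) (snd p) x)"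
      by (intro symbol_mono[OF symbol_mult[OF symbol_inv_entry symbol_entry]]) (simp add: height_def level_def)
  qed
  then show ?thesis by (simp add: shift_entry_def entry_def inv_entry_def case_prod_unfold)
qed

definition gauge_sum_c :: "real^'n::_^'n::{finite,wellorder} \<Rightarrow> complex" where "gauge_sum_c x = complex_of_real (gauge_sum x)"

lemma gauge_sum_c_nz: "gauge_sum_c x \<noteq> 0" using gauge_sum_ge(1)[of x] by (simp add: gauge_sum_c_def)

lemma gauge_sum_c_eq: "gauge_sum_c x = 1 + (\<Sum>cd\<in>lower_pairs. complex_of_real (shift_entry cd x) ^ (2 * gauge_expo cd))"
  by (simp add: gauge_sum_c_def gauge_sum_def)

lemma symbol_gauge_sum: "symbol (2 * real (gauge_degree TYPE('n))) (gauge_sum_c :: real^'n::_^'n::{finite,wellorder} \<Rightarrow> complex)"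
  unfolding gauge_sum_c_eq[abs_def]
proof (intro symbol_add symbol_sum symbol_const)
  fix cd :: "'n \<times> 'n"
  have "real (2 * gauge_expo cd) * (real (level cd) + 1) = 2 * real (Suc (level cd) * gauge_expo cd)" by (simp add: algebra_simps)
  then have "real (2 * gauge_expo cd) * (real (level cd) + 1) = 2 * real (gauge_degree TYPE('n))" unfolding gauge_expo_mult .
  then show "symbol (2 * real (gauge_degree TYPE('n))) (\<lambda>x. complex_of_real (shift_entry cd x) ^ (2 * gauge_expo cd))"
    using symbol_power[OF symbol_shift_entry[of cd], of "2 * gauge_expo cd"] by (simp only:)
qed simp

text \<open>Differentiating \<open>1 / R\<close> gives \<open>- X R / R\<^sup>2\<close>; the orders
  \<open>2 D\<close> of \<open>R\<close> and \<open>- 2 D\<close> of \<open>1 / R\<close> make this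
  again a symbol of order \<open>- 2 D\<close>, apart from the weight of the field.\<close>

lemma symbol_inverse_gauge_sum: "symbol (- 2 * real (gauge_degree TYPE('n))) (\<lambda>x. inverse (gauge_sum_c (x :: real^'n::_^'n::{finite,wellorder})))"
  unfolding symbol_def
proof
  fix k
  let ?N = "2 * real (gauge_degree TYPE('n))" and ?I = "\<lambda>x :: real^'n::_^'n::{finite,wellorder}. inverse (gauge_sum_c x)"
  have sm: "smooth_on GL ?I" using symbol_smooth[OF symbol_gauge_sum] gauge_sum_c_nz by (intro smooth_on_inverse open_GL)
  have b: "norm (?I x) \<le> hgauge x powr (- ?N)" for x
    unfolding gauge_sum_c_def gauge_sum_gauge norm_inverse norm_of_real by (simp add: powr_minus)
  show "\<exists>C\<ge>0. sym.bounded_by k (\<lambda>x. C * hgauge x powr (- 2 * real (gauge_degree TYPE('n)))) ?I"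
  proof (induction k)
    case 0
    show ?case using sm b by (intro exI[of _ 1]) auto
  next
    case (Suc k)
    then obtain C where C: "0 \<le> C" "sym.bounded_by k (\<lambda>x. C * hgauge x powr (- ?N)) ?I" by auto
    obtain B where B: "0 \<le> B" "sym.bounded_by (Suc k) (\<lambda>x. B * hgauge x powr ?N) (gauge_sum_c :: real^'n::_^'n::{finite,wellorder} \<Rightarrow> complex)"
      by (rule symbE[OF symbol_gauge_sum])
    let ?A = "4 ^ k * B * C ^ 2"
    have d: "sym.bounded_by k (\<lambda>x. (C + ?A) * hgauge x powr (- ?N) * hgauge x ^ level cd) (vf_deriv (borel_field cd) ?I)" for cd
    proof (rule sym.bounded_by_cong)
      show "sym.bounded_by k (\<lambda>x. (C + ?A) * hgauge x powr (- ?N) * hgauge x ^ level cd) (\<lambda>x. (-1) * (vf_deriv (borel_field cd) gauge_sum_c x * ?I x * ?I x))"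
      proof (rule sym.bounded_by_mono[OF sym.bounded_by_cmult[OF sym.bounded_by_mult[OF sym.bounded_by_mult[OF sym.bounded_by_field[OF B(2)] C(2)] C(2)]]])
        fix x :: "real^'n::_^'n::{finite,wellorder}"
        have oo: "hgauge x powr ?N * hgauge x powr (- ?N) = 1" using hgauge_pos[of x] by (simp add: powr_add[symmetric])
        have p4: "2 ^ k * 2 ^ k = (4 :: real) ^ k" by (simp flip: power_mult_distrib)
        have "cmod (- 1) * (2 ^ k * (2 ^ k * (B * hgauge x powr ?N * hgauge x ^ level cd * (C * hgauge x powr - ?N)) *
           (C * hgauge x powr - ?N))) =
           (2 ^ k * 2 ^ k) * B * C\<^sup>2 * (hgauge x powr ?N * hgauge x powr (- ?N)) * hgauge x powr (- ?N) * hgauge x ^ level cd"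
          by (simp add: power2_eq_square mult_ac)
        also have "\<dots> = ?A * hgauge x powr (- ?N) * hgauge x ^ level cd"
          unfolding oo p4 by simp
        also have "\<dots> \<le> (C + ?A) * hgauge x powr (- ?N) * hgauge x ^ level cd"
          using C(1) hgauge_pos[of x] by (intro mult_right_mono) auto
        finally show "cmod (- 1) * (2 ^ k * (2 ^ k * (B * hgauge x powr ?N * hgauge x ^ level cd * (C * hgauge x powr - ?N)) *
           (C * hgauge x powr - ?N))) \<le> (C + ?A) * hgauge x powr (- ?N) * hgauge x ^ level cd" .
      qed
      fix x :: "real^'n::_^'n::{finite,wellorder}" assume "x \<in> GL"
      then have "gauge_sum_c differentiable at x" using symbol_smooth[OF symbol_gauge_sum] smooth_on_imp_differentiable by blast
      from vf_deriv_eqI[OF Deriv.has_derivative_inverse[OF gauge_sum_c_nz has_derivative_vf_deriv[OF this]]]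
      show "(-1) * (vf_deriv (borel_field cd) gauge_sum_c x * ?I x * ?I x) = vf_deriv (borel_field cd) ?I x"
        by (simp add: vf_deriv_apply[of "borel_field cd"] mult_ac)
    qed
    have "sym.bounded_by k (\<lambda>x. (C + ?A) * hgauge x powr (- ?N)) ?I"
      by (rule sym.bounded_by_mono[OF C(2)]) (use B(1) in \<open>simp add: distrib_right\<close>)
    then have "sym.bounded_by (Suc k) (\<lambda>x. (C + ?A) * hgauge x powr (- ?N)) ?I"
      using d by (rule sym.bounded_by_SucI)
    moreover have "0 \<le> C + ?A" using C(1) B(1) by simp
    ultimately show ?case by auto
  qed
qed

subsection \<open>The operator that gains decay\<close>

text \<open>The coefficient of \<open>\<theta>\<^sub>c\<^sub>d\<close> in the decomposition \<open>1
  = 1 / R + \<Sum> \<theta>\<^sub>c\<^sub>d \<cdot> (\<theta>\<^sub>c\<^sub>d\<^bsup>2 e - 1\<^esup>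
  / R)\<close>.\<close>

definition multiplier :: "'n::{finite,wellorder} \<times> 'n \<Rightarrow> real^'n::_^'n::{finite,wellorder} \<Rightarrow> complex" where
  "multiplier cd x = complex_of_real (shift_entry cd x) ^ (2 * gauge_expo cd - 1) * inverse (gauge_sum_c x)"

text \<open>The right invariant vector field that generates left translation by \<open>exp (t
  E\<^sub>a\<^sub>b)\<close>; for \<open>a < b\<close> it is tangent to \<open>N\<close>.\<close>

definition left_field :: "'n \<times> 'n \<Rightarrow> real^'n^'n \<Rightarrow> real^'n^'n" where
  "left_field ab x = munit (fst ab) (snd ab) ** x"

text \<open>The entry \<open>(a, b)\<close> of \<open>borel_field cd x \<cdot>
  x\<^sup>-\<^sup>1\<close>, that is, the coefficient of \<open>borel_field\<close> with respect to
  the right invariant frame of \<open>N\<close>.\<close>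

definition frame_coeff :: "'n::{finite,wellorder} \<times> 'n \<Rightarrow> 'n \<times> 'n \<Rightarrow> real^'n::_^'n::{finite,wellorder} \<Rightarrow> complex" where
  "frame_coeff cd ab x = (\<Sum>p\<in>UNIV. \<Sum>l\<in>{..<p}. (entry (fst ab) l x * inv_entry l (fst cd) x) * (entry (snd cd) p x * inv_entry p (snd ab) x))"

definition upper_pairs :: "('n::{finite,wellorder} \<times> 'n) set" where "upper_pairs = {(a, b). a < b}"

text \<open>The divergence of \<open>borel_field cd\<close> with respect to the left Haar measure,
  for which the fields \<open>left_field ab\<close> of the frame are divergence free.\<close>

definition frame_div :: "'n::{finite,wellorder} \<times> 'n \<Rightarrow> real^'n::_^'n::{finite,wellorder} \<Rightarrow> complex" where
  "frame_div cd x = (\<Sum>ab\<in>upper_pairs. vf_deriv (left_field ab) (frame_coeff cd ab) x)"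

text \<open>The transpose of the identity \<open>\<psi> = \<psi> / R + (1 / (2 \<pi> i)) \<Sum>
  multiplier\<^sub>c\<^sub>d \<cdot> X\<^sub>c\<^sub>d \<psi>\<close> with respect to Haar
  measure.\<close>

definition gain_op :: "(real^'n::_^'n::{finite,wellorder} \<Rightarrow> complex) \<Rightarrow> real^'n::_^'n::{finite,wellorder} \<Rightarrow> complex" where
  "gain_op F x = inverse (gauge_sum_c x) * F x - 1 / (2 * of_real pi * \<i>) *
     (\<Sum>cd\<in>lower_pairs. vf_deriv (borel_field cd) (\<lambda>x. multiplier cd x * F x) x + frame_div cd x * (multiplier cd x * F x))"

lemma symbol_multiplier: "symbol (- (real (level cd) + 1)) (multiplier cd)" for cd :: "'n::{finite,wellorder} \<times> 'n"
proof -
  have e: "real (2 * gauge_expo cd - 1) = 2 * real (gauge_expo cd) - 1" using gauge_expo_pos[of cd] by (simp add: of_nat_diff)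
  have "real (2 * gauge_expo cd - 1) * (real (level cd) + 1) + - 2 * real (gauge_degree TYPE('n)) =
     2 * real (Suc (level cd) * gauge_expo cd) - (real (level cd) + 1) - 2 * real (gauge_degree TYPE('n))"
    unfolding e by (simp add: algebra_simps)
  also have "\<dots> = - (real (level cd) + 1)" unfolding gauge_expo_mult by simp
  finally show ?thesis
    using symbol_mult[OF symbol_power[OF symbol_shift_entry[of cd], of "2 * gauge_expo cd - 1"] symbol_inverse_gauge_sum]
    by (simp add: multiplier_def[abs_def])
qed

lemma left_field_entry: "left_field ab x $ i $ j = (if i = fst ab then x $ snd ab $ j else 0)"
  unfolding left_field_def matrix_matrix_mult_def
  by (simp add: if_distrib[of "\<lambda>z. z * _"] sum.delta cong: if_cong)

lemma vf_deriv_left_field_entry: "vf_deriv (left_field ab) (entry i j) x = (if i = fst ab then entry (snd ab) j x else 0)"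
  unfolding vf_deriv_entry left_field_entry by (simp add: entry_def)

lemma vf_deriv_left_field_inv_entry:
  assumes x: "x \<in> GL"
  shows "vf_deriv (left_field ab) (inv_entry i j) x = (if j = snd ab then - inv_entry i (fst ab) x else 0)"
proof -
  have "(\<Sum>l\<in>UNIV. inv_entry i l x * complex_of_real (left_field ab x $ l $ p) * inv_entry p j x) = inv_entry i (fst ab) x * (entry (snd ab) p x * inv_entry p j x)" for p
    unfolding left_field_entry by (simp add: entry_def if_distrib if_distribR mult_ac cong: if_cong)
  then show ?thesis unfolding vf_deriv_inv_entry[OF x]
    by (simp add: sum_distrib_left[symmetric] sum_entry_inv_entry[OF x])
qed

text \<open>Along the right invariant fields of \<open>N\<close> the order drops by \<open>b -
  a\<close>. One derivative along them is all that the divergence needs.\<close>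

definition symbol1 :: "'n::{finite,wellorder} \<times> 'n \<Rightarrow> real \<Rightarrow> (real^'n::_^'n::{finite,wellorder} \<Rightarrow> complex) \<Rightarrow> bool" where
  "symbol1 ab e F \<longleftrightarrow> symbol e F \<and> symbol (e + height (snd ab) (fst ab)) (vf_deriv (left_field ab) F)"

lemma symbol1_entry: "symbol1 ab (height i j) (entry i j)"
proof -
  have "symbol (height i j + height (snd ab) (fst ab)) (vf_deriv (left_field ab) (entry i j))"
    unfolding vf_deriv_left_field_entry[abs_def]
    by (cases "i = fst ab") (auto intro!: symbol_mono[OF symbol_entry] symbol_zero simp: height_def)
  then show ?thesis by (simp add: symbol1_def symbol_entry)
qed

lemma symbol1_inv_entry: "symbol1 ab (height i j) (inv_entry i j)"
proof -
  have "symbol (height i j + height (snd ab) (fst ab)) (\<lambda>x. if j = snd ab then - inv_entry i (fst ab) x else 0)"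
    by (cases "j = snd ab") (auto intro!: symbol_mono[OF symbol_minus[OF symbol_inv_entry]] symbol_zero simp: height_def)
  then have "symbol (height i j + height (snd ab) (fst ab)) (vf_deriv (left_field ab) (inv_entry i j))"
    by (rule symbol_cong) (simp add: vf_deriv_left_field_inv_entry)
  then show ?thesis by (simp add: symbol1_def symbol_inv_entry)
qed

lemma symbol1_mult:
  fixes ab :: "'n::{finite,wellorder} \<times> 'n"
  assumes "symbol1 ab e F" "symbol1 ab e' G" shows "symbol1 ab (e + e') (\<lambda>x. F x * G x)"
proof -
  let ?X = "vf_deriv (left_field ab)" and ?d = "height (snd ab) (fst ab)"
  have F: "symbol e F" "symbol (e + ?d) (?X F)" and G: "symbol e' G" "symbol (e' + ?d) (?X G)"
    using assms by (auto simp: symbol1_def)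
  have "symbol (e + e' + ?d) (\<lambda>x. ?X F x * G x + F x * ?X G x)"
    using symbol_mult[OF F(2) G(1)] symbol_mult[OF F(1) G(2)] by (intro symbol_add) (simp_all add: algebra_simps)
  then have "symbol (e + e' + ?d) (?X (\<lambda>x. F x * G x))"
  proof (rule symbol_cong)
    fix x :: "real^'n::_^'n::{finite,wellorder}" assume x: "x \<in> GL"
    show "?X F x * G x + F x * ?X G x = ?X (\<lambda>x. F x * G x) x"
      using smooth_on_imp_differentiable[OF symbol_smooth[OF F(1)] x]
        smooth_on_imp_differentiable[OF symbol_smooth[OF G(1)] x] by (simp add: vf_deriv_mult)
  qed
  then show ?thesis using symbol_mult[OF F(1) G(1)] by (simp add: symbol1_def)
qed

lemma symbol1_sum:
  fixes ab :: "'n::{finite,wellorder} \<times> 'n"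
  assumes "finite I" "\<And>i. i \<in> I \<Longrightarrow> symbol1 ab e (F i)" shows "symbol1 ab e (\<lambda>x. \<Sum>i\<in>I. F i x)"
proof -
  have s: "symbol e (\<lambda>x. \<Sum>i\<in>I. F i x)" using assms by (intro symbol_sum) (auto simp: symbol1_def)
  have "symbol (e + height (snd ab) (fst ab)) (\<lambda>x. \<Sum>i\<in>I. vf_deriv (left_field ab) (F i) x)"
    using assms by (intro symbol_sum) (auto simp: symbol1_def)
  then have "symbol (e + height (snd ab) (fst ab)) (vf_deriv (left_field ab) (\<lambda>x. \<Sum>i\<in>I. F i x))"
  proof (rule symbol_cong)
    fix x :: "real^'n::_^'n::{finite,wellorder}" assume "x \<in> GL"
    then show "(\<Sum>i\<in>I. vf_deriv (left_field ab) (F i) x) = vf_deriv (left_field ab) (\<lambda>x. \<Sum>i\<in>I. F i x) x"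
      using assms(2) by (subst vf_deriv_sum) (auto simp: symbol1_def dest: symbol_smooth smooth_on_imp_differentiable)
  qed
  with s show ?thesis by (simp add: symbol1_def)
qed

lemma symbol1_frame_coeff:
  "symbol1 ab (real (pos (fst cd)) - real (pos (snd cd)) + height (fst ab) (snd ab)) (frame_coeff cd ab)"
  unfolding frame_coeff_def[abs_def]
proof (intro symbol1_sum finite)
  fix p l
  have "height (fst ab) l + height l (fst cd) + (height (snd cd) p + height p (snd ab)) =
     real (pos (fst cd)) - real (pos (snd cd)) + height (fst ab) (snd ab)" by (simp add: height_def)
  with symbol1_mult[OF symbol1_mult[OF symbol1_entry[of ab "fst ab" l] symbol1_inv_entry[of ab l "fst cd"]] symbol1_mult[OF symbol1_entry[of ab "snd cd" p] symbol1_inv_entry[of ab p "snd ab"]]]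
  show "symbol1 ab (real (pos (fst cd)) - real (pos (snd cd)) + height (fst ab) (snd ab))
     (\<lambda>x. entry (fst ab) l x * inv_entry l (fst cd) x * (entry (snd cd) p x * inv_entry p (snd ab) x))" by simp
qed

lemma symbol_frame_div: "symbol (real (level cd)) (frame_div cd)" for cd :: "'n::{finite,wellorder} \<times> 'n"
  unfolding frame_div_def[abs_def]
proof (rule symbol_sum)
  fix ab :: "'n \<times> 'n"
  have "real (pos (fst cd)) - real (pos (snd cd)) + height (fst ab) (snd ab) + height (snd ab) (fst ab) \<le> real (level cd)"
    by (simp add: height_def level_def)
  then show "symbol (real (level cd)) (vf_deriv (left_field ab) (frame_coeff cd ab))"
    using symbol1_frame_coeff[of ab cd] symbol_mono by (auto simp: symbol1_def)
qed

text \<open>The multiplier has order \<open>- (level + 1)\<close>, while a derivative along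
  \<open>borel_field\<close>, like the multiplication with the divergence, costs only
  \<open>level\<close>. The price is one order of differentiability.\<close>

lemma gain_op_gain_step:
  "\<exists>C\<ge>0. \<forall>\<alpha> F. sym.bounded_by (Suc k) \<alpha> F \<longrightarrow> sym.bounded_by k (\<lambda>x. C * (\<alpha> x * hgauge x powr - 1)) (gain_op (F :: real^'n::_^'n::{finite,wellorder} \<Rightarrow> complex))"
proof -
  obtain Ci where Ci: "0 \<le> Ci" "sym.bounded_by k (\<lambda>x. Ci * hgauge x powr (- 2 * real (gauge_degree TYPE('n)))) (\<lambda>x :: real^'n::_^'n::{finite,wellorder}. inverse (gauge_sum_c x))"
    by (rule symbE[OF symbol_inverse_gauge_sum])
  have "\<forall>cd. \<exists>C\<ge>0. sym.bounded_by (Suc k) (\<lambda>x. C * hgauge x powr (- (real (level cd) + 1))) (multiplier (cd :: 'n \<times> 'n))"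
    by (intro allI symbD symbol_multiplier)
  then obtain Cg where Cg: "\<And>cd. 0 \<le> Cg cd" "\<And>cd :: 'n \<times> 'n. sym.bounded_by (Suc k) (\<lambda>x. Cg cd * hgauge x powr (- (real (level cd) + 1))) (multiplier cd)"
    by metis
  have "\<forall>cd. \<exists>C\<ge>0. sym.bounded_by k (\<lambda>x. C * hgauge x powr (real (level cd))) (frame_div (cd :: 'n \<times> 'n))"
    by (intro allI symbD symbol_frame_div)
  then obtain Cd where Cd: "\<And>cd. 0 \<le> Cd cd" "\<And>cd :: 'n \<times> 'n. sym.bounded_by k (\<lambda>x. Cd cd * hgauge x powr (real (level cd))) (frame_div cd)"
    by metis
  let ?c = "- (1 / (2 * complex_of_real pi * \<i>))"
  define A where "A cd = 2 ^ Suc k * Cg cd + 2 ^ k * Cd cd * (2 ^ k * Cg cd)" for cd :: "'n \<times> 'n"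
  define C where "C = 2 ^ k * Ci + norm ?c * (\<Sum>cd\<in>lower_pairs. A cd)"
  have "sym.bounded_by k (\<lambda>x. C * (\<alpha> x * hgauge x powr - 1)) (gain_op F)" if F: "sym.bounded_by (Suc k) \<alpha> F" for \<alpha> and F :: "real^'n::_^'n::{finite,wellorder} \<Rightarrow> complex"
  proof -
    have Fk: "sym.bounded_by k \<alpha> F" by (rule sym.bounded_by_SucD[OF F])
    have \<alpha>: "0 \<le> \<alpha> x" if "x \<in> unipotent_upper" for x using sym.bounded_by_nonneg[OF F that] .
    have 1: "sym.bounded_by k (\<lambda>x. 2 ^ k * Ci * (\<alpha> x * hgauge x powr - 1)) (\<lambda>x. inverse (gauge_sum_c x) * F x)"
    proof (rule sym.bounded_by_mono[OF sym.bounded_by_mult[OF Ci(2) Fk]])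
      fix x :: "real^'n::_^'n::{finite,wellorder}" assume x: "x \<in> unipotent_upper"
      have "1 \<le> real (gauge_degree TYPE('n))" using gauge_degree_pos[where 'n = 'n] by linarith
      then have "hgauge x powr (- 2 * real (gauge_degree TYPE('n))) \<le> hgauge x powr - 1"
        by (intro hgauge_powr_mono) linarith
      then have "2 ^ k * (Ci * \<alpha> x) * hgauge x powr (- 2 * real (gauge_degree TYPE('n))) \<le> 2 ^ k * (Ci * \<alpha> x) * hgauge x powr - 1"
        using Ci(1) \<alpha>[OF x] by (intro mult_left_mono) auto
      then show "2 ^ k * (Ci * hgauge x powr (- 2 * real (gauge_degree TYPE('n))) * \<alpha> x) \<le> 2 ^ k * Ci * (\<alpha> x * hgauge x powr - 1)"
        by (simp add: mult_ac)
    qed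
    have 2: "sym.bounded_by k (\<lambda>x. A cd * (\<alpha> x * hgauge x powr - 1))
        (\<lambda>x. vf_deriv (borel_field cd) (\<lambda>x. multiplier cd x * F x) x + frame_div cd x * (multiplier cd x * F x))" for cd
    proof (rule sym.bounded_by_mono[OF sym.bounded_by_add[OF sym.bounded_by_field[OF sym.bounded_by_mult[OF Cg(2) F]]
            sym.bounded_by_mult[OF Cd(2) sym.bounded_by_mult[OF sym.bounded_by_SucD[OF Cg(2)] Fk]]]])
      fix x :: "real^'n::_^'n::{finite,wellorder}"
      have e: "hgauge x powr (- (real (level cd) + 1)) = hgauge x powr - 1 / hgauge x ^ level cd"
        using hgauge_pos[of x] by (simp add: powr_diff powr_minus powr_add powr_realpow field_simps)
      have nz: "hgauge x ^ level cd \<noteq> 0" using hgauge_pos[of x] by simp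
      show "2 ^ Suc k * (Cg cd * hgauge x powr (- (real (level cd) + 1)) * \<alpha> x) * hgauge x ^ level cd +
          2 ^ k * (Cd cd * hgauge x powr real (level cd) * (2 ^ k * (Cg cd * hgauge x powr (- (real (level cd) + 1)) * \<alpha> x)))
          \<le> A cd * (\<alpha> x * hgauge x powr - 1)"
      proof -
        have "2 ^ Suc k * (Cg cd * (p / w) * a) * w + 2 ^ k * (Cd cd * w * (2 ^ k * (Cg cd * (p / w) * a))) = A cd * (a * p)"
          if "w \<noteq> 0" for p w a :: real
          unfolding A_def using that by (simp add: field_simps)
        from this[OF nz] show ?thesis unfolding e powr_realpow[OF hgauge_pos] by (rule eq_refl)
      qed
    qed
    have "sym.bounded_by k (\<lambda>x. C * (\<alpha> x * hgauge x powr - 1)) (\<lambda>x. inverse (gauge_sum_c x) * F x + ?c *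
       (\<Sum>cd\<in>lower_pairs. vf_deriv (borel_field cd) (\<lambda>x. multiplier cd x * F x) x + frame_div cd x * (multiplier cd x * F x)))"
    proof (rule sym.bounded_by_mono[OF sym.bounded_by_add[OF 1 sym.bounded_by_cmult[OF sym.bounded_by_sum[OF 2]]]])
      have "2 ^ k * Ci * z + cmod ?c * (\<Sum>cd\<in>lower_pairs. A cd * z) \<le> C * z" for z
        unfolding C_def distrib_right sum_distrib_right[symmetric] by (simp add: mult.assoc)
      then show "2 ^ k * Ci * (\<alpha> x * hgauge x powr - 1) + cmod ?c * (\<Sum>cd\<in>lower_pairs. A cd * (\<alpha> x * hgauge x powr - 1))
         \<le> C * (\<alpha> x * hgauge x powr - 1)" for x .
    qed
    then show ?thesis by (simp add: gain_op_def[abs_def])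
  qed
  moreover have "0 \<le> C" unfolding C_def A_def using Ci(1) Cg(1) Cd(1)
    by (intro add_nonneg_nonneg mult_nonneg_nonneg sum_nonneg) auto
  ultimately show ?thesis by blast
qed

lemma gain_op_gain:
  "\<exists>C\<ge>0. \<forall>\<alpha> F. sym.bounded_by (k + M) \<alpha> F \<longrightarrow> sym.bounded_by k (\<lambda>x. C * (\<alpha> x * hgauge x powr - real M)) ((gain_op ^^ M) (F :: real^'n::_^'n::{finite,wellorder} \<Rightarrow> complex))"
proof (induction M arbitrary: k)
  case 0
  have "sym.bounded_by k (\<lambda>x. 1 * (\<alpha> x * hgauge x powr - real 0)) F" if "sym.bounded_by k \<alpha> F" for \<alpha> and F :: "real^'n::_^'n::{finite,wellorder} \<Rightarrow> complex"
  proof (rule sym.bounded_by_mono[OF that])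
    fix x :: "real^'n::_^'n::{finite,wellorder}"
    show "\<alpha> x \<le> 1 * (\<alpha> x * hgauge x powr - real 0)" using hgauge_pos[of x] by simp
  qed
  then show ?case unfolding add_0_right funpow_0 using zero_le_one by blast
next
  case (Suc M)
  obtain C where C: "0 \<le> C" "\<And>\<alpha> F. sym.bounded_by (Suc k + M) \<alpha> F \<Longrightarrow>
     sym.bounded_by (Suc k) (\<lambda>x. C * (\<alpha> x * hgauge x powr - real M)) ((gain_op ^^ M) (F :: real^'n::_^'n::{finite,wellorder} \<Rightarrow> complex))"
    using Suc.IH[of "Suc k"] by blast
  obtain B where B: "0 \<le> B" "\<And>\<alpha> F. sym.bounded_by (Suc k) \<alpha> F \<Longrightarrow> sym.bounded_by k (\<lambda>x. B * (\<alpha> x * hgauge x powr - 1)) (gain_op (F :: real^'n::_^'n::{finite,wellorder} \<Rightarrow> complex))"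
    using gain_op_gain_step by blast
  have "sym.bounded_by k (\<lambda>x. (B * C) * (\<alpha> x * hgauge x powr - real (Suc M))) ((gain_op ^^ Suc M) F)" if "sym.bounded_by (k + Suc M) \<alpha> F"
    for \<alpha> and F :: "real^'n::_^'n::{finite,wellorder} \<Rightarrow> complex"
  proof -
    have "sym.bounded_by k (\<lambda>x. B * (C * (\<alpha> x * hgauge x powr - real M) * hgauge x powr - 1)) (gain_op ((gain_op ^^ M) F))"
      by (rule B(2), rule C(2)) (use that in \<open>simp only: add_Suc_right add_Suc\<close>)
    moreover have "hgauge x powr - real (Suc M) = hgauge x powr - real M * hgauge x powr - 1" for x :: "real^'n::_^'n::{finite,wellorder}"
    proof -
      have "- real (Suc M) = - real M + - 1" by simp
      then show ?thesis by (simp only: powr_add)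
    qed
    ultimately show ?thesis by (simp add: mult_ac del: sym.bounded_by.simps)
  qed
  moreover have "0 \<le> B * C" using B(1) C(1) by simp
  ultimately show ?case by blast
qed

section \<open>Iwasawa decomposition and the principal series\<close>

text \<open>Gram-Schmidt from the last column backwards, so that the triangular factor is lower
  triangular.\<close>

function gram_schmidt :: "real^'n::_^'n::{finite,wellorder} \<Rightarrow> 'n \<Rightarrow> real^'n::{finite,wellorder}" where
  "gram_schmidt g j = (let u = column j g - (\<Sum>l\<in>{j<..}. (column j g \<bullet> gram_schmidt g l) *\<^sub>R gram_schmidt g l) in u /\<^sub>R norm u)"
  by auto
termination
  by (relation "Wellfounded.measure (\<lambda>(g, j). card {j<..})") (auto intro!: psubset_card_mono)

declare gram_schmidt.simps [simp del]

text \<open>The vector before normalization, whose norm is the diagonal entry of the triangular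
  factor.\<close>

definition gs_residual :: "real^'n::_^'n::{finite,wellorder} \<Rightarrow> 'n \<Rightarrow> real^'n::{finite,wellorder}" where
  "gs_residual g j = column j g - (\<Sum>l\<in>{j<..}. (column j g \<bullet> gram_schmidt g l) *\<^sub>R gram_schmidt g l)"

definition torus_part :: "real^'n::_^'n::{finite,wellorder} \<Rightarrow> 'n \<Rightarrow> real" where "torus_part g j = norm (gs_residual g j)"

lemma gram_schmidt_eq: "gram_schmidt g j = gs_residual g j /\<^sub>R torus_part g j"
  by (subst gram_schmidt.simps) (simp add: gs_residual_def torus_part_def Let_def)

text \<open>The residual is \<open>g v\<close> with \<open>v\<^sub>j = 1\<close>, hence nonzero for
  invertible \<open>g\<close>; the last clause carries this through the induction.\<close>

lemma gram_schmidt_invariant: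
  fixes g :: "real^'n::_^'n::{finite,wellorder}"
  assumes "g \<in> GL"
  shows "0 < torus_part g j \<and> gram_schmidt g j \<bullet> gram_schmidt g j = 1 \<and> (\<forall>l>j. gram_schmidt g l \<bullet> gram_schmidt g j = 0) \<and>
     (\<exists>c. gram_schmidt g j = g *v c \<and> (\<forall>i<j. c $ i = 0))"
proof (induction j rule: down_induct)
  case (step j)
  have on: "gram_schmidt g l \<bullet> gram_schmidt g m = (if l = m then 1 else 0)" if "j < l" "j < m" for l m
    using step[OF that(1)] step[OF that(2)] by (cases l m rule: linorder_cases) (auto simp: inner_commute)
  have "\<forall>l\<in>{j<..}. \<exists>c. gram_schmidt g l = g *v c \<and> (\<forall>i<l. c $ i = 0)" using step by auto
  then obtain c where c: "\<And>l. j < l \<Longrightarrow> gram_schmidt g l = g *v c l" "\<And>l i. j < l \<Longrightarrow> i < l \<Longrightarrow> c l $ i = 0"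
    unfolding greaterThan_iff bchoice_iff by (metis greaterThan_iff)
  \<comment> \<open>The coordinates of the residual with respect to the columns of
    \<open>g\<close>.\<close>
  define v where "v = axis j 1 - (\<Sum>l\<in>{j<..}. (column j g \<bullet> gram_schmidt g l) *\<^sub>R c l)"
  have "g *v v = column j g - (\<Sum>l\<in>{j<..}. (column j g \<bullet> gram_schmidt g l) *\<^sub>R (g *v c l))"
    unfolding v_def by (simp add: matrix_vector_mult_diff_distrib matrix_vector_mult_basis
        linear_sum[OF matrix_vector_mul_linear] linear_cmul[OF matrix_vector_mul_linear])
  then have gv: "g *v v = gs_residual g j" unfolding gs_residual_def using c(1) by simp
  have vj: "v $ j = 1" and vi: "\<And>i. i < j \<Longrightarrow> v $ i = 0"
    unfolding v_def using c(2) by (auto simp: axis_def intro!: sum.neutral)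
  have "gs_residual g j \<noteq> 0"
  proof
    assume "gs_residual g j = 0"
    then have "matrix_inv g *v (g *v v) = 0" by (simp add: gv)
    then have "v = 0" by (simp add: matrix_vector_mul_assoc matrix_inv_right_left[OF assms])
    with vj show False by simp
  qed
  then have t: "0 < torus_part g j" by (simp add: torus_part_def)
  have "gram_schmidt g j \<bullet> gram_schmidt g j = 1" using t unfolding gram_schmidt_eq by (simp add: torus_part_def dot_square_norm power2_eq_square field_simps)
  moreover have "gram_schmidt g l \<bullet> gram_schmidt g j = 0" if "j < l" for l
  proof -
    have "gram_schmidt g l \<bullet> gs_residual g j = gram_schmidt g l \<bullet> column j g - (\<Sum>m\<in>{j<..}. (column j g \<bullet> gram_schmidt g m) * (gram_schmidt g l \<bullet> gram_schmidt g m))"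
      unfolding gs_residual_def by (simp add: inner_diff_right inner_sum_right)
    also have "(\<Sum>m\<in>{j<..}. (column j g \<bullet> gram_schmidt g m) * (gram_schmidt g l \<bullet> gram_schmidt g m)) = (\<Sum>m\<in>{j<..}. if m = l then column j g \<bullet> gram_schmidt g l else 0)"
      by (rule sum.cong) (use on[OF that] in auto)
    also have "\<dots> = gram_schmidt g l \<bullet> column j g" using that by (simp add: inner_commute)
    finally show ?thesis unfolding gram_schmidt_eq[of g j] by simp
  qed
  moreover have "gram_schmidt g j = g *v (v /\<^sub>R torus_part g j)"
    unfolding gram_schmidt_eq[of g j] gv[symmetric] by (simp add: linear_cmul[OF matrix_vector_mul_linear])
  ultimately show ?case using t vi by (intro conjI exI[of _ "v /\<^sub>R torus_part g j"]) auto
qed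

lemma torus_part_pos: "g \<in> GL \<Longrightarrow> 0 < torus_part g j"
  using gram_schmidt_invariant by blast

lemma gram_schmidt_orthonormal: "g \<in> GL \<Longrightarrow> gram_schmidt g i \<bullet> gram_schmidt g j = (if i = j then 1 else 0)"
  using gram_schmidt_invariant[of g i] gram_schmidt_invariant[of g j] by (cases i j rule: linorder_cases) (auto simp: inner_commute)

lemma column_gram_schmidt:
  assumes "g \<in> GL"
  shows "column j g = torus_part g j *\<^sub>R gram_schmidt g j + (\<Sum>l\<in>{j<..}. (column j g \<bullet> gram_schmidt g l) *\<^sub>R gram_schmidt g l)"
  using torus_part_pos[OF assms, of j] unfolding gram_schmidt_eq[of g j] by (simp add: gs_residual_def)

lemma column_inner_gram_schmidt:
  assumes "g \<in> GL"
  shows "i < j \<Longrightarrow> gram_schmidt g i \<bullet> column j g = 0" "gram_schmidt g j \<bullet> column j g = torus_part g j"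
proof -
  have e: "gram_schmidt g i \<bullet> column j g = torus_part g j * (gram_schmidt g i \<bullet> gram_schmidt g j) + (\<Sum>l\<in>{j<..}. (column j g \<bullet> gram_schmidt g l) * (gram_schmidt g i \<bullet> gram_schmidt g l))" for i
    using arg_cong[OF column_gram_schmidt[OF assms, of j], of "\<lambda>v. gram_schmidt g i \<bullet> v"]
    by (simp add: inner_add_right inner_sum_right)
  show "i < j \<Longrightarrow> gram_schmidt g i \<bullet> column j g = 0"
    unfolding e gram_schmidt_orthonormal[OF assms] by (auto intro!: sum.neutral)
  have "(\<Sum>l\<in>{j<..}. (column j g \<bullet> gram_schmidt g l) * (gram_schmidt g j \<bullet> gram_schmidt g l)) = 0"
    unfolding gram_schmidt_orthonormal[OF assms] by (rule sum.neutral) auto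
  then show "gram_schmidt g j \<bullet> column j g = torus_part g j"
    using e[of j] gram_schmidt_orthonormal[OF assms, of j j] by simp
qed

text \<open>The factors of the Iwasawa decomposition \<open>g = k b\<close> with \<open>k\<close>
  orthogonal and \<open>b\<close> lower triangular with positive diagonal.\<close>

definition orth_part :: "real^'n::_^'n::{finite,wellorder} \<Rightarrow> real^'n::_^'n::{finite,wellorder}" where
  "orth_part g = (\<chi> i j. gram_schmidt g j $ i)"

definition borel_part :: "real^'n::_^'n::{finite,wellorder} \<Rightarrow> real^'n::_^'n::{finite,wellorder}" where
  "borel_part g = transpose (orth_part g) ** g"

lemma transpose_orth_part_mult: "(transpose (orth_part g) ** x) $ i $ j = gram_schmidt g i \<bullet> column j x"
  by (simp add: orth_part_def transpose_def matrix_matrix_mult_def inner_vec_def column_def)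

lemma orth_part_orthogonal:
  assumes "g \<in> GL" shows "orth_part g \<in> orthogonal_group"
proof -
  have "column j (orth_part g) = gram_schmidt g j" for j by (simp add: column_def orth_part_def vec_eq_iff)
  then have "(transpose (orth_part g) ** orth_part g) $ i $ j = mat 1 $ i $ j" for i j
    unfolding transpose_orth_part_mult by (simp add: gram_schmidt_orthonormal[OF assms] mat_def)
  then have "transpose (orth_part g) ** orth_part g = mat 1" by (simp only: vec_eq_iff) blast
  then show ?thesis by (simp add: orthogonal_group_def orthogonal_matrix)
qed

lemma borel_part_entry: "borel_part g $ i $ j = gram_schmidt g i \<bullet> column j g"
  unfolding borel_part_def by (rule transpose_orth_part_mult)

lemma orth_part_borel_part: "g \<in> GL \<Longrightarrow> orth_part g ** borel_part g = g"
  using orth_part_orthogonal[of g] unfolding borel_part_def orthogonal_group_def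
  by (simp add: orthogonal_matrix_def matrix_mul_assoc)

lemma orthogonal_GL: "orthogonal_group \<subseteq> (GL :: (real^'n^'n) set)"
  unfolding orthogonal_group_def GL_def invertible_def orthogonal_matrix_def by blast

lemma borel_part_lower:
  assumes "g \<in> GL" shows "borel_part g \<in> lower_borel" "borel_part g $ j $ j = torus_part g j" "0 < borel_part g $ j $ j"
proof -
  show d: "borel_part g $ j $ j = torus_part g j" for j by (simp add: borel_part_entry column_inner_gram_schmidt(2)[OF assms])
  then show "0 < borel_part g $ j $ j" using torus_part_pos[OF assms] by simp
  have "transpose (orth_part g) \<in> GL"
    using orth_part_orthogonal[OF assms] orthogonal_GL by (auto simp: GL_iff_det det_transpose)
  then have "borel_part g \<in> GL" unfolding borel_part_def using assms mult_GL by blast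
  then show "borel_part g \<in> lower_borel"
    unfolding lower_borel_def by (auto simp: borel_part_entry column_inner_gram_schmidt(1)[OF assms])
qed

lemma lower_borel_diag_nz:
  assumes "b \<in> lower_borel" shows "b $ j $ j \<noteq> 0"
proof -
  have "det b = prod (\<lambda>i. b $ i $ i) UNIV"
    by (rule det_lowerdiagonal) (use assms in \<open>auto simp: lower_borel_def\<close>)
  moreover have "det b \<noteq> 0" using assms by (auto simp: lower_borel_def GL_iff_det)
  ultimately show ?thesis by auto
qed

text \<open>Multiplication by a lower triangular matrix replaces column \<open>j\<close> by a
  multiple of itself plus later columns, which the orthogonalization removes.\<close>

lemma gram_schmidt_mult_lower:
  fixes g :: "real^'n::_^'n::{finite,wellorder}"
  assumes g: "g \<in> GL" and b: "b \<in> lower_borel"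
  shows "gram_schmidt (g ** b) j = sgn (b $ j $ j) *\<^sub>R gram_schmidt g j \<and> torus_part (g ** b) j = \<bar>b $ j $ j\<bar> * torus_part g j"
proof (induction j rule: down_induct)
  case (step j)
  define pr where "pr v = v - (\<Sum>l\<in>{j<..}. (v \<bullet> gram_schmidt g l) *\<^sub>R gram_schmidt g l)" for v
  have lin: "linear pr"
    unfolding pr_def by (intro linearI) (simp_all add: inner_add_left scaleR_add_left sum.distrib scaleR_right_diff_distrib scaleR_sum_right)
  have p0: "pr (column p g) = 0" if "j < p" for p
  proof -
    have "(\<Sum>l\<in>{j<..}. (column p g \<bullet> gram_schmidt g l) *\<^sub>R gram_schmidt g l) = (\<Sum>l\<in>insert p {p<..}. (column p g \<bullet> gram_schmidt g l) *\<^sub>R gram_schmidt g l)"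
      by (rule sum.mono_neutral_right)
        (use that column_inner_gram_schmidt(1)[OF g] in \<open>auto simp: inner_commute not_less\<close>)
    also have "\<dots> = column p g"
      using column_gram_schmidt[OF g, of p] column_inner_gram_schmidt(2)[OF g, of p] by (simp add: inner_commute)
    finally show ?thesis by (simp add: pr_def)
  qed
  have "column j (g ** b) = (\<Sum>p\<in>UNIV. b $ p $ j *\<^sub>R column p g)"
    by (simp add: vec_eq_iff column_def matrix_matrix_mult_def mult.commute)
  also have "\<dots> = (\<Sum>p\<in>{j..}. b $ p $ j *\<^sub>R column p g)"
    by (rule sum.mono_neutral_right) (use b in \<open>auto simp: lower_borel_def not_le\<close>)
  finally have col: "column j (g ** b) = (\<Sum>p\<in>{j..}. b $ p $ j *\<^sub>R column p g)" .
  have "gs_residual (g ** b) j = pr (column j (g ** b))"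
  proof -
    have "(column j (g ** b) \<bullet> gram_schmidt (g ** b) l) *\<^sub>R gram_schmidt (g ** b) l = (column j (g ** b) \<bullet> gram_schmidt g l) *\<^sub>R gram_schmidt g l" if "j < l" for l
      using step[OF that] lower_borel_diag_nz[OF b, of l] by (simp add: sgn_if)
    then show ?thesis by (simp add: gs_residual_def pr_def)
  qed
  also have "\<dots> = (\<Sum>p\<in>{j..}. b $ p $ j *\<^sub>R pr (column p g))"
    unfolding col linear_sum[OF lin] linear_cmul[OF lin] ..
  also have "\<dots> = (\<Sum>p\<in>{j}. b $ p $ j *\<^sub>R pr (column p g))"
    by (rule sum.mono_neutral_right) (auto simp: p0)
  also have "\<dots> = b $ j $ j *\<^sub>R gs_residual g j" by (simp add: pr_def gs_residual_def)
  finally have u: "gs_residual (g ** b) j = b $ j $ j *\<^sub>R gs_residual g j" .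
  then have t: "torus_part (g ** b) j = \<bar>b $ j $ j\<bar> * torus_part g j" by (simp add: torus_part_def)
  show ?case unfolding gram_schmidt_eq u t using lower_borel_diag_nz[OF b, of j] by (auto simp: sgn_if)
qed

lemma smooth_on_gram_schmidt_torus_part:
  fixes j :: "'n::{finite,wellorder}"
  shows "(\<forall>i. smooth_on GL (\<lambda>g. complex_of_real (gram_schmidt g j $ i))) \<and> smooth_on GL (\<lambda>g. complex_of_real (ln (torus_part g j)))"
proof (induction j rule: down_induct)
  case (step j)
  have x: "smooth_on GL (\<lambda>g. complex_of_real (g $ i $ j))" for i
    using smooth_on_entry[of GL i j] by (simp add: entry_def[abs_def])
  have u: "smooth_on GL (\<lambda>g. complex_of_real (gs_residual g j $ i))" for i
  proof -
    have "gs_residual g j $ i = g $ i $ j - (\<Sum>l\<in>{j<..}. (\<Sum>p\<in>UNIV. g $ p $ j * gram_schmidt g l $ p) * gram_schmidt g l $ i)" for g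
      by (simp add: gs_residual_def column_def inner_vec_def)
    then have "(\<lambda>g. complex_of_real (gs_residual g j $ i)) = (\<lambda>g. complex_of_real (g $ i $ j) - (\<Sum>l\<in>{j<..}. (\<Sum>p\<in>UNIV.
        complex_of_real (g $ p $ j) * complex_of_real (gram_schmidt g l $ p)) * complex_of_real (gram_schmidt g l $ i)))" by simp
    moreover have "smooth_on GL \<dots>"
      by (intro smooth_on_diff smooth_on_sum smooth_on_mult open_GL x; use step in auto)
    ultimately show ?thesis by (simp only:)
  qed
  have sq: "smooth_on GL (\<lambda>g. complex_of_real (gs_residual g j \<bullet> gs_residual g j))"
    unfolding inner_vec_def inner_real_def of_real_sum of_real_mult
    by (intro smooth_on_sum smooth_on_mult open_GL u)
  have pos: "0 < gs_residual g j \<bullet> gs_residual g j" if "g \<in> GL" for g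
    using torus_part_pos[OF that, of j] by (simp add: torus_part_def)
  have l2: "smooth_on GL (\<lambda>g. (1 / 2) * complex_of_real (ln (gs_residual g j \<bullet> gs_residual g j)))"
    by (intro smooth_on_mult smooth_on_const smooth_on_of_real_ln open_GL sq pos)
  have leq: "(1 / 2) * complex_of_real (ln (gs_residual g j \<bullet> gs_residual g j)) = complex_of_real (ln (torus_part g j))" if "g \<in> GL" for g
    using torus_part_pos[OF that, of j] by (simp add: torus_part_def dot_square_norm ln_realpow)
  have lt: "smooth_on GL (\<lambda>g. complex_of_real (ln (torus_part g j)))"
    by (rule smooth_on_cong[OF open_GL leq l2])
  have "smooth_on GL (\<lambda>g. complex_of_real (gram_schmidt g j $ i))" for i
  proof (rule smooth_on_cong[OF open_GL])
    show "smooth_on GL (\<lambda>g. complex_of_real (gs_residual g j $ i) * exp (- complex_of_real (ln (torus_part g j))))"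
      by (intro smooth_on_mult smooth_on_exp smooth_on_minus open_GL u lt)
    show "complex_of_real (gs_residual g j $ i) * exp (- complex_of_real (ln (torus_part g j))) = complex_of_real (gram_schmidt g j $ i)" if "g \<in> GL" for g
    proof -
      have "exp (- complex_of_real (ln (torus_part g j))) = complex_of_real (exp (- ln (torus_part g j)))"
        by (simp add: exp_of_real flip: of_real_minus)
      also have "\<dots> = complex_of_real (inverse (torus_part g j))" using torus_part_pos[OF that, of j] by (simp add: exp_minus)
      finally show ?thesis unfolding gram_schmidt_eq by (simp add: mult.commute)
    qed
  qed
  with lt show ?case by blast
qed

lemma smooth_on_gram_schmidt: "smooth_on GL (\<lambda>g. complex_of_real (gram_schmidt g j $ i))"
  using smooth_on_gram_schmidt_torus_part by blast

lemma smooth_on_ln_torus_part: "smooth_on GL (\<lambda>g. complex_of_real (ln (torus_part g j)))"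
  using smooth_on_gram_schmidt_torus_part by blast

text \<open>The exponent in the equivariance of the space with parameter \<open>- \<lambda>\<close>:
  the inverse of \<open>\<chi>\<^bsub>- \<lambda> - \<rho>\<^esub>\<close> has the exponent
  \<open>\<lambda> + \<rho>\<close>.\<close>

definition shifted :: "complex^'n::{finite,wellorder} \<Rightarrow> 'n \<Rightarrow> complex" where "shifted lam j = lam $ j + rho $ j"

text \<open>The Iwasawa character: the value at \<open>g\<close> of the equivariant function that is
  \<open>1\<close> on \<open>O(r)\<close>.\<close>

definition torus_char :: "complex^'n::{finite,wellorder} \<Rightarrow> real^'n::_^'n::{finite,wellorder} \<Rightarrow> complex" where
  "torus_char lam g = exp (\<Sum>j\<in>UNIV. shifted lam j * complex_of_real (ln (torus_part g j)))"

text \<open>The extension of \<open>\<phi>\<close> from \<open>O(r)\<close> to the space with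
  parameter \<open>- \<lambda>\<close>; its dependence on \<open>\<lambda>\<close> is through an
  exponential only.\<close>

definition series_family :: "(real^'n::_^'n::{finite,wellorder} \<Rightarrow> complex) \<Rightarrow> complex^'n::{finite,wellorder} \<Rightarrow> real^'n::_^'n::{finite,wellorder} \<Rightarrow> complex" where
  "series_family \<phi> lam g = (if g \<in> GL then \<phi> (orth_part g) * torus_char lam g else 0)"

text \<open>The element of \<open>O(r) \<inter> B\<^sub>-\<close> by which \<open>b\<close> differs
  from a matrix with positive diagonal.\<close>

definition sign_part :: "real^'n::_^'n::{finite,wellorder} \<Rightarrow> real^'n::_^'n::{finite,wellorder}" where
  "sign_part b = (\<chi> i j. if i = j then sgn (b $ j $ j) else 0)"

lemma sign_part_props:
  fixes b :: "real^'n::_^'n::{finite,wellorder}"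
  assumes "b \<in> lower_borel"
  shows "sign_part b \<in> orthogonal_group \<inter> lower_borel" "chi 0 \<delta> (sign_part b) = (\<Prod>j\<in>UNIV. of_real (sgn (b $ j $ j) ^ (of_bit (\<delta> $ j) :: nat)))"
proof -
  have s: "sgn (b $ j $ j) * sgn (b $ j $ j) = 1" "\<bar>sgn (b $ j $ j)\<bar> = 1" for j
    using lower_borel_diag_nz[OF assms, of j] by (auto simp: sgn_if)
  have "transpose (sign_part b) ** sign_part b = mat 1"
    by (auto simp: vec_eq_iff sign_part_def transpose_def matrix_matrix_mult_def mat_def s if_distrib[of "\<lambda>z. z * _"]  lower_borel_diag_nz[OF assms] cong: if_cong)
  then have o: "sign_part b \<in> orthogonal_group" by (simp add: orthogonal_group_def orthogonal_matrix)
  then show "sign_part b \<in> orthogonal_group \<inter> lower_borel"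
    using orthogonal_GL by (auto simp: lower_borel_def sign_part_def)
  have "sgn (sgn x) = sgn x" for x :: real by (simp add: sgn_if)
  then show "chi 0 \<delta> (sign_part b) = (\<Prod>j\<in>UNIV. of_real (sgn (b $ j $ j) ^ (of_bit (\<delta> $ j) :: nat)))"
    by (simp add: chi_def sign_part_def s lower_borel_diag_nz[OF assms])
qed

lemma inverse_chi:
  fixes b :: "real^'n::_^'n::{finite,wellorder}"
  assumes b: "b \<in> lower_borel"
  shows "inverse (chi (- lam - rho) \<delta> b) = inverse (chi 0 \<delta> (sign_part b)) * exp (\<Sum>j\<in>UNIV. shifted lam j * complex_of_real (ln \<bar>b $ j $ j\<bar>))"
proof -
  have "of_real \<bar>b $ j $ j\<bar> powr ((- lam - rho) $ j) = inverse (exp (shifted lam j * complex_of_real (ln \<bar>b $ j $ j\<bar>)))" for j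
  proof -
    have "of_real \<bar>b $ j $ j\<bar> powr ((- lam - rho) $ j) = exp ((- lam - rho) $ j * complex_of_real (ln \<bar>b $ j $ j\<bar>))"
      using lower_borel_diag_nz[OF b, of j] by (simp add: powr_def Ln_of_real)
    moreover have m: "(- lam - rho) $ j = - shifted lam j" by (simp add: shifted_def)
    ultimately show ?thesis unfolding m by (simp add: exp_minus)
  qed
  then show ?thesis
    unfolding sign_part_props(2)[OF b] unfolding chi_def
    by (simp add: prod.distrib exp_sum prod_inversef[symmetric] flip: prod_inversef)
qed

lemma orth_part_mult_lower:
  assumes "g \<in> GL" "b \<in> lower_borel"
  shows "orth_part (g ** b) = orth_part g ** sign_part b"
  using gram_schmidt_mult_lower[OF assms]
  by (auto simp: vec_eq_iff orth_part_def sign_part_def matrix_matrix_mult_def if_distrib cong: if_cong)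

lemma torus_char_mult_lower:
  assumes "g \<in> GL" "b \<in> lower_borel"
  shows "torus_char lam (g ** b) = exp (\<Sum>j\<in>UNIV. shifted lam j * complex_of_real (ln \<bar>b $ j $ j\<bar>)) * torus_char lam g"
proof -
  have "ln (torus_part (g ** b) j) = ln \<bar>b $ j $ j\<bar> + ln (torus_part g j)" for j
    using gram_schmidt_mult_lower[OF assms, of j] lower_borel_diag_nz[OF assms(2), of j] torus_part_pos[OF assms(1), of j]
    by (simp add: ln_mult)
  then show ?thesis
    by (simp add: torus_char_def exp_add[symmetric] distrib_left sum.distrib)
qed

lemma smooth_on_torus_char: "smooth_on GL (torus_char lam)"
  unfolding torus_char_def[abs_def]
  by (intro smooth_on_exp smooth_on_sum smooth_on_mult smooth_on_const open_GL smooth_on_ln_torus_part)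

lemma smooth_on_model:
  assumes "\<phi> \<in> compact_model \<delta>" shows "smooth_on GL (\<lambda>g. \<phi> (orth_part g))"
proof -
  obtain \<Omega> h where h: "open \<Omega>" "orthogonal_group \<subseteq> \<Omega>" "smooth_on \<Omega> h" "\<forall>k\<in>orthogonal_group. \<phi> k = h k"
    using assms by (auto simp: compact_model_def)
  have "smooth_on GL (\<lambda>g. h (orth_part g))"
  proof (rule smooth_on_compose_matrix[OF open_GL h(1) _ _ h(3)])
    show "smooth_on GL (\<lambda>x. complex_of_real (orth_part x $ i $ j))" for i j
      unfolding orth_part_def by (simp add: smooth_on_gram_schmidt)
    show "orth_part x \<in> \<Omega>" if "x \<in> GL" for x using orth_part_orthogonal[OF that] h(2) by blast
  qed
  moreover have "h (orth_part g) = \<phi> (orth_part g)" if "g \<in> GL" for g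
    using bspec[OF h(4) orth_part_orthogonal[OF that]] by simp
  ultimately show ?thesis
    using smooth_on_cong[OF open_GL, of "\<lambda>g. h (orth_part g)" "\<lambda>g. \<phi> (orth_part g)"] by blast
qed

lemma series_family_principal_series:
  assumes "\<phi> \<in> compact_model \<delta>" shows "series_family \<phi> lam \<in> principal_series (- lam) \<delta>"
proof -
  have "smooth_on GL (series_family \<phi> lam)"
    by (rule smooth_on_cong[OF open_GL _ smooth_on_mult[OF open_GL smooth_on_model[OF assms] smooth_on_torus_char[of lam]]])
      (simp add: series_family_def)
  moreover have "series_family \<phi> lam (g ** b) = inverse (chi (- lam - rho) \<delta> b) * series_family \<phi> lam g" if g: "g \<in> GL" and b: "b \<in> lower_borel" for g b
  proof -
    have "g ** b \<in> GL" using g b mult_GL by (auto simp: lower_borel_def)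
    moreover have "\<phi> (orth_part g ** sign_part b) = inverse (chi 0 \<delta> (sign_part b)) * \<phi> (orth_part g)"
      using assms orth_part_orthogonal[OF g] sign_part_props(1)[OF b] by (auto simp: compact_model_def)
    ultimately show ?thesis
      using g by (simp add: series_family_def orth_part_mult_lower[OF g b] torus_char_mult_lower[OF g b] inverse_chi[OF b])
  qed
  ultimately show ?thesis by (auto simp: principal_series_def smooth_functions_def series_family_def)
qed

lemma orth_part_torus_char_orthogonal:
  assumes k: "k \<in> orthogonal_group"
  shows "orth_part k = k" "torus_char lam k = 1" "torus_part k j = 1"
proof -
  have g: "k \<in> GL" using k orthogonal_GL by blast
  let ?b = "borel_part k"
  have "transpose ?b ** ?b = transpose k ** (orth_part k ** transpose (orth_part k)) ** k"
    unfolding borel_part_def by (simp add: matrix_transpose_mul matrix_mul_assoc transpose_transpose)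
  also have "\<dots> = mat 1"
    using k orth_part_orthogonal[OF g] by (simp add: orthogonal_group_def orthogonal_matrix_def)
  finally have bo: "transpose ?b ** ?b = mat 1" .
  have bl: "?b \<in> lower_borel" and bd: "\<And>j. 0 < ?b $ j $ j" using borel_part_lower[OF g] by auto
  have bij: "?b $ i $ j = (if i = j then 1 else 0)" for i j
  proof (induction i arbitrary: j rule: down_induct)
    case (step i)
    have e: "(\<Sum>l\<in>UNIV. ?b $ l $ i * ?b $ l $ j) = (if i = j then 1 else 0)" for j
      using arg_cong[OF bo, of "\<lambda>A. A $ i $ j"] by (simp add: matrix_matrix_mult_def transpose_def mat_def)
    have red: "(\<Sum>l\<in>UNIV. ?b $ l $ i * ?b $ l $ j) = ?b $ i $ i * ?b $ i $ j" for j
    proof -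
      have "(\<Sum>l\<in>UNIV. ?b $ l $ i * ?b $ l $ j) = (\<Sum>l\<in>{i}. ?b $ l $ i * ?b $ l $ j)"
      proof (rule sum.mono_neutral_right)
        show "\<forall>l\<in>UNIV - {i}. ?b $ l $ i * ?b $ l $ j = 0"
        proof
          fix l assume "l \<in> UNIV - {i}"
          then consider "l < i" | "i < l" by fastforce
          then show "?b $ l $ i * ?b $ l $ j = 0"
            using bl step by cases (auto simp: lower_borel_def)
        qed
      qed auto
      then show ?thesis by simp
    qed
    have "?b $ i $ i * ?b $ i $ i = 1" using e[of i] red[of i] by simp
    then have "(?b $ i $ i)\<^sup>2 = 1" by (simp add: power2_eq_square)
    then have "?b $ i $ i = 1" using bd[of i] unfolding power2_eq_1_iff by linarith
    then show ?case using e[of j] red[of j] by (simp only: mult_1)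
  qed
  then have "?b = mat 1" by (simp add: vec_eq_iff mat_def)
  then show "orth_part k = k" using orth_part_borel_part[OF g] by simp
  have t: "torus_part k j = 1" for j using borel_part_lower(2)[OF g, of j] bij[of j j] by simp
  then show "torus_char lam k = 1" by (simp add: torus_char_def)
  show "torus_part k j = 1" by (rule t)
qed

lemma restrict_series_family:
  assumes "\<phi> \<in> compact_model \<delta>" shows "restrict_to_K (series_family \<phi> lam) = \<phi>"
proof
  fix k show "restrict_to_K (series_family \<phi> lam) k = \<phi> k"
  proof (cases "k \<in> orthogonal_group")
    case True
    then show ?thesis using orth_part_torus_char_orthogonal(1,2)[OF True] orthogonal_GL
      by (auto simp: restrict_to_K_def series_family_def)
  next
    case False
    then show ?thesis using assms by (simp add: restrict_to_K_def compact_model_def)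
  qed
qed

lemma principal_series_pos:
  assumes f: "f \<in> principal_series (- lam) \<delta>" and g: "g \<in> GL" and b: "b \<in> lower_borel" and p: "\<And>j. 0 < b $ j $ j"
  shows "f (g ** b) = exp (\<Sum>j\<in>UNIV. shifted lam j * complex_of_real (ln (b $ j $ j))) * f g"
proof -
  have "sign_part b = mat 1" using p by (simp add: sign_part_def vec_eq_iff mat_def sgn_if not_less less_imp_neq[symmetric])
  moreover have "chi 0 \<delta> (sign_part b) = 1" unfolding sign_part_props(2)[OF b] using p by (simp add: sgn_pos)
  ultimately have "inverse (chi (- lam - rho) \<delta> b) = exp (\<Sum>j\<in>UNIV. shifted lam j * complex_of_real (ln (b $ j $ j)))"
    unfolding inverse_chi[OF b] using p by (simp add: abs_of_pos)
  with f g b show ?thesis by (simp add: principal_series_def)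
qed

lemma principal_series_iwasawa:
  assumes f: "f \<in> principal_series (- lam) \<delta>" and g: "g \<in> GL"
  shows "f g = torus_char lam g * f (orth_part g)"
proof -
  have "orth_part g \<in> GL" using orth_part_orthogonal[OF g] orthogonal_GL by blast
  from principal_series_pos[OF f this borel_part_lower(1)[OF g] borel_part_lower(3)[OF g]] show ?thesis
    by (simp add: orth_part_borel_part[OF g] torus_char_def borel_part_lower(2)[OF g])
qed

text \<open>Together with \<open>restrict_series_family\<close> this says that restriction to
  \<open>O(r)\<close> is a bijection onto the common model.\<close>

lemma restrict_principal_series:
  fixes f :: "real^'n::_^'n::{finite,wellorder} \<Rightarrow> complex"
  assumes f: "f \<in> principal_series (- lam) \<delta>"
  shows "restrict_to_K f \<in> compact_model \<delta>" "series_family (restrict_to_K f) lam = f"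
proof -
  have "f (k ** m) = inverse (chi 0 \<delta> m) * f k" if "k \<in> orthogonal_group" and m: "m \<in> orthogonal_group \<inter> lower_borel" for k m
  proof -
    have mm: "m \<in> lower_borel" "m \<in> orthogonal_group" using m by auto
    have o1: "(mat 1 :: real^'n::_^'n::{finite,wellorder}) \<in> orthogonal_group"
      by (simp add: orthogonal_group_def orthogonal_matrix_id)
    have ab: "\<bar>m $ j $ j\<bar> = 1" for j
      using gram_schmidt_mult_lower[OF mat1_GL mm(1), of j] orth_part_torus_char_orthogonal(3)[OF mm(2), of j] orth_part_torus_char_orthogonal(3)[OF o1, of j]
      by simp
    then have "chi (- lam - rho) \<delta> m = chi 0 \<delta> m" by (simp add: chi_def)
    with f that(1) orthogonal_GL mm(1) show ?thesis by (auto simp: principal_series_def)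
  qed
  moreover have "k ** m \<in> orthogonal_group" if "k \<in> orthogonal_group" "m \<in> orthogonal_group"
    for k m :: "real^'n::_^'n::{finite,wellorder}"
    using that by (simp add: orthogonal_group_def orthogonal_matrix_mul)
  moreover have "smooth_on GL f" using f by (simp add: principal_series_def smooth_functions_def)
  ultimately show "restrict_to_K f \<in> compact_model \<delta>"
    unfolding compact_model_def restrict_to_K_def mem_Collect_eq
    by (intro conjI exI[of _ GL] exI[of _ f]) (simp_all add: open_GL orthogonal_GL)
  show "series_family (restrict_to_K f) lam = f"
  proof
    fix g show "series_family (restrict_to_K f) lam g = f g"
    proof (cases "g \<in> GL")
      case True
      then show ?thesis
        using principal_series_iwasawa[OF f True] orth_part_orthogonal[OF True] by (simp add: series_family_def restrict_to_K_def)
    next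
      case False
      then show ?thesis using f by (simp add: series_family_def principal_series_def smooth_functions_def)
    qed
  qed
qed

lemma extend_from_K_eq_series_family:
  assumes "\<phi> \<in> compact_model \<delta>" shows "extend_from_K (- lam) \<delta> \<phi> = series_family \<phi> lam"
proof -
  have "inj_on restrict_to_K (principal_series (- lam) \<delta>)"
    by (rule inj_on_inverseI[where g = "\<lambda>\<psi>. series_family \<psi> lam"]) (rule restrict_principal_series(2))
  then show ?thesis
    unfolding extend_from_K_def
    using inv_into_f_f[OF _ series_family_principal_series[OF assms, of lam]] restrict_series_family[OF assms, of lam] by metis
qed

lemma left_translation_principal_series:
  assumes f: "f \<in> principal_series lam \<delta>" and g: "g \<in> GL"
  shows "left_translation g f \<in> principal_series lam \<delta>"
proof -
  have gi: "matrix_inv g \<in> GL" using matrix_inv_GL[OF g] .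
  have "smooth_on GL f" using f by (auto simp: principal_series_def smooth_functions_def)
  then have "smooth_on GL (left_translation g f)"
    unfolding left_translation_def by (rule smooth_on_left_mult[OF gi])
  moreover have "left_translation g f x = 0" if "x \<notin> GL" for x
  proof -
    have "matrix_inv g ** x \<notin> GL" using gi that by (simp add: GL_iff_det det_mul)
    then show ?thesis using f by (simp add: left_translation_def principal_series_def smooth_functions_def)
  qed
  ultimately show ?thesis
    using f mult_GL[OF gi]
    by (auto simp: principal_series_def smooth_functions_def left_translation_def matrix_mul_assoc)
qed

section \<open>Haar integrals over the unipotent group\<close>

text \<open>An elementary measure of size, with polynomial growth of balls evident; the gauge is
  compared with it.\<close>

definition entry_norm :: "real^'n^'n \<Rightarrow> real" where "entry_norm x = 1 + (\<Sum>i\<in>UNIV. \<Sum>j\<in>UNIV. \<bar>x $ i $ j\<bar>)"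

lemma entry_norm_ge1: "1 \<le> entry_norm x" by (simp add: entry_norm_def sum_nonneg)

lemma entry_norm_nz: "entry_norm x \<noteq> 0" using entry_norm_ge1[of x] by linarith

lemma entry_le_entry_norm: "\<bar>x $ i $ j\<bar> \<le> entry_norm x"
proof -
  have "\<bar>x $ i $ j\<bar> \<le> (\<Sum>j\<in>UNIV. \<bar>x $ i $ j\<bar>)" by (rule member_le_sum) auto
  also have "\<dots> \<le> (\<Sum>i\<in>UNIV. \<Sum>j\<in>UNIV. \<bar>x $ i $ j\<bar>)" by (rule member_le_sum[of _ _ "\<lambda>i. \<Sum>j\<in>UNIV. \<bar>x $ i $ j\<bar>"]) (auto intro: sum_nonneg)
  finally show ?thesis by (simp add: entry_norm_def)
qed

lemma entry_norm_le_gauge: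
  "\<exists>C\<ge>1. \<forall>n\<in>unipotent_upper. entry_norm (n :: real^'n::_^'n::{finite,wellorder}) \<le> C * hgauge n powr real CARD('n)"
proof -
  let ?K = "real CARD('n)"
  have "entry_norm n \<le> (1 + ?K * (?K * ?K ^ CARD('n))) * hgauge n powr ?K" if n: "n \<in> unipotent_upper" for n :: "real^'n::_^'n::{finite,wellorder}"
  proof -
    have "\<bar>n $ i $ j\<bar> \<le> ?K ^ CARD('n) * hgauge n powr ?K" for i j
    proof -
      have "height i j \<le> ?K" using pos_lt_card[of j] by (simp add: height_def)
      then show ?thesis by (intro order_trans[OF entry_gauge_bound(1)[OF n]] mult_left_mono hgauge_powr_mono) auto
    qed
    then have "(\<Sum>i\<in>(UNIV::'n set). \<Sum>j\<in>(UNIV::'n set). \<bar>n $ i $ j\<bar>) \<le> (\<Sum>i\<in>(UNIV::'n set). \<Sum>j\<in>(UNIV::'n set). ?K ^ CARD('n) * hgauge n powr ?K)"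
      by (intro sum_mono)
    moreover have "1 \<le> hgauge n powr ?K" using hgauge_ge1[of n] by (simp add: ge_one_powr_ge_zero)
    ultimately show ?thesis by (simp add: entry_norm_def distrib_right mult.assoc)
  qed
  then show ?thesis by (intro exI[of _ "1 + ?K * (?K * ?K ^ CARD('n))"]) auto
qed

text \<open>Back substitution from the last row upwards costs a factor \<open>1 + r T\<close> per
  row.\<close>

lemma unipotent_inverse_bound:
  fixes n :: "real^'n::_^'n::{finite,wellorder}"
  assumes n: "n \<in> unipotent_upper" and T: "\<And>i j. \<bar>n $ i $ j\<bar> \<le> T"
  shows "\<bar>matrix_inv n $ i $ j\<bar> \<le> (1 + real CARD('n) * T) ^ CARD('n)"
proof -
  let ?B = "1 + real CARD('n) * T"
  have T0: "0 \<le> T" using T[of i j] by linarith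
  then have B1: "1 \<le> ?B" by simp
  have "\<bar>matrix_inv n $ i $ j\<bar> \<le> ?B ^ card {i..}"
  proof (induction i rule: down_induct)
    case (step i)
    have ci: "card {i..} = Suc (card {i<..})"
    proof -
      have "{i..} = insert i {i<..}" by auto
      then show ?thesis by simp
    qed
    have l: "\<bar>matrix_inv n $ l $ j\<bar> \<le> ?B ^ card {i<..}" if "i < l" for l
    proof -
      have "card {l..} \<le> card {i<..}" using that by (intro card_mono) auto
      then show ?thesis using step[OF that] power_increasing[OF _ B1] order_trans by blast
    qed
    have "\<bar>matrix_inv n $ i $ j\<bar> \<le> 1 + (\<Sum>l\<in>{i<..}. \<bar>n $ i $ l * matrix_inv n $ l $ j\<bar>)"
    proof -
      let ?s = "\<Sum>l\<in>{i<..}. n $ i $ l * matrix_inv n $ l $ j"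
      have "\<bar>?s\<bar> \<le> (\<Sum>l\<in>{i<..}. \<bar>n $ i $ l * matrix_inv n $ l $ j\<bar>)" by (rule sum_abs)
      moreover have "\<bar>(if i = j then 1 else 0) - ?s\<bar> \<le> 1 + \<bar>?s\<bar>" by auto
      ultimately show ?thesis unfolding unipotent_inverse_rec[OF n, of i j] by linarith
    qed
    also have "\<dots> \<le> 1 + (\<Sum>l\<in>{i<..}. T * ?B ^ card {i<..})"
      unfolding abs_mult using T0 by (intro add_left_mono sum_mono mult_mono T l) auto
    also have "\<dots> \<le> ?B ^ card {i<..} + real CARD('n) * (T * ?B ^ card {i<..})"
      using T0 B1 card_mono[of UNIV "{i<..}"] by (intro add_mono one_le_power) (auto intro!: mult_right_mono)
    also have "\<dots> = ?B ^ card {i..}" by (simp add: ci algebra_simps)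
    finally show ?case .
  qed
  also have "\<dots> \<le> ?B ^ CARD('n)" by (intro power_increasing B1 card_mono) auto
  finally show ?thesis .
qed

text \<open>Each function \<open>shift_entry\<close> is polynomial in the entries of
  \<open>n\<close> and of its inverse.\<close>

lemma hgauge_le_entry_norm:
  "\<exists>C\<ge>1. \<exists>p. \<forall>n\<in>unipotent_upper. hgauge (n :: real^'n::_^'n::{finite,wellorder}) \<le> C * entry_norm n ^ p"
proof -
  let ?K = "CARD('n)" and ?D = "gauge_degree TYPE('n)"
  have K1: "1 \<le> real ?K" by (simp add: Suc_leI)
  define A where "A = real (card (consec :: ('n \<times> 'n) set)) * (1 + real ?K) ^ ?K"
  have A0: "0 \<le> A" by (simp add: A_def)
  have "hgauge n \<le> (1 + real (card (lower_pairs :: ('n \<times> 'n) set)) * (1 + A) ^ (2 * ?D)) * entry_norm n ^ ((?K + 1) * (2 * ?D))"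
    if n: "n \<in> unipotent_upper" for n :: "real^'n::_^'n::{finite,wellorder}"
  proof -
    have b1: "1 \<le> entry_norm n" by (rule entry_norm_ge1)
    have "\<bar>shift_entry cd n\<bar> \<le> A * entry_norm n ^ (?K + 1)" for cd
    proof -
      have "\<bar>matrix_inv n $ i $ fst cd * n $ snd cd $ j\<bar> \<le> (1 + real ?K) ^ ?K * entry_norm n ^ (?K + 1)" for i j
      proof -
        have "\<bar>matrix_inv n $ i $ fst cd\<bar> \<le> (1 + real ?K * entry_norm n) ^ ?K"
          by (rule unipotent_inverse_bound[OF n entry_le_entry_norm])
        also have "\<dots> \<le> ((1 + real ?K) * entry_norm n) ^ ?K"
          using b1 by (intro power_mono) (auto simp: distrib_right)
        finally have "\<bar>matrix_inv n $ i $ fst cd * n $ snd cd $ j\<bar> \<le> ((1 + real ?K) * entry_norm n) ^ ?K * entry_norm n"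
          unfolding abs_mult using b1 by (intro mult_mono entry_le_entry_norm) auto
        then show ?thesis by (simp add: power_mult_distrib mult_ac)
      qed
      then have "(\<Sum>p\<in>consec. \<bar>matrix_inv n $ fst p $ fst cd * n $ snd cd $ snd p\<bar>) \<le> (\<Sum>p\<in>(consec :: ('n \<times> 'n) set). (1 + real ?K) ^ ?K * entry_norm n ^ (?K + 1))"
        by (intro sum_mono)
      then show ?thesis
        unfolding shift_entry_def case_prod_unfold A_def
        by (intro order_trans[OF sum_abs]) (simp add: mult.assoc)
    qed
    then have t: "shift_entry cd n ^ (2 * gauge_expo cd) \<le> (1 + A) ^ (2 * ?D) * entry_norm n ^ ((?K + 1) * (2 * ?D))" for cd
    proof -
      have "shift_entry cd n ^ (2 * gauge_expo cd) = \<bar>shift_entry cd n\<bar> ^ (2 * gauge_expo cd)" by (simp add: power_mult)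
      also have "\<dots> \<le> ((1 + A) * entry_norm n ^ (?K + 1)) ^ (2 * gauge_expo cd)"
        using \<open>\<bar>shift_entry cd n\<bar> \<le> A * entry_norm n ^ (?K + 1)\<close> b1 A0
        by (intro power_mono) (auto simp: distrib_right intro: order_trans[of _ "A * entry_norm n ^ (?K + 1)"])
      also have "\<dots> \<le> ((1 + A) * entry_norm n ^ (?K + 1)) ^ (2 * ?D)"
      proof (rule power_increasing)
        have "gauge_expo cd \<le> ?D" using gauge_expo_mult[of cd] by (metis le_add1 mult_Suc)
        then show "2 * gauge_expo cd \<le> 2 * ?D" by simp
        have "1 * 1 \<le> (1 + A) * entry_norm n ^ (?K + 1)" using A0 b1 by (intro mult_mono one_le_power) auto
        then show "1 \<le> (1 + A) * entry_norm n ^ (?K + 1)" by simp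
      qed
      finally show ?thesis by (simp only: power_mult_distrib power_mult)
    qed
    have "hgauge n \<le> gauge_sum n powr 1"
      unfolding hgauge_def using gauge_sum_ge(1)[of n] gauge_degree_pos[where 'n = 'n] by (intro powr_mono) (auto simp: divide_le_eq)
    also have "\<dots> = gauge_sum n" using gauge_sum_ge(1)[of n] by simp
    also have "\<dots> \<le> entry_norm n ^ ((?K + 1) * (2 * ?D)) + (\<Sum>cd\<in>(lower_pairs :: ('n \<times> 'n) set). (1 + A) ^ (2 * ?D) * entry_norm n ^ ((?K + 1) * (2 * ?D)))"
      unfolding gauge_sum_def using b1 by (intro add_mono sum_mono t one_le_power)
    finally show ?thesis by (simp add: distrib_right mult.assoc)
  qed
  moreover have "1 \<le> 1 + real (card (lower_pairs :: ('n \<times> 'n) set)) * (1 + A) ^ (2 * ?D)" using A0 by simp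
  ultimately show ?thesis by blast
qed

lemma continuous_on_entry_norm: "continuous_on S entry_norm"
  unfolding entry_norm_def[abs_def] by (intro continuous_intros)

locale haar_unipotent =
  fixes dn :: "(real^'n::_^'n::{finite,wellorder}) measure"
  assumes haar: "haar_measure_on unipotent_upper dn"
begin

lemma space_dn: "space dn = unipotent_upper"
  using haar unfolding haar_measure_on_def by (elim conjE)

lemma sets_dn: "sets dn = sets (restrict_space borel unipotent_upper)"
  using haar unfolding haar_measure_on_def by (elim conjE)

lemma emeasure_translate: "h \<in> unipotent_upper \<Longrightarrow> A \<in> sets dn \<Longrightarrow> emeasure dn ((\<lambda>x. h ** x) ` A) = emeasure dn A"
  using haar unfolding haar_measure_on_def by (elim conjE) (blast dest: bspec)

lemma emeasure_compact: "compact C \<Longrightarrow> C \<subseteq> unipotent_upper \<Longrightarrow> emeasure dn C < \<infinity>"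
  using haar unfolding haar_measure_on_def by (elim conjE) blast

lemma measurable_dn: "continuous_on unipotent_upper F \<Longrightarrow> F \<in> borel_measurable dn"
  by (subst measurable_cong_sets[OF sets_dn refl]) (rule borel_measurable_continuous_on_restrict)

lemma measurable_dn_smooth: "smooth_on GL F \<Longrightarrow> F \<in> borel_measurable dn"
  by (intro measurable_dn continuous_on_subset[OF smooth_on_imp_continuous_on]) (auto intro: unipotent_GL)

lemma continuous_on_left_mult: "continuous_on S (\<lambda>x::real^'n::_^'n::{finite,wellorder}. h ** x)"
  unfolding matrix_matrix_mult_def by (intro continuous_intros)

lemma sets_dnI: "A \<in> sets borel \<Longrightarrow> A \<subseteq> unipotent_upper \<Longrightarrow> A \<in> sets dn"
  unfolding sets_dn by (subst sets_restrict_space_iff) (auto intro: borel_closed closed_unipotent)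

lemma measurable_left_mult:
  assumes "h \<in> unipotent_upper" shows "(\<lambda>x. h ** x) \<in> measurable dn dn"
proof -
  have "(\<lambda>x. h ** x) \<in> measurable dn (restrict_space borel unipotent_upper)"
    using measurable_dn[OF continuous_on_left_mult] assms
    by (intro measurable_restrict_space2) (auto simp: space_dn unipotent_mult)
  then show ?thesis by (subst measurable_cong_sets[OF refl sets_dn])
qed

lemma distr_left_mult:
  assumes h: "h \<in> unipotent_upper" shows "distr dn dn (\<lambda>x. h ** x) = dn"
proof (rule measure_eqI)
  fix A assume "A \<in> sets (distr dn dn (\<lambda>x. h ** x))"
  then have A: "A \<in> sets dn" by simp
  then have AN: "A \<subseteq> unipotent_upper" using sets.sets_into_space space_dn by blast
  have i: "matrix_inv h \<in> unipotent_upper" by (rule unipotent_inverse[OF h])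
  note hh = matrix_inv_right_left[OF unipotent_GL[OF h]]
  have "(\<lambda>x. h ** x) -` A \<inter> space dn = (\<lambda>x. matrix_inv h ** x) ` A"
  proof (intro set_eqI iffI)
    fix x assume "x \<in> (\<lambda>x. h ** x) -` A \<inter> space dn"
    moreover have "x = matrix_inv h ** (h ** x)" by (simp add: matrix_mul_assoc hh)
    ultimately show "x \<in> (\<lambda>x. matrix_inv h ** x) ` A" by blast
  next
    fix x assume "x \<in> (\<lambda>x. matrix_inv h ** x) ` A"
    then obtain y where y: "y \<in> A" "x = matrix_inv h ** y" by blast
    then have "h ** x = y" by (simp add: matrix_mul_assoc hh)
    moreover have "x \<in> unipotent_upper" using y AN i unipotent_mult by blast
    ultimately show "x \<in> (\<lambda>x. h ** x) -` A \<inter> space dn" using y by (simp add: space_dn)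
  qed
  then show "emeasure (distr dn dn (\<lambda>x. h ** x)) A = emeasure dn A"
    using emeasure_translate[OF i A] by (simp add: emeasure_distr[OF measurable_left_mult[OF h] A])
qed simp

lemma integral_translate:
  fixes F :: "real^'n::_^'n::{finite,wellorder} \<Rightarrow> complex"
  assumes "h \<in> unipotent_upper" "F \<in> borel_measurable dn"
  shows "(LINT n|dn. F (h ** n)) = (LINT n|dn. F n)"
    and "integrable dn (\<lambda>n. F (h ** n)) \<longleftrightarrow> integrable dn F"
  using integral_distr[OF measurable_left_mult[OF assms(1)] assms(2)]
    integrable_distr_eq[OF measurable_left_mult[OF assms(1)] assms(2)]
  by (simp_all add: distr_left_mult[OF assms(1)])

definition ubox :: "real \<Rightarrow> (real^'n::_^'n::{finite,wellorder}) set" where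
  "ubox T = {n \<in> unipotent_upper. \<forall>i j. \<bar>n $ i $ j\<bar> \<le> T}"

lemma compact_ubox: "compact (ubox T)"
proof -
  have "closed (ubox T)"
  proof -
    have "closed {n :: real^'n::_^'n::{finite,wellorder}. \<forall>i j. \<bar>n $ i $ j\<bar> \<le> T}"
      by (intro closed_Collect_all closed_Collect_le continuous_intros)
    moreover have "ubox T = unipotent_upper \<inter> {n. \<forall>i j. \<bar>n $ i $ j\<bar> \<le> T}" by (auto simp: ubox_def)
    ultimately show ?thesis by (simp only: closed_Int[OF closed_unipotent])
  qed
  moreover have "bounded (ubox T)"
  proof (rule boundedI)
    fix n assume "n \<in> ubox T"
    then have "\<bar>n $ i $ j\<bar> \<le> T" for i j by (auto simp: ubox_def)
    then have "(\<Sum>j\<in>UNIV. \<bar>n $ i $ j\<bar>) \<le> (\<Sum>j\<in>(UNIV::'n set). T)" for i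
      by (intro sum_mono)
    then have "norm (n $ i) \<le> (\<Sum>j\<in>(UNIV::'n set). T)" for i
      by (rule order_trans[OF norm_le_l1_cart])
    then have "(\<Sum>i\<in>UNIV. norm (n $ i)) \<le> (\<Sum>i\<in>(UNIV::'n set). \<Sum>j\<in>(UNIV::'n set). T)" by (intro sum_mono)
    moreover have "norm n \<le> (\<Sum>i\<in>UNIV. norm (n $ i))"
      unfolding norm_vec_def[of n] by (rule L2_set_le_sum) simp
    ultimately show "norm n \<le> (\<Sum>i\<in>(UNIV::'n set). \<Sum>j\<in>(UNIV::'n set). T)" by linarith
  qed
  ultimately show ?thesis by (simp add: compact_eq_bounded_closed)
qed

text \<open>A box of side \<open>T\<close> is covered by polynomially many left translates of a
  fixed compact box: translate by the points of a grid so fine that, the inverses of the grid points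
  being polynomially bounded, every point is close to the identity after a translation.\<close>

lemma ubox_growth:
  "\<exists>c\<ge>0. \<exists>q. \<forall>T::nat. 1 \<le> T \<longrightarrow> emeasure dn (ubox (real T)) \<le> ennreal (c * real T ^ q)"
proof -
  let ?K = "CARD('n)"
  \<comment> \<open>The entries of the grid points are at most \<open>T + 1\<close>, so
    \<open>SS T\<close> is \<open>r\<close> times a bound for the entries of their inverses: a
    grid of mesh \<open>1 / SS T\<close> leaves an error of at most \<open>1\<close> after
    translation, which is why the box of side \<open>2\<close> suffices.\<close>
  define SS where "SS T = ?K * (1 + ?K * (T + 1)) ^ ?K" for T :: nat
  define grid where "grid T z = (\<chi> i j. if i = j then 1 else if i < j then real_of_int (z (i, j)) / real (SS T) else 0)"
    for T :: nat and z :: "'n \<times> 'n \<Rightarrow> int"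
  define Z where "Z T = (\<Pi>\<^sub>E ij\<in>(UNIV :: ('n \<times> 'n) set). {- int (SS T * (T + 1))..int (SS T * (T + 1))})" for T :: nat
  have finZ: "finite (Z T)" for T unfolding Z_def by (intro finite_PiE) auto
  have cardZ: "card (Z T) = (2 * (SS T * (T + 1)) + 1) ^ (?K * ?K)" for T
    unfolding Z_def by (subst card_PiE) (auto simp: nat_add_distrib nat_mult_distrib algebra_simps)
  obtain c0 where c0: "0 \<le> c0" "emeasure dn (ubox 2) = ennreal c0"
    using emeasure_compact[OF compact_ubox, of 2] by (cases "emeasure dn (ubox 2)") (auto simp: ubox_def)
  have b2: "ubox 2 \<in> sets dn"
    by (rule sets_dnI) (auto simp: ubox_def intro!: borel_closed compact_imp_closed[OF compact_ubox[unfolded ubox_def]])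
  have gN: "grid T z \<in> unipotent_upper" for T z by (auto simp: grid_def unipotent_upper_def)
  have cover: "ubox (real T) \<subseteq> (\<Union>z\<in>Z T. (\<lambda>x. grid T z ** x) ` ubox 2)" if T: "1 \<le> T" for T
  proof
    fix n assume n: "n \<in> ubox (real T)"
    then have nN: "n \<in> unipotent_upper" and nT: "\<And>i j. \<bar>n $ i $ j\<bar> \<le> real T" by (auto simp: ubox_def)
    have S1: "1 \<le> SS T" unfolding SS_def by (simp add: Suc_leI)
    define z where "z ij = \<lfloor>real (SS T) * n $ fst ij $ snd ij\<rfloor>" for ij
    let ?g = "grid T z"
    have zb: "\<bar>z ij\<bar> \<le> int (SS T * (T + 1))" for ij
    proof -
      have "\<bar>real (SS T) * n $ fst ij $ snd ij\<bar> \<le> real (SS T) * real T"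
        unfolding abs_mult using nT by (intro mult_mono) auto
      then have "\<bar>real_of_int (z ij)\<bar> \<le> real (SS T) * real T + 1" unfolding z_def by linarith
      also have "\<dots> \<le> real (SS T) * (real T + 1)" using S1 by (simp add: distrib_left)
      finally have "real_of_int \<bar>z ij\<bar> \<le> real_of_int (int (SS T * (T + 1)))" by (simp add: distrib_left)
      then show ?thesis by (simp only: of_int_le_iff)
    qed
    have "- int (SS T * (T + 1)) \<le> z ij \<and> z ij \<le> int (SS T * (T + 1))" for ij
      using zb[of ij] by linarith
    then have zZ: "z \<in> Z T" unfolding Z_def by (auto simp only: PiE_iff extensional_UNIV atLeastAtMost_iff)
    have diff: "\<bar>n $ i $ j - ?g $ i $ j\<bar> \<le> 1 / real (SS T)" for i j
    proof (cases i j rule: linorder_cases)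
      case less
      have "\<bar>real (SS T) * n $ i $ j - real_of_int (z (i, j))\<bar> \<le> 1" unfolding z_def by simp linarith
      then have "\<bar>real (SS T) * n $ i $ j - real_of_int (z (i, j))\<bar> / real (SS T) \<le> 1 / real (SS T)"
        by (intro divide_right_mono) auto
      moreover have "n $ i $ j - ?g $ i $ j = (real (SS T) * n $ i $ j - real_of_int (z (i, j))) / real (SS T)"
        using less S1 less_imp_neq[OF less] by (simp add: grid_def diff_divide_distrib)
      ultimately show ?thesis by simp
    qed (use unipotent_upperD[OF nN] in \<open>auto simp: grid_def\<close>)
    have gT: "\<bar>?g $ i $ j\<bar> \<le> real T + 1" for i j
    proof -
      have "1 / real (SS T) \<le> 1" using S1 by simp
      then show ?thesis using diff[of i j] nT[of i j] by linarith
    qed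
    let ?m = "matrix_inv ?g ** n"
    note ginv = matrix_inv_right_left[OF unipotent_GL[OF gN[of T z]]]
    have "?m $ i $ j = (if i = j then 1 else 0) + (\<Sum>l\<in>UNIV. matrix_inv ?g $ i $ l * (n $ l $ j - ?g $ l $ j))" for i j
    proof -
      have "(\<Sum>l\<in>UNIV. matrix_inv ?g $ i $ l * ?g $ l $ j) = (if i = j then 1 else 0)"
        using arg_cong[OF ginv(2), of "\<lambda>A. A $ i $ j"] by (simp add: matrix_matrix_mult_def mat_def)
      then show ?thesis by (simp add: matrix_matrix_mult_def right_diff_distrib sum_subtractf)
    qed
    moreover have "\<bar>\<Sum>l\<in>UNIV. matrix_inv ?g $ i $ l * (n $ l $ j - ?g $ l $ j)\<bar> \<le> 1" for i j
    proof -
      have "\<bar>\<Sum>l\<in>UNIV. matrix_inv ?g $ i $ l * (n $ l $ j - ?g $ l $ j)\<bar>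
         \<le> (\<Sum>l\<in>(UNIV::'n set). (1 + real ?K * (real T + 1)) ^ ?K * (1 / real (SS T)))"
      proof (rule order_trans[OF sum_abs sum_mono])
        fix l
        have "0 \<le> (1 + real ?K * (real T + 1)) ^ ?K" by (intro zero_le_power) simp
        then show "\<bar>matrix_inv ?g $ i $ l * (n $ l $ j - ?g $ l $ j)\<bar> \<le> (1 + real ?K * (real T + 1)) ^ ?K * (1 / real (SS T))"
          unfolding abs_mult by (intro mult_mono unipotent_inverse_bound gN gT diff) auto
      qed
      also have "\<dots> = 1"
      proof -
        have SX: "real (SS T) = real ?K * (1 + real ?K * (real T + 1)) ^ ?K"
          by (simp only: SS_def of_nat_mult of_nat_power of_nat_add of_nat_1)
        have "(\<Sum>l\<in>(UNIV::'n set). X * (1 / (real ?K * X))) = 1" if "0 < X" for X using that by simp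
        moreover have "0 < (1 + real ?K * (real T + 1)) ^ ?K" by (intro zero_less_power add_pos_nonneg) auto
        ultimately show ?thesis unfolding SX by blast
      qed
      finally show ?thesis .
    qed
    ultimately have "\<bar>?m $ i $ j\<bar> \<le> 2" for i j
      by (smt (verit, best))
    then have "?m \<in> ubox 2" using unipotent_mult[OF unipotent_inverse[OF gN] nN] by (simp add: ubox_def)
    moreover have "n = ?g ** ?m" by (simp add: matrix_mul_assoc ginv)
    ultimately show "n \<in> (\<Union>z\<in>Z T. (\<lambda>x. grid T z ** x) ` ubox 2)" using zZ by blast
  qed
  have tr: "(\<lambda>x. grid T z ** x) ` ubox 2 \<in> sets dn" for T z
  proof (rule sets_dnI)
    show "(\<lambda>x. grid T z ** x) ` ubox 2 \<in> sets borel"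
      by (intro borel_closed compact_imp_closed compact_continuous_image continuous_on_left_mult compact_ubox)
    show "(\<lambda>x. grid T z ** x) ` ubox 2 \<subseteq> unipotent_upper" using gN unipotent_mult by (auto simp: ubox_def)
  qed
  have bound: "emeasure dn (ubox (real T)) \<le> ennreal (c0 * real (card (Z T)))" if T: "1 \<le> T" for T
  proof -
    have "emeasure dn (ubox (real T)) \<le> emeasure dn (\<Union>z\<in>Z T. (\<lambda>x. grid T z ** x) ` ubox 2)"
      by (intro emeasure_mono cover T sets.finite_UN finZ tr)
    also have "\<dots> \<le> (\<Sum>z\<in>Z T. emeasure dn ((\<lambda>x. grid T z ** x) ` ubox 2))"
      by (intro emeasure_subadditive_finite finZ) (use tr in auto)
    also have "\<dots> = (\<Sum>z\<in>Z T. ennreal c0)" by (simp add: emeasure_translate[OF gN b2] c0(2))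
    also have "\<dots> = ennreal (c0 * real (card (Z T)))"
      using c0(1) by (simp add: ennreal_of_nat_eq_real_of_nat ennreal_mult mult.commute)
    finally show ?thesis .
  qed
  define A where "A = real (2 * (?K * (1 + ?K * 2) ^ ?K * 2) + 1)"
  have "real (card (Z T)) \<le> A ^ (?K * ?K) * real T ^ ((?K + 1) * (?K * ?K))" if T: "1 \<le> T" for T
  proof -
    have "SS T \<le> ?K * ((1 + ?K * 2) * T) ^ ?K"
    proof -
      have "1 + ?K * (T + 1) \<le> T + ?K * (2 * T)" using T by (intro add_mono mult_le_mono2) auto
      then show ?thesis unfolding SS_def by (intro mult_le_mono2 power_mono) (auto simp: distrib_right mult_ac)
    qed
    also have "\<dots> = ?K * (1 + ?K * 2) ^ ?K * T ^ ?K" by (simp only: power_mult_distrib mult.assoc)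
    finally have "SS T * (T + 1) \<le> (?K * (1 + ?K * 2) ^ ?K * T ^ ?K) * (2 * T)"
      using T by (intro mult_le_mono) auto
    then have "2 * (SS T * (T + 1)) + 1 \<le> 2 * ((?K * (1 + ?K * 2) ^ ?K * T ^ ?K) * (2 * T)) + T ^ (?K + 1)"
      using T by (intro add_mono mult_le_mono2) auto
    also have "\<dots> = (2 * (?K * (1 + ?K * 2) ^ ?K * 2) + 1) * T ^ (?K + 1)" by (simp add: algebra_simps)
    finally have "real (2 * (SS T * (T + 1)) + 1) \<le> A * real T ^ (?K + 1)"
      unfolding A_def of_nat_power[symmetric] of_nat_mult[symmetric] of_nat_le_iff .
    then have "real (2 * (SS T * (T + 1)) + 1) ^ (?K * ?K) \<le> (A * real T ^ (?K + 1)) ^ (?K * ?K)"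
      by (intro power_mono) auto
    then show ?thesis unfolding cardZ of_nat_power by (simp only: power_mult_distrib power_mult)
  qed
  then have "emeasure dn (ubox (real T)) \<le> ennreal (c0 * A ^ (?K * ?K) * real T ^ ((?K + 1) * (?K * ?K)))" if T: "1 \<le> T" for T
    using bound[OF T] c0(1) T by (elim order_trans) (auto intro!: ennreal_leI mult_left_mono simp: mult.assoc)
  moreover have "0 \<le> c0 * A ^ (?K * ?K)" using c0(1) by (simp add: A_def)
  ultimately show ?thesis by blast
qed

text \<open>Sum over the shells \<open>k \<le> entry_norm \<le> k + 1\<close>, whose measure
  is polynomial in \<open>k\<close>.\<close>

lemma integrable_entry_norm: "\<exists>Q>0. integrable dn (\<lambda>n. entry_norm n powr - Q)"
proof -
  obtain c q where c: "0 \<le> c" "\<And>T::nat. 1 \<le> T \<Longrightarrow> emeasure dn (ubox (real T)) \<le> ennreal (c * real T ^ q)"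
    using ubox_growth by blast
  let ?Q = "real q + 2"
  have meas: "(\<lambda>n. entry_norm n powr - ?Q) \<in> borel_measurable dn"
    by (intro measurable_dn continuous_on_powr continuous_on_entry_norm continuous_on_const ballI entry_norm_nz)
  have le: "ennreal (entry_norm n powr - ?Q) \<le> (\<Sum>k. ennreal (real (Suc k) powr - ?Q) * indicator (ubox (real (Suc (Suc k)))) n)"
    if n: "n \<in> unipotent_upper" for n
  proof -
    \<comment> \<open>The index of the shell that contains \<open>n\<close>; it is natural since
      \<open>entry_norm n \<ge> 1\<close>.\<close>
    define k where "k = nat \<lfloor>entry_norm n\<rfloor> - 1"
    have k: "real (Suc k) \<le> entry_norm n" "entry_norm n \<le> real (Suc (Suc k))"
      using entry_norm_ge1[of n] unfolding k_def by linarith+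
    have "n \<in> ubox (real (Suc (Suc k)))"
      unfolding ubox_def using n entry_le_entry_norm[of n] k(2) by (auto intro: order_trans)
    moreover have "entry_norm n powr - ?Q \<le> real (Suc k) powr - ?Q"
      using k(1) by (intro powr_mono2') auto
    moreover define g where "g k = ennreal (real (Suc k) powr - ?Q) * indicator (ubox (real (Suc (Suc k)))) n" for k
    ultimately have "ennreal (entry_norm n powr - ?Q) \<le> g k"
      by (simp add: ennreal_leI)
    also have "g k \<le> suminf g"
      using sum_le_suminf[of g "{k}"] by simp
    finally show ?thesis unfolding g_def .
  qed
  have bs: "ubox T \<in> sets dn" for T
    by (rule sets_dnI) (auto simp: ubox_def intro!: borel_closed compact_imp_closed[OF compact_ubox[unfolded ubox_def]])
  have summ: "summable (\<lambda>k. c * 2 ^ q * (real (Suc k) powr - 2))"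
    using summable_real_powr_iff[of "-2"] summable_Suc_iff[of "\<lambda>n. real n powr - 2"] by (intro summable_mult) simp
  have "(\<integral>\<^sup>+ n. ennreal (entry_norm n powr - ?Q) \<partial>dn) \<le>
     (\<integral>\<^sup>+ n. (\<Sum>k. ennreal (real (Suc k) powr - ?Q) * indicator (ubox (real (Suc (Suc k)))) n) \<partial>dn)"
    by (rule nn_integral_mono) (use le in \<open>simp add: space_dn\<close>)
  also have "\<dots> = (\<Sum>k. \<integral>\<^sup>+ n. ennreal (real (Suc k) powr - ?Q) * indicator (ubox (real (Suc (Suc k)))) n \<partial>dn)"
    by (rule nn_integral_suminf) (use bs in measurable)
  also have "\<dots> \<le> (\<Sum>k. ennreal (c * 2 ^ q * (real (Suc k) powr - 2)))"
  proof (rule suminf_le)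
    fix k
    have "(\<integral>\<^sup>+ n. ennreal (real (Suc k) powr - ?Q) * indicator (ubox (real (Suc (Suc k)))) n \<partial>dn) =
        ennreal (real (Suc k) powr - ?Q) * emeasure dn (ubox (real (Suc (Suc k))))"
      by (rule nn_integral_cmult_indicator[OF bs])
    also have "\<dots> \<le> ennreal (real (Suc k) powr - ?Q) * ennreal (c * real (Suc (Suc k)) ^ q)"
      by (intro mult_left_mono c(2)) auto
    also have "\<dots> = ennreal (real (Suc k) powr - ?Q * (c * real (Suc (Suc k)) ^ q))"
      using c(1) by (simp add: ennreal_mult)
    also have "\<dots> \<le> ennreal (c * 2 ^ q * (real (Suc k) powr - 2))"
    proof (rule ennreal_leI)
      have "real (Suc (Suc k)) ^ q \<le> (2 * real (Suc k)) ^ q" by (intro power_mono) auto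
      then have "real (Suc k) powr - ?Q * (c * real (Suc (Suc k)) ^ q) \<le> real (Suc k) powr - ?Q * (c * (2 * real (Suc k)) ^ q)"
        using c(1) by (intro mult_left_mono) auto
      also have "\<dots> = c * 2 ^ q * (real (Suc k) powr - ?Q * real (Suc k) powr real q)"
        by (simp add: powr_realpow power_mult_distrib del: of_nat_Suc)
      also have "\<dots> = c * 2 ^ q * (real (Suc k) powr - 2)" by (simp add: powr_add[symmetric] del: of_nat_Suc)
      finally show "real (Suc k) powr - ?Q * (c * real (Suc (Suc k)) ^ q) \<le> c * 2 ^ q * (real (Suc k) powr - 2)" .
    qed
    finally show "(\<integral>\<^sup>+ n. ennreal (real (Suc k) powr - ?Q) * indicator (ubox (real (Suc (Suc k)))) n \<partial>dn)
       \<le> ennreal (c * 2 ^ q * (real (Suc k) powr - 2))" .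
  qed auto
  also have "\<dots> < \<infinity>"
  proof -
    have "(\<Sum>k. ennreal (c * 2 ^ q * (real (Suc k) powr - 2))) = ennreal (\<Sum>k. c * 2 ^ q * (real (Suc k) powr - 2))"
      using c(1) by (intro suminf_ennreal2 summ) auto
    then show ?thesis by simp
  qed
  finally have "integrable dn (\<lambda>n. entry_norm n powr - ?Q)"
    using meas by (intro integrableI_bounded) auto
  then show ?thesis by (intro exI[of _ ?Q]) auto
qed

lemma integrable_bound_entry_norm:
  fixes F :: "real^'n::_^'n::{finite,wellorder} \<Rightarrow> complex"
  assumes "integrable dn (\<lambda>n. entry_norm n powr - Q)" "smooth_on GL F" "\<And>n. n \<in> unipotent_upper \<Longrightarrow> norm (F n) \<le> C * entry_norm n powr - Q"
  shows "integrable dn F"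
  by (rule Bochner_Integration.integrable_bound[OF integrable_mult_right[OF assms(1), of C] measurable_dn_smooth[OF assms(2)]])
    (use assms(3) in \<open>auto simp: space_dn intro!: AE_I2 intro: order_trans[OF _ abs_ge_self]\<close>)

subsection \<open>Integration by parts\<close>

text \<open>Left translation by \<open>1 + s E\<^sub>a\<^sub>b\<close> is the flow of
  \<open>left_field (a, b)\<close>; it changes sizes by a bounded factor for \<open>\<bar>s\<bar>
  \<le> 1\<close>.\<close>

lemma transvection:
  fixes a b :: 'n
  assumes "a < b"
  shows "mat 1 + s *\<^sub>R munit a b \<in> unipotent_upper"
    and "(mat 1 + s *\<^sub>R munit a b) ** x = x + s *\<^sub>R left_field (a, b) x"
    and "left_field (a, b) (x + s *\<^sub>R left_field (a, b) x) = left_field (a, b) x"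
    and "\<bar>s\<bar> \<le> 1 \<Longrightarrow> entry_norm x \<le> 2 * entry_norm (x + s *\<^sub>R left_field (a, b) x)"
proof -
  show "mat 1 + s *\<^sub>R munit a b \<in> unipotent_upper"
    using assms less_imp_neq[OF assms] by (auto simp: unipotent_upper_def mat_def)
  show e: "(mat 1 + s *\<^sub>R munit a b) ** x = x + s *\<^sub>R left_field (a, b) x"
  proof -
    have "((mat 1 + s *\<^sub>R munit a b) ** x) $ i $ j = (\<Sum>l\<in>UNIV. (if i = l then x $ l $ j else 0)) + s * left_field (a, b) x $ i $ j" for i j
      unfolding left_field_def matrix_matrix_mult_def
      by (simp add: mat_def distrib_right sum.distrib sum_distrib_left mult.assoc if_distrib[of "\<lambda>z. z * _"] cong: if_cong)
    then show ?thesis by (simp add: vec_eq_iff)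
  qed
  show l: "left_field (a, b) (x + s *\<^sub>R left_field (a, b) x) = left_field (a, b) x"
    using less_imp_neq[OF assms] by (auto simp: vec_eq_iff left_field_entry)
  assume s: "\<bar>s\<bar> \<le> 1"
  let ?y = "x + s *\<^sub>R left_field (a, b) x"
  have "\<bar>x $ i $ j\<bar> \<le> \<bar>?y $ i $ j\<bar> + (if i = a then \<bar>?y $ b $ j\<bar> else 0)" for i j
  proof (cases "i = a")
    case True
    have b: "?y $ b $ j = x $ b $ j" using less_imp_neq[OF assms] by (auto simp: left_field_entry)
    have a: "?y $ a $ j = x $ a $ j + s * x $ b $ j" by (simp add: left_field_entry)
    have c: "\<bar>s * x $ b $ j\<bar> \<le> \<bar>x $ b $ j\<bar>" using s by (simp add: abs_mult mult_left_le_one_le)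
    have "\<bar>p\<bar> \<le> \<bar>p + q\<bar> + \<bar>r\<bar>" if "\<bar>q\<bar> \<le> \<bar>r\<bar>" for p q r :: real
      using that by linarith
    from this[OF c] have "\<bar>x $ a $ j\<bar> \<le> \<bar>?y $ a $ j\<bar> + \<bar>?y $ b $ j\<bar>" unfolding a b .
    then show ?thesis unfolding True if_P[OF refl] .
  qed (simp add: left_field_entry)
  then have "(\<Sum>i\<in>UNIV. \<Sum>j\<in>UNIV. \<bar>x $ i $ j\<bar>) \<le> (\<Sum>i\<in>UNIV. \<Sum>j\<in>UNIV. \<bar>?y $ i $ j\<bar> + (if i = a then \<bar>?y $ b $ j\<bar> else 0))"
    by (intro sum_mono)
  also have "\<dots> = (\<Sum>i\<in>UNIV. \<Sum>j\<in>UNIV. \<bar>?y $ i $ j\<bar>) + (\<Sum>j\<in>UNIV. \<bar>?y $ b $ j\<bar>)"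
  proof -
    have "(\<Sum>j\<in>UNIV. if i = a then \<bar>?y $ b $ j\<bar> else 0) = (if i = a then \<Sum>j\<in>UNIV. \<bar>?y $ b $ j\<bar> else 0)" for i
      by simp
    then show ?thesis unfolding sum.distrib by (simp only: sum.delta finite UNIV_I if_True)
  qed
  also have "(\<Sum>j\<in>UNIV. \<bar>?y $ b $ j\<bar>) \<le> (\<Sum>i\<in>UNIV. \<Sum>j\<in>UNIV. \<bar>?y $ i $ j\<bar>)"
    by (rule member_le_sum[of _ _ "\<lambda>i. \<Sum>j\<in>UNIV. \<bar>?y $ i $ j\<bar>"]) (auto intro: sum_nonneg)
  finally show "entry_norm x \<le> 2 * entry_norm ?y" by (simp add: entry_norm_def)
qed

text \<open>The integral of \<open>F\<close> over a left translate does not depend on the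
  translation. The difference quotients converge under the integral since, by the mean value
  theorem, they are dominated through the bound on the derivative.\<close>

lemma integral_left_field_zero:
  fixes F :: "real^'n::_^'n::{finite,wellorder} \<Rightarrow> complex" and a b :: 'n
  assumes ab: "a < b" and Q: "0 < Q" "integrable dn (\<lambda>n. entry_norm n powr - Q)" and sm: "smooth_on GL F"
    and bF: "\<And>n. n \<in> unipotent_upper \<Longrightarrow> norm (F n) \<le> C * entry_norm n powr - Q"
    and bX: "\<And>n. n \<in> unipotent_upper \<Longrightarrow> norm (vf_deriv (left_field (a, b)) F n) \<le> C * entry_norm n powr - Q"
  shows "(LINT n|dn. vf_deriv (left_field (a, b)) F n) = 0" "integrable dn (vf_deriv (left_field (a, b)) F)"
proof -
  let ?X = "vf_deriv (left_field (a, b)) F"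
  let ?sh = "\<lambda>s n. n + s *\<^sub>R left_field (a, b) n"
  have smX: "smooth_on GL ?X"
  proof (rule smooth_on_vf_deriv_matrix[OF open_GL sm])
    fix i j show "smooth_on GL (\<lambda>x. complex_of_real (left_field (a, b) x $ i $ j))"
      unfolding left_field_entry by (cases "i = a") (auto simp: smooth_on_const intro: smooth_on_entry[unfolded entry_def[abs_def]])
  qed
  show "integrable dn ?X" by (rule integrable_bound_entry_norm[OF Q(2) smX bX])
  have iF: "integrable dn F" by (rule integrable_bound_entry_norm[OF Q(2) sm bF])
  have shN: "?sh s n \<in> unipotent_upper" if "n \<in> unipotent_upper" for s n
    using unipotent_mult[OF transvection(1)[OF ab, of s] that] unfolding transvection(2)[OF ab] .
  have iFs: "integrable dn (\<lambda>n. F (?sh s n))" "(LINT n|dn. F (?sh s n)) = (LINT n|dn. F n)" for s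
    using integral_translate[OF transvection(1)[OF ab, of s] measurable_dn_smooth[OF sm]] iF
    unfolding transvection(2)[OF ab] by auto
  have C0: "0 \<le> C"
  proof -
    have "mat 1 \<in> (unipotent_upper :: (real^'n::_^'n::{finite,wellorder}) set)" by (auto simp: unipotent_upper_def mat_def)
    from order_trans[OF norm_ge_zero bF[OF this]] show ?thesis
      using entry_norm_ge1[of "mat 1 :: real^'n::_^'n::{finite,wellorder}"] by (simp add: zero_le_mult_iff powr_eq_0_iff)
  qed
  have der: "((\<lambda>s. F (?sh s n)) has_vector_derivative ?X (?sh s n)) (at s)" if n: "n \<in> unipotent_upper" for n s
  proof -
    have "F differentiable at (?sh s n)"
      by (rule smooth_on_imp_differentiable[OF sm unipotent_GL[OF shN[OF n]]])
    then have D: "(F has_derivative (\<lambda>v. vf_deriv (\<lambda>_. v) F (?sh s n))) (at (?sh s n))"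
      by (rule has_derivative_vf_deriv)
    have "((\<lambda>s. ?sh s n) has_derivative (\<lambda>h. h *\<^sub>R left_field (a, b) n)) (at s)"
      by (auto intro!: derivative_eq_intros)
    from diff_chain_at[OF this D] have "((\<lambda>s. F (?sh s n)) has_derivative (\<lambda>h. vf_deriv (\<lambda>_. h *\<^sub>R left_field (a, b) n) F (?sh s n))) (at s)"
      by (simp add: o_def)
    moreover have "vf_deriv (\<lambda>_. h *\<^sub>R left_field (a, b) n) F (?sh s n) = h *\<^sub>R ?X (?sh s n)" for h
    proof -
      have "linear (\<lambda>v. vf_deriv (\<lambda>_. v) F (?sh s n))" using D has_derivative_linear by blast
      then have "vf_deriv (\<lambda>_. h *\<^sub>R left_field (a, b) n) F (?sh s n) = h *\<^sub>R vf_deriv (\<lambda>_. left_field (a, b) n) F (?sh s n)"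
        by (rule linear_cmul)
      also have "vf_deriv (\<lambda>_. left_field (a, b) n) F (?sh s n) = ?X (?sh s n)"
        unfolding vf_deriv_apply[of "left_field (a, b)"] transvection(3)[OF ab] ..
      finally show ?thesis .
    qed
    ultimately show ?thesis by (simp add: has_vector_derivative_def)
  qed
  define e where "e k = 1 / real (Suc k)" for k
  define D where "D k n = (F (?sh (e k) n) - F n) / complex_of_real (e k)" for k n
  have e01: "0 < e k" "e k \<le> 1" for k by (auto simp: e_def)
  have "(\<lambda>k. LINT n|dn. D k n) \<longlonglongrightarrow> (LINT n|dn. ?X n)"
  proof (rule integral_dominated_convergence[where w = "\<lambda>n. C * (2 powr Q) * entry_norm n powr - Q"])
    show "?X \<in> borel_measurable dn" by (rule measurable_dn_smooth[OF smX])
    show "D k \<in> borel_measurable dn" for k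
      unfolding D_def using iFs(1)[of "e k"] iF by (intro borel_measurable_divide borel_measurable_diff) auto
    show "integrable dn (\<lambda>n. C * (2 powr Q) * entry_norm n powr - Q)" using Q(2) by simp
    show "AE n in dn. (\<lambda>k. D k n) \<longlonglongrightarrow> ?X n"
    proof (rule AE_I2)
      fix n assume "n \<in> space dn"
      then have n: "n \<in> unipotent_upper" by (simp add: space_dn)
      have "((\<lambda>t. (F (?sh t n) - F n) / complex_of_real t) \<longlongrightarrow> ?X n) (at 0)"
      proof -
        have 1: "((\<lambda>h. norm (F (?sh h n) - F n - h *\<^sub>R ?X n) / norm h) \<longlongrightarrow> 0) (at 0)"
          using der[OF n, of 0] unfolding has_vector_derivative_def has_derivative_at by simp
        have 2: "norm (F (?sh h n) - F n - h *\<^sub>R ?X n) / norm h = norm ((F (?sh h n) - F n) / complex_of_real h - ?X n)"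
          if "h \<noteq> 0" for h
        proof -
          have "(F (?sh h n) - F n) / complex_of_real h - ?X n = (F (?sh h n) - F n - h *\<^sub>R ?X n) / complex_of_real h"
            using that by (simp add: scaleR_conv_of_real field_simps)
          then show ?thesis by (simp only: norm_divide norm_of_real real_norm_def)
        qed
        have "((\<lambda>h. norm ((F (?sh h n) - F n) / complex_of_real h - ?X n)) \<longlongrightarrow> 0) (at 0)"
          using 1
        proof (rule Lim_transform_eventually)
          show "\<forall>\<^sub>F h in at 0. norm (F (?sh h n) - F n - h *\<^sub>R ?X n) / norm h = norm ((F (?sh h n) - F n) / complex_of_real h - ?X n)"
            unfolding eventually_at_filter by (rule always_eventually) (use 2 in blast)
        qed
        from tendsto_norm_zero_cancel[OF this] show ?thesis
          by (rule LIM_zero_cancel)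
      qed
      moreover have "filterlim e (at 0) sequentially"
      proof (rule filterlim_atI)
        show "e \<longlonglongrightarrow> 0" unfolding e_def using LIMSEQ_inverse_real_of_nat by (simp add: inverse_eq_divide)
        show "\<forall>\<^sub>F k in sequentially. e k \<noteq> 0" using e01 by (auto intro!: always_eventually simp: less_imp_neq[symmetric])
      qed
      ultimately show "(\<lambda>k. D k n) \<longlonglongrightarrow> ?X n"
        unfolding D_def by (rule filterlim_compose)
    qed
    show "AE n in dn. norm (D k n) \<le> C * (2 powr Q) * entry_norm n powr - Q" for k
    proof (rule AE_I2)
      fix n assume "n \<in> space dn"
      then have n: "n \<in> unipotent_upper" by (simp add: space_dn)
      have B: "norm (?X (?sh s n)) \<le> C * (2 powr Q) * entry_norm n powr - Q" if "s \<in> {0..e k}" for s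
      proof -
        have "entry_norm n / 2 \<le> entry_norm (?sh s n)" using transvection(4)[OF ab, of s n] that e01[of k] by auto
        then have "entry_norm (?sh s n) powr - Q \<le> (entry_norm n / 2) powr - Q"
          using Q(1) entry_norm_ge1[of n] by (intro powr_mono2') auto
        also have "\<dots> = 2 powr Q * entry_norm n powr - Q"
          using entry_norm_ge1[of n] by (simp add: powr_divide powr_minus field_simps)
        finally show ?thesis using order_trans[OF bX[OF shN[OF n]] mult_left_mono[OF _ C0]] by (simp add: mult.assoc)
      qed
      have "norm (F (?sh (e k) n) - F (?sh 0 n)) \<le> (C * (2 powr Q) * entry_norm n powr - Q) * norm (e k - 0)"
      proof (rule differentiable_bound[where S = "{0..e k}"])
        show "((\<lambda>s. F (?sh s n)) has_derivative (\<lambda>h. h *\<^sub>R ?X (?sh s n))) (at s within {0..e k})" for s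
          using der[OF n, of s] unfolding has_vector_derivative_def by (rule has_derivative_at_withinI)
        show "onorm (\<lambda>h. h *\<^sub>R ?X (?sh s n)) \<le> C * (2 powr Q) * entry_norm n powr - Q" if "s \<in> {0..e k}" for s
          using B[OF that] by (intro onorm_bound) (auto simp: mult.commute intro: mult_left_mono order_trans[OF norm_ge_zero])
      qed (use e01[of k] in auto)
      then show "norm (D k n) \<le> C * (2 powr Q) * entry_norm n powr - Q"
        unfolding D_def norm_divide using e01[of k] by (simp add: divide_le_eq)
    qed
  qed
  moreover have "(LINT n|dn. D k n) = 0" for k
    unfolding D_def using iFs[of "e k"] iF by simp
  ultimately show "(LINT n|dn. ?X n) = 0" by (simp add: LIMSEQ_const_iff)
qed

end

lemma psi_eq: "psi x = exp (\<Sum>p\<in>consec. 2 * of_real pi * \<i> * entry (fst p) (snd p) x)"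
  unfolding psi_def consec_def case_prod_unfold entry_def by (simp add: sum_distrib_left)

lemma norm_psi: "norm (psi x) = 1"
  unfolding psi_def norm_exp_eq_Re by simp

lemma smooth_on_psi: "open \<Omega> \<Longrightarrow> smooth_on \<Omega> psi"
  unfolding psi_eq[abs_def] by (intro smooth_on_exp smooth_on_sum smooth_on_mult smooth_on_const smooth_on_entry)

lemma psi_differentiable: "psi differentiable at x"
  using smooth_on_imp_differentiable[OF smooth_on_psi[OF open_UNIV]] by simp

lemma vf_deriv_psi:
  "vf_deriv \<xi> psi x = 2 * of_real pi * \<i> * (\<Sum>p\<in>consec. of_real (\<xi> x $ fst p $ snd p)) * psi x"
proof -
  let ?L = "\<lambda>x. \<Sum>p\<in>consec. 2 * of_real pi * \<i> * entry (fst p) (snd p) x"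
  have d: "?L differentiable at x"
    by (rule smooth_on_imp_differentiable[of UNIV]) (auto intro!: smooth_on_sum smooth_on_mult smooth_on_const smooth_on_entry)
  have "vf_deriv \<xi> psi x = exp (?L x) * vf_deriv (\<lambda>_. \<xi> x) ?L x"
    unfolding psi_eq[abs_def] by (rule vf_deriv_eqI[OF has_derivative_exp_vf_deriv[OF d]])
  also have "vf_deriv (\<lambda>_. \<xi> x) ?L x = 2 * of_real pi * \<i> * (\<Sum>p\<in>consec. of_real (\<xi> x $ fst p $ snd p))"
    by (subst vf_deriv_sum) (auto simp: vf_deriv_mult vf_deriv_entry sum_distrib_left intro!: differentiable_mult)
  finally show ?thesis unfolding psi_eq[of x, symmetric] by (simp add: mult_ac)
qed

text \<open>On the first superdiagonal only the leading term of \<open>borel_field\<close>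
  survives.\<close>

lemma borel_field_consec:
  assumes n: "n \<in> unipotent_upper" and ij: "(i, j) \<in> consec"
  shows "borel_field cd n $ i $ j = matrix_inv n $ i $ fst cd * n $ snd cd $ j"
proof -
  have "i < j" using ij by (simp add: consec_def)
  have "borel_field cd n $ i $ j = (\<Sum>l\<in>{i}. n $ i $ l * matrix_inv n $ l $ fst cd * n $ snd cd $ j)"
    unfolding borel_field_def vec_lambda_beta
  proof (rule sum.mono_neutral_right)
    show "\<forall>l\<in>{..<j} - {i}. n $ i $ l * matrix_inv n $ l $ fst cd * n $ snd cd $ j = 0"
    proof
      fix l assume l: "l \<in> {..<j} - {i}"
      then have "\<not> i < l" using ij by (auto simp: consec_def)
      then have "l < i" using l by auto
      then show "n $ i $ l * matrix_inv n $ l $ fst cd * n $ snd cd $ j = 0" by (simp add: unipotent_upperD(2)[OF n])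
    qed
  qed (use \<open>i < j\<close> in auto)
  then show ?thesis by (simp add: unipotent_upperD(1)[OF n])
qed

lemma vf_deriv_borel_field_psi:
  assumes n: "n \<in> unipotent_upper"
  shows "vf_deriv (borel_field cd) psi n = 2 * of_real pi * \<i> * of_real (shift_entry cd n) * psi n"
proof -
  have "(\<Sum>p\<in>consec. complex_of_real (borel_field cd n $ fst p $ snd p)) = (\<Sum>p\<in>consec. complex_of_real (matrix_inv n $ fst p $ fst cd * n $ snd cd $ snd p))"
    using borel_field_consec[OF n] by (intro sum.cong) auto
  then show ?thesis unfolding vf_deriv_psi shift_entry_def case_prod_unfold by simp
qed

lemma bounded_by_psi: "sym.bounded_by 1 (\<lambda>x. 2 * pi * hgauge x powr 1) psi"
proof -
  have b: "1 \<le> 2 * pi * hgauge x powr 1" for x :: "real^'n::_^'n::{finite,wellorder}"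
  proof -
    have "1 * 1 \<le> 2 * pi * hgauge x" using hgauge_ge1[of x] pi_gt3 by (intro mult_mono) auto
    then show ?thesis using hgauge_pos[of x] by simp
  qed
  have "norm (vf_deriv (borel_field cd) psi n) \<le> 2 * pi * hgauge n powr 1 * hgauge n ^ level cd" if n: "n \<in> unipotent_upper"
    for n :: "real^'n::_^'n::{finite,wellorder}" and cd
  proof -
    have "\<bar>shift_entry cd n\<bar> \<le> hgauge n powr (real (level cd) + 1)"
    proof -
      have "height (snd cd) (fst cd) + 1 \<le> real (level cd) + 1" by (simp add: height_def level_def)
      from order_trans[OF shift_entry_bound_all[OF n, of "fst cd" "snd cd"] hgauge_powr_mono[OF this]] show ?thesis by simp
    qed
    also have "\<dots> = hgauge n powr 1 * hgauge n ^ level cd" by (simp add: powr_add powr_realpow hgauge_pos mult.commute)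
    finally show ?thesis
      unfolding vf_deriv_borel_field_psi[OF n] norm_mult norm_psi by simp
  qed
  then show ?thesis
    unfolding One_nat_def sym.bounded_by.simps
    using b smooth_on_psi[OF open_GL] sym.smooth_field[OF smooth_on_psi[OF open_GL]] by (auto simp: norm_psi)
qed

text \<open>For \<open>a < b\<close> the matrix \<open>n\<^sup>-\<^sup>1 E\<^sub>a\<^sub>b n\<close>
  is strictly upper triangular, so nothing is cut off.\<close>

lemma borel_field_left_field:
  assumes n: "n \<in> unipotent_upper" and ab: "ab \<in> upper_pairs"
  shows "borel_field ab n = left_field ab n"
proof -
  have ab': "fst ab < snd ab" using ab by (auto simp: upper_pairs_def)
  have "borel_field ab n $ i $ j = left_field ab n $ i $ j" for i j
  proof (cases "j < snd ab")
    case True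
    then have "n $ snd ab $ j = 0" by (rule unipotent_upperD(2)[OF n])
    then show ?thesis by (simp add: borel_field_def left_field_entry)
  next
    case False
    have "(\<Sum>l\<in>{..<j}. n $ i $ l * matrix_inv n $ l $ fst ab) = (\<Sum>l\<in>UNIV. n $ i $ l * matrix_inv n $ l $ fst ab)"
      by (rule sum.mono_neutral_left)
        (use False ab' unipotent_upperD(2)[OF unipotent_inverse[OF n]] in \<open>auto simp: not_less\<close>)
    also have "\<dots> = (if i = fst ab then 1 else 0)"
      using arg_cong[OF matrix_inv_right_left(1)[OF unipotent_GL[OF n]], of "\<lambda>A. A $ i $ fst ab"]
      by (simp add: matrix_matrix_mult_def mat_def)
    finally show ?thesis by (simp add: borel_field_def left_field_entry sum_distrib_right[symmetric])
  qed
  then show ?thesis by (simp add: vec_eq_iff)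
qed

lemma borel_field_eq_sum_left_field:
  fixes n :: "real^'n::_^'n::{finite,wellorder}"
  assumes n: "n \<in> unipotent_upper"
  shows "borel_field cd n = (\<Sum>ab\<in>upper_pairs. Re (frame_coeff cd ab n) *\<^sub>R left_field ab n)"
proof -
  have re: "complex_of_real (Re (frame_coeff cd ab n)) = frame_coeff cd ab n" for ab
    by (simp add: frame_coeff_def entry_def inv_entry_def)
  have z: "frame_coeff cd (i, b) n = 0" if "b \<le> i" for i b :: 'n
    unfolding frame_coeff_def
  proof (intro sum.neutral ballI)
    fix p l :: 'n assume "l \<in> {..<p}"
    then have "l < i \<or> b < p" using that by (cases "l < i") (auto simp: not_less)
    then show "entry (fst (i, b)) l n * inv_entry l (fst cd) n * (entry (snd cd) p n * inv_entry p (snd (i, b)) n) = 0"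
      using unipotent_upperD(2)[OF n] unipotent_upperD(2)[OF unipotent_inverse[OF n]]
      by (auto simp: entry_def inv_entry_def)
  qed
  have "complex_of_real (borel_field cd n $ i $ j) = complex_of_real ((\<Sum>ab\<in>upper_pairs. Re (frame_coeff cd ab n) *\<^sub>R left_field ab n) $ i $ j)" for i j
  proof -
    have "complex_of_real ((\<Sum>ab\<in>upper_pairs. Re (frame_coeff cd ab n) *\<^sub>R left_field ab n) $ i $ j) =
        (\<Sum>ab\<in>upper_pairs. frame_coeff cd ab n * (if i = fst ab then entry (snd ab) j n else 0))"
      by (auto simp: sum_component re left_field_entry entry_def intro!: sum.cong)
    also have "\<dots> = (\<Sum>ab\<in>(\<lambda>b. (i, b)) ` UNIV. frame_coeff cd ab n * entry (snd ab) j n)"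
      by (rule sum.mono_neutral_cong) (use z in \<open>auto simp: upper_pairs_def not_less split: if_splits\<close>)
    also have "\<dots> = (\<Sum>b\<in>UNIV. frame_coeff cd (i, b) n * entry b j n)"
      by (subst sum.reindex) (auto simp: inj_on_def)
    also have "\<dots> = (\<Sum>p\<in>UNIV. (\<Sum>l\<in>{..<p}. entry i l n * inv_entry l (fst cd) n * entry (snd cd) p n) * (\<Sum>b\<in>UNIV. inv_entry p b n * entry b j n))"
      unfolding frame_coeff_def fst_conv snd_conv sum_distrib_right sum_distrib_left
      by (subst sum.swap, rule sum.cong[OF refl]) (simp add: mult_ac)
    also have "\<dots> = complex_of_real (borel_field cd n $ i $ j)"
      unfolding sum_inv_entry_entry[OF unipotent_GL[OF n]] borel_field_entry
      by (simp add: if_distrib[where f = "\<lambda>z. _ * z"] cong: if_cong)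
    finally show ?thesis by simp
  qed
  then show ?thesis by (simp only: of_real_eq_iff vec_eq_iff) blast
qed

lemma sum_shift_entry_multiplier: "(\<Sum>cd\<in>lower_pairs. complex_of_real (shift_entry cd x) * multiplier cd x) = (gauge_sum_c x - 1) * inverse (gauge_sum_c x)"
proof -
  have "complex_of_real (shift_entry cd x) * multiplier cd x = complex_of_real (shift_entry cd x) ^ (2 * gauge_expo cd) * inverse (gauge_sum_c x)" for cd
  proof -
    have "2 * gauge_expo cd = Suc (2 * gauge_expo cd - 1)" using gauge_expo_pos[of cd] by simp
    then show ?thesis unfolding multiplier_def by (metis mult.assoc power_Suc)
  qed
  then show ?thesis unfolding gauge_sum_c_eq[of x] by (simp add: sum_distrib_right)
qed

text \<open>The integrand \<open>\<psi> f - \<psi> L f\<close> is a divergence, expanded in the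
  right invariant frame so that each term integrates to zero.\<close>

lemma psi_gain_op_divergence:
  fixes f :: "real^'n::_^'n::{finite,wellorder} \<Rightarrow> complex"
  assumes n: "n \<in> unipotent_upper" and f: "smooth_on GL f"
  shows "(\<Sum>cd\<in>lower_pairs. \<Sum>ab\<in>upper_pairs. vf_deriv (left_field ab) (\<lambda>x. frame_coeff cd ab x * (psi x * (multiplier cd x * f x))) n) =
     2 * of_real pi * \<i> * (psi n * f n - psi n * gain_op f n)"
proof -
  note nG = unipotent_GL[OF n]
  have sgf: "smooth_on GL (\<lambda>x. multiplier cd x * f x)" for cd
    by (intro smooth_on_mult open_GL f symbol_smooth[OF symbol_multiplier])
  let ?G = "\<lambda>cd x. psi x * (multiplier cd x * f x)"
  have sG: "smooth_on GL (?G cd)" for cd by (intro smooth_on_mult open_GL sgf smooth_on_psi)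
  note dG = smooth_on_imp_differentiable[OF sG nG]
  have dy: "frame_coeff cd ab differentiable at n" for cd ab
    using symbol1_frame_coeff symbol_smooth nG smooth_on_imp_differentiable unfolding symbol1_def by blast
  have 1: "(\<Sum>ab\<in>upper_pairs. vf_deriv (left_field ab) (\<lambda>x. frame_coeff cd ab x * ?G cd x) n) = frame_div cd n * ?G cd n + vf_deriv (borel_field cd) (?G cd) n" for cd
  proof -
    have lin: "linear (frechet_derivative (?G cd) (at n))" using dG by (rule linear_frechet_derivative)
    have "vf_deriv (borel_field cd) (?G cd) n = (\<Sum>ab\<in>upper_pairs. frame_coeff cd ab n * vf_deriv (left_field ab) (?G cd) n)"
    proof -
      have "complex_of_real (Re (frame_coeff cd ab n)) = frame_coeff cd ab n" for ab by (simp add: frame_coeff_def entry_def inv_entry_def)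
      then show ?thesis
        unfolding vf_deriv_def borel_field_eq_sum_left_field[OF n] linear_sum[OF lin] linear_cmul[OF lin] by (simp add: scaleR_conv_of_real)
    qed
    then show ?thesis by (simp add: vf_deriv_mult[OF dy dG] sum.distrib frame_div_def sum_distrib_right)
  qed
  have 2: "vf_deriv (borel_field cd) (?G cd) n = 2 * of_real pi * \<i> * psi n * f n * (of_real (shift_entry cd n) * multiplier cd n) + psi n * vf_deriv (borel_field cd) (\<lambda>x. multiplier cd x * f x) n" for cd
    by (subst vf_deriv_mult[OF psi_differentiable smooth_on_imp_differentiable[OF sgf nG]])
      (simp add: vf_deriv_borel_field_psi[OF n] mult_ac)
  let ?S = "\<Sum>cd\<in>lower_pairs. vf_deriv (borel_field cd) (\<lambda>x. multiplier cd x * f x) n + frame_div cd n * (multiplier cd n * f n)"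
  have "(\<Sum>cd\<in>lower_pairs. \<Sum>ab\<in>upper_pairs. vf_deriv (left_field ab) (\<lambda>x. frame_coeff cd ab x * ?G cd x) n) =
     2 * of_real pi * \<i> * psi n * f n * (\<Sum>cd\<in>lower_pairs. of_real (shift_entry cd n) * multiplier cd n) + psi n * ?S"
    unfolding 1 2 sum_distrib_left sum.distrib[symmetric] by (rule sum.cong) (auto simp: algebra_simps)
  also have "\<dots> = 2 * of_real pi * \<i> * (psi n * f n - psi n * (inverse (gauge_sum_c n) * f n)) + psi n * ?S"
    unfolding sum_shift_entry_multiplier using gauge_sum_c_nz[of n] by (simp add: field_simps)
  also have "\<dots> = 2 * of_real pi * \<i> * (psi n * f n - psi n * gain_op f n)"
  proof -
    have g: "c * (p * u - p * v) + p * S = c * (p * u - p * (v - 1 / c * S))" if "c \<noteq> 0" for c p u v S :: complex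
      using that by (simp add: field_simps)
    show ?thesis unfolding gain_op_def by (rule g) simp
  qed
  finally show ?thesis .
qed

context haar_unipotent
begin

lemma hgauge_decay:
  "\<exists>Q1>0. integrable dn (\<lambda>n. entry_norm n powr - Q1) \<and> (\<exists>Q2>0. \<exists>B\<ge>0. \<forall>n\<in>unipotent_upper.
     hgauge (n :: real^'n::_^'n::{finite,wellorder}) powr - Q2 \<le> B * entry_norm n powr - Q1)"
proof -
  obtain Q1 where Q1: "0 < Q1" "integrable dn (\<lambda>n. entry_norm n powr - Q1)" using integrable_entry_norm by blast
  obtain C where C: "1 \<le> C" "\<And>n :: real^'n::_^'n::{finite,wellorder}. n \<in> unipotent_upper \<Longrightarrow> entry_norm n \<le> C * hgauge n powr real CARD('n)"
    using entry_norm_le_gauge by blast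
  have "hgauge n powr - (real CARD('n) * Q1) \<le> C powr Q1 * entry_norm n powr - Q1" if "n \<in> unipotent_upper" for n :: "real^'n::_^'n::{finite,wellorder}"
  proof -
    have "entry_norm n / C \<le> hgauge n powr real CARD('n)" using C(1) C(2)[OF that] by (simp add: divide_le_eq mult.commute)
    then have "(hgauge n powr real CARD('n)) powr - Q1 \<le> (entry_norm n / C) powr - Q1"
      using Q1(1) C(1) entry_norm_ge1[of n] by (intro powr_mono2') auto
    also have "\<dots> = C powr Q1 * entry_norm n powr - Q1"
      using C(1) entry_norm_ge1[of n] by (simp add: powr_divide powr_minus field_simps)
    finally show ?thesis by (simp add: powr_powr)
  qed
  then have B: "\<exists>B\<ge>0. \<forall>n\<in>unipotent_upper. hgauge (n :: real^'n::_^'n::{finite,wellorder}) powr - (real CARD('n) * Q1) \<le> B * entry_norm n powr - Q1"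
    by (intro exI[of _ "C powr Q1"]) simp
  have "0 < real CARD('n) * Q1" using Q1 by auto
  with B have "\<exists>Q2>0. \<exists>B\<ge>0. \<forall>n\<in>unipotent_upper. hgauge (n :: real^'n::_^'n::{finite,wellorder}) powr - Q2 \<le> B * entry_norm n powr - Q1"
    by (rule_tac exI[of _ "real CARD('n) * Q1"]) (rule conjI)
  then have "0 < Q1 \<and> integrable dn (\<lambda>n. entry_norm n powr - Q1) \<and> (\<exists>Q2>0. \<exists>B\<ge>0. \<forall>n\<in>unipotent_upper.
     hgauge (n :: real^'n::_^'n::{finite,wellorder}) powr - Q2 \<le> B * entry_norm n powr - Q1)"
    using Q1 by (simp only: simp_thms)
  then show ?thesis by (rule exI)
qed

text \<open>The loss \<open>2 r\<close> pays for the frame coefficients and the additional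
  \<open>1\<close> for the derivative of \<open>\<psi>\<close>, which is not a symbol of order
  \<open>0\<close>.\<close>

theorem integral_psi_gain_op:
  "\<exists>Q>0. \<forall>f C. sym.bounded_by 1 (\<lambda>n. C * hgauge n powr - Q) f \<longrightarrow>
     integrable dn (\<lambda>n. psi n * f n) \<and> integrable dn (\<lambda>n. psi n * gain_op f n) \<and>
     (LINT n|dn. psi n * f n) = (LINT n|dn. psi n * gain_op f n)"
proof -
  obtain Q1 Q2 B where Q1: "0 < Q1" "integrable dn (\<lambda>n. entry_norm n powr - Q1)" and Q2: "0 < Q2" "0 \<le> B"
      "\<And>n :: real^'n::_^'n::{finite,wellorder}. n \<in> unipotent_upper \<Longrightarrow> hgauge n powr - Q2 \<le> B * entry_norm n powr - Q1"
    using hgauge_decay by blast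
  let ?K = "real CARD('n)"
  let ?Q = "2 * ?K + 1 + Q2"
  have "integrable dn (\<lambda>n. psi n * f n) \<and> integrable dn (\<lambda>n. psi n * gain_op f n) \<and>
     (LINT n|dn. psi n * f n) = (LINT n|dn. psi n * gain_op f n)"
    if f: "sym.bounded_by 1 (\<lambda>n. C * hgauge n powr - ?Q) f" for f C
  proof -
    note smf = sym.bounded_by_smooth[OF f]
    have C0: "0 \<le> C"
    proof -
      have "mat 1 \<in> (unipotent_upper :: (real^'n::_^'n::{finite,wellorder}) set)" by (auto simp: unipotent_upper_def mat_def)
      from sym.bounded_by_nonneg[OF f this] show ?thesis
        using hgauge_pos[of "mat 1 :: real^'n::_^'n::{finite,wellorder}"] by (simp add: zero_le_mult_iff powr_eq_0_iff)
    qed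
    let ?F = "\<lambda>cd ab x. frame_coeff cd ab x * (psi x * (multiplier cd x * f x))"
    have bF: "\<exists>A\<ge>0. sym.bounded_by 1 (\<lambda>n. A * hgauge n powr - Q2) (?F cd ab)" for cd ab
    proof -
      have "symbol (2 * ?K) (frame_coeff cd ab)"
      proof (rule symbol_mono)
        show "symbol (real (pos (fst cd)) - real (pos (snd cd)) + height (fst ab) (snd ab)) (frame_coeff cd ab)"
          using symbol1_frame_coeff[of ab cd] unfolding symbol1_def by (rule conjunct1)
        show "real (pos (fst cd)) - real (pos (snd cd)) + height (fst ab) (snd ab) \<le> 2 * ?K"
          using pos_lt_card[of "fst cd"] pos_lt_card[of "snd ab"] by (simp add: height_def)
      qed
      then obtain A1 where A1: "0 \<le> A1" "sym.bounded_by 1 (\<lambda>n. A1 * hgauge n powr (2 * ?K)) (frame_coeff cd ab)" by (rule symbE)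
      have "symbol 0 (multiplier cd)" by (rule symbol_mono[OF symbol_multiplier]) simp
      then obtain A2 where A2: "0 \<le> A2" "sym.bounded_by 1 (\<lambda>n. A2 * hgauge n powr 0) (multiplier cd)" by (rule symbE)
      let ?A = "2 * (A1 * (2 * (2 * pi * (2 * (A2 * C)))))"
      have "sym.bounded_by 1 (\<lambda>n. ?A * hgauge n powr - Q2) (?F cd ab)"
      proof (rule sym.bounded_by_mono[OF sym.bounded_by_mult[OF A1(2) sym.bounded_by_mult[OF bounded_by_psi sym.bounded_by_mult[OF A2(2) f]]]])
        fix n :: "real^'n::_^'n::{finite,wellorder}"
        have "hgauge n powr (2 * ?K) * (hgauge n powr 1 * (hgauge n powr 0 * hgauge n powr - ?Q)) = hgauge n powr - Q2"
          by (simp only: powr_add[symmetric]) simp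
        then show "2 ^ 1 * (A1 * hgauge n powr (2 * ?K) * (2 ^ 1 * (2 * pi * hgauge n powr 1 * (2 ^ 1 * (A2 * hgauge n powr 0 * (C * hgauge n powr - ?Q))))))
           \<le> ?A * hgauge n powr - Q2"
          by (simp only: power_one_right) (simp only: mult_ac order_refl)
      qed
      then show ?thesis using A1(1) A2(1) C0 by (intro exI[of _ ?A]) auto
    qed
    have X: "(LINT n|dn. vf_deriv (left_field ab) (?F cd ab) n) = 0 \<and> integrable dn (vf_deriv (left_field ab) (?F cd ab))"
      if ab: "ab \<in> upper_pairs" for cd ab
    proof -
      obtain A where A: "0 \<le> A" "sym.bounded_by 1 (\<lambda>n. A * hgauge n powr - Q2) (?F cd ab)" using bF by blast
      have ab': "fst ab < snd ab" using ab by (auto simp: upper_pairs_def)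
      have l0: "level ab = 0" using pos_less[OF ab'] by (simp add: level_def)
      have le: "z \<le> A * B * entry_norm n powr - Q1" if "n \<in> unipotent_upper" "z \<le> A * hgauge n powr - Q2"
        for z and n :: "real^'n::_^'n::{finite,wellorder}"
        using that(2) mult_left_mono[OF Q2(3)[OF that(1)] A(1)] by (simp add: mult.assoc)
      have b1: "norm (?F cd ab n) \<le> A * B * entry_norm n powr - Q1" if "n \<in> unipotent_upper" for n
        by (rule le[OF that sym.bounded_by_le[OF A(2) that]])
      have b2: "norm (vf_deriv (left_field (fst ab, snd ab)) (?F cd ab) n) \<le> A * B * entry_norm n powr - Q1" if n: "n \<in> unipotent_upper" for n
      proof (rule le[OF n])
        have "norm (vf_deriv (borel_field ab) (?F cd ab) n) \<le> A * hgauge n powr - Q2 * hgauge n ^ level ab"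
          using sym.bounded_by_le[OF sym.bounded_by_field[OF A(2)[unfolded One_nat_def]] n] .
        moreover have "vf_deriv (borel_field ab) (?F cd ab) n = vf_deriv (left_field ab) (?F cd ab) n"
          by (simp add: vf_deriv_def borel_field_left_field[OF n ab])
        ultimately show "norm (vf_deriv (left_field (fst ab, snd ab)) (?F cd ab) n) \<le> A * hgauge n powr - Q2" by (simp add: l0)
      qed
      show ?thesis
        using integral_left_field_zero[OF ab' Q1 sym.bounded_by_smooth[OF A(2)] b1 b2] by simp
    qed
    have ipf: "integrable dn (\<lambda>n. psi n * f n)"
    proof (rule integrable_bound_entry_norm[OF Q1(2)])
      show "smooth_on GL (\<lambda>n. psi n * f n)" by (intro smooth_on_mult open_GL smf smooth_on_psi)
      fix n :: "real^'n::_^'n::{finite,wellorder}" assume n: "n \<in> unipotent_upper"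
      have "norm (psi n * f n) \<le> C * hgauge n powr - ?Q" using sym.bounded_by_le[OF f n] by (simp add: norm_mult norm_psi)
      also have "\<dots> \<le> C * hgauge n powr - Q2" using C0 by (intro mult_left_mono hgauge_powr_mono) auto
      also have "\<dots> \<le> C * (B * entry_norm n powr - Q1)" by (intro mult_left_mono Q2(3)[OF n] C0)
      finally show "norm (psi n * f n) \<le> C * B * entry_norm n powr - Q1" by (simp add: mult.assoc)
    qed
    let ?c = "2 * of_real pi * \<i> :: complex"
    let ?D = "\<lambda>n. \<Sum>cd\<in>lower_pairs. \<Sum>ab\<in>upper_pairs. vf_deriv (left_field ab) (?F cd ab) n"
    have iD: "integrable dn ?D" "(LINT n|dn. ?D n) = 0" using X by (auto intro!: Bochner_Integration.integrable_sum)
    have eq: "psi n * gain_op f n = psi n * f n - ?D n / ?c" if "n \<in> space dn" for n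
      using psi_gain_op_divergence[of n f] smf that by (simp add: space_dn field_simps)
    have "integrable dn (\<lambda>n. psi n * f n - ?D n / ?c)" using ipf iD(1) by auto
    then have iL: "integrable dn (\<lambda>n. psi n * gain_op f n)"
      by (subst Bochner_Integration.integrable_cong[OF refl eq])
    have "(LINT n|dn. psi n * gain_op f n) = (LINT n|dn. psi n * f n - ?D n / ?c)"
      by (rule Bochner_Integration.integral_cong[OF refl eq])
    also have "\<dots> = (LINT n|dn. psi n * f n)"
      using ipf iD by (subst Bochner_Integration.integral_diff) auto
    finally show ?thesis using ipf iL by simp
  qed
  moreover have "0 < ?Q" using Q2(1) by (simp add: add_pos_pos)
  ultimately show ?thesis by blast
qed

end

section \<open>Size of principal series functions on the unipotent group\<close>

text \<open>Hadamard's inequality in the only case needed.\<close>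

lemma abs_det_le_1:
  fixes g :: "real^'n::_^'n::{finite,wellorder}"
  assumes "\<And>i. norm (g $ i) \<le> 1" shows "\<bar>det g\<bar> \<le> 1"
proof (cases "transpose g \<in> GL")
  case True
  let ?g = "transpose g"
  have "det ?g = det (orth_part ?g) * det (borel_part ?g)" using orth_part_borel_part[OF True] by (metis det_mul)
  moreover have "\<bar>det (orth_part ?g)\<bar> = 1"
    using orth_part_orthogonal[OF True] det_orthogonal_matrix[of "orth_part ?g"] by (auto simp: orthogonal_group_def)
  moreover have "det (borel_part ?g) = (\<Prod>j\<in>UNIV. torus_part ?g j)"
    by (subst det_lowerdiagonal) (use borel_part_lower[OF True] in \<open>auto simp: lower_borel_def\<close>)
  moreover have "torus_part ?g j \<le> 1" for j
  proof -
    have "torus_part ?g j \<le> norm (gram_schmidt ?g j) * norm (column j ?g)"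
      unfolding column_inner_gram_schmidt(2)[OF True, symmetric] by (rule norm_cauchy_schwarz)
    also have "norm (gram_schmidt ?g j) = 1" using gram_schmidt_orthonormal[OF True, of j j] by (simp add: norm_eq_1)
    also have "column j ?g = g $ j" by (simp add: column_def transpose_def vec_eq_iff)
    finally show ?thesis using assms[of j] by simp
  qed
  moreover have "0 \<le> torus_part ?g j" for j using torus_part_pos[OF True, of j] by simp
  ultimately have "\<bar>det ?g\<bar> \<le> 1" by (simp add: abs_mult prod_le_1 prod_nonneg)
  then show ?thesis by (simp add: det_transpose)
qed (simp add: GL_iff_det det_transpose)

text \<open>For \<open>n = k b\<close> the entry \<open>n\<^sub>i\<^sub>j\<close> is the minor of
  \<open>n\<close> with the columns \<open>j, j + 1, \<dots>\<close> and the rows \<open>i, j + 1, j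
  + 2, \<dots>\<close>. As \<open>b\<close> is lower triangular, this minor is the product of the
  corresponding minor of the orthogonal matrix \<open>k\<close>, at most \<open>1\<close> in
  absolute value, and the lower right minor of \<open>b\<close>.\<close>

lemma entry_le_prod_torus_part:
  fixes n :: "real^'n::_^'n::{finite,wellorder}"
  assumes n: "n \<in> unipotent_upper"
  shows "\<bar>n $ i $ j\<bar> \<le> (\<Prod>l\<in>{j..}. torus_part n l)"
proof -
  note nG = unipotent_GL[OF n]
  define ro where "ro l = (if l = j then i else l)" for l
  \<comment> \<open>The minor as a determinant of full size: rows and columns before
    \<open>j\<close> are those of the identity matrix, and row \<open>j\<close> is replaced by row
    \<open>i\<close>.\<close>
  define cut where "cut x = (\<chi> l m. if l < j then (if l = m then 1 else 0) else if m < j then 0 else x $ ro l $ m)"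
    for x :: "real^'n::_^'n::{finite,wellorder}"
  define low where "low = (\<chi> l m. if l < j \<or> m < j then (if l = m then 1 else 0) else borel_part n $ l $ m)"
  have bl: "borel_part n $ l $ m = 0" if "l < m" for l m
    using borel_part_lower(1)[OF nG] that by (auto simp: lower_borel_def)
  have "cut n $ l $ m = (cut (orth_part n) ** low) $ l $ m" for l m
  proof (cases "l < j")
    case True
    have "(cut (orth_part n) ** low) $ l $ m = (\<Sum>p\<in>UNIV. if l = p then low $ p $ m else 0)"
      unfolding matrix_matrix_mult_def vec_lambda_beta by (rule sum.cong) (use True in \<open>auto simp: cut_def\<close>)
    then show ?thesis using True by (simp add: cut_def low_def)
  next
    case lj: False
    show ?thesis
    proof (cases "m < j")
      case True
      have "(cut (orth_part n) ** low) $ l $ m = 0"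
        unfolding matrix_matrix_mult_def vec_lambda_beta by (rule sum.neutral) (use lj True in \<open>auto simp: cut_def low_def\<close>)
      then show ?thesis using True lj by (simp add: cut_def)
    next
      case False
      have "n $ ro l $ m = (\<Sum>p\<in>UNIV. orth_part n $ ro l $ p * borel_part n $ p $ m)"
        using arg_cong[OF orth_part_borel_part[OF nG], of "\<lambda>A. A $ ro l $ m"] by (simp add: matrix_matrix_mult_def)
      also have "\<dots> = (cut (orth_part n) ** low) $ l $ m"
        unfolding matrix_matrix_mult_def vec_lambda_beta
        by (rule sum.cong) (use lj False bl in \<open>auto simp: cut_def low_def not_less\<close>)
      finally show ?thesis using lj False by (simp add: cut_def)
    qed
  qed
  then have "cut n = cut (orth_part n) ** low" by (simp only: vec_eq_iff) blast
  then have "det (cut n) = det (cut (orth_part n)) * det low" by (simp only: det_mul)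
  moreover have "det (cut n) = n $ i $ j"
  proof -
    have "det (cut n) = (\<Prod>l\<in>UNIV. cut n $ l $ l)"
      by (rule det_upperdiagonal) (use unipotent_upperD(2)[OF n] in \<open>auto simp: cut_def ro_def\<close>)
    also have "\<dots> = (\<Prod>l\<in>UNIV. if l = j then n $ i $ j else 1)"
      by (rule prod.cong) (use unipotent_upperD(1)[OF n] in \<open>auto simp: cut_def ro_def\<close>)
    finally show ?thesis by simp
  qed
  moreover have "det low = (\<Prod>l\<in>{j..}. torus_part n l)"
  proof -
    have "det low = (\<Prod>l\<in>UNIV. low $ l $ l)"
      by (rule det_lowerdiagonal) (use bl in \<open>auto simp: low_def\<close>)
    also have "\<dots> = (\<Prod>l\<in>{j..}. torus_part n l)"
      by (rule prod.mono_neutral_cong_right) (auto simp: low_def borel_part_lower(2)[OF nG] not_le)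
    finally show ?thesis .
  qed
  moreover have "\<bar>det (cut (orth_part n))\<bar> \<le> 1"
  proof (rule abs_det_le_1)
    fix l
    have "transpose (orth_part n) \<in> orthogonal_group"
      using orth_part_orthogonal[OF nG] by (simp add: orthogonal_group_def orthogonal_matrix_transpose)
    then have "orth_part n ** transpose (orth_part n) = mat 1"
      by (simp add: orthogonal_group_def orthogonal_matrix_def transpose_transpose)
    then have k1: "(\<Sum>m\<in>UNIV. (orth_part n $ p $ m)\<^sup>2) = 1" for p
      by (drule_tac arg_cong[of _ _ "\<lambda>A. A $ p $ p"]) (simp add: matrix_matrix_mult_def transpose_def mat_def power2_eq_square)
    have "(\<Sum>m\<in>UNIV. (cut (orth_part n) $ l $ m)\<^sup>2) \<le> 1"
    proof (cases "l < j")
      case True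
      have "(\<Sum>m\<in>UNIV. (cut (orth_part n) $ l $ m)\<^sup>2) = (\<Sum>m\<in>UNIV. if l = m then 1 else 0)"
        by (rule sum.cong) (use True in \<open>auto simp: cut_def\<close>)
      then show ?thesis by simp
    next
      case False
      have "(\<Sum>m\<in>UNIV. (cut (orth_part n) $ l $ m)\<^sup>2) \<le> (\<Sum>m\<in>UNIV. (orth_part n $ ro l $ m)\<^sup>2)"
        by (rule sum_mono) (use False in \<open>auto simp: cut_def\<close>)
      then show ?thesis by (simp add: k1)
    qed
    then show "norm (cut (orth_part n) $ l) \<le> 1"
      by (simp add: norm_vec_def L2_set_def)
  qed
  moreover have "0 \<le> (\<Prod>l\<in>{j..}. torus_part n l)" by (intro prod_nonneg) (auto intro: less_imp_le torus_part_pos nG)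
  ultimately show ?thesis by (simp add: abs_mult mult_left_le_one_le)
qed

lemma prod_torus_part_ge1: "n \<in> unipotent_upper \<Longrightarrow> 1 \<le> (\<Prod>l\<in>{j..}. torus_part n l)"
  using entry_le_prod_torus_part[of n j j] by (simp add: unipotent_upperD(1))

lemma torus_part_le_entry_norm:
  assumes "g \<in> GL" shows "torus_part g j \<le> entry_norm g"
proof -
  have "torus_part g j \<le> norm (gram_schmidt g j) * norm (column j g)"
    unfolding column_inner_gram_schmidt(2)[OF assms, symmetric] by (rule norm_cauchy_schwarz)
  also have "norm (gram_schmidt g j) = 1" using gram_schmidt_orthonormal[OF assms, of j j] by (simp add: norm_eq_1)
  also have "norm (column j g) \<le> (\<Sum>i\<in>UNIV. \<bar>g $ i $ j\<bar>)"
    using norm_le_l1_cart[of "column j g"] by (simp add: column_def)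
  also have "\<dots> \<le> (\<Sum>i\<in>UNIV. \<Sum>j\<in>UNIV. \<bar>g $ i $ j\<bar>)"
    by (intro sum_mono member_le_sum) auto
  finally show ?thesis by (simp add: entry_norm_def)
qed

text \<open>The upper bound is clear. For the lower bound, the products over the final segments are
  at least \<open>1\<close>, by the preceding estimate at a diagonal entry.\<close>

lemma abs_ln_torus_part_le:
  fixes n :: "real^'n::_^'n::{finite,wellorder}"
  assumes n: "n \<in> unipotent_upper"
  shows "\<bar>ln (torus_part n j)\<bar> \<le> real CARD('n) * ln (entry_norm n)"
proof -
  note nG = unipotent_GL[OF n]
  have tp: "0 < torus_part n l" for l by (rule torus_part_pos[OF nG])
  have lb: "0 \<le> ln (entry_norm n)" using entry_norm_ge1[of n] by simp
  have up: "ln (torus_part n l) \<le> ln (entry_norm n)" for l using torus_part_le_entry_norm[OF nG, of l] tp[of l] entry_norm_ge1[of n] by simp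
  have "1 \<le> real CARD('n)" by (simp add: Suc_leI)
  then have "ln (entry_norm n) \<le> real CARD('n) * ln (entry_norm n)" using lb by (simp add: mult_le_cancel_right1)
  moreover have "- ln (torus_part n j) \<le> real CARD('n) * ln (entry_norm n)"
  proof -
    have "0 \<le> ln (\<Prod>l\<in>{j..}. torus_part n l)" using prod_torus_part_ge1[OF n, of j] by simp
    also have "\<dots> = (\<Sum>l\<in>{j..}. ln (torus_part n l))" by (rule ln_prod) (use tp in \<open>auto simp: less_imp_neq[symmetric]\<close>)
    also have "{j..} = insert j {j<..}" by auto
    finally have "- ln (torus_part n j) \<le> (\<Sum>l\<in>{j<..}. ln (torus_part n l))" by simp
    also have "\<dots> \<le> (\<Sum>l\<in>{j<..}. ln (entry_norm n))" by (intro sum_mono up)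
    also have "\<dots> \<le> real CARD('n) * ln (entry_norm n)"
      using lb card_mono[of UNIV "{j<..}"] by (auto intro!: mult_right_mono)
    finally show ?thesis .
  qed
  ultimately show ?thesis using up[of j] by linarith
qed

definition param_norm :: "complex^'n::{finite,wellorder} \<Rightarrow> real" where "param_norm lam = (\<Sum>j\<in>UNIV. norm (shifted lam j))"

lemma norm_torus_char: "norm (torus_char lam g) = exp (\<Sum>j\<in>UNIV. Re (shifted lam j) * ln (torus_part g j))"
  unfolding torus_char_def norm_exp_eq_Re by simp

lemma norm_torus_char_le:
  fixes n :: "real^'n::_^'n::{finite,wellorder}"
  assumes n: "n \<in> unipotent_upper"
  shows "norm (torus_char lam n) \<le> entry_norm n powr (real CARD('n) * param_norm lam)"
proof -
  have "Re (shifted lam j) * ln (torus_part n j) \<le> norm (shifted lam j) * (real CARD('n) * ln (entry_norm n))" for j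
  proof -
    have "Re (shifted lam j) * ln (torus_part n j) \<le> \<bar>Re (shifted lam j)\<bar> * \<bar>ln (torus_part n j)\<bar>" by (metis abs_ge_self abs_mult)
    also have "\<dots> \<le> norm (shifted lam j) * (real CARD('n) * ln (entry_norm n))"
      by (intro mult_mono abs_Re_le_cmod abs_ln_torus_part_le n) auto
    finally show ?thesis .
  qed
  then have "(\<Sum>j\<in>UNIV. Re (shifted lam j) * ln (torus_part n j)) \<le> (\<Sum>j\<in>UNIV. norm (shifted lam j) * (real CARD('n) * ln (entry_norm n)))"
    by (rule sum_mono)
  also have "\<dots> = real CARD('n) * param_norm lam * ln (entry_norm n)"
    unfolding param_norm_def sum_distrib_right[symmetric] by simp
  finally show ?thesis unfolding norm_torus_char using entry_norm_ge1[of n] entry_norm_nz[of n] by (simp add: powr_def)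
qed

text \<open>The parameter at which the exponents of the Iwasawa character are \<open>- S, - 2 S,
  \<dots>, - r S\<close>: the character is then the power \<open>- S\<close> of the product of all
  final products of the \<open>torus_part n l\<close>, each of which is at least
  \<open>1\<close>.\<close>

definition far_param :: "real \<Rightarrow> complex^'n::{finite,wellorder}" where
  "far_param S = (\<chi> j. - of_real (S * (real (pos j) + 1)) - rho $ j)"

text \<open>Every entry of \<open>n\<close> is bounded by one of the final products, so the
  character at \<open>far_param S\<close> decays like the power \<open>- S\<close> of
  \<open>entry_norm\<close>. A perturbation of the parameter by at most \<open>1\<close> loses the
  power \<open>r\<^sup>2\<close>.\<close>

lemma norm_torus_char_far:
  fixes n :: "real^'n::_^'n::{finite,wellorder}"
  assumes n: "n \<in> unipotent_upper" and S: "0 \<le> S" and lam: "lam \<in> ball (far_param S) 1"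
  shows "norm (torus_char lam n) \<le> (1 + real CARD('n) * real CARD('n)) powr S * entry_norm n powr (real CARD('n) * real CARD('n) - S)"
proof -
  let ?K = "real CARD('n)"
  note nG = unipotent_GL[OF n]
  have tp: "0 < torus_part n l" for l by (rule torus_part_pos[OF nG])
  define G where "G i = (\<Prod>l\<in>{i..}. torus_part n l)" for i
  have G1: "1 \<le> G i" for i unfolding G_def by (rule prod_torus_part_ge1[OF n])
  have G0: "0 < G i" for i using G1[of i] by linarith
  have KK: "0 < 1 + ?K * ?K" by (intro add_pos_nonneg) auto
  have eta: "\<bar>Re (shifted lam j) + S * (real (pos j) + 1)\<bar> \<le> 1" for j
  proof -
    have "shifted lam j + of_real (S * (real (pos j) + 1)) = (lam - far_param S) $ j"
      by (simp add: shifted_def far_param_def)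
    then have "norm (shifted lam j + of_real (S * (real (pos j) + 1))) \<le> norm (lam - far_param S)"
      using Finite_Cartesian_Product.norm_nth_le[of "lam - far_param S" j] by simp
    also have "\<dots> \<le> 1" using lam by (simp add: dist_norm norm_minus_commute)
    finally have "\<bar>Re (shifted lam j + of_real (S * (real (pos j) + 1)))\<bar> \<le> 1"
      by (rule order_trans[OF abs_Re_le_cmod])
    then show ?thesis by simp
  qed
  have lnG: "(\<Sum>i\<in>UNIV. ln (G i)) = (\<Sum>j\<in>UNIV. (real (pos j) + 1) * ln (torus_part n j))"
  proof -
    have "ln (G i) = (\<Sum>j\<in>UNIV. if i \<le> j then ln (torus_part n j) else 0)" for i
    proof -
      have "ln (G i) = (\<Sum>j\<in>{i..}. ln (torus_part n j))" unfolding G_def by (rule ln_prod) (use tp in \<open>auto simp: less_imp_neq[symmetric]\<close>)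
      also have "\<dots> = (\<Sum>j\<in>UNIV. if i \<le> j then ln (torus_part n j) else 0)"
        by (rule sum.mono_neutral_cong_left) auto
      finally show ?thesis .
    qed
    then have 1: "(\<Sum>i\<in>UNIV. ln (G i)) = (\<Sum>j\<in>UNIV. \<Sum>i\<in>UNIV. if i \<le> j then ln (torus_part n j) else 0)"
      by (simp only:) (rule sum.swap)
    have 2: "(\<Sum>i\<in>UNIV. if i \<le> j then ln (torus_part n j) else 0) = (real (pos j) + 1) * ln (torus_part n j)" for j
    proof -
      have "(\<Sum>i\<in>UNIV. if i \<le> j then ln (torus_part n j) else 0) = (\<Sum>i\<in>{..j}. ln (torus_part n j))"
        by (rule sum.mono_neutral_cong_right) auto
      moreover have "{..j} = insert j {..<j}" by auto
      ultimately show ?thesis by (simp add: pos_def)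
    qed
    have "(\<Sum>j\<in>UNIV. \<Sum>i\<in>UNIV. if i \<le> j then ln (torus_part n j) else 0) = (\<Sum>j\<in>UNIV. (real (pos j) + 1) * ln (torus_part n j))"
      by (intro sum.cong refl 2)
    with 1 show ?thesis by (rule trans)
  qed
  have bnP: "ln (entry_norm n) \<le> ln (1 + ?K * ?K) + (\<Sum>i\<in>UNIV. ln (G i))"
  proof -
    let ?P = "\<Prod>i\<in>UNIV. G i"
    have GP: "G j \<le> ?P" for j
    proof -
      have "?P = G j * (\<Prod>i\<in>UNIV - {j}. G i)" by (rule prod.remove) auto
      moreover have "1 \<le> (\<Prod>i\<in>UNIV - {j}. G i)" by (intro prod_ge_1 G1)
      ultimately have "G j * 1 \<le> ?P" using G0[of j] by (simp only:) (intro mult_left_mono, auto)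
      then show ?thesis by simp
    qed
    have P1: "1 \<le> ?P" by (intro prod_ge_1 G1)
    have "\<bar>n $ i $ j\<bar> \<le> ?P" for i j
      using entry_le_prod_torus_part[OF n, of i j] GP[of j] unfolding G_def by linarith
    then have "entry_norm n \<le> 1 + (\<Sum>i\<in>(UNIV::'n set). \<Sum>j\<in>(UNIV::'n set). ?P)"
      unfolding entry_norm_def by (intro add_left_mono sum_mono)
    also have "\<dots> \<le> (1 + ?K * ?K) * ?P" using P1 by (simp add: distrib_right mult.assoc)
    finally have "ln (entry_norm n) \<le> ln ((1 + ?K * ?K) * ?P)" using entry_norm_ge1[of n] by (intro ln_mono) auto
    also have "\<dots> = ln (1 + ?K * ?K) + ln ?P"
    proof (rule ln_mult_pos[OF KK])
      show "0 < ?P" using P1 by linarith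
    qed
    also have "ln ?P = (\<Sum>i\<in>UNIV. ln (G i))"
      by (rule ln_prod) (use G0 in \<open>auto simp: less_imp_neq[symmetric]\<close>)
    finally show ?thesis .
  qed
  have "(\<Sum>j\<in>UNIV. Re (shifted lam j) * ln (torus_part n j)) =
      (\<Sum>j\<in>UNIV. (Re (shifted lam j) + S * (real (pos j) + 1)) * ln (torus_part n j)) - S * (\<Sum>i\<in>UNIV. ln (G i))"
    unfolding lnG sum_distrib_left sum_subtractf[symmetric] by (rule sum.cong) (auto simp: algebra_simps)
  also have "\<dots> \<le> (\<Sum>j\<in>(UNIV::'n set). ?K * ln (entry_norm n)) - S * (ln (entry_norm n) - ln (1 + ?K * ?K))"
  proof (intro diff_mono sum_mono)
    fix j
    have "(Re (shifted lam j) + S * (real (pos j) + 1)) * ln (torus_part n j) \<le> \<bar>Re (shifted lam j) + S * (real (pos j) + 1)\<bar> * \<bar>ln (torus_part n j)\<bar>"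
      by (metis abs_ge_self abs_mult)
    also have "\<dots> \<le> 1 * (?K * ln (entry_norm n))" by (intro mult_mono eta abs_ln_torus_part_le n) auto
    finally show "(Re (shifted lam j) + S * (real (pos j) + 1)) * ln (torus_part n j) \<le> ?K * ln (entry_norm n)" by simp
    show "S * (ln (entry_norm n) - ln (1 + ?K * ?K)) \<le> S * (\<Sum>i\<in>UNIV. ln (G i))"
      using bnP S by (intro mult_left_mono) auto
  qed
  also have "\<dots> = S * ln (1 + ?K * ?K) + (?K * ?K - S) * ln (entry_norm n)" by (simp add: algebra_simps)
  finally have "norm (torus_char lam n) \<le> exp (S * ln (1 + ?K * ?K) + (?K * ?K - S) * ln (entry_norm n))"
    unfolding norm_torus_char by simp
  moreover have "1 + ?K * ?K \<noteq> 0" using KK by linarith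
  ultimately show ?thesis using entry_norm_nz[of n] by (simp add: powr_def exp_add)
qed

subsection \<open>Derivatives of equivariant functions\<close>

text \<open>The part of the equivariance that does not involve \<open>\<delta>\<close>. Unlike
  \<open>principal_series\<close> it does not prescribe the values outside of the group, so that it
  is inherited by derivatives along \<open>left_field\<close>.\<close>

definition pos_equivariant :: "complex^'n::{finite,wellorder} \<Rightarrow> (real^'n::_^'n::{finite,wellorder} \<Rightarrow> complex) \<Rightarrow> bool" where
  "pos_equivariant lam f \<longleftrightarrow> smooth_on GL f \<and> (\<forall>g\<in>GL. \<forall>b\<in>lower_borel. (\<forall>j. 0 < b $ j $ j) \<longrightarrow>
     f (g ** b) = exp (\<Sum>j\<in>UNIV. shifted lam j * complex_of_real (ln (b $ j $ j))) * f g)"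

lemma pos_equivariant_principal_series: "f \<in> principal_series (- lam) \<delta> \<Longrightarrow> pos_equivariant lam f"
  unfolding pos_equivariant_def using principal_series_pos[of f lam \<delta>]
  by (auto simp: principal_series_def smooth_functions_def)

lemma pos_equivariant_iwasawa:
  assumes f: "pos_equivariant lam f" and g: "g \<in> GL"
  shows "f g = torus_char lam g * f (orth_part g)"
proof -
  have "orth_part g \<in> GL" using orth_part_orthogonal[OF g] orthogonal_GL by blast
  then have "f (orth_part g ** borel_part g) = exp (\<Sum>j\<in>UNIV. shifted lam j * complex_of_real (ln (borel_part g $ j $ j))) * f (orth_part g)"
    using f borel_part_lower(1,3)[OF g] unfolding pos_equivariant_def by blast
  then show ?thesis by (simp add: orth_part_borel_part[OF g] torus_char_def borel_part_lower(2)[OF g])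
qed

lemma smooth_on_left_field: "smooth_on \<Omega> (\<lambda>x. complex_of_real (left_field ab x $ i $ j))"
  unfolding left_field_entry by (cases "i = fst ab") (auto simp: smooth_on_const intro: smooth_on_entry[unfolded entry_def[abs_def]])

lemma bounded_linear_matrix_mult:
  "bounded_linear (\<lambda>x::real^'n^'n. x ** b)" "bounded_linear (\<lambda>x::real^'n^'n. b ** x)"
  unfolding linear_conv_bounded_linear[symmetric]
  by (auto intro!: linearI simp: vec_eq_iff matrix_matrix_mult_def sum.distrib sum_distrib_left algebra_simps)

lemma pos_equivariant_left_field:
  assumes f: "pos_equivariant lam f"
  shows "pos_equivariant lam (vf_deriv (left_field ab) f)"
proof -
  have smf: "smooth_on GL f" using f by (simp add: pos_equivariant_def)
  have "vf_deriv (left_field ab) f (g ** b) = exp (\<Sum>j\<in>UNIV. shifted lam j * complex_of_real (ln (b $ j $ j))) * vf_deriv (left_field ab) f g"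
    (is "_ = ?e * _") if g: "g \<in> GL" and b: "b \<in> lower_borel" "\<forall>j. 0 < b $ j $ j" for g b
  proof -
    have gb: "g ** b \<in> GL" using g b(1) mult_GL by (auto simp: lower_borel_def)
    have 1: "((\<lambda>x. f (x ** b)) has_derivative (\<lambda>v. vf_deriv (\<lambda>_. v ** b) f (g ** b))) (at g)"
      using diff_chain_at[OF bounded_linear_imp_has_derivative[OF bounded_linear_matrix_mult(1)[of b]]
          has_derivative_vf_deriv[OF smooth_on_imp_differentiable[OF smf gb]]] by (simp add: o_def)
    have "((\<lambda>x. ?e * f x) has_derivative (\<lambda>v. ?e * vf_deriv (\<lambda>_. v) f g)) (at g)"
      by (rule has_derivative_mult_right[OF has_derivative_vf_deriv[OF smooth_on_imp_differentiable[OF smf g]]])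
    then have 2: "((\<lambda>x. f (x ** b)) has_derivative (\<lambda>v. ?e * vf_deriv (\<lambda>_. v) f g)) (at g)"
      by (rule has_derivative_transform_within_open[OF _ open_GL g]) (use f b in \<open>simp add: pos_equivariant_def\<close>)
    have "vf_deriv (\<lambda>_. left_field ab g ** b) f (g ** b) = ?e * vf_deriv (\<lambda>_. left_field ab g) f g"
      using fun_cong[OF has_derivative_unique[OF 1 2], of "left_field ab g"] .
    moreover have "left_field ab g ** b = left_field ab (g ** b)" by (simp add: left_field_def matrix_mul_assoc)
    ultimately show ?thesis by (simp add: vf_deriv_def)
  qed
  then show ?thesis
    unfolding pos_equivariant_def using smooth_on_vf_deriv_matrix[OF open_GL smf smooth_on_left_field] by blast
qed

text \<open>The differential of the character at the lower triangular part of
  \<open>x\<^sup>-\<^sup>1 E\<^sub>c\<^sub>d x\<close>.\<close>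

definition borel_weight :: "complex^'n::{finite,wellorder} \<Rightarrow> 'n \<times> 'n \<Rightarrow> real^'n::_^'n::{finite,wellorder} \<Rightarrow> complex" where
  "borel_weight lam cd x = (\<Sum>j\<in>UNIV. shifted lam j * (inv_entry j (fst cd) x * entry (snd cd) j x))"

text \<open>Split \<open>x\<^sup>-\<^sup>1 E\<^sub>c\<^sub>d x\<close> into its strictly upper
  triangular part and its lower triangular part \<open>\<beta>\<close>; along \<open>x
  \<beta>\<close> the function is differentiated by equivariance.\<close>

lemma pos_equivariant_borel_field:
  fixes x :: "real^'n::_^'n::{finite,wellorder}"
  assumes f: "pos_equivariant lam f" and x: "x \<in> GL"
  shows "vf_deriv (borel_field cd) f x = vf_deriv (left_field cd) f x - borel_weight lam cd x * f x"
proof -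
  define \<beta> :: "real^'n::_^'n::{finite,wellorder}"
    where "\<beta> = (\<chi> i j. if j \<le> i then matrix_inv x $ i $ fst cd * x $ snd cd $ j else 0)"
  have df: "f differentiable at x" using f x smooth_on_imp_differentiable by (auto simp: pos_equivariant_def)
  have split: "left_field cd x = borel_field cd x + x ** \<beta>"
  proof -
    have "left_field cd x $ i $ j = borel_field cd x $ i $ j + (x ** \<beta>) $ i $ j" for i j
    proof -
      have "left_field cd x $ i $ j = (\<Sum>l\<in>UNIV. x $ i $ l * matrix_inv x $ l $ fst cd) * x $ snd cd $ j"
        using arg_cong[OF matrix_inv_right_left(1)[OF x], of "\<lambda>A. A $ i $ fst cd"]
        by (simp add: left_field_entry matrix_matrix_mult_def mat_def)
      also have "\<dots> = (\<Sum>l\<in>UNIV. (if l < j then x $ i $ l * matrix_inv x $ l $ fst cd * x $ snd cd $ j else 0)) + (\<Sum>l\<in>UNIV. x $ i $ l * \<beta> $ l $ j)"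
        unfolding sum.distrib[symmetric]
        unfolding sum_distrib_right by (rule sum.cong) (auto simp: \<beta>_def)
      also have "(\<Sum>l\<in>UNIV. if l < j then x $ i $ l * matrix_inv x $ l $ fst cd * x $ snd cd $ j else 0) = borel_field cd x $ i $ j"
        unfolding borel_field_def vec_lambda_beta by (rule sum.mono_neutral_cong_right) auto
      finally show ?thesis by (simp add: matrix_matrix_mult_def)
    qed
    then show ?thesis by (simp add: vec_eq_iff)
  qed
  have "vf_deriv (\<lambda>_. x ** \<beta>) f x = (\<Sum>j\<in>UNIV. shifted lam j * complex_of_real (\<beta> $ j $ j)) * f x"
  proof -
    \<comment> \<open>For \<open>\<bar>t\<bar> < 1 / M\<close> the matrix \<open>1 + t
      \<beta>\<close> has a positive diagonal, so that equivariance applies along the line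
      \<open>x (1 + t \<beta>)\<close>.\<close>
    define M where "M = 1 + (\<Sum>j\<in>UNIV. \<bar>\<beta> $ j $ j\<bar>)"
    have M: "0 < M" "\<bar>\<beta> $ j $ j\<bar> < M" for j
    proof -
      show "0 < M" by (simp add: M_def add_pos_nonneg sum_nonneg)
      have "\<bar>\<beta> $ j $ j\<bar> \<le> (\<Sum>j\<in>UNIV. \<bar>\<beta> $ j $ j\<bar>)" by (rule member_le_sum) auto
      then show "\<bar>\<beta> $ j $ j\<bar> < M" by (simp add: M_def)
    qed
    let ?b = "\<lambda>t. mat 1 + t *\<^sub>R \<beta>"
    have pos: "0 < 1 + t * \<beta> $ j $ j" if "\<bar>t\<bar> < 1 / M" for t j
    proof -
      have "\<bar>t * \<beta> $ j $ j\<bar> \<le> \<bar>t\<bar> * M" unfolding abs_mult using M(2)[of j] by (intro mult_left_mono) auto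
      also have "\<dots> < 1" using that M(1) by (simp add: field_simps)
      finally show ?thesis by linarith
    qed
    have lower: "?b t \<in> lower_borel" if "\<bar>t\<bar> < 1 / M" for t
    proof -
      have z: "?b t $ i $ j = 0" if "i < j" for i j
        using that less_imp_neq[OF that] by (simp add: mat_def \<beta>_def not_le)
      have "det (?b t) = (\<Prod>j\<in>UNIV. ?b t $ j $ j)" by (rule det_lowerdiagonal) (rule z)
      also have "\<dots> = (\<Prod>j\<in>UNIV. 1 + t * \<beta> $ j $ j)" by (simp add: mat_def)
      also have "\<dots> \<noteq> 0" using pos[OF that] by (auto simp: prod_zero_iff less_imp_neq[symmetric])
      finally show ?thesis using z by (auto simp: lower_borel_def GL_iff_det)
    qed
    have xb: "x ** ?b t = x + t *\<^sub>R (x ** \<beta>)" for t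
      by (simp add: matrix_add_ldistrib) (simp add: vec_eq_iff matrix_matrix_mult_def sum_distrib_left mult_ac)
    have "((\<lambda>t. x + t *\<^sub>R (x ** \<beta>)) has_derivative (\<lambda>h. h *\<^sub>R (x ** \<beta>))) (at 0)"
      by (auto intro!: derivative_eq_intros)
    from diff_chain_at[OF this, of f "\<lambda>v. vf_deriv (\<lambda>_. v) f x"] has_derivative_vf_deriv[OF df]
    have 1: "((\<lambda>t. f (x + t *\<^sub>R (x ** \<beta>))) has_derivative (\<lambda>h. vf_deriv (\<lambda>_. h *\<^sub>R (x ** \<beta>)) f x)) (at 0)"
      by (simp add: o_def)
    have "((\<lambda>t. exp (\<Sum>j\<in>UNIV. shifted lam j * complex_of_real (ln (1 + t * \<beta> $ j $ j))) * f x) has_derivative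
       (\<lambda>h. h *\<^sub>R ((\<Sum>j\<in>UNIV. shifted lam j * complex_of_real (\<beta> $ j $ j)) * f x))) (at 0)"
    proof -
      have e0: "(exp has_derivative (\<lambda>h. h)) (at (0 :: complex))"
      proof -
        have "(exp has_derivative (*) 1) (at (0 :: complex))"
          using DERIV_exp[of "0 :: complex"] by (simp add: has_field_derivative_def)
        moreover have "(*) 1 = (\<lambda>h :: complex. h)" by (simp add: fun_eq_iff)
        ultimately show ?thesis by simp
      qed
      have l: "((\<lambda>t. complex_of_real (ln (1 + t * \<beta> $ j $ j))) has_derivative (\<lambda>h. complex_of_real (h * \<beta> $ j $ j))) (at 0)" for j
        by (auto intro!: derivative_eq_intros)
      have "((\<lambda>t. \<Sum>j\<in>UNIV. shifted lam j * complex_of_real (ln (1 + t * \<beta> $ j $ j))) has_derivative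
          (\<lambda>h. \<Sum>j\<in>UNIV. shifted lam j * complex_of_real (h * \<beta> $ j $ j))) (at 0)"
        by (intro has_derivative_sum has_derivative_mult_right l)
      from diff_chain_at[OF this, of exp "\<lambda>h. h"]
      have "((\<lambda>t. exp (\<Sum>j\<in>UNIV. shifted lam j * complex_of_real (ln (1 + t * \<beta> $ j $ j)))) has_derivative
          (\<lambda>h. \<Sum>j\<in>UNIV. shifted lam j * complex_of_real (h * \<beta> $ j $ j))) (at 0)"
        using e0 by (simp add: o_def)
      from has_derivative_mult_left[OF this, of "f x"] show ?thesis
        by (simp add: sum_distrib_right sum_distrib_left scaleR_conv_of_real mult_ac)
    qed
    then have 2: "((\<lambda>t. f (x + t *\<^sub>R (x ** \<beta>))) has_derivative
       (\<lambda>h. h *\<^sub>R ((\<Sum>j\<in>UNIV. shifted lam j * complex_of_real (\<beta> $ j $ j)) * f x))) (at 0)"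
    proof (rule has_derivative_transform_within_open[where s = "ball 0 (1 / M)"])
      fix t :: real assume "t \<in> ball 0 (1 / M)"
      then have t: "\<bar>t\<bar> < 1 / M" by simp
      have "f (x ** ?b t) = exp (\<Sum>j\<in>UNIV. shifted lam j * complex_of_real (ln (?b t $ j $ j))) * f x"
        using f x lower[OF t] pos[OF t] unfolding pos_equivariant_def by (auto simp: mat_def)
      then show "exp (\<Sum>j\<in>UNIV. shifted lam j * complex_of_real (ln (1 + t * \<beta> $ j $ j))) * f x = f (x + t *\<^sub>R (x ** \<beta>))"
        unfolding xb by (simp add: mat_def)
    qed (use M(1) in auto)
    from fun_cong[OF has_derivative_unique[OF 1 2], of 1] show ?thesis by simp
  qed
  also have "(\<Sum>j\<in>UNIV. shifted lam j * complex_of_real (\<beta> $ j $ j)) = borel_weight lam cd x"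
    by (simp add: \<beta>_def borel_weight_def inv_entry_def entry_def)
  finally have b: "vf_deriv (\<lambda>_. x ** \<beta>) f x = borel_weight lam cd x * f x" .
  have lin: "linear (frechet_derivative f (at x))" using df by (rule linear_frechet_derivative)
  have "vf_deriv (left_field cd) f x = vf_deriv (borel_field cd) f x + vf_deriv (\<lambda>_. x ** \<beta>) f x"
    unfolding vf_deriv_def split linear_add[OF lin] ..
  then show ?thesis by (simp add: b)
qed

interpretation left: derivation_bounds left_field "\<lambda>_ _. 1" orthogonal_group GL
  by unfold_locales (use orthogonal_GL in \<open>auto intro: open_GL smooth_on_vf_deriv_matrix smooth_on_left_field\<close>)

lemma symbol_borel_weight_coeff:
  "symbol (real (level cd)) (\<lambda>x. inv_entry j (fst cd) x * entry (snd cd) j x)" for cd :: "'n::{finite,wellorder} \<times> 'n"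
  by (rule symbol_mono[OF symbol_mult[OF symbol_inv_entry symbol_entry]]) (simp add: height_def level_def)

text \<open>Derivatives along \<open>borel_field\<close> are traded for those along
  \<open>left_field\<close>, which preserve equivariance and are bounded on \<open>O(r)\<close>, and
  for factors \<open>borel_weight\<close>, which are symbols of order \<open>level\<close> and
  linear in \<open>\<lambda>\<close>.\<close>

lemma pos_equivariant_symbol:
  "\<exists>C\<ge>0. \<forall>lam B. \<forall>f :: real^'n::_^'n::{finite,wellorder} \<Rightarrow> complex. pos_equivariant lam f \<longrightarrow> left.bounded_by k (\<lambda>_. B) f \<longrightarrow>
     sym.bounded_by k (\<lambda>n. C * (1 + param_norm lam) ^ k * B * norm (torus_char lam n)) f"
proof (induction k)
  case 0
  have "norm (f n) \<le> B * norm (torus_char lam n)"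
    if f: "pos_equivariant lam f" and b: "left.bounded_by 0 (\<lambda>_. B) f" and n: "n \<in> unipotent_upper" for lam B n
      and f :: "real^'n::_^'n::{finite,wellorder} \<Rightarrow> complex"
  proof -
    have "norm (f n) = norm (f (orth_part n)) * norm (torus_char lam n)"
      by (subst pos_equivariant_iwasawa[OF f unipotent_GL[OF n]]) (simp only: norm_mult mult.commute)
    also have "\<dots> \<le> B * norm (torus_char lam n)"
      by (intro mult_right_mono left.bounded_by_le[OF b orth_part_orthogonal[OF unipotent_GL[OF n]]]) simp
    finally show ?thesis .
  qed
  then have "sym.bounded_by 0 (\<lambda>n. 1 * (1 + param_norm lam) ^ 0 * B * norm (torus_char lam n)) f"
    if "pos_equivariant lam f" "left.bounded_by 0 (\<lambda>_. B) f" for lam B and f :: "real^'n::_^'n::{finite,wellorder} \<Rightarrow> complex"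
    using that by (simp add: pos_equivariant_def)
  then show ?case using zero_le_one by blast
next
  case (Suc k)
  then obtain C where C: "0 \<le> C" "\<And>lam B f. pos_equivariant lam f \<Longrightarrow> left.bounded_by k (\<lambda>_. B) f \<Longrightarrow>
     sym.bounded_by k (\<lambda>n. C * (1 + param_norm lam) ^ k * B * norm (torus_char lam n)) (f :: real^'n::_^'n::{finite,wellorder} \<Rightarrow> complex)" by blast
  have "\<forall>p. \<exists>A\<ge>0. sym.bounded_by k (\<lambda>x. A * hgauge x powr real (level (snd p))) (\<lambda>x. inv_entry (fst p) (fst (snd p)) x * entry (snd (snd p)) (fst (p :: 'n \<times> 'n \<times> 'n)) x)"
    by (intro allI symbD symbol_borel_weight_coeff)
  then have "\<exists>A. \<forall>p :: 'n \<times> 'n \<times> 'n. 0 \<le> A p \<and> sym.bounded_by k (\<lambda>x. A p * hgauge x powr real (level (snd p))) (\<lambda>x. inv_entry (fst p) (fst (snd p)) x * entry (snd (snd p)) (fst p) x)"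
    by (rule choice)
  then obtain A where A: "\<And>p. 0 \<le> A p" "\<And>p :: 'n \<times> 'n \<times> 'n. sym.bounded_by k (\<lambda>x. A p * hgauge x powr real (level (snd p))) (\<lambda>x. inv_entry (fst p) (fst (snd p)) x * entry (snd (snd p)) (fst p) x)"
    by blast
  define A' where "A' = (\<Sum>p\<in>UNIV. A p)"
  have AA: "A p \<le> A'" for p unfolding A'_def using A(1) by (intro member_le_sum) auto
  have A0: "0 \<le> A'" using A(1) by (simp add: A'_def sum_nonneg)
  let ?C = "C + 2 ^ k * A' * C"
  have "sym.bounded_by (Suc k) (\<lambda>n. ?C * (1 + param_norm lam) ^ Suc k * B * norm (torus_char lam n)) f"
    if f: "pos_equivariant lam f" and b: "left.bounded_by (Suc k) (\<lambda>_. B) f" for lam B and f :: "real^'n::_^'n::{finite,wellorder} \<Rightarrow> complex"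
  proof (rule sym.bounded_by_SucI)
    have "mat 1 \<in> (orthogonal_group :: (real^'n::_^'n::{finite,wellorder}) set)"
      by (simp add: orthogonal_group_def orthogonal_matrix_id)
    then have B0: "0 \<le> B" using left.bounded_by_nonneg[OF b] by blast
    have nm: "0 \<le> param_norm lam" by (simp add: param_norm_def sum_nonneg)
    let ?w = "\<lambda>n. C * (1 + param_norm lam) ^ k * B * norm (torus_char lam n)"
    have w0: "0 \<le> ?w n" for n using C(1) B0 nm by simp
    have fk: "sym.bounded_by k ?w f" by (rule C(2)[OF f left.bounded_by_SucD[OF b]])
    have le: "?w n \<le> ?C * (1 + param_norm lam) ^ Suc k * B * norm (torus_char lam n)" for n
    proof -
      have "?w n * 1 \<le> ?w n * ((1 + 2 ^ k * A') * (1 + param_norm lam))"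
      proof (rule mult_left_mono[OF _ w0])
        have "1 * 1 \<le> (1 + 2 ^ k * A') * (1 + param_norm lam)" using A0 nm by (intro mult_mono) auto
        then show "1 \<le> (1 + 2 ^ k * A') * (1 + param_norm lam)" by simp
      qed
      then show ?thesis by (simp add: algebra_simps)
    qed
    show "sym.bounded_by k (\<lambda>n. ?C * (1 + param_norm lam) ^ Suc k * B * norm (torus_char lam n)) f"
      by (rule sym.bounded_by_mono[OF fk le])
    fix cd :: "'n \<times> 'n"
    have lf: "sym.bounded_by k ?w (vf_deriv (left_field cd) f)"
      using C(2)[OF pos_equivariant_left_field[OF f]] left.bounded_by_field[OF b, of cd] by simp
    have czb: "sym.bounded_by k (\<lambda>x. param_norm lam * A' * hgauge x powr real (level cd)) (borel_weight lam cd)"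
    proof -
      have "sym.bounded_by k (\<lambda>x. \<Sum>j\<in>UNIV. norm (shifted lam j) * (A (j, cd) * hgauge x powr real (level cd))) (borel_weight lam cd)"
        unfolding borel_weight_def[abs_def] by (intro sym.bounded_by_sum sym.bounded_by_cmult) (use A(2)[of "(_, cd)"] in simp)
      then show ?thesis
      proof (rule sym.bounded_by_mono)
        fix x :: "real^'n::_^'n::{finite,wellorder}"
        have "(\<Sum>j\<in>UNIV. norm (shifted lam j) * (A (j, cd) * hgauge x powr real (level cd))) \<le> (\<Sum>j\<in>UNIV. norm (shifted lam j) * (A' * hgauge x powr real (level cd)))"
          by (intro sum_mono mult_left_mono mult_right_mono AA) auto
        then show "(\<Sum>j\<in>UNIV. norm (shifted lam j) * (A (j, cd) * hgauge x powr real (level cd))) \<le> param_norm lam * A' * hgauge x powr real (level cd)"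
          unfolding sum_distrib_right[symmetric] by (simp add: param_norm_def mult_ac)
      qed
    qed
    have "sym.bounded_by k (\<lambda>x. ?w x + norm (- 1 :: complex) * (2 ^ k * (param_norm lam * A' * hgauge x powr real (level cd) * ?w x)))
       (\<lambda>x. vf_deriv (left_field cd) f x + (- 1) * (borel_weight lam cd x * f x))"
      by (intro sym.bounded_by_add lf sym.bounded_by_cmult sym.bounded_by_mult czb fk)
    then have "sym.bounded_by k (\<lambda>x. ?w x + norm (- 1 :: complex) * (2 ^ k * (param_norm lam * A' * hgauge x powr real (level cd) * ?w x))) (vf_deriv (borel_field cd) f)"
      by (rule sym.bounded_by_cong) (simp add: pos_equivariant_borel_field[OF f])
    then show "sym.bounded_by k (\<lambda>n. ?C * (1 + param_norm lam) ^ Suc k * B * norm (torus_char lam n) * hgauge n ^ level cd) (vf_deriv (borel_field cd) f)"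
    proof (rule sym.bounded_by_mono)
      fix x :: "real^'n::_^'n::{finite,wellorder}"
      let ?o = "hgauge x ^ level cd"
      have o1: "1 \<le> ?o" using hgauge_ge1[of x] by simp
      have "?w x + norm (- 1 :: complex) * (2 ^ k * (param_norm lam * A' * hgauge x powr real (level cd) * ?w x)) = ?w x * (1 + 2 ^ k * A' * param_norm lam * ?o)"
        by (simp add: powr_realpow[OF hgauge_pos] algebra_simps)
      also have "\<dots> \<le> ?w x * ((1 + 2 ^ k * A') * (1 + param_norm lam) * ?o)"
      proof (rule mult_left_mono[OF _ w0])
        have "1 + 2 ^ k * A' * param_norm lam * ?o \<le> 1 * ?o + 2 ^ k * A' * param_norm lam * ?o" using o1 by simp
        also have "\<dots> \<le> (1 + 2 ^ k * A') * (1 + param_norm lam) * ?o"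
          unfolding distrib_right[symmetric] using o1 A0 nm by (intro mult_right_mono) (auto simp: algebra_simps)
        finally show "1 + 2 ^ k * A' * param_norm lam * ?o \<le> (1 + 2 ^ k * A') * (1 + param_norm lam) * ?o" .
      qed
      also have "\<dots> = ?C * (1 + param_norm lam) ^ Suc k * B * norm (torus_char lam x) * ?o" by (simp add: algebra_simps)
      finally show "?w x + norm (- 1 :: complex) * (2 ^ k * (param_norm lam * A' * hgauge x powr real (level cd) * ?w x))
        \<le> ?C * (1 + param_norm lam) ^ Suc k * B * norm (torus_char lam x) * ?o" .
    qed
  qed
  moreover have "0 \<le> ?C" using C(1) A0 by simp
  ultimately show ?case by blast
qed

subsection \<open>Bounds on the orthogonal group\<close>

lemma compact_orthogonal_group: "compact (orthogonal_group :: (real^'n^'n) set)"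
proof -
  have e: "(orthogonal_group :: (real^'n^'n) set) = {k. transpose k ** k = mat 1}"
    by (auto simp: orthogonal_group_def orthogonal_matrix)
  have "closed {k :: real^'n^'n. transpose k ** k = mat 1}"
    unfolding transpose_def matrix_matrix_mult_def by (intro closed_Collect_eq continuous_intros)
  moreover have "bounded {k :: real^'n^'n. transpose k ** k = mat 1}"
  proof (rule boundedI)
    fix k :: "real^'n^'n" assume "k \<in> {k. transpose k ** k = mat 1}"
    then have k: "k \<in> orthogonal_group" using e by blast
    then have "transpose k \<in> orthogonal_group" by (simp add: orthogonal_group_def orthogonal_matrix_transpose)
    then have "k ** transpose k = mat 1" by (simp add: orthogonal_group_def orthogonal_matrix_def transpose_transpose)
    then have "(k ** transpose k) $ i $ i = 1" for i by (simp add: mat_def)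
    then have "norm (k $ i) = 1" for i
      by (simp add: norm_vec_def L2_set_def matrix_matrix_mult_def transpose_def power2_eq_square)
    then have "(\<Sum>i\<in>UNIV. norm (k $ i)) = real CARD('n)" by simp
    moreover have "norm k \<le> (\<Sum>i\<in>UNIV. norm (k $ i))"
      unfolding norm_vec_def[of k] by (rule L2_set_le_sum) simp
    ultimately show "norm k \<le> real CARD('n)" by linarith
  qed
  ultimately show ?thesis unfolding e by (simp add: compact_eq_bounded_closed)
qed

lemma continuous_bounded_K:
  assumes "continuous_on GL (q :: real^'n::_^'n::{finite,wellorder} \<Rightarrow> complex)"
  shows "\<exists>B\<ge>0. \<forall>x\<in>orthogonal_group. norm (q x) \<le> B"
proof -
  have "compact (q ` orthogonal_group)"
    by (intro compact_continuous_image compact_orthogonal_group continuous_on_subset[OF assms orthogonal_GL])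
  then obtain B where "\<forall>x\<in>orthogonal_group. norm (q x) \<le> B" by (auto dest!: compact_imp_bounded simp: bounded_iff)
  then show ?thesis by (intro exI[of _ "\<bar>B\<bar>"]) (auto intro: order_trans)
qed

text \<open>The bound of order \<open>k + 1\<close> from those of order \<open>k\<close>, uniformly
  in a family; finiteness of the set of fields makes the constants uniform in them.\<close>

lemma left_bounded_by_Suc_uniform:
  fixes F :: "'a \<Rightarrow> real^'n::_^'n::{finite,wellorder} \<Rightarrow> complex"
  assumes "\<exists>B\<ge>0. \<forall>i\<in>I. left.bounded_by k (\<lambda>_. B) (F i)"
    and "\<And>cd. \<exists>C\<ge>0. \<forall>i\<in>I. left.bounded_by k (\<lambda>_. C) (vf_deriv (left_field cd) (F i))"
  shows "\<exists>B\<ge>0. \<forall>i\<in>I. left.bounded_by (Suc k) (\<lambda>_. B) (F i)"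
proof -
  obtain B where B: "0 \<le> B" "\<forall>i\<in>I. left.bounded_by k (\<lambda>_. B) (F i)" using assms(1) by blast
  have "\<forall>cd. \<exists>C. 0 \<le> C \<and> (\<forall>i\<in>I. left.bounded_by k (\<lambda>_. C) (vf_deriv (left_field cd) (F i)))"
    using assms(2) by blast
  then have "\<exists>C. \<forall>cd. 0 \<le> C cd \<and> (\<forall>i\<in>I. left.bounded_by k (\<lambda>_. C cd) (vf_deriv (left_field cd) (F i)))" by (rule choice)
  then obtain C where C: "\<And>cd. 0 \<le> C cd" "\<And>cd i. i \<in> I \<Longrightarrow> left.bounded_by k (\<lambda>_. C cd) (vf_deriv (left_field cd) (F i))" by blast
  let ?S = "\<Sum>cd\<in>UNIV. C cd"
  have S: "C cd \<le> ?S" for cd using C(1) by (intro member_le_sum) auto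
  have S0: "0 \<le> ?S" using C(1) by (simp add: sum_nonneg)
  have "left.bounded_by (Suc k) (\<lambda>_. B + ?S) (F i)" if l: "i \<in> I" for i
  proof (rule left.bounded_by_SucI)
    show "left.bounded_by k (\<lambda>_. B + ?S) (F i)" by (rule left.bounded_by_mono[OF bspec[OF B(2) l]]) (use S0 in simp)
    show "left.bounded_by k (\<lambda>x. (B + ?S) * 1) (vf_deriv (left_field cd) (F i))" for cd
      by (rule left.bounded_by_mono[OF C(2)[OF l]]) (use S[of cd] B(1) in simp)
  qed
  then show ?thesis using B(1) S0 by (intro exI[of _ "B + ?S"]) (auto simp del: left.bounded_by.simps)
qed

text \<open>The trivial index set makes this an instance of the uniform lemma.\<close>

lemma left_bounded_by_exists:
  "smooth_on GL p \<Longrightarrow> \<exists>C\<ge>0. \<forall>i\<in>UNIV :: unit set. left.bounded_by k (\<lambda>_. C) (p :: real^'n::_^'n::{finite,wellorder} \<Rightarrow> complex)"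
proof (induction k arbitrary: p)
  case 0
  then show ?case using continuous_bounded_K[OF smooth_on_imp_continuous_on[OF 0]] by auto
next
  case (Suc k)
  show ?case
    by (rule left_bounded_by_Suc_uniform[OF Suc.IH[OF Suc.prems] Suc.IH[OF left.smooth_field[OF Suc.prems]]])
qed

interpretation coord: derivation_bounds "\<lambda>ij _. munit (fst ij) (snd ij)" "\<lambda>_ _. 1" orthogonal_group "GL :: (real^'n::_^'n::{finite,wellorder}) set"
  by unfold_locales (use orthogonal_GL in \<open>auto intro: open_GL smooth_on_vf_deriv_const\<close>)

lemma vf_deriv_left_field_coord:
  fixes f :: "real^'n::_^'n::{finite,wellorder} \<Rightarrow> complex"
  assumes "f differentiable at x"
  shows "vf_deriv (left_field cd) f x = (\<Sum>j\<in>UNIV. entry (snd cd) j x * vf_deriv (\<lambda>_. munit (fst cd) j) f x)"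
proof -
  have lin: "linear (frechet_derivative f (at x))" using assms by (rule linear_frechet_derivative)
  have e: "left_field cd x = (\<Sum>j\<in>UNIV. x $ snd cd $ j *\<^sub>R munit (fst cd) j)"
    by (simp add: vec_eq_iff left_field_entry sum_component if_distrib cong: if_cong)
  show ?thesis
    unfolding vf_deriv_def e linear_sum[OF lin] linear_cmul[OF lin] by (simp add: entry_def scaleR_conv_of_real)
qed

text \<open>The fields \<open>left_field\<close> have smooth coefficients with respect to the
  constant fields, and \<open>O(r)\<close> is compact. This links the estimates with the Frechet
  topology, which is defined by coordinate derivatives.\<close>

lemma coord_imp_left:
  "\<exists>C\<ge>0. \<forall>B. \<forall>f :: real^'n::_^'n::{finite,wellorder} \<Rightarrow> complex. coord.bounded_by k (\<lambda>_. B) f \<longrightarrow> left.bounded_by k (\<lambda>_. C * B) f"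
proof (induction k)
  case 0
  have "left.bounded_by 0 (\<lambda>_. 1 * B) f" if "coord.bounded_by 0 (\<lambda>_. B) f" for B and f :: "real^'n::_^'n::{finite,wellorder} \<Rightarrow> complex"
    using that by simp
  then show ?case using zero_le_one by blast
next
  case (Suc k)
  then obtain C where C: "0 \<le> C" "\<And>B f. coord.bounded_by k (\<lambda>_. B) f \<Longrightarrow> left.bounded_by k (\<lambda>_. C * B) (f :: real^'n::_^'n::{finite,wellorder} \<Rightarrow> complex)" by blast
  obtain X where X: "0 \<le> X" "\<And>i j. left.bounded_by k (\<lambda>_. X) (entry i j :: real^'n::_^'n::{finite,wellorder} \<Rightarrow> complex)"
  proof -
    have "\<forall>p :: 'n \<times> 'n. \<exists>C. 0 \<le> C \<and> left.bounded_by k (\<lambda>_. C) (entry (fst p) (snd p))"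
      using left_bounded_by_exists[OF smooth_on_entry] by blast
    then have "\<exists>C. \<forall>p :: 'n \<times> 'n. 0 \<le> C p \<and> left.bounded_by k (\<lambda>_. C p) (entry (fst p) (snd p))" by (rule choice)
    then obtain Y where Y: "\<And>p :: 'n \<times> 'n. 0 \<le> Y p" "\<And>p :: 'n \<times> 'n. left.bounded_by k (\<lambda>_. Y p) (entry (fst p) (snd p))" by blast
    have "left.bounded_by k (\<lambda>_. \<Sum>p\<in>UNIV. Y p) (entry i j)" for i j :: 'n
    proof -
      have "Y (i, j) \<le> (\<Sum>p\<in>UNIV. Y p)" using Y(1) by (intro member_le_sum) auto
      then show ?thesis using Y(2)[of "(i, j)"] left.bounded_by_mono by fastforce
    qed
    then show thesis using Y(1) by (intro that[of "\<Sum>p\<in>UNIV. Y p"]) (auto intro: sum_nonneg)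
  qed
  let ?D = "C + real CARD('n) * (2 ^ k * (X * C))"
  have "left.bounded_by (Suc k) (\<lambda>_. ?D * B) f" if f: "coord.bounded_by (Suc k) (\<lambda>_. B) f" for B and f :: "real^'n::_^'n::{finite,wellorder} \<Rightarrow> complex"
  proof (rule left.bounded_by_SucI)
    have "mat 1 \<in> (orthogonal_group :: (real^'n::_^'n::{finite,wellorder}) set)"
      by (simp add: orthogonal_group_def orthogonal_matrix_id)
    then have B0: "0 \<le> B" using coord.bounded_by_nonneg[OF f] by blast
    show "left.bounded_by k (\<lambda>_. ?D * B) f"
      by (rule left.bounded_by_mono[OF C(2)[OF coord.bounded_by_SucD[OF f]]]) (use C(1) X(1) B0 in \<open>simp add: distrib_right\<close>)
    fix cd :: "'n \<times> 'n"
    have d: "left.bounded_by k (\<lambda>_. C * B) (vf_deriv (\<lambda>_. munit (fst cd) j) f)" for j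
      using C(2)[of B "vf_deriv (\<lambda>_. munit (fst cd) j) f"] coord.bounded_by_field[OF f, of "(fst cd, j)"] by simp
    have "left.bounded_by k (\<lambda>_. \<Sum>j\<in>(UNIV :: 'n set). 2 ^ k * (X * (C * B))) (\<lambda>x. \<Sum>j\<in>UNIV. entry (snd cd) j x * vf_deriv (\<lambda>_. munit (fst cd) j) f x)"
      by (intro left.bounded_by_sum left.bounded_by_mult X d)
    then have "left.bounded_by k (\<lambda>_. \<Sum>j\<in>(UNIV :: 'n set). 2 ^ k * (X * (C * B))) (vf_deriv (left_field cd) f)"
      by (rule left.bounded_by_cong) (simp add: vf_deriv_left_field_coord[OF coord.bounded_by_differentiable[OF f]])
    then show "left.bounded_by k (\<lambda>x. ?D * B * 1) (vf_deriv (left_field cd) f)"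
      by (rule left.bounded_by_mono) (use C(1) B0 in \<open>simp add: algebra_simps\<close>)
  qed
  moreover have "0 \<le> ?D" using C(1) X(1) by simp
  ultimately show ?case by blast
qed

text \<open>The finitely many coordinate derivatives that control a bound of order
  \<open>k\<close>.\<close>

definition unit_words :: "nat \<Rightarrow> (real^'n::_^'n::{finite,wellorder}) list set" where
  "unit_words k = {vs. set vs \<subseteq> range (\<lambda>ij. munit (fst ij) (snd ij)) \<and> length vs \<le> k}"

lemma finite_unit_words: "finite (unit_words k)"
  unfolding unit_words_def by (rule finite_lists_length_le) simp

lemma iterated_imp_coord:
  fixes f :: "real^'n::_^'n::{finite,wellorder} \<Rightarrow> complex"
  assumes "smooth_on GL f" "\<And>vs x. vs \<in> unit_words k \<Longrightarrow> x \<in> orthogonal_group \<Longrightarrow> norm (iterated_deriv vs f x) \<le> B"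
  shows "coord.bounded_by k (\<lambda>_. B) f"
  using assms
proof (induction k arbitrary: f)
  case 0
  then show ?case using 0(2)[of "[]"] by (simp add: unit_words_def)
next
  case (Suc k)
  show ?case
  proof (rule coord.bounded_by_SucI)
    show "coord.bounded_by k (\<lambda>_. B) f"
      by (rule Suc.IH[OF Suc.prems(1)]) (use Suc.prems(2) in \<open>auto simp: unit_words_def\<close>)
    fix ij :: "'n \<times> 'n"
    have "coord.bounded_by k (\<lambda>_. B) (vf_deriv (\<lambda>_. munit (fst ij) (snd ij)) f)"
    proof (rule Suc.IH[OF smooth_on_vf_deriv_const[OF Suc.prems(1)]])
      fix vs :: "(real^'n::_^'n::{finite,wellorder}) list" and x
      assume vs: "vs \<in> unit_words k" and x: "x \<in> (orthogonal_group :: (real^'n::_^'n::{finite,wellorder}) set)"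
      have "vs @ [munit (fst ij) (snd ij)] \<in> unit_words (Suc k)" using vs by (auto simp: unit_words_def)
      from Suc.prems(2)[OF this x]
      show "norm (iterated_deriv vs (vf_deriv (\<lambda>_. munit (fst ij) (snd ij)) f) x) \<le> B"
        by (simp only: iterated_deriv_snoc)
    qed
    then show "coord.bounded_by k (\<lambda>x. B * 1) (vf_deriv (\<lambda>_. munit (fst ij) (snd ij)) f)" by simp
  qed
qed

section \<open>Holomorphic families\<close>

text \<open>Families of functions that depend on \<open>\<lambda>\<close> through an exponential of
  a linear form and polynomially: closed under all operations that occur in \<open>gain_op\<close>,
  holomorphic in \<open>\<lambda>\<close> and locally uniformly bounded. The exponents
  \<open>\<tau>\<close> are left open in order to include translates of the Iwasawa
  character.\<close>

locale exp_family =
  fixes \<tau> :: "'n::{finite,wellorder} \<Rightarrow> real^'n::_^'n::{finite,wellorder} \<Rightarrow> real"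
  assumes smooth_exponent: "\<And>j. smooth_on GL (\<lambda>x. complex_of_real (\<tau> j x))"
begin

definition exp_factor :: "complex^'n::{finite,wellorder} \<Rightarrow> real^'n::_^'n::{finite,wellorder} \<Rightarrow> complex" where
  "exp_factor lam x = exp (\<Sum>j\<in>UNIV. shifted lam j * complex_of_real (\<tau> j x))"

text \<open>The least class of families needed; \<open>exp_span\<close> is its closure under
  equality on the group, since functions
  that are equal on the group have equal derivatives only there.\<close>

inductive exp_span_raw :: "(complex^'n::{finite,wellorder} \<Rightarrow> real^'n::_^'n::{finite,wellorder} \<Rightarrow> complex) \<Rightarrow> bool" where
  base: "smooth_on GL p \<Longrightarrow> exp_span_raw (\<lambda>lam x. p x * exp_factor lam x)"
| add: "exp_span_raw F \<Longrightarrow> exp_span_raw G \<Longrightarrow> exp_span_raw (\<lambda>lam x. F lam x + G lam x)"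
| scale: "exp_span_raw F \<Longrightarrow> exp_span_raw (\<lambda>lam x. shifted lam j * F lam x)"

definition exp_span :: "(complex^'n::{finite,wellorder} \<Rightarrow> real^'n::_^'n::{finite,wellorder} \<Rightarrow> complex) \<Rightarrow> bool" where
  "exp_span F \<longleftrightarrow> (\<exists>G. exp_span_raw G \<and> (\<forall>lam. \<forall>x\<in>GL. F lam x = G lam x))"

lemma smooth_exp_factor: "smooth_on GL (exp_factor lam)"
  unfolding exp_factor_def[abs_def] by (intro smooth_on_exp smooth_on_sum smooth_on_mult smooth_on_const open_GL smooth_exponent)

lemma exp_span_raw_smooth: "exp_span_raw F \<Longrightarrow> smooth_on GL (F lam)"
  by (induction rule: exp_span_raw.induct) (auto intro: smooth_on_add smooth_on_mult smooth_on_const open_GL smooth_exp_factor)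

lemma exp_span_smooth: "exp_span F \<Longrightarrow> smooth_on GL (F lam)"
  unfolding exp_span_def using exp_span_raw_smooth smooth_on_cong[OF open_GL] by metis

lemma exp_span_add: "exp_span F \<Longrightarrow> exp_span G \<Longrightarrow> exp_span (\<lambda>lam x. F lam x + G lam x)"
  unfolding exp_span_def
proof (elim exE conjE)
  fix F' G' assume "exp_span_raw F'" "\<forall>lam. \<forall>x\<in>GL. F lam x = F' lam x" "exp_span_raw G'" "\<forall>lam. \<forall>x\<in>GL. G lam x = G' lam x"
  then show "\<exists>H. exp_span_raw H \<and> (\<forall>lam. \<forall>x\<in>GL. F lam x + G lam x = H lam x)"
    by (intro exI[of _ "\<lambda>lam x. F' lam x + G' lam x"]) (auto intro: exp_span_raw.add)
qed

lemma exp_span_scale: "exp_span F \<Longrightarrow> exp_span (\<lambda>lam x. shifted lam j * F lam x)"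
  unfolding exp_span_def
proof (elim exE conjE)
  fix F' assume "exp_span_raw F'" "\<forall>lam. \<forall>x\<in>GL. F lam x = F' lam x"
  then show "\<exists>H. exp_span_raw H \<and> (\<forall>lam. \<forall>x\<in>GL. shifted lam j * F lam x = H lam x)"
    by (intro exI[of _ "\<lambda>lam x. shifted lam j * F' lam x"]) (auto intro: exp_span_raw.scale)
qed

lemma exp_span_base: "smooth_on GL p \<Longrightarrow> exp_span (\<lambda>lam x. p x * exp_factor lam x)"
  unfolding exp_span_def by (intro exI[of _ "\<lambda>lam x. p x * exp_factor lam x"]) (auto intro: exp_span_raw.base)

lemma exp_span_cong: "exp_span F \<Longrightarrow> (\<And>lam x. x \<in> GL \<Longrightarrow> G lam x = F lam x) \<Longrightarrow> exp_span G"
  unfolding exp_span_def by metis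

lemma exp_span_zero: "exp_span (\<lambda>lam x. 0)"
  by (rule exp_span_cong[OF exp_span_base[of "\<lambda>x. 0"]]) (auto intro: smooth_on_const)

lemma exp_span_sum: "(\<And>i. i \<in> I \<Longrightarrow> exp_span (F i)) \<Longrightarrow> exp_span (\<lambda>lam x. \<Sum>i\<in>I. F i lam x)"
  by (induction I rule: infinite_finite_induct) (auto intro: exp_span_zero exp_span_add)

lemma exp_span_raw_smult: "exp_span_raw F \<Longrightarrow> smooth_on GL q \<Longrightarrow> exp_span (\<lambda>lam x. q x * F lam x)"
proof (induction rule: exp_span_raw.induct)
  case (base p)
  show ?case
    by (rule exp_span_cong[OF exp_span_base[of "\<lambda>x. q x * p x"]]) (auto intro: smooth_on_mult open_GL base mult.assoc[symmetric])
next
  case (add F G)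
  show ?case by (rule exp_span_cong[OF exp_span_add[OF add.IH(1)[OF add.prems] add.IH(2)[OF add.prems]]]) (simp add: distrib_left)
next
  case (scale F j)
  show ?case by (rule exp_span_cong[OF exp_span_scale[OF scale.IH[OF scale.prems], of j]]) (simp add: mult_ac)
qed

lemma exp_span_smult: "exp_span F \<Longrightarrow> smooth_on GL q \<Longrightarrow> exp_span (\<lambda>lam x. q x * F lam x)"
proof -
  assume F: "exp_span F" and q: "smooth_on GL q"
  obtain G where G: "exp_span_raw G" "\<forall>lam. \<forall>x\<in>GL. F lam x = G lam x" using F unfolding exp_span_def by blast
  show ?thesis by (rule exp_span_cong[OF exp_span_raw_smult[OF G(1) q]]) (use G(2) in simp)
qed

text \<open>A derivative of the exponential brings down the factors \<open>\<lambda>\<^sub>j +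
  \<rho>\<^sub>j\<close>.\<close>

lemma exp_span_raw_vf_deriv:
  assumes \<xi>: "\<And>f. smooth_on GL f \<Longrightarrow> smooth_on GL (vf_deriv \<xi> f)" and "exp_span_raw F"
  shows "exp_span (\<lambda>lam. vf_deriv \<xi> (F lam))"
  using assms(2)
proof (induction rule: exp_span_raw.induct)
  case (base p)
  let ?t = "\<lambda>j x. complex_of_real (\<tau> j x)"
  have "exp_span (\<lambda>lam x. vf_deriv \<xi> p x * exp_factor lam x + (\<Sum>j\<in>UNIV. shifted lam j * ((p x * vf_deriv \<xi> (?t j) x) * exp_factor lam x)))"
    by (intro exp_span_add exp_span_sum exp_span_scale exp_span_base \<xi> base smooth_on_mult open_GL smooth_exponent)
  then show ?case
  proof (rule exp_span_cong)
    fix lam and x :: "real^'n::_^'n::{finite,wellorder}" assume x: "x \<in> GL"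
    let ?L = "\<lambda>x. \<Sum>j\<in>UNIV. shifted lam j * ?t j x"
    have sL: "smooth_on GL ?L" by (intro smooth_on_sum smooth_on_mult smooth_on_const open_GL smooth_exponent)
    have "vf_deriv \<xi> (exp_factor lam) x = exp (?L x) * vf_deriv (\<lambda>_. \<xi> x) ?L x"
      unfolding exp_factor_def[abs_def] by (rule vf_deriv_eqI[OF has_derivative_exp_vf_deriv[OF smooth_on_imp_differentiable[OF sL x]]])
    also have "vf_deriv (\<lambda>_. \<xi> x) ?L x = (\<Sum>j\<in>UNIV. shifted lam j * vf_deriv \<xi> (?t j) x)"
    proof -
      have d: "?t j differentiable at x" for j by (rule smooth_on_imp_differentiable[OF smooth_exponent x])
      show ?thesis
        by (subst vf_deriv_sum) (auto simp: vf_deriv_mult[OF _ d] vf_deriv_apply[of \<xi>] intro!: differentiable_mult d)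
    qed
    finally have e: "vf_deriv \<xi> (exp_factor lam) x = exp_factor lam x * (\<Sum>j\<in>UNIV. shifted lam j * vf_deriv \<xi> (?t j) x)"
      unfolding exp_factor_def .
    have "vf_deriv \<xi> (\<lambda>x. p x * exp_factor lam x) x = vf_deriv \<xi> p x * exp_factor lam x + p x * vf_deriv \<xi> (exp_factor lam) x"
      by (rule vf_deriv_mult) (use smooth_on_imp_differentiable[OF base x] smooth_on_imp_differentiable[OF smooth_exp_factor x] in auto)
    then show "vf_deriv \<xi> (\<lambda>x. p x * exp_factor lam x) x =
       vf_deriv \<xi> p x * exp_factor lam x + (\<Sum>j\<in>UNIV. shifted lam j * ((p x * vf_deriv \<xi> (?t j) x) * exp_factor lam x))"
      unfolding e by (simp add: sum_distrib_left mult_ac)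
  qed
next
  case (add F G)
  show ?case
    by (rule exp_span_cong[OF exp_span_add[OF add.IH]])
      (simp add: vf_deriv_add smooth_on_imp_differentiable[OF exp_span_raw_smooth[OF add.hyps(1)]]
        smooth_on_imp_differentiable[OF exp_span_raw_smooth[OF add.hyps(2)]])
next
  case (scale F j)
  show ?case
    by (rule exp_span_cong[OF exp_span_scale[OF scale.IH, of j]])
      (simp add: vf_deriv_mult smooth_on_imp_differentiable[OF exp_span_raw_smooth[OF scale.hyps]])
qed

lemma exp_span_vf_deriv:
  assumes \<xi>: "\<And>f. smooth_on GL f \<Longrightarrow> smooth_on GL (vf_deriv \<xi> f)" and F: "exp_span F"
  shows "exp_span (\<lambda>lam. vf_deriv \<xi> (F lam))"
proof -
  obtain G where G: "exp_span_raw G" "\<forall>lam. \<forall>x\<in>GL. F lam x = G lam x" using F unfolding exp_span_def by blast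
  show ?thesis
  proof (rule exp_span_cong[OF exp_span_raw_vf_deriv[OF \<xi> G(1)]])
    fix lam and x :: "real^'n::_^'n::{finite,wellorder}" assume x: "x \<in> GL"
    show "vf_deriv \<xi> (F lam) x = vf_deriv \<xi> (G lam) x"
      by (rule vf_deriv_cong[OF open_GL x]) (use G(2) smooth_on_imp_differentiable[OF exp_span_smooth[OF F] x] in auto)
  qed
qed

lemma exp_span_gain_op: "exp_span F \<Longrightarrow> exp_span (\<lambda>lam. gain_op (F lam))"
proof -
  assume F: "exp_span F"
  have "exp_span (\<lambda>lam x. inverse (gauge_sum_c x) * F lam x + (- (1 / (2 * of_real pi * \<i>))) *
     (\<Sum>cd\<in>lower_pairs. vf_deriv (borel_field cd) (\<lambda>x. multiplier cd x * F lam x) x + frame_div cd x * (multiplier cd x * F lam x)))"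
    by (intro exp_span_add exp_span_smult exp_span_sum F exp_span_vf_deriv sym.smooth_field smooth_on_const symbol_smooth[OF symbol_multiplier]
        symbol_smooth[OF symbol_frame_div] symbol_smooth[OF symbol_inverse_gauge_sum])
  then show ?thesis by (rule exp_span_cong) (simp add: gain_op_def)
qed

lemma exp_span_gain_op_pow: "exp_span F \<Longrightarrow> exp_span (\<lambda>lam. (gain_op ^^ M) (F lam))"
  by (induction M) (auto intro: exp_span_gain_op)

lemma exp_span_holomorphic:
  assumes F: "exp_span F" and x: "x \<in> GL"
  shows "holomorphic_several_on (\<lambda>lam. F lam x) UNIV"
proof -
  obtain G where G: "exp_span_raw G" "\<forall>lam. \<forall>x\<in>GL. F lam x = G lam x" using F unfolding exp_span_def by blast
  have m: "((\<lambda>lam. shifted lam j) has_derivative (\<lambda>v. v $ j)) (at lam)" for j :: 'n and lam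
    unfolding shifted_def by (auto intro!: derivative_eq_intros bounded_linear_imp_has_derivative bounded_linear_vec_nth)
  have "\<exists>D. ((\<lambda>lam. G lam x) has_derivative D) (at lam) \<and> (\<forall>c v. D (c *s v) = c * D v)" for lam
    using G(1)
  proof (induction rule: exp_span_raw.induct)
    case (base p)
    let ?L = "\<lambda>lam. \<Sum>j\<in>UNIV. shifted lam j * complex_of_real (\<tau> j x)"
    let ?D = "\<lambda>v. \<Sum>j\<in>UNIV. v $ j * complex_of_real (\<tau> j x)"
    have "(?L has_derivative ?D) (at lam)" by (intro has_derivative_sum has_derivative_mult_left m)
    moreover have "(exp has_derivative (\<lambda>h. exp (?L lam) * h)) (at (?L lam))"
      using DERIV_exp[of "?L lam"] by (simp add: has_field_derivative_def)
    ultimately have "((\<lambda>lam. exp (?L lam)) has_derivative (\<lambda>v. exp (?L lam) * ?D v)) (at lam)"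
      using diff_chain_at by (fastforce simp: o_def)
    then have "((\<lambda>lam. p x * exp (?L lam)) has_derivative (\<lambda>v. p x * (exp (?L lam) * ?D v))) (at lam)"
      by (rule has_derivative_mult_right)
    moreover have "p x * (exp (?L lam) * ?D (c *s v)) = c * (p x * (exp (?L lam) * ?D v))" for c v
    proof -
      have "?D (c *s v) = c * ?D v" by (simp add: sum_distrib_left mult.assoc)
      then show ?thesis by (simp only: mult_ac)
    qed
    ultimately show ?case unfolding exp_factor_def by blast
  next
    case (add F G)
    then obtain D E where "((\<lambda>lam. F lam x) has_derivative D) (at lam)" "\<forall>c v. D (c *s v) = c * D v"
      "((\<lambda>lam. G lam x) has_derivative E) (at lam)" "\<forall>c v. E (c *s v) = c * E v" by blast
    then show ?case by (intro exI[of _ "\<lambda>v. D v + E v"]) (auto intro: has_derivative_add simp: distrib_left)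
  next
    case (scale F j)
    then obtain D where D: "((\<lambda>lam. F lam x) has_derivative D) (at lam)" "\<forall>c v. D (c *s v) = c * D v" by blast
    from has_derivative_mult[OF m[of j lam] D(1)]
    show ?case using D(2) by (intro exI conjI) (assumption, auto simp: algebra_simps)
  qed
  then show ?thesis using G(2) x by (simp add: holomorphic_several_on_def)
qed

lemma norm_shifted_ball: "lam \<in> ball lam0 1 \<Longrightarrow> norm (shifted lam j) \<le> norm (shifted lam0 j) + 1"
proof -
  assume l: "lam \<in> ball lam0 1"
  have "shifted lam j = shifted lam0 j + (lam - lam0) $ j" by (simp add: shifted_def)
  then have "norm (shifted lam j) \<le> norm (shifted lam0 j) + norm ((lam - lam0) $ j)" by (simp only: norm_triangle_ineq)
  also have "norm ((lam - lam0) $ j) \<le> norm (lam - lam0)" by (rule Finite_Cartesian_Product.norm_nth_le)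
  finally show ?thesis using l by (simp add: dist_norm norm_minus_commute)
qed

lemma exp_span_bounded:
  assumes F: "exp_span F"
  shows "\<exists>B\<ge>0. \<forall>lam\<in>ball lam0 1. \<forall>x\<in>orthogonal_group. norm (F lam x) \<le> B"
proof -
  obtain G where G: "exp_span_raw G" "\<forall>lam. \<forall>x\<in>GL. F lam x = G lam x" using F unfolding exp_span_def by blast
  have "\<exists>B\<ge>0. \<forall>lam\<in>ball lam0 1. \<forall>x\<in>orthogonal_group. norm (G lam x) \<le> B" using G(1)
  proof (induction rule: exp_span_raw.induct)
    case (base p)
    obtain P where P: "0 \<le> P" "\<forall>x\<in>orthogonal_group. norm (p x) \<le> P"
      using continuous_bounded_K[OF smooth_on_imp_continuous_on[OF base]] by blast
    have "\<forall>j. \<exists>T. 0 \<le> T \<and> (\<forall>x\<in>orthogonal_group. norm (complex_of_real (\<tau> j x)) \<le> T)"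
      using continuous_bounded_K[OF smooth_on_imp_continuous_on[OF smooth_exponent]] by blast
    then have "\<exists>T. \<forall>j. 0 \<le> T j \<and> (\<forall>x\<in>orthogonal_group. norm (complex_of_real (\<tau> j x)) \<le> T j)" by (rule choice)
    then obtain T where T: "\<And>j. 0 \<le> T j" "\<And>j x. x \<in> orthogonal_group \<Longrightarrow> norm (complex_of_real (\<tau> j x)) \<le> T j" by blast
    have "norm (p x * exp_factor lam x) \<le> P * exp (\<Sum>j\<in>UNIV. (norm (shifted lam0 j) + 1) * T j)"
      if l: "lam \<in> ball lam0 1" and x: "x \<in> orthogonal_group" for lam x
    proof -
      have "norm (exp_factor lam x) \<le> exp (norm (\<Sum>j\<in>UNIV. shifted lam j * complex_of_real (\<tau> j x)))"
        unfolding exp_factor_def by (rule norm_exp)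
      also have "\<dots> \<le> exp (\<Sum>j\<in>UNIV. (norm (shifted lam0 j) + 1) * T j)"
      proof -
        have "norm (\<Sum>j\<in>UNIV. shifted lam j * complex_of_real (\<tau> j x)) \<le> (\<Sum>j\<in>UNIV. (norm (shifted lam0 j) + 1) * T j)"
          by (rule sum_norm_le) (unfold norm_mult, intro mult_mono norm_shifted_ball[OF l] T x, auto)
        then show ?thesis by simp
      qed
      finally show ?thesis unfolding norm_mult using P x by (intro mult_mono) auto
    qed
    then show ?case using P(1) by (intro exI[of _ "P * exp (\<Sum>j\<in>UNIV. (norm (shifted lam0 j) + 1) * T j)"]) auto
  next
    case (add F G)
    then obtain B C where "0 \<le> B" "\<forall>lam\<in>ball lam0 1. \<forall>x\<in>orthogonal_group. norm (F lam x) \<le> B"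
      "0 \<le> C" "\<forall>lam\<in>ball lam0 1. \<forall>x\<in>orthogonal_group. norm (G lam x) \<le> C" by blast
    then show ?case by (intro exI[of _ "B + C"]) (auto intro!: norm_triangle_le add_mono)
  next
    case (scale F j)
    then obtain B where B: "0 \<le> B" "\<forall>lam\<in>ball lam0 1. \<forall>x\<in>orthogonal_group. norm (F lam x) \<le> B" by blast
    have "norm (shifted lam j * F lam x) \<le> (norm (shifted lam0 j) + 1) * B" if "lam \<in> ball lam0 1" "x \<in> orthogonal_group" for lam x
      unfolding norm_mult by (intro mult_mono norm_shifted_ball that) (use B that in auto)
    then show ?case using B(1) by (intro exI[of _ "(norm (shifted lam0 j) + 1) * B"]) auto
  qed
  then show ?thesis using G(2) orthogonal_GL by (metis (no_types, lifting) subsetD)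
qed

lemma exp_span_left_bounded_by:
  "exp_span F \<Longrightarrow> \<exists>B\<ge>0. \<forall>lam\<in>ball lam0 1. left.bounded_by k (\<lambda>_. B) (F lam)"
proof (induction k arbitrary: F)
  case 0
  then show ?case using exp_span_bounded[OF 0, of lam0] exp_span_smooth[OF 0] by auto
next
  case (Suc k)
  show ?case
    by (rule left_bounded_by_Suc_uniform[OF Suc.IH[OF Suc.prems] Suc.IH[OF exp_span_vf_deriv[OF left.smooth_field Suc.prems]]])
qed

end

section \<open>Holomorphic dependence of integrals\<close>

lemma norm_vector_scalar: "norm (c *s v) = norm c * norm v" for v :: "complex^'n"
proof -
  have "norm (c *s v) = L2_set (\<lambda>i. norm c * norm (v $ i)) UNIV"
    by (simp add: norm_vec_def norm_mult)
  then show ?thesis by (simp add: L2_set_right_distrib[symmetric] norm_vec_def)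
qed

text \<open>The one variable theory is applied on complex lines.\<close>

lemma holomorphic_on_line:
  fixes F :: "complex^'n \<Rightarrow> complex"
  assumes "holomorphic_several_on F S"
  shows "(\<lambda>z. F (a + z *s v)) holomorphic_on {z. a + z *s v \<in> S}"
    and "a \<in> S \<Longrightarrow> (F has_derivative D) (at a) \<Longrightarrow> deriv (\<lambda>z. F (a + z *s v)) 0 = D v"
proof -
  have lin: "((\<lambda>z. a + z *s v) has_derivative (\<lambda>h. h *s v)) (at z)" for z
  proof -
    have "bounded_linear (\<lambda>z. z *s v)"
      by (rule bounded_linear_intro[of _ "norm v"])
        (auto simp: vec_eq_iff norm_vector_scalar distrib_right)
    then show ?thesis by (auto intro!: derivative_eq_intros bounded_linear_imp_has_derivative)
  qed
  have d: "((\<lambda>z. F (a + z *s v)) has_field_derivative D v) (at z)"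
    if "(F has_derivative D) (at (a + z *s v))" "\<forall>c v. D (c *s v) = c * D v" for z D
  proof -
    have "((\<lambda>z. F (a + z *s v)) has_derivative (\<lambda>h. D (h *s v))) (at z)"
      using diff_chain_at[OF lin that(1)] by (simp add: o_def)
    moreover have "(\<lambda>h. D (h *s v)) = (*) (D v)" using that(2) by (simp add: fun_eq_iff mult.commute)
    ultimately show ?thesis by (simp add: has_field_derivative_def)
  qed
  show "(\<lambda>z. F (a + z *s v)) holomorphic_on {z. a + z *s v \<in> S}"
    unfolding holomorphic_on_def
  proof
    fix z assume "z \<in> {z. a + z *s v \<in> S}"
    then obtain D where "(F has_derivative D) (at (a + z *s v))" "\<forall>c v. D (c *s v) = c * D v"
      using assms unfolding holomorphic_several_on_def by blast
    from d[OF this] show "(\<lambda>z. F (a + z *s v)) field_differentiable at z within {z. a + z *s v \<in> S}"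
      by (metis field_differentiable_def field_differentiable_at_within)
  qed
  assume "a \<in> S" and D: "(F has_derivative D) (at a)"
  then obtain E where E: "(F has_derivative E) (at a)" "\<forall>c v. E (c *s v) = c * E v"
    using assms unfolding holomorphic_several_on_def by blast
  then have "E = D" using D has_derivative_unique by blast
  then show "deriv (\<lambda>z. F (a + z *s v)) 0 = D v" using d[of E 0] E by (simp add: DERIV_imp_deriv)
qed

text \<open>Cauchy estimates on discs of radius \<open>\<rho> / 2\<close> around points of the unit
  disc, which stay inside the disc of radius \<open>\<rho>\<close> once \<open>\<rho> >
  2\<close>.\<close>

lemma quadratic_remainder:
  assumes hol: "f holomorphic_on ball 0 \<rho>" and \<rho>: "4 \<le> \<rho>" and B: "\<And>z. z \<in> ball 0 \<rho> \<Longrightarrow> norm (f z) \<le> B"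
  shows "norm (f 1 - f 0 - deriv f 0) \<le> 8 * B / \<rho>\<^sup>2" "norm (deriv f 0) \<le> 2 * B / \<rho>"
proof -
  have cauchy: "norm ((deriv ^^ n) f w) \<le> fact n * B / (\<rho> / 2) ^ n" if w: "norm w \<le> 1" for w n
  proof (rule Cauchy_inequality)
    have sub: "cball w (\<rho> / 2) \<subseteq> ball 0 \<rho>"
    proof
      fix z assume "z \<in> cball w (\<rho> / 2)"
      then have "norm (z - w) \<le> \<rho> / 2" by (simp add: dist_norm norm_minus_commute)
      then have "norm z \<le> 1 + \<rho> / 2" using w norm_triangle_sub[of z w] by linarith
      then show "z \<in> ball 0 \<rho>" using \<rho> by simp
    qed
    show "f holomorphic_on ball w (\<rho> / 2)" using hol sub ball_subset_cball holomorphic_on_subset by blast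
    show "continuous_on (cball w (\<rho> / 2)) f" using holomorphic_on_imp_continuous_on[OF hol] sub continuous_on_subset by blast
    show "0 < \<rho> / 2" using \<rho> by simp
    fix x assume "norm (w - x) = \<rho> / 2"
    then show "norm (f x) \<le> B" by (intro B subsetD[OF sub]) (simp add: dist_norm)
  qed
  show "norm (deriv f 0) \<le> 2 * B / \<rho>" using cauchy[of 0 1] by (simp add: mult.commute)
  have "norm (f 1 - (\<Sum>i\<le>1. (deriv ^^ i) f 0 * (1 - 0) ^ i / fact i)) \<le> (8 * B / \<rho>\<^sup>2) * norm (1 - 0 :: complex) ^ Suc 1 / fact 1"
  proof (rule order_trans[OF complex_Taylor[of "cball 0 1" 1 "\<lambda>i. (deriv ^^ i) f" "8 * B / \<rho>\<^sup>2" 0 1, unfolded funpow_0]])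
    fix i and z :: complex assume z: "z \<in> cball 0 1"
    have "z \<in> ball 0 \<rho>" using z \<rho> by simp
    from has_field_derivative_higher_deriv[OF hol open_ball this, of i]
    show "((deriv ^^ i) f has_field_derivative (deriv ^^ Suc i) f z) (at z within cball 0 1)"
      by (rule has_field_derivative_at_within)
    show "norm ((deriv ^^ Suc 1) f z) \<le> 8 * B / \<rho>\<^sup>2"
      using cauchy[of z 2] z by (simp add: power2_eq_square numeral_2_eq_2)
  qed auto
  then show "norm (f 1 - f 0 - deriv f 0) \<le> 8 * B / \<rho>\<^sup>2" by (simp add: diff_diff_eq add.commute)
qed

lemma norm_integral_le:
  fixes f :: "'a \<Rightarrow> complex"
  assumes "integrable M f" "integrable M g" "\<And>x. x \<in> space M \<Longrightarrow> norm (f x) \<le> g x"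
  shows "norm (LINT x|M. f x) \<le> (LINT x|M. g x)"
  by (rule order_trans[OF integral_norm_bound integral_mono[OF integrable_norm[OF assms(1)] assms(2,3)]])

text \<open>A locally dominated integral of holomorphic functions is holomorphic: on the complex
  line through \<open>l0 + h\<close>, scaled to give \<open>h\<close> the parameter
  \<open>1\<close>, the integrand is holomorphic on a disc of radius \<open>\<rho> = r /
  \<bar>h\<bar>\<close>, so that the second order remainder of the integrand is dominated by a
  multiple of \<open>g\<close> times \<open>\<bar>h\<bar>\<^sup>2\<close>.\<close>

lemma holomorphic_integral:
  fixes \<Phi> :: "complex^'n \<Rightarrow> 'a \<Rightarrow> complex"
  assumes hol: "\<And>x. x \<in> space M \<Longrightarrow> holomorphic_several_on (\<lambda>l. \<Phi> l x) (ball l0 r)" and r: "0 < r"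
    and meas: "\<And>l. l \<in> ball l0 r \<Longrightarrow> \<Phi> l \<in> borel_measurable M"
    and bound: "\<And>l x. l \<in> ball l0 r \<Longrightarrow> x \<in> space M \<Longrightarrow> norm (\<Phi> l x) \<le> g x" and g: "integrable M g"
  shows "\<exists>D. ((\<lambda>l. LINT x|M. \<Phi> l x) has_derivative D) (at l0) \<and> (\<forall>c v. D (c *s v) = c * D v)"
proof -
  have l0: "l0 \<in> ball l0 r" using r by simp
  have "\<forall>x. \<exists>D. x \<in> space M \<longrightarrow> ((\<lambda>l. \<Phi> l x) has_derivative D) (at l0) \<and> (\<forall>c v. D (c *s v) = c * D v)"
    using hol l0 unfolding holomorphic_several_on_def by blast
  then have "\<exists>D. \<forall>x. x \<in> space M \<longrightarrow> ((\<lambda>l. \<Phi> l x) has_derivative D x) (at l0) \<and> (\<forall>c v. D x (c *s v) = c * D x v)"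
    by (rule choice)
  then obtain D where D: "\<And>x. x \<in> space M \<Longrightarrow> ((\<lambda>l. \<Phi> l x) has_derivative D x) (at l0)"
    "\<And>x c v. x \<in> space M \<Longrightarrow> D x (c *s v) = c * D x v"
    by blast
  have g0: "0 \<le> g x" if "x \<in> space M" for x using bound[OF l0 that] norm_ge_zero order_trans by blast
  have rem: "norm (\<Phi> (l0 + v) x - \<Phi> l0 x - D x v) \<le> 8 * g x * (norm v)\<^sup>2 / r\<^sup>2" "norm (D x v) \<le> 2 * g x * norm v / r"
    if x: "x \<in> space M" and v: "norm v \<le> r / 4" for x v
  proof -
    show "norm (\<Phi> (l0 + v) x - \<Phi> l0 x - D x v) \<le> 8 * g x * (norm v)\<^sup>2 / r\<^sup>2" "norm (D x v) \<le> 2 * g x * norm v / r"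
    proof (atomize(full), cases "v = 0")
      case True
      have "D x 0 = 0" using D(2)[OF x, of 0 0] by simp
      then show "norm (\<Phi> (l0 + v) x - \<Phi> l0 x - D x v) \<le> 8 * g x * (norm v)\<^sup>2 / r\<^sup>2 \<and> norm (D x v) \<le> 2 * g x * norm v / r"
        using True by simp
    next
      case False
      let ?f = "\<lambda>z. \<Phi> (l0 + z *s v) x" and ?\<rho> = "r / norm v"
      have ball: "l0 + z *s v \<in> ball l0 r" if "z \<in> ball 0 ?\<rho>" for z
        using that False by (simp add: dist_norm norm_vector_scalar less_divide_eq)
      have "?f holomorphic_on ball 0 ?\<rho>"
        by (rule holomorphic_on_subset[OF holomorphic_on_line(1)[OF hol[OF x]]]) (use ball in auto)
      moreover have "4 \<le> ?\<rho>" using v False by (simp add: le_divide_eq)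
      moreover have "norm (?f z) \<le> g x" if "z \<in> ball 0 ?\<rho>" for z using bound[OF ball[OF that] x] .
      ultimately have "norm (?f 1 - ?f 0 - deriv ?f 0) \<le> 8 * g x / ?\<rho>\<^sup>2 \<and> norm (deriv ?f 0) \<le> 2 * g x / ?\<rho>"
        using quadratic_remainder by blast
      moreover have "deriv ?f 0 = D x v" by (rule holomorphic_on_line(2)[OF hol[OF x] l0 D(1)[OF x]])
      ultimately show "norm (\<Phi> (l0 + v) x - \<Phi> l0 x - D x v) \<le> 8 * g x * (norm v)\<^sup>2 / r\<^sup>2 \<and> norm (D x v) \<le> 2 * g x * norm v / r"
        by (simp add: power_divide)
    qed
  qed
  have blin: "bounded_linear (D x)" if "x \<in> space M" for x using D(1)[OF that] has_derivative_bounded_linear by blast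
  have \<Phi>i: "integrable M (\<Phi> l)" if "l \<in> ball l0 r" for l
    by (rule Bochner_Integration.integrable_bound[OF g meas[OF that]])
      (use bound[OF that] g0 in \<open>auto intro!: AE_I2\<close>)
  have Dm: "(\<lambda>x. D x v) \<in> borel_measurable M" for v
  proof (rule borel_measurable_LIMSEQ_metric)
    define s where "s = (r / 2) / (1 + norm v)"
    have s: "0 < s" using r by (simp add: s_def add_pos_nonneg)
    define e where "e k = s * inverse (real (Suc k))" for k
    have e: "0 < e k" for k using s by (simp add: e_def)
    have elim: "e \<longlonglongrightarrow> 0" unfolding e_def by (rule tendsto_mult_right_zero[OF LIMSEQ_inverse_real_of_nat])
    have inb: "l0 + e k *\<^sub>R v \<in> ball l0 r" for k
    proof -
      have "inverse (real (Suc k)) \<le> 1" by (rule inverse_le_1_iff[THEN iffD2]) simp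
      then have "s * inverse (real (Suc k)) \<le> s * 1" using s by (intro mult_left_mono) auto
      then have "e k * norm v \<le> s * norm v" unfolding e_def by (intro mult_right_mono) auto
      also have "s * norm v \<le> s * (1 + norm v)" using s by (intro mult_left_mono) auto
      also have "\<dots> = r / 2"
      proof -
        have "1 + norm v \<noteq> 0" using norm_ge_zero[of v] by linarith
        from nonzero_eq_divide_eq[OF this, of s "r / 2"] show ?thesis unfolding s_def by blast
      qed
      finally show ?thesis using r e[of k] by (simp add: dist_norm)
    qed
    show "(\<lambda>x. (\<Phi> (l0 + e k *\<^sub>R v) x - \<Phi> l0 x) / of_real (e k)) \<in> borel_measurable M" for k
      using meas[OF inb] meas[OF l0] by measurable
    fix x assume x: "x \<in> space M"
    have "((\<lambda>t. \<Phi> (l0 + t *\<^sub>R v) x) has_derivative (\<lambda>h. D x (h *\<^sub>R v))) (at 0)"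
    proof -
      have "((\<lambda>t. l0 + t *\<^sub>R v) has_derivative (\<lambda>h. h *\<^sub>R v)) (at 0)" by (auto intro!: derivative_eq_intros)
      from diff_chain_at[OF this, of "\<lambda>l. \<Phi> l x" "D x"] D(1)[OF x] show ?thesis by (simp add: o_def)
    qed
    then have 1: "((\<lambda>h. norm (\<Phi> (l0 + h *\<^sub>R v) x - \<Phi> l0 x - D x (h *\<^sub>R v)) / norm h) \<longlongrightarrow> 0) (at 0)"
      unfolding has_derivative_at by simp
    have "filterlim e (at 0) sequentially"
      by (rule filterlim_atI[OF elim]) (use e in \<open>auto intro!: always_eventually simp: less_imp_neq[symmetric]\<close>)
    from filterlim_compose[OF 1 this]
    have "(\<lambda>k. norm (\<Phi> (l0 + e k *\<^sub>R v) x - \<Phi> l0 x - D x (e k *\<^sub>R v)) / norm (e k)) \<longlonglongrightarrow> 0" .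
    moreover have "norm (\<Phi> (l0 + e k *\<^sub>R v) x - \<Phi> l0 x - D x (e k *\<^sub>R v)) / norm (e k) =
       norm ((\<Phi> (l0 + e k *\<^sub>R v) x - \<Phi> l0 x) / of_real (e k) - D x v)" for k
    proof -
      have "D x (e k *\<^sub>R v) = of_real (e k) * D x v"
        using linear_cmul[OF bounded_linear.linear[OF blin[OF x]]] by (simp add: scaleR_conv_of_real)
      then have "(\<Phi> (l0 + e k *\<^sub>R v) x - \<Phi> l0 x) / of_real (e k) - D x v = (\<Phi> (l0 + e k *\<^sub>R v) x - \<Phi> l0 x - D x (e k *\<^sub>R v)) / of_real (e k)"
        using e[of k] by (simp add: field_simps)
      then show ?thesis by (simp only: norm_divide norm_of_real real_norm_def)
    qed
    ultimately have "(\<lambda>k. norm ((\<Phi> (l0 + e k *\<^sub>R v) x - \<Phi> l0 x) / of_real (e k) - D x v)) \<longlonglongrightarrow> 0" by (simp only:)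
    from tendsto_norm_zero_cancel[OF this]
    show "(\<lambda>k. (\<Phi> (l0 + e k *\<^sub>R v) x - \<Phi> l0 x) / of_real (e k)) \<longlonglongrightarrow> D x v" by (rule LIM_zero_cancel)
  qed
  have Di: "integrable M (\<lambda>x. D x v)" for v
  proof -
    define s where "s = (r / 4) / (1 + norm v)"
    have s: "0 < s" using r by (simp add: s_def add_pos_nonneg)
    have sv: "norm (s *\<^sub>R v) \<le> r / 4"
      using r s by (simp add: s_def divide_le_eq add_pos_nonneg mult_left_mono)
    define c where "c = 2 * norm (s *\<^sub>R v) / r / s"
    have bd: "norm (D x v) \<le> c * g x" if x: "x \<in> space M" for x
    proof -
      have "s * norm (D x v) = norm (D x (s *\<^sub>R v))"
        using linear_cmul[OF bounded_linear.linear[OF blin[OF x]]] s by simp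
      also have "\<dots> \<le> 2 * g x * norm (s *\<^sub>R v) / r" by (rule rem(2)[OF x sv])
      finally have "norm (D x v) \<le> (2 * g x * norm (s *\<^sub>R v) / r) / s"
        using s by (simp only: pos_le_divide_eq mult.commute)
      then show ?thesis by (simp add: c_def mult_ac)
    qed
    show ?thesis
    proof (rule Bochner_Integration.integrable_bound[OF integrable_mult_right[OF g, of c] Dm], rule AE_I2)
      show "norm (D x v) \<le> norm (c * g x)" if "x \<in> space M" for x
        unfolding real_norm_def by (rule order_trans[OF bd[OF that] abs_ge_self])
    qed
  qed
  let ?I = "\<lambda>l. LINT x|M. \<Phi> l x" and ?D = "\<lambda>v. LINT x|M. D x v"
  have linD: "linear ?D"
  proof (rule linearI)
    show "?D (v + w) = ?D v + ?D w" for v w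
    proof -
      have "?D (v + w) = (LINT x|M. D x v + D x w)"
        by (rule Bochner_Integration.integral_cong[OF refl]) (use linear_add[OF bounded_linear.linear[OF blin]] in auto)
      then show ?thesis using Di by simp
    qed
    show "?D (a *\<^sub>R v) = a *\<^sub>R ?D v" for a v
    proof -
      have "?D (a *\<^sub>R v) = (LINT x|M. a *\<^sub>R D x v)"
        by (rule Bochner_Integration.integral_cong[OF refl]) (use linear_cmul[OF bounded_linear.linear[OF blin]] in auto)
      then show ?thesis using Di by simp
    qed
  qed
  have "(?I has_derivative ?D) (at l0)"
    unfolding has_derivative_at
  proof
    show "bounded_linear ?D" using linD linear_conv_bounded_linear by blast
    let ?G = "LINT x|M. g x"
    show "((\<lambda>h. norm (?I (l0 + h) - ?I l0 - ?D h) / norm h) \<longlongrightarrow> 0) (at 0)"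
    proof (rule tendsto_sandwich[OF _ _ tendsto_const])
      show "\<forall>\<^sub>F h in at 0. 0 \<le> norm (?I (l0 + h) - ?I l0 - ?D h) / norm h" by simp
      show "\<forall>\<^sub>F h in at 0. norm (?I (l0 + h) - ?I l0 - ?D h) / norm h \<le> (8 * ?G / r\<^sup>2) * norm h"
        unfolding eventually_at
      proof (intro exI[of _ "r / 4"] conjI ballI impI)
        fix h :: "complex^'n" assume "h \<noteq> 0 \<and> dist h 0 < r / 4"
        then have h: "h \<noteq> 0" "norm h \<le> r / 4" by (auto simp: dist_norm)
        have inb: "l0 + h \<in> ball l0 r" using h r by (simp add: dist_norm)
        have "?I (l0 + h) - ?I l0 - ?D h = (LINT x|M. \<Phi> (l0 + h) x - \<Phi> l0 x - D x h)"
          using \<Phi>i[OF inb] \<Phi>i[OF l0] Di by simp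
        also have "norm \<dots> \<le> (LINT x|M. 8 * g x * (norm h)\<^sup>2 / r\<^sup>2)"
        proof (rule norm_integral_le)
          show "integrable M (\<lambda>x. \<Phi> (l0 + h) x - \<Phi> l0 x - D x h)"
            by (intro Bochner_Integration.integrable_diff \<Phi>i inb l0 Di)
          show "integrable M (\<lambda>x. 8 * g x * (norm h)\<^sup>2 / r\<^sup>2)"
            by (intro integrable_divide_zero integrable_mult_left integrable_mult_right impI g)
        qed (rule rem(1)[OF _ h(2)])
        also have "\<dots> = (8 * ?G / r\<^sup>2 * norm h) * norm h" by (simp add: power2_eq_square)
        finally show "norm (?I (l0 + h) - ?I l0 - ?D h) / norm h \<le> 8 * ?G / r\<^sup>2 * norm h"
          using h(1) by (simp add: divide_le_eq)
      qed (use r in simp)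
      show "((\<lambda>h. (8 * ?G / r\<^sup>2) * norm h) \<longlongrightarrow> 0) (at 0)"
        by (rule tendsto_mult_right_zero[OF tendsto_norm_zero[OF tendsto_ident_at]])
    qed
  qed
  moreover have "?D (c *s v) = c * ?D v" for c v
  proof -
    have "?D (c *s v) = (LINT x|M. c * D x v)"
      by (rule Bochner_Integration.integral_cong[OF refl]) (use D(2) in auto)
    then show ?thesis by simp
  qed
  ultimately show ?thesis by blast
qed

section \<open>The continued integral\<close>

lemma smooth_on_gain_op: "smooth_on GL F \<Longrightarrow> smooth_on GL (gain_op F)"
  unfolding gain_op_def[abs_def]
  by (intro smooth_on_diff smooth_on_add smooth_on_mult smooth_on_sum smooth_on_const open_GL sym.smooth_field
      symbol_smooth[OF symbol_multiplier] symbol_smooth[OF symbol_frame_div] symbol_smooth[OF symbol_inverse_gauge_sum])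

lemma smooth_on_gain_op_pow: "smooth_on GL F \<Longrightarrow> smooth_on GL ((gain_op ^^ M) F)"
  by (induction M) (auto intro: smooth_on_gain_op)

lemma gain_op_cong:
  fixes F G :: "real^'n::_^'n::{finite,wellorder} \<Rightarrow> complex"
  assumes "smooth_on GL F" "\<And>x. x \<in> GL \<Longrightarrow> F x = G x" "x \<in> GL"
  shows "gain_op F x = gain_op G x"
proof -
  have "vf_deriv (borel_field cd) (\<lambda>x. multiplier cd x * F x) x = vf_deriv (borel_field cd) (\<lambda>x. multiplier cd x * G x) x" for cd
  proof (rule vf_deriv_cong[OF open_GL assms(3)])
    show "(\<lambda>x. multiplier cd x * F x) differentiable at x"
      by (rule smooth_on_imp_differentiable[OF smooth_on_mult[OF open_GL symbol_smooth[OF symbol_multiplier] assms(1)] assms(3)])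
  qed (simp add: assms(2))
  then show ?thesis using assms(2)[OF assms(3)] by (simp add: gain_op_def)
qed

lemma gain_op_lincomb:
  fixes F G :: "real^'n::_^'n::{finite,wellorder} \<Rightarrow> complex"
  assumes "smooth_on GL F" "smooth_on GL G" "x \<in> GL"
  shows "gain_op (\<lambda>x. c * F x + G x) x = c * gain_op F x + gain_op G x"
proof -
  have d: "(\<lambda>x. multiplier cd x * F x) differentiable at x" "(\<lambda>x. multiplier cd x * G x) differentiable at x" for cd
    by (intro smooth_on_imp_differentiable[OF smooth_on_mult[OF open_GL symbol_smooth[OF symbol_multiplier]] assms(3)] assms)+
  have dc: "(\<lambda>x. c) differentiable at x" by simp
  have "vf_deriv (borel_field cd) (\<lambda>x. multiplier cd x * (c * F x + G x)) x =
     c * vf_deriv (borel_field cd) (\<lambda>x. multiplier cd x * F x) x + vf_deriv (borel_field cd) (\<lambda>x. multiplier cd x * G x) x" for cd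
  proof -
    have "(\<lambda>x. multiplier cd x * (c * F x + G x)) = (\<lambda>x. c * (multiplier cd x * F x) + multiplier cd x * G x)"
      by (simp add: fun_eq_iff algebra_simps)
    moreover have "vf_deriv (borel_field cd) (\<lambda>x. c) x = 0"
      by (simp add: vf_deriv_def)
    ultimately show ?thesis
      using vf_deriv_add[OF differentiable_mult[OF dc d(1)] d(2)] vf_deriv_mult[OF dc d(1)] by simp
  qed
  then show ?thesis
    by (simp add: gain_op_def sum.distrib sum_distrib_left algebra_simps)
qed

lemma gain_op_pow_lincomb:
  fixes F G :: "real^'n::_^'n::{finite,wellorder} \<Rightarrow> complex"
  assumes F: "smooth_on GL F" and G: "smooth_on GL G" and x: "x \<in> GL"
  shows "(gain_op ^^ M) (\<lambda>x. c * F x + G x) x = c * (gain_op ^^ M) F x + (gain_op ^^ M) G x"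
  using x
proof (induction M arbitrary: x)
  case (Suc M)
  have "smooth_on GL (\<lambda>x. c * F x + G x)" by (intro smooth_on_add smooth_on_mult smooth_on_const open_GL F G)
  from gain_op_cong[OF smooth_on_gain_op_pow[OF this] Suc.IH Suc.prems]
  have "(gain_op ^^ Suc M) (\<lambda>x. c * F x + G x) x = gain_op (\<lambda>x. c * (gain_op ^^ M) F x + (gain_op ^^ M) G x) x" by simp
  also have "\<dots> = c * gain_op ((gain_op ^^ M) F) x + gain_op ((gain_op ^^ M) G) x"
    by (rule gain_op_lincomb[OF smooth_on_gain_op_pow[OF F] smooth_on_gain_op_pow[OF G] Suc.prems])
  finally show ?case by simp
qed simp

lemma param_norm_nonneg: "0 \<le> param_norm lam" by (simp add: param_norm_def sum_nonneg)

text \<open>Both the exponent and the constant are uniform on bounded sets of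
  \<open>\<lambda>\<close>.\<close>

lemma norm_torus_char_le_gauge:
  "\<exists>A\<ge>0. \<forall>lam. \<forall>n\<in>unipotent_upper. param_norm lam \<le> R \<longrightarrow>
     norm (torus_char lam (n :: real^'n::_^'n::{finite,wellorder})) \<le> A * hgauge n powr (real CARD('n) * real CARD('n) * R)"
proof -
  let ?K = "real CARD('n)"
  obtain C where C: "1 \<le> C" "\<And>n :: real^'n::_^'n::{finite,wellorder}. n \<in> unipotent_upper \<Longrightarrow> entry_norm n \<le> C * hgauge n powr ?K"
    using entry_norm_le_gauge by blast
  have "norm (torus_char lam n) \<le> C powr (?K * R) * hgauge n powr (?K * ?K * R)"
    if n: "n \<in> unipotent_upper" and R: "param_norm lam \<le> R" for lam and n :: "real^'n::_^'n::{finite,wellorder}"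
  proof -
    have R0: "0 \<le> ?K * R" using R param_norm_nonneg[of lam] by simp
    have "norm (torus_char lam n) \<le> entry_norm n powr (?K * param_norm lam)" by (rule norm_torus_char_le[OF n])
    also have "\<dots> \<le> entry_norm n powr (?K * R)" using entry_norm_ge1[of n] R by (intro powr_mono mult_left_mono) auto
    also have "\<dots> \<le> (C * hgauge n powr ?K) powr (?K * R)" using C(2)[OF n] entry_norm_ge1[of n] R0 by (intro powr_mono2) auto
    also have "\<dots> = C powr (?K * R) * hgauge n powr (?K * ?K * R)"
      using C(1) by (simp add: powr_mult powr_powr mult.assoc)
    finally show ?thesis .
  qed
  then show ?thesis by (intro exI[of _ "C powr (?K * R)"]) auto
qed

text \<open>The combined estimate on which everything below rests: linear in the size
  \<open>B\<close> of \<open>f\<close> on \<open>O(r)\<close> and polynomial in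
  \<open>\<lambda>\<close>. One derivative is kept in reserve for the integration by parts.\<close>

lemma pos_equivariant_gain_op_gain:
  "\<exists>C\<ge>0. \<forall>lam B A e. \<forall>f :: real^'n::_^'n::{finite,wellorder} \<Rightarrow> complex. pos_equivariant lam f \<longrightarrow> left.bounded_by (Suc M) (\<lambda>_. B) f \<longrightarrow>
     (\<forall>n\<in>unipotent_upper. norm (torus_char lam (n :: real^'n::_^'n::{finite,wellorder})) \<le> A * hgauge n powr e) \<longrightarrow>
     sym.bounded_by 1 (\<lambda>n. (C * (1 + param_norm lam) ^ Suc M * A * B) * hgauge n powr (e - real M)) ((gain_op ^^ M) f)"
proof -
  obtain C1 where C1: "0 \<le> C1" "\<And>\<alpha> F. sym.bounded_by (1 + M) \<alpha> F \<Longrightarrow> sym.bounded_by 1 (\<lambda>x. C1 * (\<alpha> x * hgauge x powr - real M)) ((gain_op ^^ M) (F :: real^'n::_^'n::{finite,wellorder} \<Rightarrow> complex))"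
    using gain_op_gain[of 1 M] by blast
  obtain C2 where C2: "0 \<le> C2" "\<And>lam B f. pos_equivariant lam f \<Longrightarrow> left.bounded_by (Suc M) (\<lambda>_. B) f \<Longrightarrow>
     sym.bounded_by (Suc M) (\<lambda>n. C2 * (1 + param_norm lam) ^ Suc M * B * norm (torus_char lam n)) (f :: real^'n::_^'n::{finite,wellorder} \<Rightarrow> complex)"
    using pos_equivariant_symbol[of "Suc M"] by blast
  have "sym.bounded_by 1 (\<lambda>n. (C1 * C2 * (1 + param_norm lam) ^ Suc M * A * B) * hgauge n powr (e - real M)) ((gain_op ^^ M) f)"
    if f: "pos_equivariant lam f" and b: "left.bounded_by (Suc M) (\<lambda>_. B) f"
      and a: "\<forall>n\<in>unipotent_upper. norm (torus_char lam (n :: real^'n::_^'n::{finite,wellorder})) \<le> A * hgauge n powr e"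
    for lam B A e and f :: "real^'n::_^'n::{finite,wellorder} \<Rightarrow> complex"
  proof (rule sym.bounded_by_mono[OF C1(2)])
    show "sym.bounded_by (1 + M) (\<lambda>n. C2 * (1 + param_norm lam) ^ Suc M * B * norm (torus_char lam n)) f" using C2(2)[OF f b] by simp
    fix n :: "real^'n::_^'n::{finite,wellorder}" assume n: "n \<in> unipotent_upper"
    have "mat 1 \<in> (orthogonal_group :: (real^'n::_^'n::{finite,wellorder}) set)"
      by (simp add: orthogonal_group_def orthogonal_matrix_id)
    then have B0: "0 \<le> B" using left.bounded_by_nonneg[OF b] by blast
    let ?c = "C2 * (1 + param_norm lam) ^ Suc M * B"
    have c0: "0 \<le> ?c" using C2(1) B0 param_norm_nonneg[of lam] by simp
    have "C1 * (?c * norm (torus_char lam n) * hgauge n powr - real M) \<le> C1 * (?c * (A * hgauge n powr e) * hgauge n powr - real M)"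
      using a n c0 C1(1) by (intro mult_left_mono mult_right_mono) auto
    also have "\<dots> = C1 * ?c * A * (hgauge n powr e * hgauge n powr - real M)" by (simp only: mult_ac)
    also have "hgauge n powr e * hgauge n powr - real M = hgauge n powr (e - real M)" by (simp add: powr_add[symmetric])
    finally show "C1 * (?c * norm (torus_char lam n) * hgauge n powr - real M) \<le> (C1 * C2 * (1 + param_norm lam) ^ Suc M * A * B) * hgauge n powr (e - real M)"
      by (simp only: mult_ac)
  qed
  moreover have "0 \<le> C1 * C2" using C1(1) C2(1) by simp
  ultimately show ?thesis by blast
qed

lemma pos_equivariant_smooth: "pos_equivariant lam f \<Longrightarrow> smooth_on GL f" by (simp add: pos_equivariant_def)

context haar_unipotent
begin

text \<open>One exponent that serves for absolute convergence and for the integration by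
  parts.\<close>

lemma integrable_order:
  "\<exists>Q>0. (\<exists>g. integrable dn g \<and> (\<forall>n\<in>unipotent_upper. hgauge (n :: real^'n::_^'n::{finite,wellorder}) powr - Q \<le> g n)) \<and>
     (\<forall>f C. sym.bounded_by 1 (\<lambda>n. C * hgauge n powr - Q) f \<longrightarrow>
       integrable dn (\<lambda>n. psi n * f n) \<and> integrable dn (\<lambda>n. psi n * gain_op f n) \<and>
       (LINT n|dn. psi n * f n) = (LINT n|dn. psi n * gain_op f n))"
proof -
  obtain Q0 where Q0: "0 < Q0" "\<And>f C. sym.bounded_by 1 (\<lambda>n. C * hgauge n powr - Q0) f \<Longrightarrow>
       integrable dn (\<lambda>n. psi n * f n) \<and> integrable dn (\<lambda>n. psi n * gain_op f n) \<and>
       (LINT n|dn. psi n * f n) = (LINT n|dn. psi n * gain_op f n)"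
    using integral_psi_gain_op by blast
  obtain Q1 Q2 B where Q1: "0 < Q1" "integrable dn (\<lambda>n. entry_norm n powr - Q1)" and Q2: "0 < Q2" "0 \<le> B"
      "\<And>n :: real^'n::_^'n::{finite,wellorder}. n \<in> unipotent_upper \<Longrightarrow> hgauge n powr - Q2 \<le> B * entry_norm n powr - Q1"
    using hgauge_decay by blast
  let ?Q = "max Q0 Q2"
  have "hgauge n powr - ?Q \<le> B * entry_norm n powr - Q1" if "n \<in> unipotent_upper" for n :: "real^'n::_^'n::{finite,wellorder}"
    by (rule order_trans[OF hgauge_powr_mono Q2(3)[OF that]]) simp
  moreover have "integrable dn (\<lambda>n. B * entry_norm n powr - Q1)" using Q1(2) by simp
  moreover have "sym.bounded_by 1 (\<lambda>n. C * hgauge n powr - Q0) f" if f: "sym.bounded_by 1 (\<lambda>n. C * hgauge n powr - ?Q) f"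
    for C and f :: "real^'n::_^'n::{finite,wellorder} \<Rightarrow> complex"
  proof (rule sym.bounded_by_mono[OF f])
    fix n :: "real^'n::_^'n::{finite,wellorder}" assume "n \<in> unipotent_upper"
    from sym.bounded_by_nonneg[OF f this] have "0 \<le> C"
      using hgauge_pos[of n] by (simp add: zero_le_mult_iff powr_eq_0_iff)
    then show "C * hgauge n powr - ?Q \<le> C * hgauge n powr - Q0"
      by (intro mult_left_mono hgauge_powr_mono) simp_all
  qed
  moreover have "0 < ?Q" using Q0(1) by simp
  ultimately show ?thesis using Q0(2) by blast
qed

definition decay_order :: real where
  "decay_order = (SOME Q. 0 < Q \<and> (\<exists>g. integrable dn g \<and> (\<forall>n\<in>unipotent_upper. hgauge (n :: real^'n::_^'n::{finite,wellorder}) powr - Q \<le> g n)) \<and>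
     (\<forall>f C. sym.bounded_by 1 (\<lambda>n. C * hgauge n powr - Q) f \<longrightarrow>
       integrable dn (\<lambda>n. psi n * f n) \<and> integrable dn (\<lambda>n. psi n * gain_op f n) \<and>
       (LINT n|dn. psi n * f n) = (LINT n|dn. psi n * gain_op f n)))"

lemma decay_order:
  "0 < decay_order"
  "\<exists>g. integrable dn g \<and> (\<forall>n\<in>unipotent_upper. hgauge (n :: real^'n::_^'n::{finite,wellorder}) powr - decay_order \<le> g n)"
  "sym.bounded_by 1 (\<lambda>n. C * hgauge n powr - decay_order) f \<Longrightarrow> integrable dn (\<lambda>n. psi n * f n)"
  "sym.bounded_by 1 (\<lambda>n. C * hgauge n powr - decay_order) f \<Longrightarrow> (LINT n|dn. psi n * f n) = (LINT n|dn. psi n * gain_op f n)"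
  using someI_ex[OF integrable_order, folded decay_order_def] by blast+

text \<open>The candidate for the continuation after \<open>M\<close> integrations by parts.\<close>

definition gained_integral :: "nat \<Rightarrow> (real^'n::_^'n::{finite,wellorder} \<Rightarrow> complex) \<Rightarrow> complex" where
  "gained_integral M f = (LINT n|dn. psi n * (gain_op ^^ M) f n)"

text \<open>The exponent \<open>e\<close> is kept general: it is \<open>growth lam\<close> for
  arbitrary parameters and negative in the region of absolute convergence.\<close>

lemma gained_integral_step:
  assumes f: "pos_equivariant lam f" and a: "\<forall>n\<in>unipotent_upper. norm (torus_char lam (n :: real^'n::_^'n::{finite,wellorder})) \<le> A * hgauge n powr e"
    and M: "e + decay_order \<le> real M"
  shows "integrable dn (\<lambda>n. psi n * (gain_op ^^ M) f n)" "gained_integral (Suc M) f = gained_integral M f"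
proof -
  obtain B where B: "left.bounded_by (Suc M) (\<lambda>_. B) f" using left_bounded_by_exists[OF pos_equivariant_smooth[OF f]] by blast
  obtain C where C: "sym.bounded_by 1 (\<lambda>n. C * hgauge n powr (e - real M)) ((gain_op ^^ M) f)"
    using pos_equivariant_gain_op_gain[of M] f a B by blast
  have s: "sym.bounded_by 1 (\<lambda>n. C * hgauge n powr - decay_order) ((gain_op ^^ M) f)"
  proof (rule sym.bounded_by_mono[OF C])
    fix n :: "real^'n::_^'n::{finite,wellorder}" assume "n \<in> unipotent_upper"
    from sym.bounded_by_nonneg[OF C this] have "0 \<le> C"
      using hgauge_pos[of n] by (simp add: zero_le_mult_iff powr_eq_0_iff)
    then show "C * hgauge n powr (e - real M) \<le> C * hgauge n powr - decay_order" using M by (intro mult_left_mono hgauge_powr_mono) simp_all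
  qed
  show "integrable dn (\<lambda>n. psi n * (gain_op ^^ M) f n)" by (rule decay_order(3)[OF s])
  show "gained_integral (Suc M) f = gained_integral M f" using decay_order(4)[OF s] by (simp add: gained_integral_def)
qed

lemma gained_integral_stable:
  assumes f: "pos_equivariant lam f" and a: "\<forall>n\<in>unipotent_upper. norm (torus_char lam (n :: real^'n::_^'n::{finite,wellorder})) \<le> A * hgauge n powr e"
    and M: "e + decay_order \<le> real M" and le: "M \<le> M'"
  shows "gained_integral M' f = gained_integral M f"
  using le
proof (induction M' rule: dec_induct)
  case (step k)
  then have "e + decay_order \<le> real k" using M by linarith
  from gained_integral_step(2)[OF f a this] show ?case using step by simp
qed simp

text \<open>The exponent of the gauge that bounds the Iwasawa character.\<close>

definition growth :: "complex^'n::{finite,wellorder} \<Rightarrow> real" where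
  "growth lam = real CARD('n) * real CARD('n) * param_norm lam"

text \<open>The number of integrations by parts depends on \<open>\<lambda>\<close> and jumps; by
  \<open>gained_integral_stable\<close> the value of the integral does not notice this.\<close>

definition gain_count :: "complex^'n::{finite,wellorder} \<Rightarrow> nat" where
  "gain_count lam = nat \<lceil>growth lam + decay_order\<rceil>"

definition continued_integral :: "complex^'n::{finite,wellorder} \<Rightarrow> (real^'n::_^'n::{finite,wellorder} \<Rightarrow> complex) \<Rightarrow> complex" where
  "continued_integral lam f = gained_integral (gain_count lam) f"

lemma growth_bound:
  "\<exists>A\<ge>0. \<forall>n\<in>unipotent_upper. norm (torus_char lam (n :: real^'n::_^'n::{finite,wellorder})) \<le> A * hgauge n powr growth lam"
  unfolding growth_def using norm_torus_char_le_gauge[of "param_norm lam"] by blast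

lemma growth_le_gain_count: "growth lam + decay_order \<le> real (gain_count lam)"
  unfolding gain_count_def by (rule real_nat_ceiling_ge)

lemma continued_integral_eq:
  assumes f: "pos_equivariant lam f" and M: "growth lam + decay_order \<le> real M"
  shows "continued_integral lam f = gained_integral M f" "integrable dn (\<lambda>n. psi n * (gain_op ^^ M) f n)"
proof -
  obtain A where A: "\<forall>n\<in>unipotent_upper. norm (torus_char lam (n :: real^'n::_^'n::{finite,wellorder})) \<le> A * hgauge n powr growth lam"
    using growth_bound by blast
  have "gain_count lam \<le> M" using M unfolding gain_count_def by linarith
  from gained_integral_stable[OF f A growth_le_gain_count this] show "continued_integral lam f = gained_integral M f" by (simp add: continued_integral_def)
  show "integrable dn (\<lambda>n. psi n * (gain_op ^^ M) f n)" by (rule gained_integral_step(1)[OF f A M])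
qed

lemma continued_integral_lincomb:
  assumes f: "pos_equivariant lam f" and h: "pos_equivariant lam h"
  shows "continued_integral lam (\<lambda>x. c * f x + h x) = c * continued_integral lam f + continued_integral lam h"
proof -
  let ?M = "gain_count lam"
  have "continued_integral lam (\<lambda>x. c * f x + h x) = (LINT n|dn. c * (psi n * (gain_op ^^ ?M) f n) + psi n * (gain_op ^^ ?M) h n)"
    unfolding continued_integral_def gained_integral_def
  proof (rule Bochner_Integration.integral_cong[OF refl])
    fix n :: "real^'n::_^'n::{finite,wellorder}" assume "n \<in> space dn"
    then have "n \<in> GL" using unipotent_GL by (simp add: space_dn)
    from gain_op_pow_lincomb[OF pos_equivariant_smooth[OF f] pos_equivariant_smooth[OF h] this]
    show "psi n * (gain_op ^^ ?M) (\<lambda>x. c * f x + h x) n = c * (psi n * (gain_op ^^ ?M) f n) + psi n * (gain_op ^^ ?M) h n"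
      by (simp add: algebra_simps)
  qed
  also have "\<dots> = c * continued_integral lam f + continued_integral lam h"
    using continued_integral_eq(2)[OF f growth_le_gain_count] continued_integral_eq(2)[OF h growth_le_gain_count] by (simp add: continued_integral_def gained_integral_def)
  finally show ?thesis .
qed

lemma continued_integral_bound:
  "\<exists>A\<ge>0. \<forall>B f. pos_equivariant lam f \<longrightarrow> left.bounded_by (Suc (gain_count lam)) (\<lambda>_. B) f \<longrightarrow> norm (continued_integral lam f) \<le> A * B"
proof -
  let ?M = "gain_count lam"
  obtain A where A: "0 \<le> A" "\<forall>n\<in>unipotent_upper. norm (torus_char lam (n :: real^'n::_^'n::{finite,wellorder})) \<le> A * hgauge n powr growth lam"
    using growth_bound by blast
  obtain C where C: "0 \<le> C" "\<And>lam B A e f. pos_equivariant lam f \<Longrightarrow> left.bounded_by (Suc ?M) (\<lambda>_. B) f \<Longrightarrow>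
     (\<forall>n\<in>unipotent_upper. norm (torus_char lam (n :: real^'n::_^'n::{finite,wellorder})) \<le> A * hgauge n powr e) \<Longrightarrow>
     sym.bounded_by 1 (\<lambda>n. (C * (1 + param_norm lam) ^ Suc ?M * A * B) * hgauge n powr (e - real ?M)) ((gain_op ^^ ?M) f)"
    using pos_equivariant_gain_op_gain[of ?M] by blast
  obtain g where g: "integrable dn g" "\<forall>n\<in>unipotent_upper. hgauge (n :: real^'n::_^'n::{finite,wellorder}) powr - decay_order \<le> g n"
    using decay_order(2) by blast
  let ?c = "C * (1 + param_norm lam) ^ Suc ?M * A"
  have c0: "0 \<le> ?c" using C(1) A(1) param_norm_nonneg[of lam] by simp
  have G0: "0 \<le> (LINT n|dn. g n)"
    by (rule Bochner_Integration.integral_nonneg) (use g(2) order_trans[OF powr_ge_zero] in \<open>auto simp: space_dn\<close>)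
  have "norm (continued_integral lam f) \<le> (?c * (LINT n|dn. g n)) * B" if f: "pos_equivariant lam f" and b: "left.bounded_by (Suc ?M) (\<lambda>_. B) f" for B f
  proof -
    have "mat 1 \<in> (orthogonal_group :: (real^'n::_^'n::{finite,wellorder}) set)"
      by (simp add: orthogonal_group_def orthogonal_matrix_id)
    then have B0: "0 \<le> B" using left.bounded_by_nonneg[OF b] by blast
    have "norm (continued_integral lam f) \<le> (LINT n|dn. (?c * B) * g n)"
      unfolding continued_integral_def gained_integral_def
    proof (rule norm_integral_le[OF continued_integral_eq(2)[OF f growth_le_gain_count] integrable_mult_right[OF g(1)]])
      fix n :: "real^'n::_^'n::{finite,wellorder}" assume "n \<in> space dn"
      then have n: "n \<in> unipotent_upper" by (simp add: space_dn)
      have "norm (psi n * (gain_op ^^ ?M) f n) = norm ((gain_op ^^ ?M) f n)" by (simp add: norm_mult norm_psi)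
      also have "\<dots> \<le> (?c * B) * hgauge n powr (growth lam - real ?M)" by (rule sym.bounded_by_le[OF C(2)[OF f b A(2)] n])
      also have "\<dots> \<le> (?c * B) * hgauge n powr - decay_order"
        using growth_le_gain_count[of lam] c0 B0 by (intro mult_left_mono hgauge_powr_mono) simp_all
      also have "\<dots> \<le> (?c * B) * g n" using g(2) n c0 B0 by (intro mult_left_mono) simp_all
      finally show "norm (psi n * (gain_op ^^ ?M) f n) \<le> (?c * B) * g n" .
    qed
    then show ?thesis by (simp add: mult_ac)
  qed
  moreover have "0 \<le> ?c * (LINT n|dn. g n)" using c0 G0 by simp
  ultimately show ?thesis by blast
qed

text \<open>By \<open>norm_torus_char_far\<close> the character decays like any given power of
  \<open>entry_norm\<close> if \<open>S\<close> is large, and by \<open>hgauge_le_entry_norm\<close>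
  such a power is dominated by the power \<open>- decay_order\<close> of the gauge; then no
  integration by parts is needed.\<close>

lemma continued_integral_far:
  "\<exists>a :: complex^'n::{finite,wellorder}. \<forall>lam\<in>ball a 1. \<forall>f. pos_equivariant lam f \<longrightarrow>
     integrable dn (\<lambda>n. psi n * f n) \<and> continued_integral lam f = jacquet_integral dn f"
proof -
  let ?K = "real CARD('n)"
  obtain C p where C: "1 \<le> C" "\<And>n :: real^'n::_^'n::{finite,wellorder}. n \<in> unipotent_upper \<Longrightarrow> hgauge n \<le> C * entry_norm n ^ p"
    using hgauge_le_entry_norm by blast
  \<comment> \<open>The first summand compensates the loss in
    \<open>norm_torus_char_far\<close>, the second turns \<open>entry_norm\<close> into the
    gauge.\<close>
  define S where "S = ?K * ?K + real p * decay_order"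
  have S0: "0 \<le> S" using decay_order(1) by (simp add: S_def)
  let ?c = "(1 + ?K * ?K) powr S"
  have "integrable dn (\<lambda>n. psi n * f n) \<and> continued_integral lam f = jacquet_integral dn f"
    if lam: "lam \<in> ball (far_param S) 1" and f: "pos_equivariant lam f" for lam f
  proof -
    have a: "\<forall>n\<in>unipotent_upper. norm (torus_char lam (n :: real^'n::_^'n::{finite,wellorder})) \<le> (?c * C powr decay_order) * hgauge n powr - decay_order"
    proof
      fix n :: "real^'n::_^'n::{finite,wellorder}" assume n: "n \<in> unipotent_upper"
      have b0: "0 < entry_norm n" using entry_norm_ge1[of n] by linarith
      have o0: "0 < hgauge n" by (rule hgauge_pos)
      have "entry_norm n powr (?K * ?K - S) = (entry_norm n ^ p) powr - decay_order"
        using b0 by (simp add: S_def powr_realpow[symmetric] powr_powr)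
      also have "\<dots> \<le> (hgauge n / C) powr - decay_order"
      proof (rule powr_mono2')
        show "hgauge n / C \<le> entry_norm n ^ p" using C(1) C(2)[OF n] by (simp add: divide_le_eq mult.commute)
      qed (use decay_order(1) o0 C(1) in auto)
      also have "\<dots> = C powr decay_order * hgauge n powr - decay_order"
        using C(1) o0 by (simp add: powr_divide powr_minus divide_simps)
      finally have "entry_norm n powr (?K * ?K - S) \<le> C powr decay_order * hgauge n powr - decay_order" .
      then have "?c * entry_norm n powr (?K * ?K - S) \<le> ?c * (C powr decay_order * hgauge n powr - decay_order)" by (rule mult_left_mono) simp
      then show "norm (torus_char lam n) \<le> (?c * C powr decay_order) * hgauge n powr - decay_order"
        using norm_torus_char_far[OF n S0 lam] by (simp only: mult.assoc) 
    qed
    have z: "- decay_order + decay_order \<le> real 0" by simp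
    have "continued_integral lam f = gained_integral 0 f" unfolding continued_integral_def by (rule gained_integral_stable[OF f a z]) simp
    then show ?thesis using gained_integral_step(1)[OF f a z] by (simp add: gained_integral_def jacquet_integral_def)
  qed
  then show ?thesis by blast
qed

text \<open>On a ball around a given parameter one number \<open>M\<close> of integrations by parts
  suffices, and the integrand is dominated by a fixed integrable function.\<close>

lemma continued_integral_holomorphic:
  fixes \<tau> :: "'n::{finite,wellorder} \<Rightarrow> real^'n::_^'n::{finite,wellorder} \<Rightarrow> real"
  assumes \<tau>: "exp_family \<tau>" and F: "exp_family.exp_span \<tau> F" and e: "\<And>lam. pos_equivariant lam (F lam)"
  shows "holomorphic_several_on (\<lambda>lam. continued_integral lam (F lam)) UNIV"
  unfolding holomorphic_several_on_def
proof (intro ballI)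
  interpret exp_family \<tau> by (rule \<tau>)
  fix lam0 :: "complex^'n::{finite,wellorder}"
  let ?K = "real CARD('n)"
  define R where "R = param_norm lam0 + ?K"
  have nR: "param_norm lam \<le> R" if "lam \<in> ball lam0 1" for lam
  proof -
    have "param_norm lam \<le> (\<Sum>j\<in>UNIV. norm (shifted lam0 j) + 1)" unfolding param_norm_def by (intro sum_mono norm_shifted_ball that)
    then show ?thesis by (simp add: R_def param_norm_def sum.distrib)
  qed
  define M where "M = nat \<lceil>?K * ?K * R + decay_order\<rceil>"
  have M: "?K * ?K * R + decay_order \<le> real M" unfolding M_def by (rule real_nat_ceiling_ge)
  have EM: "growth lam + decay_order \<le> real M" if "lam \<in> ball lam0 1" for lam
  proof -
    have "growth lam \<le> ?K * ?K * R" unfolding growth_def by (intro mult_left_mono nR that) simp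
    then show ?thesis using M by linarith
  qed
  obtain A where A: "0 \<le> A" "\<And>lam n. n \<in> unipotent_upper \<Longrightarrow> param_norm lam \<le> R \<Longrightarrow>
     norm (torus_char lam (n :: real^'n::_^'n::{finite,wellorder})) \<le> A * hgauge n powr (?K * ?K * R)"
    using norm_torus_char_le_gauge[of R] by blast
  obtain B where B: "0 \<le> B" "\<And>lam. lam \<in> ball lam0 1 \<Longrightarrow> left.bounded_by (Suc M) (\<lambda>_. B) (F lam)"
    using exp_span_left_bounded_by[OF F] by blast
  obtain C where C: "0 \<le> C" "\<And>lam B A e f. pos_equivariant lam f \<Longrightarrow> left.bounded_by (Suc M) (\<lambda>_. B) f \<Longrightarrow>
     (\<forall>n\<in>unipotent_upper. norm (torus_char lam (n :: real^'n::_^'n::{finite,wellorder})) \<le> A * hgauge n powr e) \<Longrightarrow>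
     sym.bounded_by 1 (\<lambda>n. (C * (1 + param_norm lam) ^ Suc M * A * B) * hgauge n powr (e - real M)) ((gain_op ^^ M) f)"
    using pos_equivariant_gain_op_gain[of M] by blast
  obtain g where g: "integrable dn g" "\<forall>n\<in>unipotent_upper. hgauge (n :: real^'n::_^'n::{finite,wellorder}) powr - decay_order \<le> g n"
    using decay_order(2) by blast
  let ?\<Phi> = "\<lambda>lam n. psi n * (gain_op ^^ M) (F lam) n"
  let ?c = "C * (1 + R) ^ Suc M * A * B"
  have "\<exists>D. ((\<lambda>lam. LINT n|dn. ?\<Phi> lam n) has_derivative D) (at lam0) \<and> (\<forall>c v. D (c *s v) = c * D v)"
  proof (rule holomorphic_integral[where r = 1 and g = "\<lambda>n. ?c * g n"])
    note FL = exp_span_gain_op_pow[OF F, of M]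
    show "?\<Phi> lam \<in> borel_measurable dn" for lam
      by (intro measurable_dn_smooth smooth_on_mult open_GL smooth_on_psi exp_span_smooth[OF FL])
    show "integrable dn (\<lambda>n. ?c * g n)" by (rule integrable_mult_right[OF g(1)])
    fix n assume "n \<in> space dn"
    then have n: "n \<in> unipotent_upper" by (simp add: space_dn)
    have "exp_span (\<lambda>lam x. psi x * (gain_op ^^ M) (F lam) x)" by (rule exp_span_smult[OF FL smooth_on_psi[OF open_GL]])
    from exp_span_holomorphic[OF this unipotent_GL[OF n]]
    show "holomorphic_several_on (\<lambda>lam. ?\<Phi> lam n) (ball lam0 1)" by (simp add: holomorphic_several_on_def)
    fix lam assume l: "lam \<in> ball lam0 1"
    have "norm (?\<Phi> lam n) = norm ((gain_op ^^ M) (F lam) n)" by (simp add: norm_mult norm_psi)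
    also have "\<dots> \<le> (C * (1 + param_norm lam) ^ Suc M * A * B) * hgauge n powr (?K * ?K * R - real M)"
      by (rule sym.bounded_by_le[OF C(2)[OF e B(2)[OF l]] n]) (use A(2) nR[OF l] in blast)
    also have "\<dots> \<le> ?c * hgauge n powr - decay_order"
      using M nR[OF l] param_norm_nonneg[of lam] A(1) B(1) C(1)
      by (intro mult_mono mult_left_mono mult_right_mono power_mono hgauge_powr_mono) auto
    also have "\<dots> \<le> ?c * g n"
      using g(2) n A(1) B(1) C(1) nR[OF l] param_norm_nonneg[of lam] by (intro mult_left_mono) auto
    finally show "norm (?\<Phi> lam n) \<le> ?c * g n" .
  qed simp
  then obtain D where D: "((\<lambda>lam. LINT n|dn. ?\<Phi> lam n) has_derivative D) (at lam0)" "\<forall>c v. D (c *s v) = c * D v" by blast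
  have "((\<lambda>lam. continued_integral lam (F lam)) has_derivative D) (at lam0)"
    by (rule has_derivative_transform_within_open[OF D(1) open_ball[of lam0 1]])
      (use continued_integral_eq(1)[OF e EM] in \<open>auto simp: gained_integral_def\<close>)
  then show "\<exists>D. ((\<lambda>lam. continued_integral lam (F lam)) has_derivative D) (at lam0) \<and> (\<forall>c v. D (c *s v) = c * D v)" using D(2) by blast
qed

end

section \<open>Equivariance and continuity of the continuation\<close>

lemma iterated_deriv_lincomb:
  assumes "open \<Omega>" "smooth_on \<Omega> f" "smooth_on \<Omega> h" "x \<in> \<Omega>"
  shows "iterated_deriv vs (\<lambda>x. c * f x + h x) x = c * iterated_deriv vs f x + iterated_deriv vs h x"
  using assms(4)
proof (induction vs arbitrary: x)
  case (Cons v vs)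
  let ?f = "iterated_deriv vs f" and ?h = "iterated_deriv vs h"
  have d: "?f differentiable at x" "?h differentiable at x"
    using assms(2,3) Cons.prems by (auto simp: smooth_on_def)
  have dc: "(\<lambda>x. c) differentiable at x" by simp
  have "smooth_on \<Omega> (\<lambda>x. c * f x + h x)" by (intro smooth_on_add smooth_on_mult smooth_on_const assms)
  then have dl: "iterated_deriv vs (\<lambda>x. c * f x + h x) differentiable at x"
    using Cons.prems by (auto simp: smooth_on_def)
  have "vf_deriv (\<lambda>_. v) (iterated_deriv vs (\<lambda>x. c * f x + h x)) x = vf_deriv (\<lambda>_. v) (\<lambda>x. c * ?f x + ?h x) x"
    by (rule vf_deriv_cong[OF assms(1) Cons.prems Cons.IH dl])
  also have "\<dots> = c * vf_deriv (\<lambda>_. v) ?f x + vf_deriv (\<lambda>_. v) ?h x"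
  proof -
    have "vf_deriv (\<lambda>_. v) (\<lambda>x. c) x = 0" by (simp add: vf_deriv_def)
    then show ?thesis
      using vf_deriv_add[OF differentiable_mult[OF dc d(1)] d(2)] vf_deriv_mult[OF dc d(1)] by simp
  qed
  finally show ?case by (simp add: vf_deriv_def)
qed simp

lemma pos_equivariant_lincomb:
  assumes "pos_equivariant lam f" "pos_equivariant lam h" shows "pos_equivariant lam (\<lambda>x. c * f x + h x)"
  using assms unfolding pos_equivariant_def
  by (auto intro!: smooth_on_add smooth_on_mult smooth_on_const open_GL simp: distrib_left)

lemma pos_equivariant_zero: "pos_equivariant lam (\<lambda>x. 0)"
  unfolding pos_equivariant_def by (simp add: smooth_on_const)

text \<open>On consecutive indices the product of unipotent matrices adds entries.\<close>

lemma psi_mult: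
  fixes m n :: "real^'n::_^'n::{finite,wellorder}"
  assumes n: "n \<in> unipotent_upper" and m: "m \<in> unipotent_upper"
  shows "psi (n ** m) = psi n * psi m"
proof -
  have "(n ** m) $ i $ j = n $ i $ j + m $ i $ j" if ij: "i < j" "{i<..<j} = {}" for i j
  proof -
    have z: "n $ i $ l * m $ l $ j = 0" if "l \<notin> {i, j}" for l
    proof -
      have "l < i \<or> j < l"
      proof (rule ccontr)
        assume "\<not> (l < i \<or> j < l)"
        then have "l \<in> {i<..<j}" using that by (auto simp: not_less order.order_iff_strict)
        then show False using ij(2) by simp
      qed
      then show ?thesis using n m by (auto simp: unipotent_upper_def)
    qed
    have "(n ** m) $ i $ j = (\<Sum>l\<in>UNIV. n $ i $ l * m $ l $ j)" by (simp add: matrix_matrix_mult_def)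
    also have "\<dots> = (\<Sum>l\<in>{i, j}. n $ i $ l * m $ l $ j)"
      by (rule sum.mono_neutral_right) (use z in auto)
    also have "\<dots> = n $ i $ j + m $ i $ j" using ij(1) n m by (simp add: unipotent_upper_def)
    finally show ?thesis .
  qed
  then have "(\<Sum>(i, j)\<in>{(i, j). i < j \<and> {i<..<j} = {}}. (n ** m) $ i $ j) =
      (\<Sum>(i, j)\<in>{(i, j). i < j \<and> {i<..<j} = {}}. n $ i $ j) + (\<Sum>(i, j)\<in>{(i, j). i < j \<and> {i<..<j} = {}}. m $ i $ j)"
    unfolding sum.distrib[symmetric] by (intro sum.cong) auto
  then show ?thesis unfolding psi_def by (simp add: distrib_left exp_add)
qed

text \<open>The identity theorem, applied on the complex line through the centre of the ball and the
  given point.\<close>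

lemma holomorphic_several_eqI:
  fixes F G :: "complex^'n \<Rightarrow> complex"
  assumes F: "holomorphic_several_on F UNIV" and G: "holomorphic_several_on G UNIV"
    and eq: "\<And>lam. lam \<in> ball a 1 \<Longrightarrow> F lam = G lam"
  shows "F lam = G lam"
proof -
  let ?l = "\<lambda>z. a + z *s (lam - a)"
  \<comment> \<open>Small enough for the disc of this radius on the line to lie in the
    ball.\<close>
  let ?r = "1 / (1 + norm (lam - a))"
  have r: "0 < ?r" by (simp add: add_pos_nonneg)
  have h: "(\<lambda>z. F (?l z)) holomorphic_on UNIV" "(\<lambda>z. G (?l z)) holomorphic_on UNIV"
    using holomorphic_on_line(1)[OF F, of a "lam - a"] holomorphic_on_line(1)[OF G, of a "lam - a"] by simp_all
  have near: "F (?l z) = G (?l z)" if z: "z \<in> ball 0 ?r" for z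
  proof (rule eq)
    have "norm z * (1 + norm (lam - a)) < 1" using z by (simp add: pos_less_divide_eq add_pos_nonneg)
    moreover have "norm z * norm (lam - a) \<le> norm z * (1 + norm (lam - a))" by (rule mult_left_mono) auto
    ultimately have "norm (z *s (lam - a)) < 1" unfolding norm_vector_scalar by linarith
    moreover have "dist a (?l z) = norm (z *s (lam - a))" by (simp only: dist_norm norm_minus_commute[of a] add_diff_cancel_left')
    ultimately show "?l z \<in> ball a 1" by (simp only: mem_ball)
  qed
  have "F (?l 1) = G (?l 1)"
    by (rule analytic_continuation_open[of "ball 0 ?r" UNIV, OF _ _ _ _ _ h near]) (use r in auto)
  then show ?thesis by simp
qed

context haar_unipotent
begin

lemma continued_integral_zero: "continued_integral lam (\<lambda>x. 0) = 0"
  using continued_integral_lincomb[OF pos_equivariant_zero pos_equivariant_zero, of lam "- 1"] by simp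

lemma jacquet_integral_translate:
  assumes n0: "n0 \<in> unipotent_upper" and f: "smooth_on GL f"
  shows "jacquet_integral dn (left_translation n0 f) = psi n0 * jacquet_integral dn f"
proof -
  let ?h = "matrix_inv n0"
  have h: "?h \<in> unipotent_upper" by (rule unipotent_inverse[OF n0])
  have n0h: "n0 ** ?h = mat 1" using matrix_inv_right_left[OF unipotent_GL[OF n0]] by blast
  let ?F = "\<lambda>m. psi n0 * (psi m * f m)"
  have "?F \<in> borel_measurable dn"
    by (intro measurable_dn_smooth smooth_on_mult smooth_on_const open_GL smooth_on_psi f)
  from integral_translate(1)[OF h this]
  have "(LINT m|dn. ?F (?h ** m)) = psi n0 * jacquet_integral dn f" by (simp add: jacquet_integral_def)
  moreover have "(LINT m|dn. ?F (?h ** m)) = jacquet_integral dn (left_translation n0 f)"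
    unfolding jacquet_integral_def left_translation_def
  proof (rule Bochner_Integration.integral_cong[OF refl])
    fix m :: "real^'n::_^'n::{finite,wellorder}" assume "m \<in> space dn"
    then have m: "m \<in> unipotent_upper" by (simp add: space_dn)
    have "psi n0 * psi (?h ** m) = psi (n0 ** (?h ** m))" by (rule psi_mult[OF n0 unipotent_mult[OF h m], symmetric])
    also have "n0 ** (?h ** m) = m" by (simp add: matrix_mul_assoc n0h)
    finally show "psi n0 * (psi (?h ** m) * f (?h ** m)) = psi m * f (?h ** m)" by (simp only: mult.assoc[symmetric])
  qed
  ultimately show ?thesis by (simp only:)
qed

text \<open>Translates are included because the two sides of the equivariance are compared as
  holomorphic functions of \<open>\<lambda>\<close>.\<close>

lemma holomorphic_continued_integral_translate:
  fixes \<phi> :: "real^'n::_^'n::{finite,wellorder} \<Rightarrow> complex"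
  assumes \<phi>: "\<phi> \<in> compact_model \<delta>" and g: "g \<in> GL"
  shows "holomorphic_several_on (\<lambda>lam. continued_integral lam (\<lambda>x. series_family \<phi> lam (g ** x))) UNIV"
proof -
  let ?\<tau> = "\<lambda>j x. ln (torus_part (g ** x) j)"
  interpret E: exp_family ?\<tau>
    by unfold_locales (rule smooth_on_left_mult[OF g smooth_on_ln_torus_part])
  have ef: "E.exp_span (\<lambda>lam x. series_family \<phi> lam (g ** x))"
    by (rule E.exp_span_cong[OF E.exp_span_base[OF smooth_on_left_mult[OF g smooth_on_model[OF \<phi>]]]])
      (simp add: series_family_def mult_GL[OF g] E.exp_factor_def torus_char_def)
  have gi: "matrix_inv g \<in> GL" by (rule matrix_inv_GL[OF g])
  have "left_translation (matrix_inv g) (series_family \<phi> lam) \<in> principal_series (- lam) \<delta>" for lam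
    by (rule left_translation_principal_series[OF series_family_principal_series[OF \<phi>] gi])
  moreover have "matrix_inv (matrix_inv g) = g"
    by (rule matrix_inv_unique_GL(4)[OF matrix_inv_right_left(1)[OF g]])
  ultimately have "pos_equivariant lam (\<lambda>x. series_family \<phi> lam (g ** x))" for lam
    using pos_equivariant_principal_series unfolding left_translation_def by metis
  from continued_integral_holomorphic[OF E.exp_family_axioms ef this] show ?thesis .
qed

lemma holomorphic_continued_integral_series_family:
  fixes \<phi> :: "real^'n::_^'n::{finite,wellorder} \<Rightarrow> complex"
  assumes "\<phi> \<in> compact_model \<delta>"
  shows "holomorphic_several_on (\<lambda>lam. continued_integral lam (series_family \<phi> lam)) UNIV"
  using holomorphic_continued_integral_translate[OF assms mat1_GL] by simp

text \<open>Both sides are entire in \<open>\<lambda>\<close> when \<open>f\<close> varies in the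
  family with fixed restriction to \<open>O(r)\<close>, and they agree where the integral
  converges.\<close>

lemma continued_integral_translate:
  assumes n0: "n0 \<in> unipotent_upper" and f: "f \<in> principal_series (- lam) \<delta>"
  shows "continued_integral lam (left_translation n0 f) = psi n0 * continued_integral lam f"
proof -
  let ?\<phi> = "restrict_to_K f"
  have \<phi>: "?\<phi> \<in> compact_model \<delta>" "series_family ?\<phi> lam = f" using restrict_principal_series[OF f] by auto
  have g: "n0 \<in> GL" by (rule unipotent_GL[OF n0])
  obtain a :: "complex^'n::{finite,wellorder}" where a: "\<And>lam f. lam \<in> ball a 1 \<Longrightarrow> pos_equivariant lam f \<Longrightarrow> continued_integral lam f = jacquet_integral dn f"
    using continued_integral_far by blast
  have "continued_integral lam (left_translation n0 (series_family ?\<phi> lam)) = psi n0 * continued_integral lam (series_family ?\<phi> lam)"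
  proof (rule holomorphic_several_eqI[where a = a])
    show "holomorphic_several_on (\<lambda>lam. continued_integral lam (left_translation n0 (series_family ?\<phi> lam))) UNIV"
      unfolding left_translation_def by (rule holomorphic_continued_integral_translate[OF \<phi>(1) matrix_inv_GL[OF g]])
    show "holomorphic_several_on (\<lambda>lam. psi n0 * continued_integral lam (series_family ?\<phi> lam)) UNIV"
      unfolding holomorphic_several_on_def
    proof
      fix z :: "complex^'n::{finite,wellorder}"
      obtain D where D: "((\<lambda>lam. continued_integral lam (series_family ?\<phi> lam)) has_derivative D) (at z)" "\<And>c v. D (c *s v) = c * D v"
        using holomorphic_continued_integral_series_family[OF \<phi>(1)] unfolding holomorphic_several_on_def by blast
      have "((\<lambda>lam. psi n0 * continued_integral lam (series_family ?\<phi> lam)) has_derivative (\<lambda>v. psi n0 * D v)) (at z)"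
        by (rule has_derivative_mult_right[OF D(1)])
      then show "\<exists>D. ((\<lambda>lam. psi n0 * continued_integral lam (series_family ?\<phi> lam)) has_derivative D) (at z) \<and> (\<forall>c v. D (c *s v) = c * D v)"
        using D(2) by (intro exI[of _ "\<lambda>v. psi n0 * D v"]) (simp add: mult.left_commute)
    qed
    fix lam assume l: "lam \<in> ball a 1"
    note ps = series_family_principal_series[OF \<phi>(1), of lam]
    note e = pos_equivariant_principal_series[OF ps] and e' = pos_equivariant_principal_series[OF left_translation_principal_series[OF ps g]]
    show "continued_integral lam (left_translation n0 (series_family ?\<phi> lam)) = psi n0 * continued_integral lam (series_family ?\<phi> lam)"
      unfolding a[OF l e] a[OF l e'] by (rule jacquet_integral_translate[OF n0 pos_equivariant_smooth[OF e]])
  qed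
  then show ?thesis by (simp only: \<phi>(2))
qed

text \<open>By \<open>continued_integral_bound\<close> the functional is dominated by finitely many
  coordinate derivatives on the compact set \<open>O(r)\<close>, which are among the seminorms that
  define the topology.\<close>

lemma continued_integral_continuous: "continuous_map (principal_series_topology (- lam) \<delta>) euclidean (continued_integral lam)"
  unfolding continuous_map_def
proof (intro conjI allI impI)
  show "continued_integral lam \<in> topspace (principal_series_topology (- lam) \<delta>) \<rightarrow> topspace euclidean" by simp
  fix U :: "complex set" assume "openin euclidean U"
  then have U: "open U" by simp
  let ?P = "principal_series (- lam) \<delta>" and ?W = "unit_words (Suc (gain_count lam)) :: (real^'n::_^'n::{finite,wellorder}) list set"
  let ?X = "principal_series_topology (- lam) \<delta>"
  obtain A where A: "0 \<le> A" "\<And>B f. pos_equivariant lam f \<Longrightarrow> left.bounded_by (Suc (gain_count lam)) (\<lambda>_. B) f \<Longrightarrow> norm (continued_integral lam f) \<le> A * B"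
    using continued_integral_bound[of lam] by blast
  obtain C where C: "0 \<le> C" "\<And>B f. coord.bounded_by (Suc (gain_count lam)) (\<lambda>_. B) f \<Longrightarrow> left.bounded_by (Suc (gain_count lam)) (\<lambda>_. C * B) (f :: real^'n::_^'n::{finite,wellorder} \<Rightarrow> complex)"
    using coord_imp_left[of "Suc (gain_count lam)"] by blast
  show "openin ?X {f \<in> topspace ?X. continued_integral lam f \<in> U}"
  proof (subst openin_subopen, intro ballI)
    fix f assume "f \<in> {f \<in> topspace ?X. continued_integral lam f \<in> U}"
    then have f: "f \<in> ?P" and fU: "continued_integral lam f \<in> U" by (auto simp: principal_series_topology_def topspace_subtopology)
    have fs: "f \<in> smooth_functions GL" using f by (simp add: principal_series_def)
    obtain \<epsilon> where \<epsilon>: "0 < \<epsilon>" "ball (continued_integral lam f) \<epsilon> \<subseteq> U" using U fU open_contains_ball by blast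
    define \<eta> where "\<eta> = \<epsilon> / (1 + A * C)"
    have AC: "0 < 1 + A * C" using A(1) C(1) by (simp add: add_pos_nonneg)
    have \<eta>: "0 < \<eta>" using \<epsilon>(1) AC by (simp add: \<eta>_def)
    have \<eta>\<epsilon>: "A * (C * \<eta>) < \<epsilon>"
    proof -
      have "1 + A * C \<noteq> 0" using AC by linarith
      from nonzero_eq_divide_eq[OF this, of \<eta> \<epsilon>] have "\<eta> * (1 + A * C) = \<epsilon>" unfolding \<eta>_def by blast
      then show ?thesis using \<eta> by (simp add: algebra_simps)
    qed
    define G where "G vs = {h \<in> smooth_functions GL. \<forall>x\<in>orthogonal_group. norm (iterated_deriv vs h x - iterated_deriv vs f x) < \<eta>}" for vs
    define T where "T = (\<Inter>vs\<in>?W. G vs) \<inter> ?P"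
    have "openin (smooth_topology GL) (G vs)" for vs
      unfolding smooth_topology_def
    proof (rule topology_generated_by_Basis, rule CollectI, intro exI conjI)
      show "G vs = {h \<in> smooth_functions GL. \<forall>x\<in>orthogonal_group. norm (iterated_deriv vs h x - iterated_deriv vs f x) < \<eta>}"
        by (rule G_def)
    qed (rule fs compact_orthogonal_group orthogonal_GL \<eta>)+
    moreover have "?W \<noteq> {}"
    proof -
      have "[] \<in> ?W" by (simp add: unit_words_def)
      then show ?thesis by blast
    qed
    ultimately have "openin (smooth_topology GL) (\<Inter>vs\<in>?W. G vs)" by (intro openin_INT2 finite_unit_words) auto
    then have T: "openin ?X T" unfolding T_def principal_series_topology_def openin_subtopology by blast
    have "f \<in> T" using f fs \<eta> by (simp add: T_def G_def)
    moreover have "T \<subseteq> {f \<in> topspace ?X. continued_integral lam f \<in> U}"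
    proof
      fix h assume h: "h \<in> T"
      have hP: "h \<in> ?P" using h by (simp add: T_def)
      have ef: "pos_equivariant lam f" and eh: "pos_equivariant lam h" using f hP pos_equivariant_principal_series by auto
      let ?d = "\<lambda>x. (- 1) * f x + h x"
      have ed: "pos_equivariant lam ?d" by (rule pos_equivariant_lincomb[OF ef eh])
      have "coord.bounded_by (Suc (gain_count lam)) (\<lambda>_. \<eta>) ?d"
      proof (rule iterated_imp_coord[OF pos_equivariant_smooth[OF ed]])
        fix vs and x :: "real^'n::_^'n::{finite,wellorder}" assume vs: "vs \<in> ?W" and x: "x \<in> orthogonal_group"
        have "x \<in> GL" using x orthogonal_GL by blast
        then have "iterated_deriv vs ?d x = (- 1) * iterated_deriv vs f x + iterated_deriv vs h x"
          by (rule iterated_deriv_lincomb[OF open_GL pos_equivariant_smooth[OF ef] pos_equivariant_smooth[OF eh]])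
        also have "norm \<dots> = norm (iterated_deriv vs h x - iterated_deriv vs f x)" by simp
        also have "\<dots> \<le> \<eta>" using h vs x by (auto simp: T_def G_def intro: less_imp_le)
        finally show "norm (iterated_deriv vs ?d x) \<le> \<eta>" .
      qed
      from A(2)[OF ed C(2)[OF this]] have "norm (continued_integral lam ?d) < \<epsilon>" using \<eta>\<epsilon> by linarith
      moreover have "continued_integral lam ?d = continued_integral lam h - continued_integral lam f" using continued_integral_lincomb[OF ef eh, of "- 1"] by simp
      ultimately have "continued_integral lam h \<in> ball (continued_integral lam f) \<epsilon>" by (simp add: dist_norm norm_minus_commute)
      moreover have "h \<in> topspace ?X" using T h openin_subset by blast
      ultimately show "h \<in> {f \<in> topspace ?X. continued_integral lam f \<in> U}" using \<epsilon>(2) by blast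
    qed
    ultimately show "\<exists>T. openin ?X T \<and> f \<in> T \<and> T \<subseteq> {f \<in> topspace ?X. continued_integral lam f \<in> U}" using T by blast
  qed
qed

lemma whittaker_functional_continued_integral: "whittaker_functional (- lam) \<delta> (continued_integral lam)"
  unfolding whittaker_functional_def
proof (intro conjI ballI allI)
  fix f assume f: "f \<in> principal_series (- lam) \<delta>"
  note ef = pos_equivariant_principal_series[OF f]
  show "continued_integral lam (\<lambda>x. c * f x) = c * continued_integral lam f" for c
    using continued_integral_lincomb[OF ef pos_equivariant_zero, of c] continued_integral_zero by simp
  show "continued_integral lam (\<lambda>x. f x + h x) = continued_integral lam f + continued_integral lam h" if "h \<in> principal_series (- lam) \<delta>" for h
    using continued_integral_lincomb[OF ef pos_equivariant_principal_series[OF that], of 1] by simp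
  show "continued_integral lam (left_translation n f) = psi n * continued_integral lam f" if "n \<in> unipotent_upper" for n
    by (rule continued_integral_translate[OF that f])
qed (rule continued_integral_continuous)

end

theorem theorem2p3:
  fixes \<delta> :: "bit^'n::{finite,wellorder}"
    and dn :: "(real^'n::_^'n::_) measure"
  assumes "CARD('n) \<ge> 2"
    and "haar_measure_on unipotent_upper dn"
  shows "\<exists>(U :: (complex^'n::_) set) (J :: complex^'n::_ \<Rightarrow> (real^'n::_^'n::_ \<Rightarrow> complex) \<Rightarrow> complex).
           open U \<and> U \<noteq> {} \<and>
           (\<forall>lam\<in>U. \<forall>f\<in>principal_series (- lam) \<delta>.
              integrable dn (\<lambda>n. psi n * f n) \<and> J lam f = jacquet_integral dn f) \<and>
           (\<forall>lam. whittaker_functional (- lam) \<delta> (J lam)) \<and>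
           (\<forall>\<phi>\<in>compact_model \<delta>.
              holomorphic_several_on (\<lambda>lam. J lam (extend_from_K (- lam) \<delta> \<phi>)) UNIV)"
proof -
  interpret haar_unipotent dn by unfold_locales (rule assms(2))
  obtain a :: "complex^'n::{finite,wellorder}" where a: "\<forall>lam\<in>ball a 1. \<forall>f. pos_equivariant lam f \<longrightarrow>
      integrable dn (\<lambda>n. psi n * f n) \<and> continued_integral lam f = jacquet_integral dn f"
    using continued_integral_far by blast
  show ?thesis
  proof (intro exI[of _ "ball a 1"] exI[of _ continued_integral] conjI ballI allI)
    show "ball a 1 \<noteq> {}" by simp
    show "whittaker_functional (- lam) \<delta> (continued_integral lam)" for lam by (rule whittaker_functional_continued_integral)
    show "holomorphic_several_on (\<lambda>lam. continued_integral lam (extend_from_K (- lam) \<delta> \<phi>)) UNIV" if "\<phi> \<in> compact_model \<delta>" for \<phi>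
      using holomorphic_continued_integral_series_family[OF that] by (simp only: extend_from_K_eq_series_family[OF that])
    fix lam f assume "lam \<in> ball a 1" "f \<in> principal_series (- lam) \<delta>"
    then show "integrable dn (\<lambda>n. psi n * f n)" "continued_integral lam f = jacquet_integral dn f"
      using a pos_equivariant_principal_series by blast+
  qed simp
qed

end
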